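(* Let $\alpha\in(\frac12,1]$, $q\in\mathcal{P}^{\log}(\mathbb{R}^3)$ with $q^-=q_\infty>3$, and $p\in\mathcal{P}((0,1))$ with $p^->4$. Suppose $$\frac{2\alpha}{p^-}+\frac32\left(\frac2{q^-}-\frac1{q^+}\right)<\alpha-\frac12.$$ If $f\in L^1\big(0,1;L^{q(\cdot)}(\mathbb{R}^3)\big)$ is a divergence-free exterior force and $u_0\in L^{q(\cdot)}(\mathbb{R}^3)$ is a divergence-free initial datum, then there exist a time $T\in(0,1]$ and a unique mild solution of the fractional Navier–Stokes equations with data $u_0,f$ in the space $L^{p(\cdot)}\big(0,T;L^{q(\cdot)}(\mathbb{R}^3)\big)$.
   Context: Variable Lebesgue spaces. For $\Omega=\mathbb{R}^3$ or an interval, $\mathcal{P}(\Omega)$ is the set of measurable $p:\Omega\to[1,\infty]$; $p^-,p^+$ are the essential infimum and supremum; $\frac a\infty:=0$. With $\omega_p(s)=s^p$ for $p<\infty$, $\omega_\infty(s)=0$ for $s\le1$ and $\omega_\infty(s)=\infty$ for $s>1$, put $\varrho_{p(\cdot)}(f)=\int_\Omega\omega_{p(x)}(|f(x)|)dx$; $L^{p(\cdot)}(\Omega)$ is the space of measurable $f$ with $\varrho_{p(\cdot)}(\lambda f)<\infty$ for some $\lambda>0$, with norm $\inf\{\lambda>0:\varrho_{p(\cdot)}(f/\lambda)\le1\}$ (similarly for vector fields). $L^{p(\cdot)}(0,T;X)$ has norm $\big\|\,\|u(t,\cdot)\|_X\big\|_{L^{p(\cdot)}((0,T))}$. $\mathcal{P}^{\log}(\mathbb{R}^3)$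 is the set of $q\in\mathcal{P}(\mathbb{R}^3)$ such that $g=1/q$ satisfies, for some $c>0$, $g_\infty\in\mathbb{R}$ and all $x,y$, $|g(x)-g(y)|\le\frac{c}{\log(e+1/|x-y|)}$ and $|g(x)-g_\infty|\le\frac{c}{\log(e+|x|)}$; $q_\infty\in[1,\infty]$ is defined by $\frac1{q_\infty}=\lim_{|x|\to\infty}\frac1{q(x)}$. Fractional Navier–Stokes equations on $\mathbb{R}^3$: $\partial_tu=-(-\Delta)^\alpha u-(u\cdot\nabla)u+\nabla P+f$, $\operatorname{div}u=0$, $u(0,\cdot)=u_0$, $\operatorname{div}u_0=0$, with unknown velocity $u$ and pressure $P$; $(-\Delta)^\alpha$ has symbol $|\xi|^{2\alpha}$. A mild solution on $(0,T)$ is a solution $u$ of $$u(t,x)=g_{\alpha,t}*u_0(x)+\int_0^tg_{\alpha,t-s}*f(s,x)\,ds-\int_0^tK_{\alpha,t-s}*(u\otimes u)(s,x)\,ds,$$ where $g_{\alpha,t}$ is the convolution kernel of $e^{-t(-\Delta)^\alpha}$ (symbol $e^{-t|\xi|^{2\alpha}}$) and $K_{\alpha,t}$ is the kernel of $e^{-t(-\Delta)^\alpha}\mathbb{P}\operatorname{div}$, $\mathbb{P}$ the Leray projector; i.e. the $j$-th component of $K_{\alpha,t}*(u\otimes u)$ is $\sum_{h,k=1}^3K^{j;h,k}_{\alpha,t}*(u_hu_k)$, where $K^{j;h,k}_{\alpha,t}$ has symbol $i\xi_k\big(\delta_{jh}-\frac{\xi_j\xi_h}{|\xi|^2}\big)e^{-t|\xi|^{2\alpha}}$.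 *)

theory Defs
  imports "HOL-Analysis.Analysis" "HOL-Probability.Essential_Supremum"
begin

section \<open>Variable Lebesgue spaces\<close>

text \<open>
  Exponents take values in \<^typ>\<open>ennreal\<close>, where \<open>inverse \<infinity> = 0\<close>. The domain \<open>\<Omega>\<close> enters through a
  measure: \<^term>\<open>lebesgue\<close> for the whole space, \<^term>\<open>lebesgue_on I\<close> for an interval. Measurability is
  Lebesgue measurability throughout.
\<close>

definition exponents :: "'a measure \<Rightarrow> ('a \<Rightarrow> ennreal) set" where
  "exponents M = {p \<in> borel_measurable M. \<forall>x\<in>space M. 1 \<le> p x}"

definition essinf :: "'a measure \<Rightarrow> ('a \<Rightarrow> ennreal) \<Rightarrow> ennreal" where
  "essinf M p = Sup {z. AE x in M. z \<le> p x}"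

definition recip :: "ennreal \<Rightarrow> real" where
  "recip r = enn2real (inverse r)"

definition omega :: "ennreal \<Rightarrow> real \<Rightarrow> ennreal" where
  "omega p s = (if p = \<infinity> then (if s \<le> 1 then 0 else \<infinity>) else ennreal (s powr enn2real p))"

definition modular :: "'a measure \<Rightarrow> ('a \<Rightarrow> ennreal) \<Rightarrow> ('a \<Rightarrow> 'b::real_normed_vector) \<Rightarrow> ennreal" where
  "modular M p f = (\<integral>\<^sup>+ x. omega (p x) (norm (f x)) \<partial>M)"

definition var_Lp :: "'a measure \<Rightarrow> ('a \<Rightarrow> ennreal) \<Rightarrow> ('a \<Rightarrow> 'b::real_normed_vector) set" where
  "var_Lp M p = {f \<in> borel_measurable M. \<exists>c>0. modular M p (\<lambda>x. c *\<^sub>R f x) < \<infinity>}"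

text \<open>Meaningful only on \<^const>\<open>var_Lp\<close>, where the infimum is over a nonempty set.\<close>

definition var_norm :: "'a measure \<Rightarrow> ('a \<Rightarrow> ennreal) \<Rightarrow> ('a \<Rightarrow> 'b::real_normed_vector) \<Rightarrow> real" where
  "var_norm M p f = Inf {c. 0 < c \<and> modular M p (\<lambda>x. f x /\<^sub>R c) \<le> 1}"

text \<open>
  The space \<open>L\<^sup>p(I; L\<^sup>q)\<close> with both exponents variable; its elements are jointly measurable
  representatives, so equality in this space is equality almost everywhere on \<open>I \<times> UNIV\<close>.
\<close>

definition mixed_Lp ::
  "real set \<Rightarrow> (real \<Rightarrow> ennreal) \<Rightarrow> (real^3 \<Rightarrow> ennreal) \<Rightarrow> (real \<Rightarrow> real^3 \<Rightarrow> real^3) set" where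
  "mixed_Lp I p q = {u.
     (\<lambda>(t, x). u t x) \<in> borel_measurable (lebesgue_on (I \<times> UNIV)) \<and>
     (AE t in lebesgue_on I. u t \<in> var_Lp lebesgue q) \<and>
     (\<lambda>t. var_norm lebesgue q (u t)) \<in> var_Lp (lebesgue_on I) p}"

text \<open>For \<open>x = y\<close> the first bound reads \<open>0 \<le> c\<close> (as \<open>1 / 0 = 0\<close>), hence is harmless.\<close>

definition log_exponents :: "(real^3 \<Rightarrow> ennreal) set" where
  "log_exponents = {q \<in> exponents lebesgue.
     \<exists>c>0. \<exists>g_inf::real.
       (\<forall>x y. \<bar>recip (q x) - recip (q y)\<bar> \<le> c / ln (exp 1 + 1 / norm (x - y))) \<and>
       (\<forall>x. \<bar>recip (q x) - g_inf\<bar> \<le> c / ln (exp 1 + norm x))}"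

definition exponent_at_infinity :: "(real^3 \<Rightarrow> ennreal) \<Rightarrow> ennreal" where
  "exponent_at_infinity q = inverse (Lim at_infinity (\<lambda>x. inverse (q x)))"

section \<open>Divergence-free fields in the sense of distributions\<close>

definition partial :: "3 \<Rightarrow> (real^3 \<Rightarrow> real) \<Rightarrow> real^3 \<Rightarrow> real" where
  "partial k \<phi> x = frechet_derivative \<phi> (at x) (axis k 1)"

primrec C_k :: "nat \<Rightarrow> (real^3 \<Rightarrow> real) \<Rightarrow> bool" where
  "C_k 0 \<phi> \<longleftrightarrow> continuous_on UNIV \<phi>"
| "C_k (Suc n) \<phi> \<longleftrightarrow> (\<forall>x. \<phi> differentiable (at x)) \<and> (\<forall>k. C_k n (partial k \<phi>))"

definition test_functions :: "(real^3 \<Rightarrow> real) set" where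
  "test_functions = {\<phi>. (\<forall>n. C_k n \<phi>) \<and> compact (closure {x. \<phi> x \<noteq> 0})}"

definition divergence_free :: "(real^3 \<Rightarrow> real^3) \<Rightarrow> bool" where
  "divergence_free v \<longleftrightarrow>
     (\<forall>\<phi>\<in>test_functions. (\<integral>x. (\<Sum>k\<in>UNIV. v x $ k * partial k \<phi> x) \<partial>lebesgue) = 0)"

section \<open>Kernels and mild solutions\<close>

text \<open>
  The convention is the one in which \<open>\<partial>\<^sub>k\<close> has symbol \<open>\<i> \<xi>\<^sub>k\<close>. All symbols \<open>m\<close> below are integrable and
  satisfy \<open>m (- \<xi>) = cnj (m \<xi>)\<close>, so the integral converges absolutely and is real; taking \<^const>\<open>Re\<close>
  only changes the type.
\<close>

definition kernel_of_symbol :: "(real^3 \<Rightarrow> complex) \<Rightarrow> real^3 \<Rightarrow> real" where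
  "kernel_of_symbol m x = Re ((\<integral>\<xi>. exp (\<i> * of_real (x \<bullet> \<xi>)) * m \<xi> \<partial>lebesgue) / of_real ((2 * pi) ^ 3))"

definition heat_kernel :: "real \<Rightarrow> real \<Rightarrow> real^3 \<Rightarrow> real" where
  "heat_kernel \<alpha> t = kernel_of_symbol (\<lambda>\<xi>. of_real (exp (- t * norm \<xi> powr (2 * \<alpha>))))"

definition oseen_kernel :: "real \<Rightarrow> real \<Rightarrow> 3 \<Rightarrow> 3 \<Rightarrow> 3 \<Rightarrow> real^3 \<Rightarrow> real" where
  "oseen_kernel \<alpha> t j h k = kernel_of_symbol (\<lambda>\<xi>.
     \<i> * of_real (\<xi> $ k * ((if j = h then 1 else 0) - \<xi> $ j * \<xi> $ h / (norm \<xi>)\<^sup>2)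
                   * exp (- t * norm \<xi> powr (2 * \<alpha>))))"

definition has_conv :: "(real^3 \<Rightarrow> real) \<Rightarrow> (real^3 \<Rightarrow> 'b::{banach, second_countable_topology}) \<Rightarrow> real^3 \<Rightarrow> bool" where
  "has_conv G v x \<longleftrightarrow> integrable lebesgue (\<lambda>y. G (x - y) *\<^sub>R v y)"

definition conv :: "(real^3 \<Rightarrow> real) \<Rightarrow> (real^3 \<Rightarrow> 'b::{banach, second_countable_topology}) \<Rightarrow> real^3 \<Rightarrow> 'b" where
  "conv G v x = (\<integral>y. G (x - y) *\<^sub>R v y \<partial>lebesgue)"

definition oseen_conv :: "real \<Rightarrow> real \<Rightarrow> (real^3 \<Rightarrow> real^3) \<Rightarrow> real^3 \<Rightarrow> real^3" where
  "oseen_conv \<alpha> t v x =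
     (\<chi> j. \<Sum>h\<in>UNIV. \<Sum>k\<in>UNIV. conv (oseen_kernel \<alpha> t j h k) (\<lambda>y. v y $ h * v y $ k) x)"

text \<open>
  Since the Bochner integral of a non-integrable function is \<open>0\<close>, the integral equation is accompanied
  by the absolute convergence of every integral occurring in it.
\<close>

definition mild_solution ::
  "real \<Rightarrow> real \<Rightarrow> (real^3 \<Rightarrow> real^3) \<Rightarrow> (real \<Rightarrow> real^3 \<Rightarrow> real^3) \<Rightarrow> (real \<Rightarrow> real^3 \<Rightarrow> real^3) \<Rightarrow> bool" where
  "mild_solution \<alpha> T u0 f u \<longleftrightarrow>
     (AE (t, x) in lebesgue_on ({0<..<T} \<times> UNIV).
        has_conv (heat_kernel \<alpha> t) u0 x \<and>
        (AE s in lebesgue_on {0<..<t}. has_conv (heat_kernel \<alpha> (t - s)) (f s) x) \<and>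
        integrable (lebesgue_on {0<..<t}) (\<lambda>s. conv (heat_kernel \<alpha> (t - s)) (f s) x) \<and>
        (AE s in lebesgue_on {0<..<t}. \<forall>j h k.
           has_conv (oseen_kernel \<alpha> (t - s) j h k) (\<lambda>y. u s y $ h * u s y $ k) x) \<and>
        integrable (lebesgue_on {0<..<t}) (\<lambda>s. oseen_conv \<alpha> (t - s) (u s) x) \<and>
        u t x = conv (heat_kernel \<alpha> t) u0 x
          + (\<integral>s. conv (heat_kernel \<alpha> (t - s)) (f s) x \<partial>lebesgue_on {0<..<t})
          - (\<integral>s. oseen_conv \<alpha> (t - s) (u s) x \<partial>lebesgue_on {0<..<t}))"

end

theory Submission
  imports Defs
begin

text \<open>
  By scaling, the heat and Oseen kernels at time \<open>t\<close> are bounded by the bumps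
  \<open>b\<^sub>\<delta>(x) = \<delta>^(-3) (1 + |x|/\<delta>)^(-\<rho>)\<close> and \<open>b\<^sub>\<delta>/\<delta>\<close>, where \<open>\<delta> = t^(1/(2\<alpha>))\<close> and \<open>3 + 3/q\<^sup>- < \<rho> < 4\<close>.
  Convolution with \<open>b\<^sub>\<delta>\<close> is bounded on \<open>L\<^sup>q\<close> uniformly in \<open>\<delta> \<le> 1\<close>: at scale \<open>\<delta>\<close> the log-Hoelder condition
  lets one exchange \<open>q(y)\<close> for \<open>q(x)\<close> at the cost of the tail factor \<open>(1 + |x - y|/\<delta>)^(3/q\<^sup>-)\<close>. Since \<open>q\<^sup>- = q\<^sub>\<infinity>\<close>,
  the space \<open>L\<^sup>q\<close> embeds into the classical Lebesgue space with exponent \<open>q\<^sup>-\<close>, and a weighted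
  arithmetic-geometric mean inequality with the weight \<open>1/q(x)\<close> bounds \<open>b\<^sub>\<delta> * (uv)\<close> in \<open>L\<^sup>q\<close> by
  \<open>C \<delta>^(-3 (2/q\<^sup>- - 1/q\<^sup>+))\<close> times the norms of \<open>u\<close> and \<open>v\<close>. Hence the bilinear operator has the time kernel
  \<open>(t - s)^(-\<theta>)\<close> with \<open>\<theta> = (1 + 3 (2/q\<^sup>- - 1/q\<^sup>+))/(2\<alpha>)\<close>, and the assumption says \<open>\<theta> < 1 - 2/p\<^sup>-\<close>.

  For existence, the Picard iterates and their increments are dominated pointwise by the increasing
  iteration \<open>U \<mapsto> L + B(U, U)\<close> of the absolute kernels, which stays bounded in \<open>L\<^sup>q\<close> on a short time
  interval. For uniqueness, Young's inequality in time shows that every solution in \<open>L\<^sup>p(0, T; L\<^sup>q)\<close> is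
  bounded in \<open>L\<^sup>q\<close>, and the difference of two solutions contracts in a norm with weight \<open>exp(\<lambda>t)\<close>.
\<close>

section \<open>Decay of the heat and Oseen kernels\<close>

text \<open>The decay exponent \<rho> has a window with two ends. The Oseen symbol is homogeneous of
  degree one at the origin, hence only Lipschitz there, and fourth differences give every \<rho> <
  4. Exchanging q(y) for q(x) consumes 3/q^- of the decay, and what is left must exceed 3. The
  window is nonempty because q^- > 3.

  A norm bound by R is carried as \<open>modg (\<lambda>x. ennreal (1 / R) * F x) \<le> 1\<close>,
  for \<open>F\<close> with values in \<open>ennreal\<close>. Such unit-ball statements come without
  finiteness conditions and treat q = \<infinity> on the same footing; the triangle and Minkowski
  inequalities become \<open>modg_add\<close> and \<open>modg_integral\<close>. Domination by
  positive kernels makes the Picard limit a pointwise one, so completeness of the mixed space never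
  enters.

  The hypothesis on the exponents is strict. Its slack allows the variable time exponent to be
  replaced by a finite constant P below p^-, to which Young's inequality applies.\<close>

lemma nn_integral_lborel_affine:
  fixes f :: "'a::euclidean_space \<Rightarrow> ennreal" and c :: real
  assumes [measurable]: "f \<in> borel_measurable borel" and "c \<noteq> 0"
  shows "(\<integral>\<^sup>+x. f x \<partial>lborel) = ennreal (\<bar>c\<bar> ^ DIM('a)) * (\<integral>\<^sup>+x. f (t + c *\<^sub>R x) \<partial>lborel)"
  by (subst lborel_affine[OF \<open>c \<noteq> 0\<close>, of t])
     (simp add: nn_integral_density nn_integral_distr nn_integral_cmult)

lemma nn_integral_lborel_reflect:
  fixes f :: "'a::euclidean_space \<Rightarrow> ennreal"
  assumes [measurable]: "f \<in> borel_measurable borel"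
  shows "(\<integral>\<^sup>+x. f (t - x) \<partial>lborel) = (\<integral>\<^sup>+x. f x \<partial>lborel)"
  using nn_integral_lborel_affine[OF assms, of "-1" t] by simp

lemma integral_lborel_affine:
  fixes f :: "'a::euclidean_space \<Rightarrow> 'b::{banach, second_countable_topology}" and c :: real
  assumes [measurable]: "f \<in> borel_measurable borel" and "c \<noteq> 0"
  shows "(\<integral>x. f x \<partial>lborel) = \<bar>c\<bar> ^ DIM('a) *\<^sub>R (\<integral>x. f (t + c *\<^sub>R x) \<partial>lborel)"
  by (subst lborel_affine[OF \<open>c \<noteq> 0\<close>, of t])
     (simp add: integral_density integral_distr)

section \<open>Power weights on the line and radial weights on space\<close>

lemma nn_integral_powr_to_1:
  assumes "0 \<le> s" "s < 1"
  shows "(\<integral>\<^sup>+r. ennreal (r powr - s) * indicator {0..1} r \<partial>lborel) = ennreal (1 / (1 - s))"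
proof -
  have "((\<lambda>x. x powr - s) has_integral (1 powr (- s + 1) / (- s + 1))) {0..1::real}"
    using assms by (intro has_integral_powr_from_0) auto
  from nn_integral_has_integral_lebesgue'[OF _ this] show ?thesis
    by simp
qed

lemma nn_integral_powr_from_1:
  assumes "1 < s"
  shows "(\<integral>\<^sup>+r. ennreal (r powr - s) * indicator {1..} r \<partial>lborel) = ennreal (1 / (s - 1))"
proof -
  have "((\<lambda>x. x powr - s) has_integral (- (1 powr (- s + 1)) / (- s + 1))) {1::real..}"
    using assms by (intro has_integral_powr_to_inf) auto
  from nn_integral_has_integral_lebesgue'[OF _ this] show ?thesis
    using assms by (simp add: minus_divide_right)
qed

lemma nn_integral_abs_le:
  fixes h :: "real \<Rightarrow> ennreal"
  assumes [measurable]: "h \<in> borel_measurable borel"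
  shows "(\<integral>\<^sup>+r. h \<bar>r\<bar> \<partial>lborel) \<le> 2 * (\<integral>\<^sup>+r. h r * indicator {0..} r \<partial>lborel)"
proof -
  have "(\<integral>\<^sup>+r. h \<bar>r\<bar> \<partial>lborel) \<le> (\<integral>\<^sup>+r. h r * indicator {0..} r + h (0 - r) * indicator {0..} (0 - r) \<partial>lborel)"
    by (intro nn_integral_mono) (auto split: split_indicator simp: abs_if)
  also have "\<dots> = (\<integral>\<^sup>+r. h r * indicator {0..} r \<partial>lborel) + (\<integral>\<^sup>+r. h (0 - r) * indicator {0..} (0 - r) \<partial>lborel)"
    by (intro nn_integral_add) auto
  also have "(\<integral>\<^sup>+r. h (0 - r) * indicator {0..} (0 - r) \<partial>lborel) = (\<integral>\<^sup>+r. h r * indicator {0..} r \<partial>lborel)"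
    by (rule nn_integral_lborel_reflect) measurable
  finally show ?thesis by (simp add: mult_2)
qed

text \<open>The singularity at 0 and the decay at infinity are tuned separately: the weight behaves
  like r^(-s1) near 0 and like r^(-(s1 + s2)) at infinity, so integrability in dimension d amounts
  to s1 < d < s1 + s2.\<close>

definition weight1 :: "real \<Rightarrow> real \<Rightarrow> real \<Rightarrow> real" where
  "weight1 s1 s2 r = r powr - s1 * (1 + r) powr - s2"

lemma weight1_measurable [measurable]: "weight1 s1 s2 \<in> borel_measurable borel"
  unfolding weight1_def by measurable

lemma nn_integral_weight1:
  assumes "0 \<le> s1" "s1 < 1" "0 \<le> s2" "1 < s1 + s2"
  shows "(\<integral>\<^sup>+r. ennreal (weight1 s1 s2 \<bar>r\<bar>) \<partial>lborel) < \<infinity>"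
proof -
  have le1: "weight1 s1 s2 r \<le> r powr - s1" if "0 \<le> r" for r
  proof -
    have "(1 + r) powr - s2 \<le> (1 + r) powr 0"
      using that assms by (intro powr_mono) auto
    then show ?thesis using that
      by (auto simp: weight1_def intro!: mult_left_le)
  qed
  have le2: "weight1 s1 s2 r \<le> r powr - (s1 + s2)" if "1 \<le> r" for r
  proof -
    have "(1 + r) powr - s2 \<le> r powr - s2"
      using that assms by (intro powr_mono2') auto
    then have "weight1 s1 s2 r \<le> r powr - s1 * r powr - s2"
      unfolding weight1_def by (intro mult_left_mono) auto
    also have "\<dots> = r powr - (s1 + s2)"
      using that by (simp add: powr_add[symmetric])
    finally show ?thesis .
  qed
  have "(\<integral>\<^sup>+r. ennreal (weight1 s1 s2 r) * indicator {0..} r \<partial>lborel)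
     \<le> (\<integral>\<^sup>+r. ennreal (r powr - s1) * indicator {0..1} r
            + ennreal (r powr - (s1 + s2)) * indicator {1..} r \<partial>lborel)"
  proof (intro nn_integral_mono)
    fix r :: real
    show "ennreal (weight1 s1 s2 r) * indicator {0..} r
      \<le> ennreal (r powr - s1) * indicator {0..1} r + ennreal (r powr - (s1 + s2)) * indicator {1..} r"
      using le1[of r] le2[of r]
      by (cases "0 \<le> r"; cases "r \<le> 1")
         (auto intro!: order_trans[OF ennreal_leI add_increasing2] ennreal_leI)
  qed
  also have "\<dots> = (\<integral>\<^sup>+r. ennreal (r powr - s1) * indicator {0..1} r \<partial>lborel)
            + (\<integral>\<^sup>+r. ennreal (r powr - (s1 + s2)) * indicator {1..} r \<partial>lborel)"
    by (intro nn_integral_add) auto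
  also have "\<dots> = ennreal (1 / (1 - s1)) + ennreal (1 / (s1 + s2 - 1))"
    using assms by (simp only: nn_integral_powr_to_1 nn_integral_powr_from_1)
  finally have "(\<integral>\<^sup>+r. ennreal (weight1 s1 s2 r) * indicator {0..} r \<partial>lborel) < \<infinity>"
    by (rule order_le_less_trans) simp
  then have fin: "2 * (\<integral>\<^sup>+r. ennreal (weight1 s1 s2 r) * indicator {0..} r \<partial>lborel) < \<infinity>"
    by (simp add: ennreal_mult_less_top)
  have "(\<integral>\<^sup>+r. ennreal (weight1 s1 s2 \<bar>r\<bar>) \<partial>lborel)
      \<le> 2 * (\<integral>\<^sup>+r. ennreal (weight1 s1 s2 r) * indicator {0..} r \<partial>lborel)"
    by (rule nn_integral_abs_le) measurable
  also note fin
  finally show ?thesis .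
qed

text \<open>A decreasing radial function satisfies \<open>\<phi>(|x|)^3 \<le> \<phi>(|x\<^sub>1|) \<phi>(|x\<^sub>2|) \<phi>(|x\<^sub>3|)\<close>, which replaces
  polar coordinates.\<close>

lemma nn_integral_radial_weight:
  assumes "0 \<le> s1" "s1 < 3" "0 \<le> s2" "3 < s1 + s2"
  shows "(\<integral>\<^sup>+x. ennreal (weight1 s1 s2 (norm (x::real^3))) \<partial>lborel) < \<infinity>"
proof -
  define w where "w = weight1 (s1/3) (s2/3)"
  have [measurable]: "w \<in> borel_measurable borel" unfolding w_def by measurable
  have w_nonneg: "0 \<le> w r" for r by (simp add: w_def weight1_def)
  have w_mono: "w r' \<le> w r" if "0 < r" "r \<le> r'" for r r'
    unfolding w_def weight1_def using that assms by (intro mult_mono powr_mono2') auto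
  \<comment> \<open>The coordinate planes are removed because \<open>0 powr s = 0\<close> makes
    \<open>w\<close> vanish at 0, where monotonicity would fail.\<close>
  have "AE x in lborel. (x::real^3) $ i \<noteq> 0" for i :: 3
  proof -
    have "{x::real^3. x $ i = 0} = {x. axis i 1 \<bullet> x = 0}"
      by (auto simp: inner_axis' )
    then have "negligible {x::real^3. x $ i = 0}"
      by (simp add: negligible_hyperplane axis_eq_0_iff)
    then have "{x::real^3. x $ i = 0} \<in> null_sets lebesgue" by (simp add: negligible_iff_null_sets)
    moreover have "{x::real^3. x $ i = 0} \<in> sets borel" by measurable
    ultimately have "{x::real^3. x $ i = 0} \<in> null_sets lborel"
      by (simp add: null_sets_def)
    from AE_not_in[OF this] show ?thesis by simp
  qed
  then have ae: "AE x in lborel. \<forall>i::3. (x::real^3) $ i \<noteq> 0"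
    by (simp add: AE_all_countable)
  \<comment> \<open>Dividing both exponents by 3 makes the product over three coordinates restore
    the original weight.\<close>
  have cube: "weight1 s1 s2 r = w r ^ 3" if "0 < r" for r
    using that unfolding w_def weight1_def
    by (simp add: power_mult_distrib powr_realpow[symmetric] powr_powr powr_power)
  have "(\<integral>\<^sup>+x. ennreal (weight1 s1 s2 (norm (x::real^3))) \<partial>lborel)
      \<le> (\<integral>\<^sup>+x. (\<Prod>b\<in>Basis. ennreal (w \<bar>(x::real^3) \<bullet> b\<bar>)) \<partial>lborel)"
  proof (intro nn_integral_mono_AE, use ae in eventually_elim)
    fix x :: "real^3" assume nz: "\<forall>i. x $ i \<noteq> 0"
    then have "x \<noteq> 0" by (metis zero_index)
    then have "weight1 s1 s2 (norm x) = (\<Prod>b\<in>(Basis::(real^3) set). w (norm x))"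
      by (simp add: cube)
    also have "\<dots> \<le> (\<Prod>b\<in>Basis. w \<bar>x \<bullet> b\<bar>)"
    proof (intro prod_mono conjI w_mono w_nonneg)
      fix b :: "real^3" assume b: "b \<in> Basis"
      then obtain i where "b = axis i 1" by (auto simp: Basis_vec_def)
      then show "0 < \<bar>x \<bullet> b\<bar>" using nz by (simp add: inner_axis)
      show "\<bar>x \<bullet> b\<bar> \<le> norm x" using b by (rule Basis_le_norm)
    qed
    finally show "ennreal (weight1 s1 s2 (norm x)) \<le> (\<Prod>b\<in>Basis. ennreal (w \<bar>x \<bullet> b\<bar>))"
      by (simp add: prod_ennreal w_nonneg ennreal_leI)
  qed
  also have "\<dots> = (\<Prod>b\<in>(Basis::(real^3) set). \<integral>\<^sup>+r. ennreal (w \<bar>r\<bar>) \<partial>lborel)"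
    by (intro nn_integral_lborel_prod) auto
  also have "\<dots> < \<infinity>"
    using nn_integral_weight1[of "s1/3" "s2/3"] assms
    by (simp add: w_def power_less_top_ennreal)
  finally show ?thesis .
qed

section \<open>Fourier integrals and iterated differences\<close>

definition fourier :: "(real^3 \<Rightarrow> real) \<Rightarrow> real^3 \<Rightarrow> complex" where
  "fourier m x = (\<integral>\<xi>. exp (\<i> * of_real (x \<bullet> \<xi>)) * of_real (m \<xi>) \<partial>lborel)"

text \<open>Kept generic so that the same iterates serve on space, in direction \<open>v\<close>,
  and on the line with a real step, where the mean value theorem applies.\<close>

definition fdiff :: "'a::real_normed_vector \<Rightarrow> ('a \<Rightarrow> real) \<Rightarrow> 'a \<Rightarrow> real" where
  "fdiff v m \<xi> = m (\<xi> + v) - m \<xi>"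

lemma integrable_fourier:
  assumes "integrable lborel m"
  shows "integrable lborel (\<lambda>\<xi>. exp (\<i> * of_real (x \<bullet> \<xi>)) * complex_of_real (m \<xi>))"
  by (rule Bochner_Integration.integrable_bound[OF assms])
     (use assms in \<open>auto simp: norm_mult\<close>)

lemma norm_fourier_le:
  assumes "integrable lborel m"
  shows "norm (fourier m x) \<le> (\<integral>\<xi>. \<bar>m \<xi>\<bar> \<partial>lborel)"
proof -
  have "norm (fourier m x) \<le> (\<integral>\<xi>. norm (exp (\<i> * of_real (x \<bullet> \<xi>)) * complex_of_real (m \<xi>)) \<partial>lborel)"
    unfolding fourier_def by (rule integral_norm_bound)
  then show ?thesis by (simp add: norm_mult)
qed

lemma integrable_translate:
  fixes m :: "'a::euclidean_space \<Rightarrow> real"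
  assumes m: "integrable lborel m"
  shows "integrable lborel (\<lambda>\<xi>. m (\<xi> + v))"
proof -
  have "integrable (distr lborel borel ((+) v)) m" using m by (simp add: lborel_distr_plus)
  then have "integrable lborel (\<lambda>\<xi>. m (v + \<xi>))"
    by (rule integrable_distr[rotated]) simp
  then show ?thesis by (simp add: add.commute)
qed

lemma fourier_translate:
  assumes m: "integrable lborel m"
  shows "fourier (\<lambda>\<xi>. m (\<xi> + v)) x = exp (- (\<i> * of_real (x \<bullet> v))) * fourier m x"
proof -
  have [measurable]: "m \<in> borel_measurable borel" using m by auto
  have "fourier m x = (\<integral>\<xi>. exp (\<i> * of_real (x \<bullet> (v + \<xi>))) * of_real (m (v + \<xi>)) \<partial>lborel)"
    unfolding fourier_def
    using integral_lborel_affine[of "\<lambda>\<xi>. exp (\<i> * of_real (x \<bullet> \<xi>)) * complex_of_real (m \<xi>)" 1 v] by simp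
  also have "\<dots> = (\<integral>\<xi>. exp (\<i> * of_real (x \<bullet> v)) * (exp (\<i> * of_real (x \<bullet> \<xi>)) * of_real (m (\<xi> + v))) \<partial>lborel)"
    by (intro Bochner_Integration.integral_cong)
       (simp_all add: inner_add_right exp_add ring_distribs add.commute mult_ac)
  also have "\<dots> = exp (\<i> * of_real (x \<bullet> v)) * fourier (\<lambda>\<xi>. m (\<xi> + v)) x"
    unfolding fourier_def by simp
  finally show ?thesis by (simp add: exp_minus)
qed

lemma integrable_fdiff: "integrable lborel m \<Longrightarrow> integrable lborel (fdiff v m)"
  for m :: "'a::euclidean_space \<Rightarrow> real"
  unfolding fdiff_def[abs_def] by (intro Bochner_Integration.integrable_diff integrable_translate)

lemma integrable_fdiff_funpow: "integrable lborel m \<Longrightarrow> integrable lborel ((fdiff v ^^ n) m)"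
  for m :: "'a::euclidean_space \<Rightarrow> real"
  by (induction n) (auto intro: integrable_fdiff)

lemma fourier_fdiff:
  assumes m: "integrable lborel m"
  shows "fourier (fdiff v m) x = (exp (- (\<i> * of_real (x \<bullet> v))) - 1) * fourier m x"
proof -
  have "fourier (fdiff v m) x = fourier (\<lambda>\<xi>. m (\<xi> + v)) x - fourier m x"
    unfolding fourier_def fdiff_def
    using integrable_fourier[OF m, of x] integrable_fourier[OF integrable_translate[OF m], of x v]
    by (simp add: right_diff_distrib)
  then show ?thesis by (simp add: fourier_translate[OF m] algebra_simps)
qed

lemma fourier_fdiff_funpow:
  assumes m: "integrable lborel m"
  shows "fourier ((fdiff v ^^ n) m) x = (exp (- (\<i> * of_real (x \<bullet> v))) - 1) ^ n * fourier m x"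
  by (induction n) (simp_all add: fourier_fdiff integrable_fdiff_funpow m)

text \<open>\<open>\<phi> i\<close> stands for the i-th derivative. The induction replaces the whole
  chain by its first differences, on an interval shorter by one step; the mean value theorem bounds
  the top member of the new chain by h * M.\<close>

lemma fdiff_le:
  fixes \<phi> :: "nat \<Rightarrow> real \<Rightarrow> real"
  assumes "\<And>i s. i < n \<Longrightarrow> a \<le> s \<Longrightarrow> s \<le> a + n * h \<Longrightarrow> (\<phi> i has_real_derivative \<phi> (Suc i) s) (at s)"
    and "\<And>s. a \<le> s \<Longrightarrow> s \<le> a + n * h \<Longrightarrow> \<bar>\<phi> n s\<bar> \<le> M" and "0 < h"
  shows "\<bar>(fdiff h ^^ n) (\<phi> 0) a\<bar> \<le> h ^ n * M"
  using assms
proof (induction n arbitrary: \<phi> M)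
  case 0
  then show ?case by simp
next
  case (Suc n)
  define \<psi> where "\<psi> i = fdiff h (\<phi> i)" for i
  have bd: "\<bar>\<psi> n s\<bar> \<le> h * M" if s: "a \<le> s" "s \<le> a + n * h" for s
  proof -
    have d: "(\<phi> n has_real_derivative \<phi> (Suc n) z) (at z)" if "s \<le> z" "z \<le> s + h" for z
      using that s Suc.prems(3) by (intro Suc.prems(1)) (auto simp: algebra_simps)
    have "\<exists>z. s < z \<and> z < s + h \<and> \<phi> n (s + h) - \<phi> n s = (s + h - s) * \<phi> (Suc n) z"
      using d Suc.prems(3) by (intro MVT2) auto
    then obtain z where z: "s < z" "z < s + h" "\<psi> n s = h * \<phi> (Suc n) z"
      by (auto simp: \<psi>_def fdiff_def)
    have "\<bar>\<phi> (Suc n) z\<bar> \<le> M"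
      using z s by (intro Suc.prems(2)) (auto simp: algebra_simps)
    then show ?thesis using Suc.prems(3) by (simp add: z(3) abs_mult)
  qed
  have "(fdiff h ^^ Suc n) (\<phi> 0) a = (fdiff h ^^ n) (\<psi> 0) a"
    by (simp only: funpow_Suc_right o_def \<psi>_def)
  also have "\<bar>\<dots>\<bar> \<le> h ^ n * (h * M)"
  proof (rule Suc.IH)
    fix i s assume i: "i < n" and s: "a \<le> s" "s \<le> a + n * h"
    have 1: "(\<phi> i has_real_derivative \<phi> (Suc i) s) (at s)"
      using i s Suc.prems(3) by (intro Suc.prems(1)) (auto simp: algebra_simps)
    have "(\<phi> i has_real_derivative \<phi> (Suc i) (s + h)) (at (s + h))"
      using i s Suc.prems(3) by (intro Suc.prems(1)) (auto simp: algebra_simps)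
    then have 2: "((\<lambda>s. \<phi> i (s + h)) has_real_derivative \<phi> (Suc i) (s + h)) (at s)"
      by (simp add: DERIV_shift)
    show "(\<psi> i has_real_derivative \<psi> (Suc i) s) (at s)"
      unfolding \<psi>_def fdiff_def[abs_def] by (intro DERIV_diff 1 2)
  qed (use bd Suc.prems in auto)
  finally show ?case by (simp add: algebra_simps)
qed

lemma fdiff_funpow_line:
  fixes m :: "'a::real_normed_vector \<Rightarrow> real"
  shows "(fdiff (h *\<^sub>R e) ^^ n) m (\<xi> + s *\<^sub>R e) = (fdiff h ^^ n) (\<lambda>s. m (\<xi> + s *\<^sub>R e)) s"
  by (induction n arbitrary: s) (simp_all add: fdiff_def add.assoc flip: scaleR_add_left)

text \<open>Differences of positive order annihilate constants, so only the oscillation around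
  \<open>c\<close> counts. No derivative is involved, which makes the bound suitable near the
  origin.\<close>

lemma fdiff_funpow_near:
  fixes m :: "'a::real_normed_vector \<Rightarrow> real"
  assumes "\<And>\<eta>. norm \<eta> \<le> R + n * norm v \<Longrightarrow> \<bar>m \<eta> - c\<bar> \<le> M" "norm \<xi> \<le> R" "0 < n"
  shows "\<bar>(fdiff v ^^ n) m \<xi>\<bar> \<le> 2 ^ n * M"
  using assms(3,1,2)
proof (induction n arbitrary: \<xi> R rule: nat_induct_non_zero)
  case 1
  have "\<bar>m (\<xi> + v) - c\<bar> \<le> M" "\<bar>m \<xi> - c\<bar> \<le> M"
    using 1(2) norm_triangle_ineq[of \<xi> v] norm_ge_zero[of v] by (auto intro!: 1(1) simp del: norm_ge_zero)
  then show ?case by (simp add: fdiff_def)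
next
  case (Suc n)
  have R: "norm (\<xi> + v) \<le> R + norm v"
    using Suc.prems(2) norm_triangle_ineq[of \<xi> v] by simp
  have 1: "\<bar>(fdiff v ^^ n) m (\<xi> + v)\<bar> \<le> 2 ^ n * M"
    by (rule Suc.IH[OF _ R]) (use Suc.prems in \<open>auto simp: algebra_simps\<close>)
  have R': "norm \<xi> \<le> R + norm v"
    using Suc.prems(2) norm_ge_zero[of v] by linarith
  have 2: "\<bar>(fdiff v ^^ n) m \<xi>\<bar> \<le> 2 ^ n * M"
    by (rule Suc.IH[OF _ R']) (use Suc.prems in \<open>auto simp: algebra_simps\<close>)
  have "(fdiff v ^^ Suc n) m \<xi> = (fdiff v ^^ n) m (\<xi> + v) - (fdiff v ^^ n) m \<xi>"
    by (simp add: fdiff_def[of v "(fdiff v ^^ n) m"])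
  then show ?case using 1 2 by simp
qed

section \<open>Symbols and their derivatives\<close>

text \<open>Symbols of order \<open>d\<close> at the origin; differentiation lowers the order by one.\<close>

inductive symbol :: "real \<Rightarrow> real \<Rightarrow> (real^3 \<Rightarrow> real) \<Rightarrow> bool" for \<alpha> where
  base: "d \<le> \<beta> \<Longrightarrow> symbol \<alpha> d (\<lambda>\<xi>. norm \<xi> powr \<beta> * exp (- (norm \<xi> powr (2 * \<alpha>))))"
| mult: "symbol \<alpha> d f \<Longrightarrow> symbol \<alpha> (d + 1) (\<lambda>\<xi>. \<xi> $ k * f \<xi>)"
| add: "symbol \<alpha> d f \<Longrightarrow> symbol \<alpha> d g \<Longrightarrow> symbol \<alpha> d (\<lambda>\<xi>. f \<xi> + g \<xi>)"
| cmult: "symbol \<alpha> d f \<Longrightarrow> symbol \<alpha> d (\<lambda>\<xi>. c * f \<xi>)"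

text \<open>The origin is left out because the symbols need not be differentiable there.\<close>

definition has_pderiv :: "3 \<Rightarrow> (real^3 \<Rightarrow> real) \<Rightarrow> (real^3 \<Rightarrow> real) \<Rightarrow> bool" where
  "has_pderiv l f f' \<longleftrightarrow>
     (\<forall>\<xi>. \<xi> \<noteq> 0 \<longrightarrow> ((\<lambda>s. f (\<xi> + s *\<^sub>R axis l 1)) has_real_derivative f' \<xi>) (at 0))"

lemma has_pderiv_at:
  assumes "has_pderiv l f f'" "\<xi> + s *\<^sub>R axis l 1 \<noteq> 0"
  shows "((\<lambda>s. f (\<xi> + s *\<^sub>R axis l 1)) has_real_derivative f' (\<xi> + s *\<^sub>R axis l 1)) (at s)"
proof -
  have "((\<lambda>u. f (\<xi> + s *\<^sub>R axis l 1 + u *\<^sub>R axis l 1)) has_real_derivative f' (\<xi> + s *\<^sub>R axis l 1)) (at 0)"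
    using assms unfolding has_pderiv_def by blast
  then have "((\<lambda>u. f (\<xi> + (u + s) *\<^sub>R axis l 1)) has_real_derivative f' (\<xi> + s *\<^sub>R axis l 1)) (at 0)"
    by (simp add: algebra_simps)
  then show ?thesis
    using DERIV_shift[of "\<lambda>s. f (\<xi> + s *\<^sub>R axis l 1)" _ 0 s] by simp
qed

lemma norm_line_derivative:
  assumes "\<xi> \<noteq> (0::real^3)"
  shows "((\<lambda>s. norm (\<xi> + s *\<^sub>R axis l 1)) has_real_derivative \<xi> $ l / norm \<xi>) (at 0)"
proof -
  have "(\<xi> + s *\<^sub>R axis l 1) \<bullet> (\<xi> + s *\<^sub>R axis l 1) = \<xi> \<bullet> \<xi> + s * (2 * \<xi> $ l) + s * s" for s
    by (simp add: inner_add_left inner_add_right inner_axis inner_axis' algebra_simps)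
  then have 1: "((\<lambda>s. (\<xi> + s *\<^sub>R axis l 1) \<bullet> (\<xi> + s *\<^sub>R axis l 1)) has_real_derivative 2 * \<xi> $ l) (at 0)"
    by (auto intro!: derivative_eq_intros)
  have "((\<lambda>s. sqrt ((\<xi> + s *\<^sub>R axis l 1) \<bullet> (\<xi> + s *\<^sub>R axis l 1))) has_real_derivative
      inverse (sqrt (\<xi> \<bullet> \<xi>)) / 2 * (2 * \<xi> $ l)) (at 0)"
    by (rule DERIV_chain2[of sqrt, OF _ 1]) (use assms in \<open>auto intro!: DERIV_real_sqrt\<close>)
  then show ?thesis by (simp add: norm_eq_sqrt_inner field_simps)
qed

lemma base_symbol_pderiv:
  assumes "0 < \<alpha>"
  shows "has_pderiv l (\<lambda>\<xi>. norm \<xi> powr \<beta> * exp (- (norm \<xi> powr (2 * \<alpha>))))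
     (\<lambda>\<xi>. \<beta> * (\<xi> $ l * (norm \<xi> powr (\<beta> - 2) * exp (- (norm \<xi> powr (2 * \<alpha>)))))
       + (- (2 * \<alpha>)) * (\<xi> $ l * (norm \<xi> powr (\<beta> + 2 * \<alpha> - 2) * exp (- (norm \<xi> powr (2 * \<alpha>))))))"
  unfolding has_pderiv_def
proof (intro allI impI)
  fix \<xi> :: "real^3" assume nz: "\<xi> \<noteq> 0"
  note nd = norm_line_derivative[OF nz, of l]
  have p: "((\<lambda>s. norm (\<xi> + s *\<^sub>R axis l 1) powr \<gamma>) has_real_derivative
        \<gamma> * norm \<xi> powr (\<gamma> - 2) * \<xi> $ l) (at 0)" for \<gamma>
  proof -
    have "((\<lambda>s. norm (\<xi> + s *\<^sub>R axis l 1) powr \<gamma>) has_real_derivative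
        (\<gamma> * norm (\<xi> + 0 *\<^sub>R axis l 1) powr (\<gamma> - 1)) * (\<xi> $ l / norm \<xi>)) (at 0)"
      by (rule DERIV_chain2[where f="\<lambda>x. x powr \<gamma>", OF _ nd]) (use nz in \<open>auto intro!: has_real_derivative_powr\<close>)
    moreover have "norm \<xi> powr (\<gamma> - 1) = norm \<xi> powr (\<gamma> - 2) * norm \<xi>"
      using nz powr_add[of "norm \<xi>" "\<gamma> - 2" 1] by simp
    ultimately show ?thesis using nz by (simp add: mult.assoc)
  qed
  have "((\<lambda>s. norm (\<xi> + s *\<^sub>R axis l 1) powr \<beta> * exp (- (norm (\<xi> + s *\<^sub>R axis l 1) powr (2 * \<alpha>)))) has_real_derivative
     \<beta> * norm \<xi> powr (\<beta> - 2) * \<xi> $ l * exp (- (norm \<xi> powr (2 * \<alpha>)))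
     + norm \<xi> powr \<beta> * (exp (- (norm \<xi> powr (2 * \<alpha>))) * - (2 * \<alpha> * norm \<xi> powr (2 * \<alpha> - 2) * \<xi> $ l))) (at 0)"
    by (rule derivative_eq_intros refl p | simp)+
  moreover have "norm \<xi> powr (\<beta> + 2 * \<alpha> - 2) = norm \<xi> powr \<beta> * norm \<xi> powr (2 * \<alpha> - 2)"
    by (simp add: powr_add[symmetric] add_diff_eq)
  ultimately show "((\<lambda>s. norm (\<xi> + s *\<^sub>R axis l 1) powr \<beta> * exp (- (norm (\<xi> + s *\<^sub>R axis l 1) powr (2 * \<alpha>)))) has_real_derivative
     \<beta> * (\<xi> $ l * (norm \<xi> powr (\<beta> - 2) * exp (- (norm \<xi> powr (2 * \<alpha>)))))
       + (- (2 * \<alpha>)) * (\<xi> $ l * (norm \<xi> powr (\<beta> + 2 * \<alpha> - 2) * exp (- (norm \<xi> powr (2 * \<alpha>)))))) (at 0)"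
    by (simp add: algebra_simps)
qed

text \<open>For a base symbol, the factor \<xi>_l together with the power \<beta> - 2 counts as
  order d - 1, and the second term has the larger power \<beta> + 2\<alpha> - 2; this is why
  \<open>base\<close> asks only for d \<le> \<beta>.\<close>

lemma symbol_pderiv:
  assumes "symbol \<alpha> d f" "0 < \<alpha>"
  shows "\<exists>f'. symbol \<alpha> (d - 1) f' \<and> has_pderiv l f f'"
  using assms(1)
proof induction
  case (base d \<beta>)
  have 1: "symbol \<alpha> (d - 2 + 1) (\<lambda>\<xi>. \<xi> $ l * (norm \<xi> powr (\<beta> - 2) * exp (- (norm \<xi> powr (2 * \<alpha>)))))"
    using base by (intro symbol.mult symbol.base) auto
  have 2: "symbol \<alpha> (d - 2 + 1) (\<lambda>\<xi>. \<xi> $ l * (norm \<xi> powr (\<beta> + 2 * \<alpha> - 2) * exp (- (norm \<xi> powr (2 * \<alpha>)))))"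
    using base assms(2) by (intro symbol.mult symbol.base) auto
  have eq: "d - 2 + 1 = d - 1" by simp
  show ?case
    using symbol.add[OF symbol.cmult[OF 1, of \<beta>] symbol.cmult[OF 2, of "- (2 * \<alpha>)"], unfolded eq]
      base_symbol_pderiv[OF assms(2)] by blast
next
  case (mult d f k)
  then obtain f' where f': "symbol \<alpha> (d - 1) f'" "has_pderiv l f f'" by blast
  have eq: "d - 1 + 1 = d" "d + 1 - 1 = d" by simp_all
  have "symbol \<alpha> d (\<lambda>\<xi>. (if k = l then 1 else 0) * f \<xi> + \<xi> $ k * f' \<xi>)"
    using symbol.add[OF symbol.cmult[OF mult.hyps] symbol.mult[OF f'(1), unfolded eq]] .
  moreover have "has_pderiv l (\<lambda>\<xi>. \<xi> $ k * f \<xi>) (\<lambda>\<xi>. (if k = l then 1 else 0) * f \<xi> + \<xi> $ k * f' \<xi>)"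
    unfolding has_pderiv_def
  proof (intro allI impI)
    fix \<xi> :: "real^3" assume nz: "\<xi> \<noteq> 0"
    have 1: "((\<lambda>s. (\<xi> + s *\<^sub>R axis l 1) $ k) has_real_derivative (if k = l then 1 else 0)) (at 0)"
      by (auto simp: axis_def intro!: derivative_eq_intros)
    have 2: "((\<lambda>s. f (\<xi> + s *\<^sub>R axis l 1)) has_real_derivative f' \<xi>) (at 0)"
      using f'(2) nz by (auto simp: has_pderiv_def)
    show "((\<lambda>s. (\<xi> + s *\<^sub>R axis l 1) $ k * f (\<xi> + s *\<^sub>R axis l 1)) has_real_derivative
         (if k = l then 1 else 0) * f \<xi> + \<xi> $ k * f' \<xi>) (at 0)"
      using DERIV_mult[OF 1 2] by (simp add: algebra_simps)
  qed
  ultimately show ?case unfolding eq by blast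
next
  case (add d f g)
  then obtain f' g' where "symbol \<alpha> (d - 1) f'" "has_pderiv l f f'" "symbol \<alpha> (d - 1) g'" "has_pderiv l g g'"
    by blast
  then show ?case
    by (intro exI[of _ "\<lambda>\<xi>. f' \<xi> + g' \<xi>"]) (auto intro!: symbol.add simp: has_pderiv_def DERIV_add)
next
  case (cmult d f c)
  then obtain f' where "symbol \<alpha> (d - 1) f'" "has_pderiv l f f'" by blast
  then show ?case
    by (intro exI[of _ "\<lambda>\<xi>. c * f' \<xi>"]) (auto intro!: symbol.cmult simp: has_pderiv_def DERIV_cmult)
qed

lemma power_le_fact_exp:
  fixes r :: real
  assumes "0 \<le> r"
  shows "r ^ n \<le> fact n * exp r"
proof -
  have "(\<Sum>i\<in>{n}. r ^ i /\<^sub>R fact i) \<le> (\<Sum>i. r ^ i /\<^sub>R fact i)"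
    using assms by (intro sum_le_suminf summable_exp_generic) auto
  then show ?thesis by (simp add: exp_def field_simps)
qed

text \<open>The decay exponent 5 survives the loss of one factor: a symbol of order 1 still decays
  like (1 + |\<xi>|)^(-4), which is integrable in dimension 3. Since 2\<alpha> \<ge> 1, the
  exponential is at most exp(-r) for r > 1, and 32 = 2^5 comes from 1 + r \<le> 2 max(1, r).\<close>

lemma power_exp_bound:
  fixes \<gamma> \<alpha> :: real
  assumes "0 \<le> \<gamma>" "1/2 \<le> \<alpha>"
  shows "\<exists>C\<ge>0. \<forall>r>0. r powr \<gamma> * exp (- (r powr (2 * \<alpha>))) \<le> C * (1 + r) powr - 5"
proof -
  obtain n :: nat where n: "\<gamma> + 5 \<le> n" using real_arch_simple by blast
  have "r powr \<gamma> * exp (- (r powr (2 * \<alpha>))) \<le> (32 + 32 * fact n) * (1 + r) powr - 5" if r: "0 < r" for r :: real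
  proof -
    have "r powr \<gamma> * exp (- (r powr (2 * \<alpha>))) * (1 + r) ^ 5 \<le> 32 + 32 * fact n"
    proof (cases "r \<le> 1")
      case True
      have "r powr \<gamma> \<le> 1" using True r assms by (simp add: powr_le1)
      moreover have "(1 + r) ^ 5 \<le> 2 ^ 5" using True r by (intro power_mono) auto
      moreover have "exp (- (r powr (2 * \<alpha>))) \<le> 1" by simp
      ultimately have "r powr \<gamma> * exp (- (r powr (2 * \<alpha>))) * (1 + r) ^ 5 \<le> 1 * 1 * 2 ^ 5"
        using r by (intro mult_mono) auto
      moreover have "(0::real) \<le> fact n" by simp
      ultimately show ?thesis by (simp add: add_increasing2)
    next
      case False
      have "r powr 1 \<le> r powr (2 * \<alpha>)" using False assms by (intro powr_mono) auto
      then have e: "exp (- (r powr (2 * \<alpha>))) \<le> exp (- r)" using r by simp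
      have "(1 + r) ^ 5 \<le> (2 * r) ^ 5" using False by (intro power_mono) auto
      also have "\<dots> = 32 * r powr 5" using r by (simp add: powr_numeral power_mult_distrib)
      finally have "r powr \<gamma> * exp (- (r powr (2 * \<alpha>))) * (1 + r) ^ 5 \<le> r powr \<gamma> * exp (- r) * (32 * r powr 5)"
        using e r by (intro mult_mono) auto
      also have "\<dots> = 32 * (r powr (\<gamma> + 5) * exp (- r))" by (simp add: powr_add)
      also have "r powr (\<gamma> + 5) \<le> r powr n" using False n by (intro powr_mono) auto
      also have "r powr n = r ^ n" using r by (simp add: powr_realpow)
      also have "r ^ n \<le> fact n * exp r"
        using r power_le_fact_exp by simp
      finally have "r powr \<gamma> * exp (- (r powr (2 * \<alpha>))) * (1 + r) ^ 5 \<le> 32 * fact n"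
        by (simp add: exp_minus field_simps)
      then show ?thesis by simp
    qed
    then show ?thesis using r by (simp add: powr_minus powr_numeral field_simps)
  qed
  then show ?thesis by (intro exI[of _ "32 + 32 * fact n"]) auto
qed

lemma symbol_bound:
  assumes "symbol \<alpha> d f" "1/2 \<le> \<alpha>"
  shows "\<exists>C\<ge>0. \<forall>\<xi>. \<xi> \<noteq> 0 \<longrightarrow> \<bar>f \<xi>\<bar> \<le> C * norm \<xi> powr d * (1 + norm \<xi>) powr - 5"
  using assms(1)
proof induction
  case (base d \<beta>)
  then obtain C where C: "0 \<le> C" "\<And>r. 0 < r \<Longrightarrow> r powr (\<beta> - d) * exp (- (r powr (2 * \<alpha>))) \<le> C * (1 + r) powr - 5"
    using power_exp_bound[of "\<beta> - d" \<alpha>] assms(2) by auto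
  have "\<bar>norm \<xi> powr \<beta> * exp (- (norm \<xi> powr (2 * \<alpha>)))\<bar> \<le> C * norm \<xi> powr d * (1 + norm \<xi>) powr - 5"
    if "\<xi> \<noteq> 0" for \<xi> :: "real^3"
  proof -
    have "norm \<xi> powr \<beta> = norm \<xi> powr d * norm \<xi> powr (\<beta> - d)" by (simp add: powr_add[symmetric])
    then show ?thesis
      using mult_left_mono[OF C(2)[of "norm \<xi>"], of "norm \<xi> powr d"] that by (simp add: mult_ac)
  qed
  then show ?case using C(1) by blast
next
  case (mult d f k)
  then obtain C where C: "0 \<le> C" "\<And>\<xi>. \<xi> \<noteq> 0 \<Longrightarrow> \<bar>f \<xi>\<bar> \<le> C * norm \<xi> powr d * (1 + norm \<xi>) powr - 5"
    by blast
  have "\<bar>\<xi> $ k * f \<xi>\<bar> \<le> C * norm \<xi> powr (d + 1) * (1 + norm \<xi>) powr - 5" if "\<xi> \<noteq> 0" for \<xi>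
  proof -
    have "\<bar>\<xi> $ k * f \<xi>\<bar> \<le> norm \<xi> * (C * norm \<xi> powr d * (1 + norm \<xi>) powr - 5)"
      unfolding abs_mult using C that by (intro mult_mono component_le_norm_cart) auto
    then show ?thesis using that by (simp add: powr_add mult_ac)
  qed
  then show ?case using C(1) by blast
next
  case (add d f g)
  then obtain C C' where C: "0 \<le> C" "\<And>\<xi>. \<xi> \<noteq> 0 \<Longrightarrow> \<bar>f \<xi>\<bar> \<le> C * norm \<xi> powr d * (1 + norm \<xi>) powr - 5"
    "0 \<le> C'" "\<And>\<xi>. \<xi> \<noteq> 0 \<Longrightarrow> \<bar>g \<xi>\<bar> \<le> C' * norm \<xi> powr d * (1 + norm \<xi>) powr - 5"
    by blast
  have "\<bar>f \<xi> + g \<xi>\<bar> \<le> (C + C') * norm \<xi> powr d * (1 + norm \<xi>) powr - 5" if "\<xi> \<noteq> 0" for \<xi>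
    using C(2)[OF that] C(4)[OF that] abs_triangle_ineq[of "f \<xi>" "g \<xi>"] by (simp add: algebra_simps)
  then show ?case using C(1,3) by (intro exI[of _ "C + C'"]) auto
next
  case (cmult d f c)
  then obtain C where C: "0 \<le> C" "\<And>\<xi>. \<xi> \<noteq> 0 \<Longrightarrow> \<bar>f \<xi>\<bar> \<le> C * norm \<xi> powr d * (1 + norm \<xi>) powr - 5"
    by blast
  have "\<bar>c * f \<xi>\<bar> \<le> (\<bar>c\<bar> * C) * norm \<xi> powr d * (1 + norm \<xi>) powr - 5" if "\<xi> \<noteq> 0" for \<xi>
    using mult_left_mono[OF C(2)[OF that], of "\<bar>c\<bar>"] by (simp add: abs_mult mult_ac)
  then show ?case using C(1) by (intro exI[of _ "\<bar>c\<bar> * C"]) auto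
qed

section \<open>Decay of Fourier transforms of symbols\<close>

lemma exists_big_component: "\<exists>k. norm x \<le> 2 * \<bar>(x::real^3) $ k\<bar>"
proof (rule ccontr)
  assume "\<not> ?thesis"
  then have k: "2 * \<bar>x $ k\<bar> < norm x" for k by (auto simp: not_le)
  have pos: "0 < norm x" using k[of 1] by linarith
  have "(norm x)\<^sup>2 = (\<Sum>k\<in>UNIV. (x $ k)\<^sup>2)"
    unfolding power2_norm_eq_inner inner_vec_def by (simp add: power2_eq_square)
  also have "\<dots> \<le> (\<Sum>k\<in>(UNIV::3 set). (norm x / 2)\<^sup>2)"
  proof (intro sum_mono)
    fix i :: 3
    have "\<bar>x $ i\<bar>\<^sup>2 \<le> (norm x / 2)\<^sup>2" using k[of i] by (intro power_mono) auto
    then show "(x $ i)\<^sup>2 \<le> (norm x / 2)\<^sup>2" by simp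
  qed
  also have "\<dots> = 3/4 * (norm x)\<^sup>2" by (simp add: power2_eq_square)
  finally have "(norm x)\<^sup>2 \<le> 0" by simp
  then show False using pos by simp
qed

text \<open>Where |\<xi>| \<le> 8h, the Lipschitz bound gives O(h), and h = h^\<rho> h^(1-\<rho>)
  with h^(1-\<rho>) of order at most |\<xi>|^(1-\<rho>). Elsewhere the fourth derivative is
  O(|\<xi>|^(-3)), and h^4 |\<xi>|^(-3) \<le> h^\<rho> |\<xi>|^(1-\<rho>) because h < |\<xi>| and
  \<rho> < 4. Both regimes end in the singularity |\<xi>|^(-(\<rho>-1)), integrable in dimension 3
  because \<rho> < 4.\<close>

lemma fdiff_symbol_bound:
  assumes \<alpha>: "1/2 \<le> \<alpha>" and \<rho>: "3 < \<rho>" "\<rho> < 4"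
    and lip: "\<And>\<xi>. \<bar>m \<xi> - m 0\<bar> \<le> C1 * norm (\<xi>::real^3)"
    and der: "symbol \<alpha> 0 m'" "has_pderiv l m m'"
  shows "\<exists>K\<ge>0. \<forall>h \<xi>. 0 < h \<longrightarrow> h \<le> 1 \<longrightarrow> \<xi> \<noteq> 0 \<longrightarrow>
    \<bar>(fdiff (h *\<^sub>R axis l 1) ^^ 4) m \<xi>\<bar> \<le> K * h powr \<rho> * weight1 (\<rho> - 1) 2 (norm \<xi>)"
proof -
  have \<alpha>0: "0 < \<alpha>" using \<alpha> by simp
  have C1: "0 \<le> C1"
    using lip[of "axis l 1"] by simp
  obtain m2 where m2: "symbol \<alpha> (- 1) m2" "has_pderiv l m' m2"
    using symbol_pderiv[OF der(1) \<alpha>0, of l] by auto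
  obtain m3 where m3: "symbol \<alpha> (- 2) m3" "has_pderiv l m2 m3"
    using symbol_pderiv[OF m2(1) \<alpha>0, of l] by auto
  obtain m4 where m4: "symbol \<alpha> (- 3) m4" "has_pderiv l m3 m4"
    using symbol_pderiv[OF m3(1) \<alpha>0, of l] by auto
  obtain C4 where C4: "0 \<le> C4" "\<And>\<xi>. \<xi> \<noteq> 0 \<Longrightarrow> \<bar>m4 \<xi>\<bar> \<le> C4 * norm \<xi> powr - 3 * (1 + norm \<xi>) powr - 5"
    using symbol_bound[OF m4(1) \<alpha>] by auto
  \<comment> \<open>Near the origin 192 = 16 * 12, 512 = 8^3 and 81 = 9^2 occur; away from it, 64 =
    8 * 8 pays for halving the radius in the two factors of the weight.\<close>
  define K where "K = 64 * C4 + 192 * 512 * 81 * C1"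
  have K: "0 \<le> K" using C1 C4(1) by (simp add: K_def)
  have "\<bar>(fdiff (h *\<^sub>R axis l 1) ^^ 4) m \<xi>\<bar> \<le> K * h powr \<rho> * weight1 (\<rho> - 1) 2 (norm \<xi>)"
    if h: "0 < h" "h \<le> 1" and nz: "\<xi> \<noteq> 0" for h \<xi>
  proof (cases "norm \<xi> \<le> 8 * h")
    case True
    define r where "r = norm \<xi>"
    have r: "0 < r" "r \<le> 8 * h" using nz True by (auto simp: r_def)
    have "\<bar>(fdiff (h *\<^sub>R axis l 1) ^^ 4) m \<xi>\<bar> \<le> 2 ^ 4 * (C1 * (12 * h))"
    proof (rule fdiff_funpow_near[where R="8 * h" and c="m 0"])
      fix \<eta> :: "real^3" assume "norm \<eta> \<le> 8 * h + real 4 * norm (h *\<^sub>R (axis l 1 :: real^3))"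
      then have "norm \<eta> \<le> 12 * h" using h by simp
      then show "\<bar>m \<eta> - m 0\<bar> \<le> C1 * (12 * h)"
        using lip[of \<eta>] C1 by (meson mult_left_mono order_trans)
    qed (use True in auto)
    also have "\<dots> = 192 * C1 * (h powr \<rho> * h powr (1 - \<rho>))"
      using h by (simp add: powr_add[symmetric])
    also have "\<dots> \<le> 192 * C1 * (h powr \<rho> * (512 * r powr (1 - \<rho>)))"
    proof -
      have "h powr (1 - \<rho>) \<le> (r / 8) powr (1 - \<rho>)"
        using r \<rho> by (intro powr_mono2') auto
      also have "\<dots> = r powr (1 - \<rho>) * 8 powr (\<rho> - 1)"
        using r by (simp add: powr_divide powr_minus_divide[of 8 "\<rho> - 1", simplified])
      also have "\<dots> \<le> r powr (1 - \<rho>) * 8 powr 3"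
        using \<rho> by (intro mult_left_mono powr_mono) auto
      also have "(8::real) powr 3 = 512" by (simp add: powr_numeral)
      finally show ?thesis using C1 by (intro mult_left_mono) (auto simp: mult.commute)
    qed
    also have "\<dots> \<le> 192 * C1 * (h powr \<rho> * (512 * r powr (1 - \<rho>))) * (81 * (1 + r) powr - 2)"
    proof -
      have "1 \<le> 81 * (1 + r) powr - 2"
      proof -
        have "(1 + r)\<^sup>2 \<le> 9\<^sup>2" using r h by (intro power_mono) auto
        then show ?thesis using r by (simp add: powr_minus powr_numeral field_simps)
      qed
      from mult_left_mono[OF this, of "192 * C1 * (h powr \<rho> * (512 * r powr (1 - \<rho>)))"]
      show ?thesis using C1 by simp
    qed
    also have "\<dots> = (192 * 512 * 81 * C1) * h powr \<rho> * weight1 (\<rho> - 1) 2 r"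
      by (simp add: weight1_def)
    also have "\<dots> \<le> K * h powr \<rho> * weight1 (\<rho> - 1) 2 r"
      using C4(1) by (intro mult_right_mono) (auto simp: K_def weight1_def)
    finally show ?thesis by (simp add: r_def)
  next
    case False
    define r where "r = norm \<xi>"
    have r: "0 < r" "8 * h < r" using nz False by (auto simp: r_def)
    define \<phi> where "\<phi> i s = ([m, m', m2, m3, m4] ! i) (\<xi> + s *\<^sub>R axis l 1)" for i s
    \<comment> \<open>Four steps cover a length 4h < r/2, so the segment stays outside the ball of
      radius r/2.\<close>
    have seg: "r / 2 \<le> norm (\<xi> + s *\<^sub>R axis l 1)" if "0 \<le> s" "s \<le> 4 * h" for s
      using norm_diff_ineq[of \<xi> "s *\<^sub>R axis l 1"] that r by (simp add: r_def)
    have seg0: "\<xi> + s *\<^sub>R axis l 1 \<noteq> 0" if "0 \<le> s" "s \<le> 4 * h" for s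
      using seg[OF that] r by auto
    have "\<bar>(fdiff h ^^ 4) (\<phi> 0) 0\<bar> \<le> h ^ 4 * (64 * C4 * (r powr - 3 * (1 + r) powr - 2))"
    proof (rule fdiff_le)
      fix i :: nat and s assume i: "i < 4" and s: "0 \<le> s" "s \<le> 0 + real 4 * h"
      have nz: "\<xi> + s *\<^sub>R axis l 1 \<noteq> 0" using s by (intro seg0) auto
      consider "i = 0" | "i = 1" | "i = 2" | "i = 3" using i by linarith
      then show "(\<phi> i has_real_derivative \<phi> (Suc i) s) (at s)"
        unfolding \<phi>_def
        by cases (use has_pderiv_at[OF der(2) nz] has_pderiv_at[OF m2(2) nz]
          has_pderiv_at[OF m3(2) nz] has_pderiv_at[OF m4(2) nz] in \<open>simp_all add: numeral_eq_Suc\<close>)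
    next
      fix s assume s: "0 \<le> s" "s \<le> 0 + real 4 * h"
      define \<eta> where "\<eta> = \<xi> + s *\<^sub>R axis l 1"
      have \<eta>: "r / 2 \<le> norm \<eta>" "\<eta> \<noteq> 0" using seg[of s] seg0[of s] s by (simp_all add: \<eta>_def)
      have "\<bar>\<phi> 4 s\<bar> \<le> C4 * (norm \<eta> powr - 3 * (1 + norm \<eta>) powr - 5)"
        using C4(2)[OF \<eta>(2)] by (simp add: \<phi>_def \<eta>_def mult.assoc)
      also have "\<dots> \<le> C4 * ((8 * r powr - 3) * (8 * (1 + r) powr - 2))"
      proof (intro mult_left_mono mult_mono)
        have "norm \<eta> powr - 3 \<le> (r / 2) powr - 3" using \<eta> r by (intro powr_mono2') auto
        also have "\<dots> = 8 * r powr - 3" using r by (simp add: powr_minus powr_numeral field_simps)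
        finally show "norm \<eta> powr - 3 \<le> 8 * r powr - 3" .
        have "(1 + norm \<eta>) powr - 5 \<le> (1 + norm \<eta>) powr - 2" by (intro powr_mono) auto
        also have "\<dots> \<le> ((1 + r) / 2) powr - 2" using \<eta> r by (intro powr_mono2') auto
        also have "\<dots> \<le> 8 * (1 + r) powr - 2" using r by (simp add: powr_minus powr_numeral field_simps)
        finally show "(1 + norm \<eta>) powr - 5 \<le> 8 * (1 + r) powr - 2" .
      qed (use C4(1) r in auto)
      finally show "\<bar>\<phi> 4 s\<bar> \<le> 64 * C4 * (r powr - 3 * (1 + r) powr - 2)" by (simp add: mult_ac)
    qed (use h in auto)
    also have "(fdiff h ^^ 4) (\<phi> 0) 0 = (fdiff (h *\<^sub>R axis l 1) ^^ 4) m \<xi>"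
      using fdiff_funpow_line[where h=h and e="axis l 1" and n=4 and m=m and \<xi>=\<xi> and s=0]
      by (simp add: \<phi>_def[abs_def])
    also have "h ^ 4 * (64 * C4 * (r powr - 3 * (1 + r) powr - 2))
      \<le> (h powr \<rho> * r powr (4 - \<rho>)) * (64 * C4 * (r powr - 3 * (1 + r) powr - 2))"
    proof -
      have "h ^ 4 = h powr \<rho> * h powr (4 - \<rho>)"
        using h powr_realpow[of h 4] by (simp add: powr_add[symmetric])
      also have "\<dots> \<le> h powr \<rho> * r powr (4 - \<rho>)"
        using h r \<rho> by (intro mult_left_mono powr_mono2) auto
      finally show ?thesis using C4(1) r by (intro mult_right_mono) auto
    qed
    also have "\<dots> = 64 * C4 * h powr \<rho> * ((r powr (4 - \<rho>) * r powr - 3) * (1 + r) powr - 2)"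
      by (simp add: mult_ac)
    also have "r powr (4 - \<rho>) * r powr - 3 = r powr - (\<rho> - 1)"
      by (simp add: powr_add[symmetric])
    also have "64 * C4 * h powr \<rho> * (r powr - (\<rho> - 1) * (1 + r) powr - 2) \<le> K * h powr \<rho> * weight1 (\<rho> - 1) 2 r"
      unfolding weight1_def using C1 by (intro mult_right_mono) (auto simp: K_def)
    finally show ?thesis by (simp add: r_def)
  qed
  then show ?thesis using K by blast
qed

lemma integrable_weight1_norm:
  assumes "0 \<le> s1" "s1 < 3" "0 \<le> s2" "3 < s1 + s2"
  shows "integrable lborel (\<lambda>x::real^3. weight1 s1 s2 (norm x))"
  using nn_integral_radial_weight[OF assms]
  by (intro integrableI_bounded) (auto simp: weight1_def)

text \<open>For a coordinate with \<open>2|x\<^sub>k| \<ge> |x|\<close> take \<open>h = \<pi>/|x\<^sub>k|\<close>: each difference with step \<open>h\<close> along axis \<open>k\<close>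
  multiplies the transform at \<open>x\<close> by \<open>-2\<close>, so 16 times the transform is bounded by the \<open>L\<^sup>1\<close> norm of a
  fourth difference, which is \<open>O(h^\<rho>)\<close> although \<open>m\<close> is only Lipschitz at the origin.\<close>

lemma fourier_decay:
  assumes \<alpha>: "1/2 \<le> \<alpha>" and \<rho>: "3 < \<rho>" "\<rho> < 4"
    and m [measurable]: "m \<in> borel_measurable borel"
    and bd: "\<And>\<xi>. \<xi> \<noteq> 0 \<Longrightarrow> \<bar>m \<xi>\<bar> \<le> C0 * (1 + norm \<xi>) powr - 4"
    and lip: "\<And>\<xi>. \<bar>m \<xi> - m 0\<bar> \<le> C1 * norm \<xi>"
    and der: "\<And>l. \<exists>m'. symbol \<alpha> 0 m' \<and> has_pderiv l m m'"
  shows "integrable lborel m"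
    "\<exists>C\<ge>0. \<forall>x. norm (fourier m x) \<le> C * (1 + norm x) powr - \<rho>"
proof -
  have nz_ae: "AE \<xi> in lborel. \<xi> \<noteq> (0::real^3)" by (rule AE_lborel_singleton)
  have "integrable lborel (\<lambda>\<xi>. C0 * weight1 0 4 (norm (\<xi>::real^3)))"
    by (intro integrable_mult_right integrable_weight1_norm) auto
  then show int: "integrable lborel m"
  proof (rule Bochner_Integration.integrable_bound)
    show "AE \<xi> in lborel. norm (m \<xi>) \<le> norm (C0 * weight1 0 4 (norm \<xi>))"
      using nz_ae
    proof eventually_elim
      fix \<xi> :: "real^3" assume "\<xi> \<noteq> 0"
      from bd[OF this] this show "norm (m \<xi>) \<le> norm (C0 * weight1 0 4 (norm \<xi>))"
        by (simp add: weight1_def abs_mult order_trans[OF _ mult_right_mono[OF abs_ge_self]])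
    qed
  qed auto
  define W where "W = (\<integral>\<xi>. weight1 (\<rho> - 1) 2 (norm (\<xi>::real^3)) \<partial>lborel)"
  have W_int: "integrable lborel (\<lambda>\<xi>::real^3. weight1 (\<rho> - 1) 2 (norm \<xi>))"
    using \<rho> by (intro integrable_weight1_norm) auto
  have W: "0 \<le> W" unfolding W_def by (intro integral_nonneg_AE) (auto simp: weight1_def)
  have "\<exists>K\<ge>0. \<forall>h \<xi>. 0 < h \<longrightarrow> h \<le> 1 \<longrightarrow> \<xi> \<noteq> 0 \<longrightarrow>
    \<bar>(fdiff (h *\<^sub>R axis l 1) ^^ 4) m \<xi>\<bar> \<le> K * h powr \<rho> * weight1 (\<rho> - 1) 2 (norm \<xi>)" for l
    using der[of l] fdiff_symbol_bound[OF \<alpha> \<rho> lip] by blast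
  then obtain Kl where Kl: "\<And>l. 0 \<le> Kl l" "\<And>l h \<xi>. 0 < h \<Longrightarrow> h \<le> 1 \<Longrightarrow> \<xi> \<noteq> 0 \<Longrightarrow>
    \<bar>(fdiff (h *\<^sub>R axis l 1) ^^ 4) m \<xi>\<bar> \<le> Kl l * h powr \<rho> * weight1 (\<rho> - 1) 2 (norm \<xi>)"
    by metis
  define K where "K = (\<Sum>l\<in>UNIV. Kl l)"
  have K: "0 \<le> K" "Kl l \<le> K" for l
    using Kl(1) by (auto simp: K_def intro!: sum_nonneg member_le_sum)
  have dec: "norm (fourier m x) \<le> K * W * h powr \<rho>"
    if h: "0 < h" "h \<le> 1" and k: "h * \<bar>x $ k\<bar> = pi" for x h and k :: 3
  proof -
    let ?v = "h *\<^sub>R axis k 1 :: real^3"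
    define y where "y = x \<bullet> ?v"
    have "y = pi \<or> y = - pi"
      using k by (auto simp: y_def inner_axis abs_if split: if_splits)
    then have "exp (- (\<i> * complex_of_real y)) = - 1"
      by (auto simp: exp_minus)
    then have e: "exp (- (\<i> * complex_of_real (x \<bullet> ?v))) = - 1"
      by (simp only: y_def)
    have "norm (fourier ((fdiff ?v ^^ 4) m) x) = 16 * norm (fourier m x)"
      unfolding fourier_fdiff_funpow[OF int] e by (simp add: norm_mult norm_power)
    then have "norm (fourier m x) \<le> norm (fourier ((fdiff ?v ^^ 4) m) x)" by simp
    also have "\<dots> \<le> (\<integral>\<xi>. \<bar>(fdiff ?v ^^ 4) m \<xi>\<bar> \<partial>lborel)"
      by (intro norm_fourier_le integrable_fdiff_funpow int)
    also have "\<dots> \<le> (\<integral>\<xi>. K * h powr \<rho> * weight1 (\<rho> - 1) 2 (norm (\<xi>::real^3)) \<partial>lborel)"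
    proof (intro integral_mono_AE)
      show "AE \<xi> in lborel. \<bar>(fdiff ?v ^^ 4) m \<xi>\<bar> \<le> K * h powr \<rho> * weight1 (\<rho> - 1) 2 (norm \<xi>)"
        using nz_ae
      proof eventually_elim
        fix \<xi> :: "real^3" assume "\<xi> \<noteq> 0"
        from Kl(2)[OF h this, of k]
        have "\<bar>(fdiff ?v ^^ 4) m \<xi>\<bar> \<le> Kl k * h powr \<rho> * weight1 (\<rho> - 1) 2 (norm \<xi>)" .
        also have "\<dots> \<le> K * h powr \<rho> * weight1 (\<rho> - 1) 2 (norm \<xi>)"
          using K by (intro mult_right_mono) (auto simp: weight1_def)
        finally show "\<bar>(fdiff ?v ^^ 4) m \<xi>\<bar> \<le> K * h powr \<rho> * weight1 (\<rho> - 1) 2 (norm \<xi>)" .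
      qed
    qed (use W_int integrable_fdiff_funpow[OF int] in auto)
    also have "\<dots> = K * W * h powr \<rho>" by (simp add: W_def)
    finally show ?thesis .
  qed
  define M where "M = (\<integral>\<xi>. \<bar>m \<xi>\<bar> \<partial>lborel)"
  have M: "0 \<le> M" "norm (fourier m x) \<le> M" for x
    unfolding M_def using norm_fourier_le[OF int] by auto
  define C where "C = K * W * (4 * pi) powr \<rho> + M * 9 powr \<rho>"
  \<comment> \<open>For |x| \<ge> 8 the large component satisfies |x_k| \<ge> 4 > pi, hence h \<le>
    1; for |x| < 8 the trivial L^1 bound suffices, with 9 = 1 + 8.\<close>
  have "norm (fourier m x) \<le> C * (1 + norm x) powr - \<rho>" for x
  proof (cases "norm x < 8")
    case True
    have "1 \<le> 9 powr \<rho> * (1 + norm x) powr - \<rho>"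
    proof -
      have "(1 + norm x) powr \<rho> \<le> 9 powr \<rho>" using True \<rho> by (intro powr_mono2) auto
      moreover have "0 < 1 + norm x" by (simp add: add_pos_nonneg)
      ultimately show ?thesis by (simp add: powr_minus field_simps)
    qed
    then have "M * 1 \<le> M * (9 powr \<rho> * (1 + norm x) powr - \<rho>)" using M(1) by (rule mult_left_mono)
    also have "\<dots> \<le> C * (1 + norm x) powr - \<rho>"
      using K(1) W unfolding C_def mult.assoc[symmetric] by (intro mult_right_mono) auto
    finally show ?thesis using M(2)[of x] by linarith
  next
    case False
    obtain k where k: "norm x \<le> 2 * \<bar>x $ k\<bar>" using exists_big_component by blast
    define h where "h = pi / \<bar>x $ k\<bar>"
    have xk: "4 \<le> \<bar>x $ k\<bar>" using k False by linarith
    have h: "0 < h" "h \<le> 1" "h * \<bar>x $ k\<bar> = pi"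
      using xk pi_less_4 by (auto simp: h_def)
    have "h \<le> 4 * pi / (1 + norm x)"
    proof -
      have "pi * (1 + norm x) \<le> pi * (4 * \<bar>x $ k\<bar>)"
        using k False by (intro mult_left_mono) auto
      then show ?thesis using xk False by (simp add: h_def field_simps)
    qed
    then have "h powr \<rho> \<le> (4 * pi / (1 + norm x)) powr \<rho>"
      using h \<rho> by (intro powr_mono2) auto
    also have "\<dots> = (4 * pi) powr \<rho> * (1 + norm x) powr - \<rho>"
      by (simp add: powr_divide powr_minus field_simps)
    finally have "K * W * h powr \<rho> \<le> K * W * ((4 * pi) powr \<rho> * (1 + norm x) powr - \<rho>)"
      using K(1) W by (intro mult_left_mono) auto
    also have "\<dots> \<le> C * (1 + norm x) powr - \<rho>"
      using M(1) unfolding C_def mult.assoc[symmetric] by (intro mult_right_mono) auto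
    finally show ?thesis using dec[OF h] by linarith
  qed
  moreover have "0 \<le> C" using K(1) W M(1) by (simp add: C_def)
  ultimately show "\<exists>C\<ge>0. \<forall>x. norm (fourier m x) \<le> C * (1 + norm x) powr - \<rho>" by blast
qed

section \<open>Heat and Oseen kernels by scaling from time 1\<close>

definition heat_symbol :: "real \<Rightarrow> real^3 \<Rightarrow> real" where
  "heat_symbol \<alpha> \<xi> = exp (- (norm \<xi> powr (2 * \<alpha>)))"

text \<open>The imaginary unit is split off, so that the symbol is real and the difference calculus
  for real functions applies.\<close>

definition oseen_symbol :: "real \<Rightarrow> 3 \<Rightarrow> 3 \<Rightarrow> 3 \<Rightarrow> real^3 \<Rightarrow> real" where
  "oseen_symbol \<alpha> j h k \<xi> =
     \<xi> $ k * ((if j = h then 1 else 0) - \<xi> $ j * \<xi> $ h / (norm \<xi>)\<^sup>2) * exp (- (norm \<xi> powr (2 * \<alpha>)))"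

lemma heat_symbol_decay:
  assumes \<alpha>: "1/2 < \<alpha>" and \<rho>: "3 < \<rho>" "\<rho> < 4"
  shows "integrable lborel (heat_symbol \<alpha>)"
    "\<exists>C\<ge>0. \<forall>x. norm (fourier (heat_symbol \<alpha>) x) \<le> C * (1 + norm x) powr - \<rho>"
proof -
  have m: "heat_symbol \<alpha> \<in> borel_measurable borel" unfolding heat_symbol_def[abs_def] by measurable
  obtain C where C: "0 \<le> C" "\<And>r. 0 < r \<Longrightarrow> r powr 0 * exp (- (r powr (2 * \<alpha>))) \<le> C * (1 + r) powr - 5"
    using power_exp_bound[of 0 \<alpha>] \<alpha> by auto
  have bd: "\<bar>heat_symbol \<alpha> \<xi>\<bar> \<le> C * (1 + norm \<xi>) powr - 4" if "\<xi> \<noteq> 0" for \<xi>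
  proof -
    have "\<bar>heat_symbol \<alpha> \<xi>\<bar> \<le> C * (1 + norm \<xi>) powr - 5"
      using C(2)[of "norm \<xi>"] that by (simp add: heat_symbol_def)
    also have "\<dots> \<le> C * (1 + norm \<xi>) powr - 4" using C(1) by (intro mult_left_mono powr_mono) auto
    finally show ?thesis .
  qed
  have lip: "\<bar>heat_symbol \<alpha> \<xi> - heat_symbol \<alpha> 0\<bar> \<le> 1 * norm \<xi>" for \<xi>
  proof (cases "norm \<xi> \<le> 1")
    case True
    have "1 - norm \<xi> powr (2 * \<alpha>) \<le> heat_symbol \<alpha> \<xi>"
      using exp_ge_add_one_self[of "- (norm \<xi> powr (2 * \<alpha>))"] by (simp add: heat_symbol_def)
    moreover have "norm \<xi> powr (2 * \<alpha>) \<le> norm \<xi>"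
    proof (cases "\<xi> = 0")
      case False
      then have "norm \<xi> powr (2 * \<alpha>) \<le> norm \<xi> powr 1"
        using True \<alpha> by (intro powr_mono') auto
      then show ?thesis by simp
    qed simp
    moreover have "heat_symbol \<alpha> \<xi> \<le> 1" by (simp add: heat_symbol_def)
    moreover have "heat_symbol \<alpha> 0 = 1" by (simp add: heat_symbol_def)
    ultimately show ?thesis by simp
  next
    case False
    then show ?thesis by (simp add: heat_symbol_def abs_if)
       (smt (verit) exp_gt_zero)
  qed
  have der: "\<exists>m'. symbol \<alpha> 0 m' \<and> has_pderiv l (heat_symbol \<alpha>) m'" for l
  proof -
    have "symbol \<alpha> (- 1 + 1) (\<lambda>\<xi>. \<xi> $ l * (norm \<xi> powr (0 + 2 * \<alpha> - 2) * exp (- (norm \<xi> powr (2 * \<alpha>)))))"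
      using \<alpha> by (intro symbol.mult symbol.base) auto
    from symbol.cmult[OF this, of "- (2 * \<alpha>)"]
    have 1: "symbol \<alpha> 0 (\<lambda>\<xi>. - (2 * \<alpha>) * (\<xi> $ l * (norm \<xi> powr (0 + 2 * \<alpha> - 2) * exp (- (norm \<xi> powr (2 * \<alpha>))))))"
      by simp
    have "((\<lambda>s. heat_symbol \<alpha> (\<xi> + s *\<^sub>R axis l 1)) has_real_derivative
        - (2 * \<alpha>) * (\<xi> $ l * (norm \<xi> powr (0 + 2 * \<alpha> - 2) * exp (- (norm \<xi> powr (2 * \<alpha>)))))) (at 0)"
      if nz: "\<xi> \<noteq> 0" for \<xi>
    proof -
      have "((\<lambda>s. norm (\<xi> + s *\<^sub>R axis l 1) powr 0 * exp (- (norm (\<xi> + s *\<^sub>R axis l 1) powr (2 * \<alpha>)))) has_real_derivative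
        - (2 * \<alpha>) * (\<xi> $ l * (norm \<xi> powr (0 + 2 * \<alpha> - 2) * exp (- (norm \<xi> powr (2 * \<alpha>)))))) (at 0)"
        using base_symbol_pderiv[of \<alpha> l 0] \<alpha> nz by (simp add: has_pderiv_def)
      \<comment> \<open>As \<open>0 powr 0 = 0\<close>, the base symbol with power 0 agrees with the
        heat symbol only away from the origin; equality near \<xi> is enough for the
        derivative.\<close>
      moreover have "\<forall>\<^sub>F s in nhds 0. norm (\<xi> + s *\<^sub>R axis l 1) powr 0 * exp (- (norm (\<xi> + s *\<^sub>R axis l 1) powr (2 * \<alpha>)))
         = heat_symbol \<alpha> (\<xi> + s *\<^sub>R axis l 1)"
      proof -
        have "((\<lambda>s. \<xi> + s *\<^sub>R axis l 1) \<longlongrightarrow> \<xi> + 0 *\<^sub>R axis l 1) (nhds 0)"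
          by (intro tendsto_intros filterlim_ident)
        then have "\<forall>\<^sub>F s in nhds 0. \<xi> + s *\<^sub>R axis l 1 \<noteq> 0"
          by (rule tendsto_imp_eventually_ne) (use nz in simp)
        then show ?thesis by eventually_elim (simp add: heat_symbol_def)
      qed
      ultimately show ?thesis by (subst (asm) DERIV_cong_ev[OF refl _ refl]) auto
    qed
    then show ?thesis using 1 unfolding has_pderiv_def by blast
  qed
  show "integrable lborel (heat_symbol \<alpha>)"
    "\<exists>C\<ge>0. \<forall>x. norm (fourier (heat_symbol \<alpha>) x) \<le> C * (1 + norm x) powr - \<rho>"
    using fourier_decay[OF _ \<rho> m bd lip der] \<alpha> by auto
qed

text \<open>Three coordinate factors raise the order -2 of |\<xi>|^(-2) to 1. Order 1 encodes the
  linear vanishing at the origin behind the Lipschitz bound in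
  \<open>oseen_symbol_decay\<close>.\<close>

lemma oseen_symbol_symbol:
  shows "\<exists>f. symbol \<alpha> 1 f \<and> (\<forall>\<xi>. \<xi> \<noteq> 0 \<longrightarrow> f \<xi> = oseen_symbol \<alpha> j h k \<xi>)"
proof -
  have "symbol \<alpha> (0 + 1) (\<lambda>\<xi>. \<xi> $ k * (norm \<xi> powr 0 * exp (- (norm \<xi> powr (2 * \<alpha>)))))"
    by (intro symbol.mult symbol.base) auto
  then have 1: "symbol \<alpha> 1 (\<lambda>\<xi>. \<xi> $ k * (norm \<xi> powr 0 * exp (- (norm \<xi> powr (2 * \<alpha>)))))"
    by (simp only: add_0)
  have 2: "symbol \<alpha> (- 2 + 1 + 1 + 1)
     (\<lambda>\<xi>. \<xi> $ k * (\<xi> $ j * (\<xi> $ h * (norm \<xi> powr - 2 * exp (- (norm \<xi> powr (2 * \<alpha>)))))))"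
    by (intro symbol.mult symbol.base) auto
  have "symbol \<alpha> 1 (\<lambda>\<xi>. (if j = h then 1 else 0) * (\<xi> $ k * (norm \<xi> powr 0 * exp (- (norm \<xi> powr (2 * \<alpha>)))))
     + (- 1) * (\<xi> $ k * (\<xi> $ j * (\<xi> $ h * (norm \<xi> powr - 2 * exp (- (norm \<xi> powr (2 * \<alpha>))))))))"
    using symbol.add[OF symbol.cmult[OF 1, of "if j = h then 1 else 0"] symbol.cmult[OF 2[simplified], of "- 1"]]
    by simp
  then show ?thesis
    by (intro exI conjI, assumption) (auto simp: oseen_symbol_def powr_minus powr_numeral field_simps)
qed

lemma oseen_symbol_decay:
  assumes \<alpha>: "1/2 < \<alpha>" and \<rho>: "3 < \<rho>" "\<rho> < 4"
  shows "integrable lborel (oseen_symbol \<alpha> j h k)"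
    "\<exists>C\<ge>0. \<forall>x. norm (fourier (oseen_symbol \<alpha> j h k) x) \<le> C * (1 + norm x) powr - \<rho>"
proof -
  have m: "oseen_symbol \<alpha> j h k \<in> borel_measurable borel" unfolding oseen_symbol_def[abs_def] by measurable
  obtain f where f: "symbol \<alpha> 1 f" "\<And>\<xi>. \<xi> \<noteq> 0 \<Longrightarrow> f \<xi> = oseen_symbol \<alpha> j h k \<xi>"
    using oseen_symbol_symbol by blast
  obtain C where C: "0 \<le> C" "\<And>\<xi>. \<xi> \<noteq> 0 \<Longrightarrow> \<bar>oseen_symbol \<alpha> j h k \<xi>\<bar> \<le> C * norm \<xi> powr 1 * (1 + norm \<xi>) powr - 5"
    using symbol_bound[OF f(1)] f(2) \<alpha> by fastforce
  have bd: "\<bar>oseen_symbol \<alpha> j h k \<xi>\<bar> \<le> C * (1 + norm \<xi>) powr - 4" if "\<xi> \<noteq> 0" for \<xi>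
  proof -
    have "\<bar>oseen_symbol \<alpha> j h k \<xi>\<bar> \<le> C * (norm \<xi> * (1 + norm \<xi>) powr - 5)"
      using C(2)[OF that] by (simp add: mult.assoc)
    also have "\<dots> \<le> C * ((1 + norm \<xi>) powr 1 * (1 + norm \<xi>) powr - 5)"
      using C(1) by (intro mult_left_mono mult_right_mono) auto
    also have "(1 + norm \<xi>) powr 1 * (1 + norm \<xi>) powr - 5 = (1 + norm \<xi>) powr - 4"
      unfolding powr_add[symmetric] by simp
    finally show ?thesis .
  qed
  have lip: "\<bar>oseen_symbol \<alpha> j h k \<xi> - oseen_symbol \<alpha> j h k 0\<bar> \<le> C * norm \<xi>" for \<xi>
  proof (cases "\<xi> = 0")
    case False
    have "\<bar>oseen_symbol \<alpha> j h k \<xi>\<bar> \<le> C * norm \<xi> * (1 + norm \<xi>) powr - 5"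
      using C(2)[OF False] False by simp
    also have "\<dots> \<le> C * norm \<xi> * (1 + norm \<xi>) powr 0"
      using C(1) by (intro mult_left_mono powr_mono) auto
    also have "\<dots> = C * norm \<xi>"
      using add_pos_nonneg[OF zero_less_one norm_ge_zero[of \<xi>]] by simp
    finally have "\<bar>oseen_symbol \<alpha> j h k \<xi>\<bar> \<le> C * norm \<xi>" .
    moreover have "oseen_symbol \<alpha> j h k 0 = 0" by (simp add: oseen_symbol_def)
    ultimately show ?thesis by simp
  qed simp
  have der: "\<exists>m'. symbol \<alpha> 0 m' \<and> has_pderiv l (oseen_symbol \<alpha> j h k) m'" for l
  proof -
    obtain f' where f': "symbol \<alpha> 0 f'" "has_pderiv l f f'" using symbol_pderiv[OF f(1), of l] \<alpha> by auto
    have "has_pderiv l (oseen_symbol \<alpha> j h k) f'"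
      unfolding has_pderiv_def
    proof (intro allI impI)
      fix \<xi> :: "real^3" assume nz: "\<xi> \<noteq> 0"
      have "((\<lambda>s. \<xi> + s *\<^sub>R axis l 1) \<longlongrightarrow> \<xi> + 0 *\<^sub>R axis l 1) (nhds 0)"
        by (intro tendsto_intros filterlim_ident)
      then have "\<forall>\<^sub>F s in nhds 0. \<xi> + s *\<^sub>R axis l 1 \<noteq> 0"
        by (rule tendsto_imp_eventually_ne) (use nz in simp)
      then have "\<forall>\<^sub>F s in nhds 0. f (\<xi> + s *\<^sub>R axis l 1) = oseen_symbol \<alpha> j h k (\<xi> + s *\<^sub>R axis l 1)"
        by eventually_elim (simp add: f(2))
      note cong = DERIV_cong_ev[OF refl this refl]
      have "((\<lambda>s. f (\<xi> + s *\<^sub>R axis l 1)) has_real_derivative f' \<xi>) (at 0)"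
        using f'(2) nz unfolding has_pderiv_def by blast
      then show "((\<lambda>s. oseen_symbol \<alpha> j h k (\<xi> + s *\<^sub>R axis l 1)) has_real_derivative f' \<xi>) (at 0)"
        by (simp only: cong)
    qed
    then show ?thesis using f'(1) by blast
  qed
  show "integrable lborel (oseen_symbol \<alpha> j h k)"
    "\<exists>C\<ge>0. \<forall>x. norm (fourier (oseen_symbol \<alpha> j h k) x) \<le> C * (1 + norm x) powr - \<rho>"
    using fourier_decay[OF _ \<rho> m bd lip der] \<alpha> by auto
qed

definition bump :: "real \<Rightarrow> real \<Rightarrow> real^3 \<Rightarrow> real" where
  "bump \<rho> \<delta> x = \<delta> powr - 3 * (1 + norm x / \<delta>) powr - \<rho>"

lemma fourier_scale:
  assumes [measurable]: "m \<in> borel_measurable borel" and "0 < \<delta>"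
  shows "fourier (\<lambda>\<xi>. m (\<delta> *\<^sub>R \<xi>)) x = \<delta> powr - 3 *\<^sub>R fourier m (x /\<^sub>R \<delta>)"
proof -
  have "fourier m (x /\<^sub>R \<delta>) = \<delta> ^ 3 *\<^sub>R (\<integral>\<xi>. exp (\<i> * of_real ((x /\<^sub>R \<delta>) \<bullet> (\<delta> *\<^sub>R \<xi>))) * of_real (m (\<delta> *\<^sub>R \<xi>)) \<partial>lborel)"
    unfolding fourier_def
    by (subst integral_lborel_affine[where c=\<delta> and t=0]) (use assms(2) in auto)
  also have "(\<lambda>\<xi>. (x /\<^sub>R \<delta>) \<bullet> (\<delta> *\<^sub>R \<xi>)) = (\<lambda>\<xi>. x \<bullet> \<xi>)"
    using assms(2) by (simp add: fun_eq_iff)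
  then have "(\<integral>\<xi>. exp (\<i> * of_real ((x /\<^sub>R \<delta>) \<bullet> (\<delta> *\<^sub>R \<xi>))) * of_real (m (\<delta> *\<^sub>R \<xi>)) \<partial>lborel)
     = fourier (\<lambda>\<xi>. m (\<delta> *\<^sub>R \<xi>)) x"
    unfolding fourier_def by (simp only: fun_eq_iff)
  finally show ?thesis using assms(2) by (simp add: powr_minus powr_numeral)
qed

lemma kernel_of_symbol_lborel:
  assumes [measurable]: "m \<in> borel_measurable borel"
  shows "kernel_of_symbol m x = Re ((\<integral>\<xi>. exp (\<i> * of_real (x \<bullet> \<xi>)) * m \<xi> \<partial>lborel)) / (2 * pi) ^ 3"
proof -
  have "(\<integral>\<xi>. exp (\<i> * of_real (x \<bullet> \<xi>)) * m \<xi> \<partial>lebesgue) = (\<integral>\<xi>. exp (\<i> * of_real (x \<bullet> \<xi>)) * m \<xi> \<partial>lborel)"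
    by (intro integral_completion) simp
  then show ?thesis unfolding kernel_of_symbol_def
    by (metis Re_divide_of_real)
qed

lemma heat_kernel_fourier:
  assumes "0 < \<alpha>" "0 < t"
  shows "heat_kernel \<alpha> t x = Re (fourier (\<lambda>\<xi>. heat_symbol \<alpha> (t powr (1 / (2 * \<alpha>)) *\<^sub>R \<xi>)) x) / (2 * pi) ^ 3"
  using assms unfolding heat_kernel_def fourier_def heat_symbol_def
  by (subst kernel_of_symbol_lborel) (auto simp: powr_mult powr_powr)

text \<open>Rescaling \<xi> by \<delta> produces one factor \<delta> from the component \<xi>_k,
  hence the division by \<delta>, the cost of the derivative. The factor i that was split off turns
  the real part into minus the imaginary part.\<close>

lemma oseen_kernel_fourier:
  assumes "0 < \<alpha>" "0 < t"
  shows "oseen_kernel \<alpha> t j h k x =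
    - Im (fourier (\<lambda>\<xi>. oseen_symbol \<alpha> j h k (t powr (1 / (2 * \<alpha>)) *\<^sub>R \<xi>)) x) / t powr (1 / (2 * \<alpha>)) / (2 * pi) ^ 3"
proof -
  define \<delta> where "\<delta> = t powr (1 / (2 * \<alpha>))"
  have \<delta>: "0 < \<delta>" "\<delta> powr (2 * \<alpha>) = t" using assms by (auto simp: \<delta>_def powr_powr)
  have eq: "oseen_symbol \<alpha> j h k (\<delta> *\<^sub>R \<xi>) = \<delta> * (\<xi> $ k * ((if j = h then 1 else 0) - \<xi> $ j * \<xi> $ h / (norm \<xi>)\<^sup>2)
                   * exp (- t * norm \<xi> powr (2 * \<alpha>)))" for \<xi>
    using \<delta> by (simp add: oseen_symbol_def powr_mult power2_eq_square)
  have "oseen_kernel \<alpha> t j h k x = Re (\<integral>\<xi>. exp (\<i> * of_real (x \<bullet> \<xi>)) * (\<i> * of_real (\<xi> $ k * ((if j = h then 1 else 0) - \<xi> $ j * \<xi> $ h / (norm \<xi>)\<^sup>2)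
                   * exp (- t * norm \<xi> powr (2 * \<alpha>)))) \<partial>lborel) / (2 * pi) ^ 3"
    unfolding oseen_kernel_def by (rule kernel_of_symbol_lborel) measurable
  also have "(\<integral>\<xi>. exp (\<i> * of_real (x \<bullet> \<xi>)) * (\<i> * of_real (\<xi> $ k * ((if j = h then 1 else 0) - \<xi> $ j * \<xi> $ h / (norm \<xi>)\<^sup>2)
                   * exp (- t * norm \<xi> powr (2 * \<alpha>)))) \<partial>lborel)
     = (\<integral>\<xi>. \<i> * inverse (of_real \<delta>) * (exp (\<i> * of_real (x \<bullet> \<xi>)) * of_real (oseen_symbol \<alpha> j h k (\<delta> *\<^sub>R \<xi>))) \<partial>lborel)"
    unfolding eq using \<delta>(1) by (intro Bochner_Integration.integral_cong) (auto simp: field_simps)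
  also have "\<dots> = \<i> * inverse (of_real \<delta>) * fourier (\<lambda>\<xi>. oseen_symbol \<alpha> j h k (\<delta> *\<^sub>R \<xi>)) x"
    by (simp add: fourier_def)
  also have "Re \<dots> = - Im (fourier (\<lambda>\<xi>. oseen_symbol \<alpha> j h k (\<delta> *\<^sub>R \<xi>)) x) / \<delta>"
    by (simp add: field_simps flip: of_real_inverse)
  finally show ?thesis by (simp add: \<delta>_def)
qed

lemma kernel_bounds:
  assumes \<alpha>: "1/2 < \<alpha>" and \<rho>: "3 < \<rho>" "\<rho> < 4"
  shows "\<exists>C>0. \<forall>t>0. \<forall>x. \<bar>heat_kernel \<alpha> t x\<bar> \<le> C * bump \<rho> (t powr (1 / (2 * \<alpha>))) x \<and>
    (\<forall>j h k. \<bar>oseen_kernel \<alpha> t j h k x\<bar> \<le> C * (bump \<rho> (t powr (1 / (2 * \<alpha>))) x / t powr (1 / (2 * \<alpha>))))"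
proof -
  obtain C0 where C0: "0 \<le> C0" "\<And>x. norm (fourier (heat_symbol \<alpha>) x) \<le> C0 * (1 + norm x) powr - \<rho>"
    using heat_symbol_decay[OF assms] by auto
  obtain C1 where C1: "\<And>j h k. 0 \<le> C1 j h k"
     "\<And>j h k x. norm (fourier (oseen_symbol \<alpha> j h k) x) \<le> C1 j h k * (1 + norm x) powr - \<rho>"
    using oseen_symbol_decay(2)[OF assms] by metis
  define C where "C = 1 + C0 + (\<Sum>j\<in>UNIV. \<Sum>h\<in>UNIV. \<Sum>k\<in>UNIV. C1 j h k)"
  have C1_le: "C1 j h k \<le> (\<Sum>j\<in>UNIV. \<Sum>h\<in>UNIV. \<Sum>k\<in>UNIV. C1 j h k)" for j h k
  proof -
    have "C1 j h k \<le> (\<Sum>k\<in>UNIV. C1 j h k)" using C1 by (intro member_le_sum) auto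
    also have "\<dots> \<le> (\<Sum>h\<in>UNIV. \<Sum>k\<in>UNIV. C1 j h k)"
      using C1 by (intro member_le_sum[of h UNIV "\<lambda>h. \<Sum>k\<in>UNIV. C1 j h k"]) (auto intro!: sum_nonneg)
    also have "\<dots> \<le> (\<Sum>j\<in>UNIV. \<Sum>h\<in>UNIV. \<Sum>k\<in>UNIV. C1 j h k)"
      using C1 by (intro member_le_sum[of j UNIV "\<lambda>j. \<Sum>h\<in>UNIV. \<Sum>k\<in>UNIV. C1 j h k"]) (auto intro!: sum_nonneg)
    finally show ?thesis .
  qed
  have C: "0 < C" "C0 \<le> C" "C1 j h k \<le> C" for j h k
    using C0(1) C1(1)[of j h k] C1_le[of j h k] order_trans[OF C1(1) C1_le]
    by (auto simp: C_def intro!: add_pos_nonneg sum_nonneg C1(1))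
  have pi1: "1 \<le> (2 * pi) ^ 3" using pi_gt3 by (intro one_le_power) auto
  have red: "\<bar>r\<bar> / (2 * pi) ^ 3 \<le> \<bar>r\<bar>" for r :: real
    using pi1 by (simp add: divide_le_eq mult_le_cancel_left1 mult_le_cancel_left)
  have "\<bar>heat_kernel \<alpha> t x\<bar> \<le> C * bump \<rho> (t powr (1 / (2 * \<alpha>))) x \<and>
     \<bar>oseen_kernel \<alpha> t j h k x\<bar> \<le> C * (bump \<rho> (t powr (1 / (2 * \<alpha>))) x / t powr (1 / (2 * \<alpha>)))"
    if t: "0 < t" for t x j h k
  proof -
    define \<delta> where "\<delta> = t powr (1 / (2 * \<alpha>))"
    have \<delta>: "0 < \<delta>" using t by (simp add: \<delta>_def)
    have [measurable]: "heat_symbol \<alpha> \<in> borel_measurable borel" "oseen_symbol \<alpha> j h k \<in> borel_measurable borel"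
      unfolding heat_symbol_def[abs_def] oseen_symbol_def[abs_def] by measurable
    have n: "norm (x /\<^sub>R \<delta>) = norm x / \<delta>" using \<delta> by (simp add: divide_inverse mult.commute)
    have 1: "norm (fourier (\<lambda>\<xi>. heat_symbol \<alpha> (\<delta> *\<^sub>R \<xi>)) x) \<le> C * bump \<rho> \<delta> x"
    proof -
      have "norm (fourier (\<lambda>\<xi>. heat_symbol \<alpha> (\<delta> *\<^sub>R \<xi>)) x) = \<delta> powr - 3 * norm (fourier (heat_symbol \<alpha>) (x /\<^sub>R \<delta>))"
        using \<delta> by (subst fourier_scale) auto
      also have "\<dots> \<le> \<delta> powr - 3 * (C0 * (1 + norm x / \<delta>) powr - \<rho>)"
        using C0(2)[of "x /\<^sub>R \<delta>"] unfolding n by (intro mult_left_mono) auto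
      also have "\<dots> = C0 * bump \<rho> \<delta> x" by (simp add: bump_def)
      also have "\<dots> \<le> C * bump \<rho> \<delta> x" using C by (intro mult_right_mono) (auto simp: bump_def)
      finally show ?thesis .
    qed
    have 2: "norm (fourier (\<lambda>\<xi>. oseen_symbol \<alpha> j h k (\<delta> *\<^sub>R \<xi>)) x) \<le> C * bump \<rho> \<delta> x"
    proof -
      have "norm (fourier (\<lambda>\<xi>. oseen_symbol \<alpha> j h k (\<delta> *\<^sub>R \<xi>)) x) = \<delta> powr - 3 * norm (fourier (oseen_symbol \<alpha> j h k) (x /\<^sub>R \<delta>))"
        using \<delta> by (subst fourier_scale) auto
      also have "\<dots> \<le> \<delta> powr - 3 * (C1 j h k * (1 + norm x / \<delta>) powr - \<rho>)"
        using C1(2)[of j h k "x /\<^sub>R \<delta>"] unfolding n by (intro mult_left_mono) auto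
      also have "\<dots> = C1 j h k * bump \<rho> \<delta> x" by (simp add: bump_def)
      also have "\<dots> \<le> C * bump \<rho> \<delta> x" using C by (intro mult_right_mono) (auto simp: bump_def)
      finally show ?thesis .
    qed
    have "\<bar>heat_kernel \<alpha> t x\<bar> \<le> \<bar>Re (fourier (\<lambda>\<xi>. heat_symbol \<alpha> (\<delta> *\<^sub>R \<xi>)) x)\<bar>"
      using red heat_kernel_fourier[of \<alpha> t x] \<alpha> t by (simp add: \<delta>_def abs_divide)
    also have "\<dots> \<le> C * bump \<rho> \<delta> x" using abs_Re_le_cmod 1 by (rule order_trans)
    finally have h: "\<bar>heat_kernel \<alpha> t x\<bar> \<le> C * bump \<rho> \<delta> x" .
    have "oseen_kernel \<alpha> t j h k x = - Im (fourier (\<lambda>\<xi>. oseen_symbol \<alpha> j h k (\<delta> *\<^sub>R \<xi>)) x) / \<delta> / (2 * pi) ^ 3"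
      using oseen_kernel_fourier[of \<alpha> t j h k x] \<alpha> t by (simp add: \<delta>_def)
    then have "\<bar>oseen_kernel \<alpha> t j h k x\<bar> = \<bar>Im (fourier (\<lambda>\<xi>. oseen_symbol \<alpha> j h k (\<delta> *\<^sub>R \<xi>)) x) / \<delta>\<bar> / (2 * pi) ^ 3"
      by (simp only: abs_divide) simp
    also note red
    finally have "\<bar>oseen_kernel \<alpha> t j h k x\<bar> \<le> \<bar>Im (fourier (\<lambda>\<xi>. oseen_symbol \<alpha> j h k (\<delta> *\<^sub>R \<xi>)) x) / \<delta>\<bar>" .
    also have "\<dots> \<le> C * bump \<rho> \<delta> x / \<delta>"
      using order_trans[OF abs_Im_le_cmod 2] \<delta> by (simp add: abs_divide divide_right_mono)
    finally show ?thesis using h by (simp add: \<delta>_def)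
  qed
  then show ?thesis using C(1) by blast
qed

section \<open>Modular estimates\<close>

text \<open>The tangent line of exp at the weighted mean \<open>A\<close> of the logarithms bounds
  each of x, y, z from below. Three weights are what the bilinear estimate consumes; a third weight
  0 gives the two-term form.\<close>

lemma weighted_am_gm:
  fixes x y z :: real
  assumes "0 < x" "0 < y" "0 < z" "0 \<le> p" "0 \<le> q" "0 \<le> r" "p + q + r = 1"
  shows "x powr p * y powr q * z powr r \<le> p * x + q * y + r * z"
proof -
  define A where "A = p * ln x + q * ln y + r * ln z"
  have t: "exp A * (1 + (ln w - A)) \<le> w" if "0 < w" for w
  proof -
    have "exp A * (1 + (ln w - A)) \<le> exp A * exp (ln w - A)"
      by (intro mult_left_mono exp_ge_add_one_self) auto
    also have "\<dots> = w" using that by (simp add: exp_add[symmetric])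
    finally show ?thesis .
  qed
  have "x powr p * y powr q * z powr r = exp A"
    using assms by (simp add: powr_def A_def exp_add)
  also have "\<dots> = exp A * ((p + q + r) + (A - (p + q + r) * A))"
    using assms(7) by simp
  also have "\<dots> = p * (exp A * (1 + (ln x - A))) + q * (exp A * (1 + (ln y - A))) + r * (exp A * (1 + (ln z - A)))"
    by (simp add: A_def algebra_simps)
  also have "\<dots> \<le> p * x + q * y + r * z"
    using assms t by (intro add_mono mult_left_mono) auto
  finally show ?thesis .
qed

text \<open>The integrand of the modular as a function of the reciprocal exponent \<open>\<gamma> = 1/q\<close>, extended to
  the value \<open>\<infinity>\<close>.\<close>

definition phi :: "real \<Rightarrow> ennreal \<Rightarrow> ennreal" where
  "phi \<gamma> s = (if s = \<infinity> then \<infinity> else if \<gamma> = 0 then (if s \<le> 1 then 0 else \<infinity>)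
     else ennreal (enn2real s powr (1 / \<gamma>)))"

lemma phi_measurable [measurable]:
  assumes [measurable]: "g \<in> borel_measurable M" "F \<in> borel_measurable M"
  shows "(\<lambda>x. phi (g x) (F x)) \<in> borel_measurable M"
  unfolding phi_def by measurable

lemma phi_infty [simp]: "phi \<gamma> \<infinity> = \<infinity>" "phi \<gamma> top = \<infinity>"
  by (simp_all add: phi_def)

lemma phi_0 [simp]: "phi \<gamma> 0 = 0"
  by (simp add: phi_def)

lemma phi_pos_exponent: "0 < \<gamma> \<Longrightarrow> 0 \<le> s \<Longrightarrow> phi \<gamma> (ennreal s) = ennreal (s powr (1 / \<gamma>))"
  by (simp add: phi_def)

lemma phi_zero_exponent: "phi 0 s = (if s \<le> 1 then 0 else \<infinity>)"
  by (cases s) (auto simp: phi_def top_unique)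

lemma ennreal_finite_cases:
  obtains "s = \<infinity>" | r where "0 \<le> r" "s = ennreal r"
  by (cases s) auto

lemma phi_mono:
  assumes "0 \<le> \<gamma>" "s \<le> s'"
  shows "phi \<gamma> s \<le> phi \<gamma> s'"
proof (cases s' rule: ennreal_finite_cases)
  case (2 r')
  then obtain r where r: "0 \<le> r" "s = ennreal r" using assms(2) by (cases s) (auto simp: top_unique)
  show ?thesis
  proof (cases "\<gamma> = 0")
    case True then show ?thesis using assms(2) by (auto simp: phi_zero_exponent)
  next
    case False
    then show ?thesis using assms r 2 by (auto simp: phi_pos_exponent intro!: ennreal_leI powr_mono2)
  qed
qed simp

lemma phi_eq_0_iff: "0 < \<gamma> \<Longrightarrow> phi \<gamma> s = 0 \<longleftrightarrow> s = 0"
  by (cases s rule: ennreal_finite_cases) (auto simp: phi_pos_exponent)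

text \<open>Since 1/\<gamma> \<ge> 1, shrinking the argument shrinks the value at least
  proportionally. Hence a modular bound N becomes a unit bound after division by N, as in
  \<open>modg_scale_le_1\<close>.\<close>

lemma phi_scale:
  assumes "0 \<le> \<gamma>" "\<gamma> \<le> 1" "0 \<le> k" "k \<le> 1"
  shows "phi \<gamma> (ennreal k * s) \<le> ennreal k * phi \<gamma> s"
proof (cases "k = 0")
  case False
  then have k: "0 < k" using assms by simp
  show ?thesis
  proof (cases s rule: ennreal_finite_cases)
    case 1 then show ?thesis using k by (simp add: ennreal_mult_top)
  next
    case (2 r)
    show ?thesis
    proof (cases "\<gamma> = 0")
      case True
      have "k * r \<le> 1" if "r \<le> 1" using that k assms 2 mult_mono[of k 1 r 1] by simp
      then show ?thesis using True 2 k
        by (auto simp: phi_zero_exponent ennreal_mult[symmetric] ennreal_mult_top)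
    next
      case False
      have "k powr (1 / \<gamma>) \<le> k powr 1" using k False assms by (intro powr_mono') auto
      then have "(k * r) powr (1 / \<gamma>) \<le> k * r powr (1 / \<gamma>)"
        using k 2 by (simp add: powr_mult mult_right_mono)
      then show ?thesis using False 2 k assms
        by (simp add: phi_pos_exponent ennreal_mult[symmetric] ennreal_leI)
    qed
  qed
qed simp

lemma le_one_plus_phi:
  assumes "0 \<le> \<gamma>" "\<gamma> \<le> 1"
  shows "s \<le> 1 + phi \<gamma> s"
proof (cases "s \<le> 1")
  case False
  show ?thesis
  proof (cases s rule: ennreal_finite_cases)
    case (2 r)
    have r: "1 < r" using False 2 by simp
    show ?thesis
    proof (cases "\<gamma> = 0")
      case False
      have "r powr 1 \<le> r powr (1 / \<gamma>)" using r False assms by (intro powr_mono) auto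
      then show ?thesis using False assms 2 r
        by (auto simp: phi_pos_exponent intro!: order_trans[OF ennreal_leI add_increasing])
    qed (use False in \<open>simp add: phi_zero_exponent\<close>)
  qed simp
qed (simp add: add_increasing2)

lemma phi_antimono_exponent:
  assumes "0 \<le> \<gamma>" "\<gamma> \<le> \<gamma>'" "s \<le> 1"
  shows "phi \<gamma> s \<le> phi \<gamma>' s"
proof (cases "\<gamma> = 0")
  case True then show ?thesis using assms by (auto simp: phi_zero_exponent)
next
  case False
  obtain r where r: "0 \<le> r" "r \<le> 1" "s = ennreal r" using assms(3) by (cases s) (auto simp: top_unique)
  show ?thesis
  proof (cases "r = 0")
    case False
    have "r powr (1 / \<gamma>) \<le> r powr (1 / \<gamma>')"
      using r False assms \<open>\<gamma> \<noteq> 0\<close> by (intro powr_mono') (auto simp: frac_le)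
    then show ?thesis using assms \<open>\<gamma> \<noteq> 0\<close> r by (auto simp: phi_pos_exponent intro!: ennreal_leI)
  qed (use r in simp)
qed

text \<open>The tangent line of s^(1/\<gamma>) at m, solved for s: convexity in a form that can be
  integrated over \<open>ennreal\<close> without subtraction.\<close>

lemma phi_tangent:
  assumes "0 < \<gamma>" "\<gamma> \<le> 1" "0 < m"
  shows "s \<le> ennreal (\<gamma> * m powr (1 - 1 / \<gamma>)) * phi \<gamma> s + ennreal ((1 - \<gamma>) * m)"
proof (cases s rule: ennreal_finite_cases)
  case 1 then show ?thesis using assms by (simp add: ennreal_mult_top)
next
  case (2 r)
  have "r \<le> \<gamma> * m powr (1 - 1 / \<gamma>) * r powr (1 / \<gamma>) + (1 - \<gamma>) * m"
  proof (cases "r = 0")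
    case False
    have "((r / m) powr (1 / \<gamma>)) powr \<gamma> * 1 powr (1 - \<gamma>) * 1 powr 0 \<le> \<gamma> * (r / m) powr (1 / \<gamma>) + (1 - \<gamma>) * 1 + 0 * 1"
      using assms 2 False by (intro weighted_am_gm) auto
    then have "r / m \<le> \<gamma> * (r / m) powr (1 / \<gamma>) + (1 - \<gamma>)"
      using assms 2 False by (simp add: powr_powr)
    then have "m * (r / m) \<le> m * (\<gamma> * (r / m) powr (1 / \<gamma>) + (1 - \<gamma>))"
      using assms(3) by (intro mult_left_mono) auto
    then show ?thesis using assms 2 False
      by (simp add: powr_divide powr_diff algebra_simps)
  qed (use assms in simp)
  then show ?thesis using assms 2
    by (simp add: phi_pos_exponent ennreal_mult[symmetric] ennreal_plus[symmetric] ennreal_leI del: ennreal_plus)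
qed

text \<open>Total weight at most 1 suffices because \<open>phi \<gamma> 0 = 0\<close>. For \<gamma>
  > 0 the tangent inequality at the mean is integrated; for \<gamma> = 0 an average of values at
  most 1 is at most 1.\<close>

lemma phi_jensen:
  assumes \<gamma>: "0 \<le> \<gamma>" "\<gamma> \<le> 1" and [measurable]: "w \<in> borel_measurable M" "h \<in> borel_measurable M"
    and w: "(\<integral>\<^sup>+x. w x \<partial>M) \<le> 1"
  shows "phi \<gamma> (\<integral>\<^sup>+x. w x * h x \<partial>M) \<le> (\<integral>\<^sup>+x. w x * phi \<gamma> (h x) \<partial>M)" (is "phi \<gamma> ?m \<le> ?R")
proof (cases "?R = \<infinity>")
  case False
  show ?thesis
  proof (cases "\<gamma> = 0")
    case True
    have "AE x in M. w x * phi \<gamma> (h x) \<noteq> \<infinity>"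
      using False by (intro nn_integral_noteq_infinite) auto
    then have "AE x in M. w x * h x \<le> w x"
    proof eventually_elim
      case (elim x)
      then show ?case using True
        by (cases "w x = 0"; cases "h x \<le> 1") (auto simp: phi_zero_exponent ennreal_mult_top mult_left_le)
    qed
    then have "?m \<le> (\<integral>\<^sup>+x. w x \<partial>M)" by (rule nn_integral_mono_AE)
    with w have "?m \<le> 1" by (rule order_trans[rotated])
    then show ?thesis using True by (simp add: phi_zero_exponent)
  next
    case g: False
    then have g0: "0 < \<gamma>" using \<gamma> by simp
    obtain R where R: "0 \<le> R" "?R = ennreal R" using False by (cases ?R) auto
    \<comment> \<open>The mean must be finite before the tangent at it can be used; the crude bound
      s \<le> 1 + phi s gives this.\<close>
    have "?m \<le> (\<integral>\<^sup>+x. w x + w x * phi \<gamma> (h x) \<partial>M)"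
    proof (intro nn_integral_mono)
      fix x show "w x * h x \<le> w x + w x * phi \<gamma> (h x)"
        using mult_left_mono[OF le_one_plus_phi[OF \<gamma>, of "h x"], of "w x"] by (simp add: distrib_left)
    qed
    also have "\<dots> = (\<integral>\<^sup>+x. w x \<partial>M) + ?R" by (intro nn_integral_add) auto
    also have "\<dots> \<le> 1 + ennreal R" using w R by (intro add_mono) auto
    finally have "?m < \<infinity>" by (rule order_le_less_trans) simp
    then obtain m where m: "0 \<le> m" "?m = ennreal m" by (cases ?m) auto
    show ?thesis
    proof (cases "m = 0")
      case True then show ?thesis using m by simp
    next
      case False
      then have m0: "0 < m" using m by simp
      let ?c = "\<gamma> * m powr (1 - 1 / \<gamma>)"
      have "?m \<le> (\<integral>\<^sup>+x. ennreal ?c * (w x * phi \<gamma> (h x)) + ennreal ((1 - \<gamma>) * m) * w x \<partial>M)"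
      proof (intro nn_integral_mono)
        fix x show "w x * h x \<le> ennreal ?c * (w x * phi \<gamma> (h x)) + ennreal ((1 - \<gamma>) * m) * w x"
          using mult_left_mono[OF phi_tangent[OF g0 \<gamma>(2) m0, of "h x"], of "w x"]
          by (simp add: distrib_left mult_ac)
      qed
      also have "\<dots> = ennreal ?c * ?R + ennreal ((1 - \<gamma>) * m) * (\<integral>\<^sup>+x. w x \<partial>M)"
        by (simp add: nn_integral_add nn_integral_cmult)
      also have "\<dots> \<le> ennreal ?c * ennreal R + ennreal ((1 - \<gamma>) * m) * 1"
        using w R by (intro add_mono mult_left_mono) auto
      also have "\<dots> = ennreal (?c * R + (1 - \<gamma>) * m)"
        using R \<gamma> m0 by (simp add: ennreal_mult[symmetric] ennreal_plus[symmetric] del: ennreal_plus)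
      finally have "m \<le> ?c * R + (1 - \<gamma>) * m"
        using m R \<gamma> m0 by (subst (asm) m(2)) (auto simp: ennreal_le_iff simp del: ennreal_plus)
      then have "\<gamma> * m \<le> \<gamma> * (m powr (1 - 1 / \<gamma>) * R)" by (simp add: algebra_simps)
      then have "m \<le> m powr (1 - 1 / \<gamma>) * R" using g0 by (rule mult_left_le_imp_le)
      then have "m \<le> m / m powr (1 / \<gamma>) * R" using m0 by (simp add: powr_diff)
      then have "m powr (1 / \<gamma>) \<le> R" using m0 by (simp add: field_simps)
      then show ?thesis using m R g0 by (simp add: phi_pos_exponent ennreal_leI)
    qed
  qed
qed simp

text \<open>Stands in for Hoelder's inequality: with m the maximum of the factors, the product is at
  most m^2, and halving the exponent 1/\<gamma> undoes the square.\<close>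

lemma phi_two_exponents:
  assumes "0 \<le> \<gamma>"
  shows "phi (2 * \<gamma>) (s * s') \<le> phi \<gamma> s + phi \<gamma> s'"
proof -
  define m where "m = max s s'"
  have "s * s' \<le> m * m" unfolding m_def by (intro mult_mono) auto
  then have "phi (2 * \<gamma>) (s * s') \<le> phi (2 * \<gamma>) (m * m)" using assms by (intro phi_mono) auto
  also have "\<dots> \<le> phi \<gamma> m"
  proof (cases m rule: ennreal_finite_cases)
    case (2 r)
    show ?thesis
    proof (cases "\<gamma> = 0")
      case True
      have "r * r \<le> 1" if "r \<le> 1" using that 2 mult_mono[of r 1 r 1] by simp
      then show ?thesis using True 2 by (auto simp: phi_zero_exponent ennreal_mult[symmetric])
    next
      case False
      have e: "1 / \<gamma> = 1 / (2 * \<gamma>) + 1 / (2 * \<gamma>)" using False by (simp add: field_simps)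
      have "(r * r) powr (1 / (2 * \<gamma>)) = r powr (1 / \<gamma>)"
        unfolding e powr_add using 2 by (simp add: powr_mult)
      then show ?thesis using False assms 2 by (simp add: phi_pos_exponent ennreal_mult[symmetric])
    qed
  qed simp
  also have "\<dots> \<le> phi \<gamma> s + phi \<gamma> s'"
    by (cases "s \<le> s'") (auto simp: m_def max_def add_increasing add_increasing2)
  finally show ?thesis .
qed

text \<open>Lower semicontinuity in the second argument, the pointwise half of the Fatou property
  \<open>modg_SUP\<close>.\<close>

lemma phi_SUP_le:
  assumes "0 \<le> \<gamma>"
  shows "phi \<gamma> (SUP n. s n) \<le> (SUP n. phi \<gamma> (s n))"
proof (cases "(SUP n. phi \<gamma> (s n)) = \<infinity>")
  case False
  then have "(SUP n. phi \<gamma> (s n)) < \<infinity>" by (simp only: infinity_ennreal_def less_top[symmetric] not_False_eq_True)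
  then have fin: "phi \<gamma> (s n) < \<infinity>" for n by (rule order_le_less_trans[rotated]) (rule SUP_upper, simp)
  show ?thesis
  proof (cases "\<gamma> = 0")
    case True
    have "s n \<le> 1" for n using fin[of n] True by (auto simp: phi_zero_exponent split: if_splits)
    then have "(SUP n. s n) \<le> 1" by (intro SUP_least)
    then show ?thesis using True by (simp add: phi_zero_exponent)
  next
    case g: False
    then have g: "0 < \<gamma>" using assms by simp
    obtain R where R: "0 \<le> R" "(SUP n. phi \<gamma> (s n)) = ennreal R"
      using False by (cases "SUP n. phi \<gamma> (s n)") auto
    have "s n \<le> ennreal (R powr \<gamma>)" for n
    proof (cases "s n" rule: ennreal_finite_cases)
      case 1 then show ?thesis using fin[of n] by simp
    next
      case (2 r)
      have "phi \<gamma> (s n) \<le> ennreal R" unfolding R(2)[symmetric] by (rule SUP_upper) simp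
      then have "r powr (1 / \<gamma>) \<le> R" using 2 g R by (simp add: phi_pos_exponent)
      then have "(r powr (1 / \<gamma>)) powr \<gamma> \<le> R powr \<gamma>" using g by (intro powr_mono2) auto
      then show ?thesis using 2 g by (cases "r = 0") (auto simp: powr_powr intro!: ennreal_leI)
    qed
    then have "(SUP n. s n) \<le> ennreal (R powr \<gamma>)" by (intro SUP_least)
    then have "phi \<gamma> (SUP n. s n) \<le> phi \<gamma> (ennreal (R powr \<gamma>))" using g by (intro phi_mono) auto
    also have "\<dots> = ennreal R" using g R by (cases "R = 0") (auto simp: phi_pos_exponent powr_powr)
    finally show ?thesis using R by simp
  qed
next
  case True
  show ?thesis unfolding True by simp
qed

section \<open>Mass of the bump functions\<close>

lemma nn_integral_bump:
  assumes "0 < \<delta>"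
  shows "(\<integral>\<^sup>+y. ennreal (bump \<rho> \<delta> (x - y)) \<partial>lborel) = (\<integral>\<^sup>+z. ennreal ((1 + norm (z::real^3)) powr - \<rho>) \<partial>lborel)"
proof -
  have [measurable]: "bump \<rho> \<delta> \<in> borel_measurable borel" unfolding bump_def[abs_def] by measurable
  have "(\<integral>\<^sup>+y. ennreal (bump \<rho> \<delta> (x - y)) \<partial>lborel) = (\<integral>\<^sup>+y. ennreal (bump \<rho> \<delta> y) \<partial>lborel)"
    by (rule nn_integral_lborel_reflect) measurable
  also have "\<dots> = ennreal (\<delta> ^ 3) * (\<integral>\<^sup>+z. ennreal (bump \<rho> \<delta> (0 + \<delta> *\<^sub>R z)) \<partial>lborel)"
    using assms by (subst nn_integral_lborel_affine[where c=\<delta> and t=0]) auto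
  also have "\<dots> = (\<integral>\<^sup>+z. ennreal (\<delta> ^ 3) * ennreal (bump \<rho> \<delta> (0 + \<delta> *\<^sub>R z)) \<partial>lborel)"
    by (rule nn_integral_cmult[symmetric]) measurable
  also have "\<dots> = (\<integral>\<^sup>+z. ennreal ((1 + norm (z::real^3)) powr - \<rho>) \<partial>lborel)"
    using assms by (intro nn_integral_cong)
      (simp add: bump_def ennreal_mult[symmetric] powr_minus powr_numeral)
  finally show ?thesis .
qed

lemma bump_weight_finite:
  assumes "3 < \<rho>"
  shows "(\<integral>\<^sup>+z. ennreal ((1 + norm (z::real^3)) powr - \<rho>) \<partial>lborel) < \<infinity>"
proof -
  have "AE z in lborel. z \<noteq> (0::real^3)" by (rule AE_lborel_singleton)
  then have "(\<integral>\<^sup>+z. ennreal ((1 + norm (z::real^3)) powr - \<rho>) \<partial>lborel) = (\<integral>\<^sup>+z. ennreal (weight1 0 \<rho> (norm (z::real^3))) \<partial>lborel)"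
    by (intro nn_integral_cong_AE) (auto elim!: eventually_mono simp: weight1_def)
  also have "\<dots> < \<infinity>" using assms by (intro nn_integral_radial_weight) auto
  finally show ?thesis .
qed

definition bump_mass :: "real \<Rightarrow> real" where
  "bump_mass \<rho> = enn2real (\<integral>\<^sup>+z. ennreal ((1 + norm (z::real^3)) powr - \<rho>) \<partial>lborel)"

lemma bump_mass_nonneg [simp]: "0 \<le> bump_mass \<rho>" by (simp add: bump_mass_def)

lemma bump_nonneg [simp]: "0 \<le> bump \<rho> \<delta> z" by (simp add: bump_def)

lemma bump_pos: "0 < \<delta> \<Longrightarrow> 0 < bump \<rho> \<delta> z"
  using add_pos_nonneg[OF zero_less_one divide_nonneg_nonneg[OF norm_ge_zero[of z], of \<delta>]] by (simp add: bump_def)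

lemma bump_minus: "bump \<rho> \<delta> (x - y) = bump \<rho> \<delta> (y - x)"
  by (simp add: bump_def norm_minus_commute)

lemma bump_le: "0 < \<delta> \<Longrightarrow> 0 \<le> \<rho> \<Longrightarrow> bump \<rho> \<delta> z \<le> \<delta> powr - 3"
  using powr_mono[of "- \<rho>" 0 "1 + norm z / \<delta>"] add_pos_nonneg[OF zero_less_one divide_nonneg_nonneg[OF norm_ge_zero[of z], of \<delta>]]
  by (auto simp: bump_def intro!: mult_left_le)

lemma bump_borel [measurable (raw)]:
  assumes [measurable]: "d \<in> borel_measurable M" "z \<in> borel_measurable M"
  shows "(\<lambda>x. bump \<rho> (d x) (z x)) \<in> borel_measurable M"
  unfolding bump_def by measurable

lemma bump_integral:
  assumes "0 < \<delta>" "3 < \<rho>"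
  shows "(\<integral>\<^sup>+y. ennreal (bump \<rho> \<delta> (x - y)) \<partial>lborel) = ennreal (bump_mass \<rho>)"
    "(\<integral>\<^sup>+x. ennreal (bump \<rho> \<delta> (x - y)) \<partial>lborel) = ennreal (bump_mass \<rho>)"
proof -
  show "(\<integral>\<^sup>+y. ennreal (bump \<rho> \<delta> (x - y)) \<partial>lborel) = ennreal (bump_mass \<rho>)" for x
    using bump_weight_finite[OF assms(2)] nn_integral_bump[OF assms(1)] by (simp add: bump_mass_def)
  from this[of y] show "(\<integral>\<^sup>+x. ennreal (bump \<rho> \<delta> (x - y)) \<partial>lborel) = ennreal (bump_mass \<rho>)"
    by (simp add: bump_minus)
qed

lemma bump_tonelli:
  assumes "0 < \<delta>" "3 < \<rho>" and [measurable]: "F \<in> borel_measurable borel"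
  shows "(\<integral>\<^sup>+x. (\<integral>\<^sup>+y. ennreal (bump \<rho> \<delta> (x - y)) * F y \<partial>lborel) \<partial>lborel) = ennreal (bump_mass \<rho>) * (\<integral>\<^sup>+y. F y \<partial>lborel)"
proof -
  have "(\<integral>\<^sup>+x. (\<integral>\<^sup>+y. ennreal (bump \<rho> \<delta> (x - y)) * F y \<partial>lborel) \<partial>lborel)
     = (\<integral>\<^sup>+y. (\<integral>\<^sup>+x. ennreal (bump \<rho> \<delta> (x - y)) * F y \<partial>lborel) \<partial>lborel)"
    by (rule lborel_pair.Fubini'[symmetric]) measurable
  also have "\<dots> = (\<integral>\<^sup>+y. ennreal (bump_mass \<rho>) * F y \<partial>lborel)"
    using assms(1,2) by (simp add: nn_integral_multc bump_integral)
  also have "\<dots> = ennreal (bump_mass \<rho>) * (\<integral>\<^sup>+y. F y \<partial>lborel)"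
    by (rule nn_integral_cmult) measurable
  finally show ?thesis .
qed

lemma ln_e_plus_ge_1: "0 \<le> r \<Longrightarrow> 1 \<le> ln (exp 1 + r)" for r :: real
  using ln_mono[of "exp 1" "exp 1 + r"] by (simp add: add_pos_nonneg)

section \<open>The modular of a log-Hoelder exponent\<close>

text \<open>The reciprocal \<open>g = 1/q\<close> of a log-Hoelder exponent with \<open>1/a = q\<^sup>- = q\<^sub>\<infinity>\<close> and \<open>1/b = q\<^sup>+\<close>. Working with \<open>g\<close>
  makes all exponents finite; \<open>q = \<infinity>\<close> is \<open>g = 0\<close>.\<close>

locale reciprocal_exponent =
  fixes g :: "real^3 \<Rightarrow> real" and a b c :: real
  assumes g_measurable [measurable]: "g \<in> borel_measurable borel"
    and b_nonneg: "0 \<le> b" and b_le_g: "\<And>x. b \<le> g x" and g_le_a: "\<And>x. g x \<le> a" and a_less: "a < 1/3"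
    and c_pos: "0 < c"
    and log_holder: "\<And>x y. \<bar>g x - g y\<bar> \<le> c / ln (exp 1 + 1 / norm (x - y))"
    and log_decay: "\<And>x. a - g x \<le> c / ln (exp 1 + norm x)"
begin

lemma g_nonneg: "0 \<le> g x"
  using b_nonneg b_le_g order_trans by blast

lemma g_le_1: "g x \<le> 1"
  using g_le_a[of x] a_less by simp

lemma a_nonneg: "0 \<le> a"
  using g_nonneg[of 0] g_le_a[of 0] by simp

definition modg :: "(real^3 \<Rightarrow> ennreal) \<Rightarrow> ennreal" where
  "modg F = (\<integral>\<^sup>+x. phi (g x) (F x) \<partial>lborel)"

lemma modg_mono: "(\<And>x. F x \<le> F' x) \<Longrightarrow> modg F \<le> modg F'"
  unfolding modg_def by (intro nn_integral_mono phi_mono g_nonneg)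

lemma modg_mono_AE: "AE x in lborel. F x \<le> F' x \<Longrightarrow> modg F \<le> modg F'"
  unfolding modg_def by (intro nn_integral_mono_AE) (auto elim!: eventually_mono intro!: phi_mono g_nonneg)

lemma modg_scale:
  assumes [measurable]: "F \<in> borel_measurable borel" and "0 \<le> k" "k \<le> 1"
  shows "modg (\<lambda>x. ennreal k * F x) \<le> ennreal k * modg F"
proof -
  have "modg (\<lambda>x. ennreal k * F x) \<le> (\<integral>\<^sup>+x. ennreal k * phi (g x) (F x) \<partial>lborel)"
    unfolding modg_def using assms by (intro nn_integral_mono phi_scale g_nonneg g_le_1)
  also have "\<dots> = ennreal k * modg F" unfolding modg_def by (rule nn_integral_cmult) measurable
  finally show ?thesis .
qed

lemma modg_scale_le_1:
  assumes [measurable]: "F \<in> borel_measurable borel" and "modg F \<le> ennreal N" "1 \<le> N"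
  shows "modg (\<lambda>x. ennreal (1 / N) * F x) \<le> 1"
proof -
  have "modg (\<lambda>x. ennreal (1 / N) * F x) \<le> ennreal (1 / N) * modg F"
    using assms by (intro modg_scale) auto
  also have "\<dots> \<le> ennreal (1 / N) * ennreal N" using assms by (intro mult_left_mono) auto
  also have "\<dots> = 1" using assms by (simp add: ennreal_mult[symmetric])
  finally show ?thesis .
qed

definition emb_const :: real where "emb_const = exp (- 4 * c)"

lemma emb_const: "0 < emb_const" "emb_const < 1"
  using c_pos by (auto simp: emb_const_def)

text \<open>The price of replacing q(x) by q^- = 1/a. Let r be the value of \<open>s\<close> and L =
  ln (e + |x|). If ln r > -4cg/(a - g), the factor exp(-4c) compensates for the smaller exponent.
  Otherwise ln (exp(-4c) r) \<le> -4ca/(a - g), and the decay condition a - g \<le> c/L bounds the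
  left side by exp(-4L), a tail that is integrable because 4 > 3.\<close>

lemma phi_a_le:
  "phi a (ennreal emb_const * s) \<le> phi (g x) s + ennreal ((exp 1 + norm x) powr - 4)"
proof (cases s rule: ennreal_finite_cases)
  case 1 then show ?thesis by simp
next
  case (2 r)
  show ?thesis
  proof (cases "r = 0 \<or> g x = a")
    case True
    then show ?thesis
    proof
      assume "r = 0" then show ?thesis using 2 by simp
    next
      assume "g x = a"
      moreover have "ennreal emb_const * s \<le> s" using emb_const mult_right_mono[of "ennreal emb_const" 1 s] by simp
      ultimately have "phi a (ennreal emb_const * s) \<le> phi (g x) s" using a_nonneg by (auto intro!: phi_mono)
      then show ?thesis by (simp add: add_increasing2)
    qed
  next
    case False
    then have r: "0 < r" and ga: "g x < a" and a0: "0 < a"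
      using 2 g_le_a[of x] g_nonneg[of x] by auto
    define L where "L = ln (exp 1 + norm x)"
    have L: "1 \<le> L" "L \<le> c / (a - g x)"
      using ln_e_plus_ge_1[OF norm_ge_zero[of x]] log_decay[of x] ga by (auto simp: L_def field_simps)
    have w: "(exp 1 + norm x) powr - 4 = exp (- 4 * L)"
      using add_pos_nonneg[OF exp_gt_zero[of "1::real"] norm_ge_zero[of x]] by (simp add: powr_def L_def)
    have pa: "phi a (ennreal emb_const * s) = ennreal ((emb_const * r) powr (1 / a))"
      using 2 emb_const a0 by (simp add: phi_pos_exponent ennreal_mult[symmetric])
    have key: "(emb_const * r) powr (1 / a) \<le> exp (- 4 * L)" if "ln r \<le> - 4 * c * (g x / (a - g x))"
    proof -
      have "ln (emb_const * r) = ln r - 4 * c" using r emb_const by (simp add: ln_mult emb_const_def)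
      also have "\<dots> \<le> - 4 * c * (g x / (a - g x)) - 4 * c" using that by simp
      also have "\<dots> = - 4 * (c / (a - g x)) * a" using ga by (simp add: field_simps)
      also have "\<dots> \<le> - 4 * L * a" using L a0 by (intro mult_right_mono) auto
      finally have "1 / a * ln (emb_const * r) \<le> - 4 * L" using a0 by (simp add: field_simps)
      then show ?thesis using r emb_const by (simp add: powr_def)
    qed
    show ?thesis
    proof (cases "ln r \<le> - 4 * c * (g x / (a - g x))")
      case True
      then show ?thesis unfolding pa w using key by (intro add_increasing ennreal_leI) auto
    next
      case False
      then have big: "- 4 * c * g x < ln r * (a - g x)" using ga by (simp add: field_simps)
      show ?thesis
      proof (cases "g x = 0")
        case True
        then have "1 < r" using big a0 r by (simp add: zero_less_mult_iff)
        then show ?thesis using True 2 by (simp add: phi_zero_exponent)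
      next
        case gx: False
        then have g0: "0 < g x" using g_nonneg[of x] by simp
        have "ln (emb_const * r) = ln r - 4 * c" using r emb_const by (simp add: ln_mult emb_const_def)
        then have "ln (emb_const * r) * g x = ln r * g x - 4 * c * g x" by (simp add: left_diff_distrib)
        then have "ln (emb_const * r) * g x \<le> ln r * a" using big by (simp add: right_diff_distrib)
        then have "1 / a * ln (emb_const * r) \<le> 1 / g x * ln r" using a0 g0 by (simp add: field_simps)
        then have "(emb_const * r) powr (1 / a) \<le> r powr (1 / g x)" using r emb_const by (simp add: powr_def)
        then show ?thesis unfolding pa using 2 g0 by (auto simp: phi_pos_exponent intro!: add_increasing2 ennreal_leI)
      qed
    qed
  qed
qed

definition far_mass :: real where "far_mass = bump_mass 4"

lemma far_mass_nonneg [simp]: "0 \<le> far_mass" by (simp add: far_mass_def)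

text \<open>The error term of \<open>phi_a_le\<close> lies below the unit-scale bump with exponent
  4, whose mass is \<open>far_mass\<close>.\<close>

lemma embedding:
  assumes [measurable]: "F \<in> borel_measurable borel" and "modg F \<le> 1"
  shows "(\<integral>\<^sup>+x. phi a (ennreal emb_const * F x) \<partial>lborel) \<le> ennreal (1 + far_mass)"
proof -
  have "(\<integral>\<^sup>+x. phi a (ennreal emb_const * F x) \<partial>lborel)
      \<le> (\<integral>\<^sup>+x. phi (g x) (F x) + ennreal (bump 4 1 (0 - x)) \<partial>lborel)"
  proof (intro nn_integral_mono)
    fix x :: "real^3"
    have "(exp 1 + norm x) powr - 4 \<le> (1 + norm x) powr - 4"
      by (intro powr_mono2') (auto simp: add_pos_nonneg)
    then have "ennreal ((exp 1 + norm x) powr - 4) \<le> ennreal (bump 4 1 (0 - x))"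
      by (intro ennreal_leI) (simp add: bump_def)
    then show "phi a (ennreal emb_const * F x) \<le> phi (g x) (F x) + ennreal (bump 4 1 (0 - x))"
      by (intro order_trans[OF phi_a_le[of "F x" x]] add_left_mono)
  qed
  also have "\<dots> = modg F + (\<integral>\<^sup>+x. ennreal (bump 4 1 (0 - x)) \<partial>lborel)"
    unfolding modg_def by (intro nn_integral_add) measurable
  also have "\<dots> \<le> 1 + ennreal far_mass"
    using assms bump_integral(1)[of 1 4 0] by (intro add_mono) (auto simp: far_mass_def simp del: diff_0)
  finally show ?thesis by simp
qed

text \<open>With z = |x - y|, writing 1/\<delta> as (z/\<delta>) (1/z) splits its logarithm into at
  most ln (1 + z/\<delta>) plus ln (e + 1/z). The oscillation |g x - g y| is at most
  \<open>a\<close> against the first and, by the log-Hoelder condition, costs only the constant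
  \<open>c\<close> against the second.\<close>

lemma delta_powr_bound:
  assumes "0 < \<delta>" "\<delta> \<le> 1"
  shows "\<delta> powr (- 3 * \<bar>g x - g y\<bar>) \<le> exp (3 * c) * (1 + norm (x - y) / \<delta>) powr (3 * a)"
proof (cases "x = y")
  case True
  then show ?thesis using assms c_pos by simp
next
  case False
  define d where "d = \<bar>g x - g y\<bar>"
  define z where "z = norm (x - y)"
  define L where "L = ln (1 + z / \<delta>)"
  have z: "0 < z" using False by (simp add: z_def)
  have d: "0 \<le> d" "d \<le> a" using g_nonneg[of x] g_nonneg[of y] g_le_a[of x] g_le_a[of y] by (auto simp: d_def)
  have e1: "exp 1 + 1 / z \<ge> 1" using z exp_ge_add_one_self[of 1] by (simp add: add_increasing2)
  have lpos: "0 < ln (exp 1 + 1 / z)"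
    using z exp_ge_add_one_self[of 1] by (intro ln_gt_zero) (smt (verit) divide_pos_pos)
  have dl: "d * ln (exp 1 + 1 / z) \<le> c"
    using log_holder[of x y] lpos by (simp add: d_def z_def field_simps)
  have L: "0 \<le> L" using z assms by (simp add: L_def)
  have "1 / \<delta> = z / \<delta> * (1 / z)" using z by simp
  also have "\<dots> \<le> (1 + z / \<delta>) * (exp 1 + 1 / z)"
    using z assms by (intro mult_mono) auto
  finally have "ln (1 / \<delta>) \<le> ln ((1 + z / \<delta>) * (exp 1 + 1 / z))"
    using assms by (intro ln_mono) auto
  also have "\<dots> = L + ln (exp 1 + 1 / z)"
    unfolding L_def using z assms e1 by (subst ln_mult_pos) (auto intro!: add_pos_pos)
  finally have "- ln \<delta> \<le> L + ln (exp 1 + 1 / z)" using assms by (simp add: ln_div)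
  then have "d * (- ln \<delta>) \<le> d * (L + ln (exp 1 + 1 / z))" using d by (intro mult_left_mono)
  also have "\<dots> \<le> a * L + c" using dl d L by (simp add: distrib_left add_mono mult_right_mono)
  finally have "- 3 * d * ln \<delta> \<le> 3 * c + 3 * a * L" by simp
  then have "exp (- 3 * d * ln \<delta>) \<le> exp (3 * c) * exp (3 * a * L)" by (simp add: exp_add[symmetric])
  moreover have "0 < 1 + z / \<delta>" using z assms by (simp add: add_pos_pos)
  ultimately show ?thesis using assms z by (simp add: powr_def L_def d_def z_def)
qed

text \<open>\<open>B\<close> will be a local average of the modular density, which can be as large
  as \<delta>^(-3); \<open>delta_powr_bound\<close> is what such a base tolerates. The lost decay 3a
  is why the linear estimate starts from \<rho> > 3 + 3a.\<close>

lemma bump_exchange: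
  assumes "0 < \<delta>" "\<delta> \<le> 1" "1 \<le> B" "B \<le> \<delta> powr - 3"
  shows "bump \<rho> \<delta> (x - y) * B powr g y \<le> exp (3 * c) * B powr g x * bump (\<rho> - 3 * a) \<delta> (x - y)"
proof -
  have "B powr g y = B powr g x * B powr (g y - g x)" using assms by (simp add: powr_add[symmetric])
  also have "B powr (g y - g x) \<le> B powr \<bar>g x - g y\<bar>" using assms by (intro powr_mono) auto
  also have "B powr \<bar>g x - g y\<bar> \<le> (\<delta> powr - 3) powr \<bar>g x - g y\<bar>" using assms by (intro powr_mono2) auto
  also have "\<dots> = \<delta> powr (- 3 * \<bar>g x - g y\<bar>)" by (simp add: powr_powr)
  also have "\<dots> \<le> exp (3 * c) * (1 + norm (x - y) / \<delta>) powr (3 * a)"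
    using assms by (intro delta_powr_bound) auto
  finally have "B powr g y \<le> B powr g x * (exp (3 * c) * (1 + norm (x - y) / \<delta>) powr (3 * a))"
    by (simp add: mult_left_mono)
  then have "bump \<rho> \<delta> (x - y) * B powr g y \<le> bump \<rho> \<delta> (x - y) * (B powr g x * (exp (3 * c) * (1 + norm (x - y) / \<delta>) powr (3 * a)))"
    by (intro mult_left_mono) auto
  also have "\<dots> = exp (3 * c) * B powr g x * (\<delta> powr - 3 * ((1 + norm (x - y) / \<delta>) powr - \<rho> * (1 + norm (x - y) / \<delta>) powr (3 * a)))"
    by (simp add: bump_def mult_ac)
  also have "(1 + norm (x - y) / \<delta>) powr - \<rho> * (1 + norm (x - y) / \<delta>) powr (3 * a) = (1 + norm (x - y) / \<delta>) powr - (\<rho> - 3 * a)"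
    by (simp add: powr_add[symmetric])
  finally show ?thesis by (simp add: bump_def)
qed

text \<open>Comes from z^\<gamma> \<le> 1 + z with z = phi/B: values of F at y are compared with the
  level B^(g y), which sees y only through the exponent.\<close>

lemma le_powr_phi:
  assumes "1 \<le> B" "phi (g y) s < \<infinity>"
  shows "s \<le> ennreal (B powr g y) * (phi (g y) s * ennreal (1 / B) + 1)"
proof (cases s rule: ennreal_finite_cases)
  case (2 r)
  show ?thesis
  proof (cases "g y = 0")
    case True
    then have "s \<le> 1" using assms(2) by (auto simp: phi_zero_exponent split: if_splits)
    then show ?thesis using True assms(1) by (auto intro!: order_trans[OF _ add_increasing])
  next
    case False
    then have g0: "0 < g y" using g_nonneg[of y] by simp
    have "r \<le> B powr g y * (r powr (1 / g y) * (1 / B) + 1)"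
    proof (cases "r = 0")
      case False
      define z where "z = r powr (1 / g y) / B"
      have z: "0 < z" using False 2 assms by (simp add: z_def)
      have "z powr g y \<le> z + 1"
      proof (cases "z \<le> 1")
        case True
        then have "z powr g y \<le> 1" using z g_nonneg by (simp add: powr_le1)
        then show ?thesis using z by simp
      next
        case False
        then have "z powr g y \<le> z powr 1" using g_le_1 by (intro powr_mono) auto
        then show ?thesis using z by simp
      qed
      moreover have "z powr g y = r / B powr g y"
        using 2 False g0 assms by (simp add: z_def powr_divide powr_powr)
      ultimately have "r / B powr g y \<le> z + 1" by simp
      then have "r \<le> B powr g y * (z + 1)" using assms by (simp add: pos_divide_le_eq mult.commute)
      then show ?thesis by (simp add: z_def)
    qed (use assms in simp)
    then have "ennreal r \<le> ennreal (B powr g y * (r powr (1 / g y) * (1 / B) + 1))" by (rule ennreal_leI)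
    also have "\<dots> = ennreal (B powr g y) * (phi (g y) s * ennreal (1 / B) + 1)"
      using 2 g0 assms by (simp add: phi_pos_exponent ennreal_mult'[symmetric] ennreal_mult ennreal_plus)
    finally show ?thesis using 2 by simp
  qed
qed (use assms in simp)

text \<open>\<open>A x\<close> averages the modular density of F around x with the weaker bump, and
  B = max 1 (A x) is the level in \<open>le_powr_phi\<close>. Exchanging exponents bounds the
  average \<open>I x\<close> of F by a multiple of B^(g x). Where A x \<ge> 1, the modular density
  of the scaled average is then at most A x. Elsewhere the scaled average is at most 1, so the
  exponent q(x) may be lowered to q^-, and Jensen's inequality with the embedding takes
  over.\<close>

lemma heat_modular:
  assumes \<rho>: "3 + 3 * a < \<rho>"
  shows "\<exists>\<beta>>0. \<forall>\<delta> F. 0 < \<delta> \<longrightarrow> \<delta> \<le> 1 \<longrightarrow> F \<in> borel_measurable borel \<longrightarrow> modg F \<le> 1 \<longrightarrow>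
    modg (\<lambda>x. ennreal \<beta> * (\<integral>\<^sup>+y. ennreal (bump \<rho> \<delta> (x - y)) * F y \<partial>lborel)) \<le> 1"
proof -
  define J where "J = bump_mass \<rho>"
  define J' where "J' = bump_mass (\<rho> - 3 * a)"
  have J: "0 \<le> J" "0 \<le> J'" by (simp_all add: J_def J'_def)
  have \<rho>3: "3 < \<rho>" "3 < \<rho> - 3 * a" using \<rho> a_nonneg by auto
  \<comment> \<open>\<open>\<beta>0\<close> cancels the constant of the exchange of exponents;
    \<open>\<beta>1\<close> combines the normalisation of the bump for Jensen's inequality with the
    embedding constant.\<close>
  define \<beta>0 where "\<beta>0 = 1 / (exp (3 * c) * (1 + J'))"
  define \<beta>1 where "\<beta>1 = emb_const / (1 + J)"
  define \<beta>2 where "\<beta>2 = min \<beta>0 \<beta>1"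
  define N where "N = 1 + J' + far_mass"
  have pos: "0 < \<beta>0" "0 < \<beta>1" "0 < \<beta>2" "1 \<le> N"
    using J emb_const by (auto simp: \<beta>0_def \<beta>1_def \<beta>2_def N_def)
  have main: "modg (\<lambda>x. ennreal \<beta>2 * (\<integral>\<^sup>+y. ennreal (bump \<rho> \<delta> (x - y)) * F y \<partial>lborel)) \<le> ennreal N"
    if \<delta>: "0 < \<delta>" "\<delta> \<le> 1" and F [measurable]: "F \<in> borel_measurable borel" and F1: "modg F \<le> 1" for \<delta> F
  proof -
    define I where "I x = (\<integral>\<^sup>+y. ennreal (bump \<rho> \<delta> (x - y)) * F y \<partial>lborel)" for x
    define A where "A x = (\<integral>\<^sup>+y. ennreal (bump (\<rho> - 3 * a) \<delta> (x - y)) * phi (g y) (F y) \<partial>lborel)" for x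
    have [measurable]: "I \<in> borel_measurable borel" "A \<in> borel_measurable borel"
      unfolding I_def[abs_def] A_def[abs_def] by measurable
    have fin: "AE y in lborel. phi (g y) (F y) < \<infinity>"
    proof -
      have "modg F \<noteq> \<infinity>" using F1 by (auto simp: top_unique)
      then have "AE y in lborel. phi (g y) (F y) \<noteq> \<infinity>"
        unfolding modg_def by (intro nn_integral_noteq_infinite) auto
      then show ?thesis by (simp add: less_top)
    qed
    have A_le: "A x \<le> ennreal (\<delta> powr - 3)" for x
    proof -
      have "A x \<le> (\<integral>\<^sup>+y. ennreal (\<delta> powr - 3) * phi (g y) (F y) \<partial>lborel)"
        unfolding A_def using \<delta> \<rho>3 by (intro nn_integral_mono mult_right_mono ennreal_leI bump_le) auto
      also have "\<dots> = ennreal (\<delta> powr - 3) * modg F" unfolding modg_def by (rule nn_integral_cmult) measurable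
      also have "\<dots> \<le> ennreal (\<delta> powr - 3) * 1" using F1 by (intro mult_left_mono) auto
      finally show ?thesis by simp
    qed
    have pw: "phi (g x) (ennreal \<beta>2 * I x) \<le> A x + phi a (ennreal \<beta>2 * I x)" for x
    proof -
      obtain A' where A': "0 \<le> A'" "A x = ennreal A'" using A_le[of x] by (cases "A x") (auto simp: top_unique)
      \<comment> \<open>The maximum keeps B in the range from 1 to \<delta>^(-3) required by
        \<open>bump_exchange\<close>; the upper end is the supremum of the bump, as the modular is
        at most 1.\<close>
      define B where "B = max 1 A'"
      have "1 \<le> \<delta> powr - 3" using \<delta> powr_mono'[of "-3" 0 \<delta>] by simp
      then have B: "1 \<le> B" "B \<le> \<delta> powr - 3" using A_le[of x] A' by (auto simp: B_def)
      have "I x \<le> (\<integral>\<^sup>+y. ennreal (exp (3 * c) * B powr g x) *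
            (ennreal (1 / B) * (ennreal (bump (\<rho> - 3 * a) \<delta> (x - y)) * phi (g y) (F y)) + ennreal (bump (\<rho> - 3 * a) \<delta> (x - y))) \<partial>lborel)"
        unfolding I_def
      proof (intro nn_integral_mono_AE, use fin in eventually_elim)
        case (elim y)
        have "ennreal (bump \<rho> \<delta> (x - y)) * F y
            \<le> ennreal (bump \<rho> \<delta> (x - y)) * (ennreal (B powr g y) * (phi (g y) (F y) * ennreal (1 / B) + 1))"
          using le_powr_phi[OF B(1) elim] by (intro mult_left_mono) auto
        also have "\<dots> = ennreal (bump \<rho> \<delta> (x - y) * B powr g y) * (phi (g y) (F y) * ennreal (1 / B) + 1)"
          by (simp add: ennreal_mult mult.assoc)
        also have "\<dots> \<le> ennreal (exp (3 * c) * B powr g x * bump (\<rho> - 3 * a) \<delta> (x - y)) * (phi (g y) (F y) * ennreal (1 / B) + 1)"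
          using bump_exchange[OF \<delta> B] by (intro mult_right_mono ennreal_leI) auto
        also have "\<dots> = ennreal (exp (3 * c) * B powr g x) *
            (ennreal (1 / B) * (ennreal (bump (\<rho> - 3 * a) \<delta> (x - y)) * phi (g y) (F y)) + ennreal (bump (\<rho> - 3 * a) \<delta> (x - y)))"
          by (simp add: ennreal_mult distrib_left distrib_right mult_ac)
        finally show ?case .
      qed
      also have "\<dots> = ennreal (exp (3 * c) * B powr g x) * (ennreal (1 / B) * A x + ennreal J')"
        unfolding A_def J'_def
        by (subst nn_integral_cmult, measurable, subst nn_integral_add, measurable, subst nn_integral_cmult, measurable)
           (simp add: bump_integral[OF \<delta>(1) \<rho>3(2)])
      also have "ennreal (1 / B) * A x \<le> 1"
        using A' B by (simp add: ennreal_mult[symmetric]) (simp add: B_def)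
      finally have "I x \<le> ennreal (exp (3 * c) * B powr g x) * (1 + ennreal J')"
        by (simp add: add_right_mono mult_left_mono)
      then have "ennreal \<beta>0 * I x \<le> ennreal \<beta>0 * (ennreal (exp (3 * c) * B powr g x) * (1 + ennreal J'))"
        by (intro mult_left_mono) auto
      also have "\<dots> = ennreal (B powr g x)"
        using J B pos unfolding ennreal_1[symmetric]
        by (simp add: ennreal_mult[symmetric] ennreal_plus[symmetric] \<beta>0_def del: ennreal_plus ennreal_1)
      finally have V: "ennreal \<beta>2 * I x \<le> ennreal (B powr g x)"
        using mult_right_mono[of "ennreal \<beta>2" "ennreal \<beta>0" "I x"] by (auto simp: \<beta>2_def ennreal_leI)
      show ?thesis
      proof (cases "1 \<le> A'")
        case True
        then have BA: "B = A'" by (simp add: B_def)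
        have "phi (g x) (ennreal \<beta>2 * I x) \<le> phi (g x) (ennreal (A' powr g x))"
          using V by (intro phi_mono g_nonneg) (simp add: BA)
        also have "\<dots> \<le> A x"
          using True A' g_nonneg[of x]
          by (cases "g x = 0") (auto simp: phi_zero_exponent phi_pos_exponent powr_powr)
        finally show ?thesis by (simp add: add_increasing2)
      next
        case False
        then have "B = 1" by (simp add: B_def)
        then have "ennreal \<beta>2 * I x \<le> 1" using V by simp
        then have "phi (g x) (ennreal \<beta>2 * I x) \<le> phi a (ennreal \<beta>2 * I x)"
          by (intro phi_antimono_exponent g_nonneg g_le_a)
        then show ?thesis by (simp add: add_increasing)
      qed
    qed
    have pa: "phi a (ennreal \<beta>2 * I x) \<le> (\<integral>\<^sup>+y. ennreal (bump \<rho> \<delta> (x - y)) * (ennreal (1 / (1 + J)) * phi a (ennreal emb_const * F y)) \<partial>lborel)" for x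
    proof -
      have "ennreal \<beta>2 * I x \<le> ennreal \<beta>1 * I x"
        by (intro mult_right_mono ennreal_leI) (auto simp: \<beta>2_def)
      also have "\<dots> = (\<integral>\<^sup>+y. ennreal \<beta>1 * (ennreal (bump \<rho> \<delta> (x - y)) * F y) \<partial>lborel)"
        unfolding I_def by (rule nn_integral_cmult[symmetric]) measurable
      also have "\<dots> = (\<integral>\<^sup>+y. (ennreal (1 / (1 + J)) * ennreal (bump \<rho> \<delta> (x - y))) * (ennreal emb_const * F y) \<partial>lborel)"
      proof (intro nn_integral_cong)
        fix y
        have "ennreal \<beta>1 = ennreal (1 / (1 + J)) * ennreal emb_const"
          using J emb_const by (simp add: \<beta>1_def ennreal_mult[symmetric])
        then show "ennreal \<beta>1 * (ennreal (bump \<rho> \<delta> (x - y)) * F y) = (ennreal (1 / (1 + J)) * ennreal (bump \<rho> \<delta> (x - y))) * (ennreal emb_const * F y)"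
          by (simp add: mult_ac)
      qed
      finally have "phi a (ennreal \<beta>2 * I x) \<le> phi a \<dots>" by (intro phi_mono a_nonneg)
      also have "\<dots> \<le> (\<integral>\<^sup>+y. (ennreal (1 / (1 + J)) * ennreal (bump \<rho> \<delta> (x - y))) * phi a (ennreal emb_const * F y) \<partial>lborel)"
      proof (rule phi_jensen)
        have "(\<integral>\<^sup>+y. ennreal (1 / (1 + J)) * ennreal (bump \<rho> \<delta> (x - y)) \<partial>lborel) = ennreal (1 / (1 + J)) * ennreal J"
          using \<delta> \<rho>3 by (subst nn_integral_cmult) (auto simp: bump_integral J_def)
        also have "\<dots> \<le> 1" using J by (simp add: ennreal_mult[symmetric])
        finally show "(\<integral>\<^sup>+y. ennreal (1 / (1 + J)) * ennreal (bump \<rho> \<delta> (x - y)) \<partial>lborel) \<le> 1" .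
      qed (use a_nonneg a_less in auto)
      finally show ?thesis by (simp add: mult_ac)
    qed
    have "modg (\<lambda>x. ennreal \<beta>2 * I x) \<le> (\<integral>\<^sup>+x. A x + (\<integral>\<^sup>+y. ennreal (bump \<rho> \<delta> (x - y)) * (ennreal (1 / (1 + J)) * phi a (ennreal emb_const * F y)) \<partial>lborel) \<partial>lborel)"
      unfolding modg_def by (intro nn_integral_mono order_trans[OF pw] add_left_mono pa)
    also have "\<dots> = (\<integral>\<^sup>+x. A x \<partial>lborel) + (\<integral>\<^sup>+x. (\<integral>\<^sup>+y. ennreal (bump \<rho> \<delta> (x - y)) * (ennreal (1 / (1 + J)) * phi a (ennreal emb_const * F y)) \<partial>lborel) \<partial>lborel)"
      by (intro nn_integral_add) measurable
    also have "(\<integral>\<^sup>+x. A x \<partial>lborel) = ennreal J' * modg F"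
      unfolding A_def modg_def J'_def using \<delta> \<rho>3 by (intro bump_tonelli) auto
    also have "(\<integral>\<^sup>+x. (\<integral>\<^sup>+y. ennreal (bump \<rho> \<delta> (x - y)) * (ennreal (1 / (1 + J)) * phi a (ennreal emb_const * F y)) \<partial>lborel) \<partial>lborel)
       = ennreal J * (\<integral>\<^sup>+y. ennreal (1 / (1 + J)) * phi a (ennreal emb_const * F y) \<partial>lborel)"
      unfolding J_def using \<delta> \<rho>3 by (intro bump_tonelli) auto
    also have "(\<integral>\<^sup>+y. ennreal (1 / (1 + J)) * phi a (ennreal emb_const * F y) \<partial>lborel)
       = ennreal (1 / (1 + J)) * (\<integral>\<^sup>+y. phi a (ennreal emb_const * F y) \<partial>lborel)"
      by (rule nn_integral_cmult) measurable
    also have "ennreal J' * modg F + ennreal J * (ennreal (1 / (1 + J)) * (\<integral>\<^sup>+y. phi a (ennreal emb_const * F y) \<partial>lborel))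
       \<le> ennreal J' * 1 + ennreal J * (ennreal (1 / (1 + J)) * ennreal (1 + far_mass))"
      using F1 embedding[OF F F1] by (intro add_mono mult_left_mono) auto
    also have "\<dots> = ennreal (J' + J / (1 + J) * (1 + far_mass))"
      using J by (simp add: ennreal_mult[symmetric] ennreal_plus[symmetric] del: ennreal_plus)
    also have "\<dots> \<le> ennreal N"
    proof (intro ennreal_leI)
      have "J / (1 + J) * (1 + far_mass) \<le> 1 * (1 + far_mass)" using J by (intro mult_right_mono) auto
      then show "J' + J / (1 + J) * (1 + far_mass) \<le> N" by (simp add: N_def)
    qed
    finally show ?thesis unfolding I_def .
  qed
  show ?thesis
  proof (intro exI[of _ "\<beta>2 / N"] conjI allI impI)
    show "0 < \<beta>2 / N" using pos by simp
    fix \<delta> :: real and F assume *: "0 < \<delta>" "\<delta> \<le> 1" and F [measurable]: "F \<in> borel_measurable borel" and "modg F \<le> 1"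
    have "modg (\<lambda>x. ennreal (1 / N) * (ennreal \<beta>2 * (\<integral>\<^sup>+y. ennreal (bump \<rho> \<delta> (x - y)) * F y \<partial>lborel))) \<le> 1"
      by (rule modg_scale_le_1[OF _ main]) (use * \<open>modg F \<le> 1\<close> pos in auto)
    moreover have "ennreal (\<beta>2 / N) = ennreal (1 / N) * ennreal \<beta>2"
      using pos by (simp add: ennreal_mult[symmetric])
    ultimately show "modg (\<lambda>x. ennreal (\<beta>2 / N) * (\<integral>\<^sup>+y. ennreal (bump \<rho> \<delta> (x - y)) * F y \<partial>lborel)) \<le> 1"
      by (simp add: mult.assoc)
  qed
qed

text \<open>Here s = h^(1/(2a)), and \<open>A\<close> will be its local average. Up to A^(g x), the
  product P^p h with p = 1 - 2a + g x factors into powers of P s/A, P and s with weights g x, 1 - 2a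
  and 2a - g x, which sum to 1. The power of \<delta> pays for replacing P by P^p, since P \<le>
  \<delta>^(-3) and 1 - p = 2a - g x \<le> 2a - b; this is the origin of the exponent 3 (2/q^- -
  1/q^+).\<close>

lemma bilinear_pointwise:
  assumes \<delta>: "0 < \<delta>" "\<delta> \<le> 1" and "3 < \<rho>" "0 < a" "0 < A" "0 \<le> h"
  shows "\<delta> powr (3 * (2 * a - b)) * bump \<rho> \<delta> z * h
    \<le> A powr g x * (g x * (bump \<rho> \<delta> z * h powr (1 / (2 * a)) / A) + (1 - 2 * a) * bump \<rho> \<delta> z + (2 * a - g x) * h powr (1 / (2 * a)))"
proof (cases "h = 0")
  case True
  then show ?thesis using assms a_less by simp
next
  case False
  then have h: "0 < h" using assms by simp
  define p where "p = 1 - 2 * a + g x"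
  define P where "P = bump \<rho> \<delta> z"
  define s where "s = h powr (1 / (2 * a))"
  define \<psi> where "\<psi> = (1 + norm z / \<delta>) powr - \<rho>"
  have pos: "0 < 1 + norm z / \<delta>" using \<delta> by (intro add_pos_nonneg) auto
  have "\<psi> \<le> (1 + norm z / \<delta>) powr 0"
    unfolding \<psi>_def using \<delta> assms(3) by (intro powr_mono) auto
  also have "\<dots> = 1" using pos by (metis less_irrefl powr_zero_eq_one)
  finally have \<psi>: "0 < \<psi>" "\<psi> \<le> 1" using pos by (auto simp: \<psi>_def)
  have P: "P = \<delta> powr - 3 * \<psi>" "0 < P" using \<delta> \<psi> by (auto simp: P_def bump_def \<psi>_def)
  have s: "0 < s" using h by (simp add: s_def)
  have p: "0 \<le> p" "p \<le> 1" using g_nonneg[of x] g_le_a[of x] a_less assms(4) by (auto simp: p_def)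
  have "\<delta> powr (3 * (2 * a - b)) * P = \<delta> powr (- 3 * (1 - 2 * a + b)) * \<psi>"
    unfolding P(1) mult.assoc[symmetric] powr_add[symmetric] by (simp add: algebra_simps)
  also have "\<dots> \<le> \<delta> powr (- 3 * p) * \<psi> powr p"
  proof (intro mult_mono)
    show "\<delta> powr (- 3 * (1 - 2 * a + b)) \<le> \<delta> powr (- 3 * p)"
      using \<delta> b_le_g[of x] by (intro powr_mono') (auto simp: p_def)
    show "\<psi> \<le> \<psi> powr p" using powr_mono'[of p 1 \<psi>] \<psi> p by simp
  qed (use \<psi> in auto)
  also have "\<dots> = P powr p" using \<delta> \<psi> by (simp add: P(1) powr_mult powr_powr)
  finally have "\<delta> powr (3 * (2 * a - b)) * P * h \<le> P powr p * h"
    using h by (intro mult_right_mono) auto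
  also have "P powr p * h = A powr g x * ((P * s / A) powr g x * P powr (1 - 2 * a) * s powr (2 * a - g x))"
  proof -
    have "h = s powr (2 * a)" using h assms(4) by (simp add: s_def powr_powr)
    also have "\<dots> = s powr g x * s powr (2 * a - g x)" by (simp add: powr_add[symmetric])
    finally have 1: "h = s powr g x * s powr (2 * a - g x)" .
    have "p = g x + (1 - 2 * a)" by (simp add: p_def)
    then have 2: "P powr p = P powr g x * P powr (1 - 2 * a)" by (simp only: powr_add)
    have 3: "(P * s / A) powr g x = P powr g x * s powr g x / A powr g x"
      using P s assms by (simp add: powr_mult powr_divide)
    have "P powr p * h = (P powr g x * P powr (1 - 2 * a)) * (s powr g x * s powr (2 * a - g x))"
      using 1 2 by presburger
    then show ?thesis unfolding 3 using assms(5) by simp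
  qed
  also have "\<dots> \<le> A powr g x * (g x * (P * s / A) + (1 - 2 * a) * P + (2 * a - g x) * s)"
    using P s assms a_less g_nonneg[of x] g_le_a[of x]
    by (intro mult_left_mono weighted_am_gm) auto
  finally show ?thesis by (simp add: P_def s_def)
qed

text \<open>After integration of \<open>bilinear_pointwise\<close> in y, the three terms contribute
  g x, (1 - 2a) J and at most 2a - g x, so the average of H is bounded by a multiple of A^(g x). Its
  modular density after scaling is at most \<open>A x\<close>, whose integral is at most J.\<close>

lemma bilinear_core:
  assumes \<delta>: "0 < \<delta>" "\<delta> \<le> 1" and \<rho>: "3 < \<rho>" and H [measurable]: "H \<in> borel_measurable borel"
    and H1: "(\<integral>\<^sup>+x. phi (2 * a) (H x) \<partial>lborel) \<le> 1"
  shows "modg (\<lambda>x. ennreal (1 / (1 + bump_mass \<rho>)) * (ennreal (\<delta> powr (3 * (2 * a - b)) / (1 + bump_mass \<rho>)) *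
     (\<integral>\<^sup>+y. ennreal (bump \<rho> \<delta> (x - y)) * H y \<partial>lborel))) \<le> 1"
proof (rule modg_scale_le_1)
  define J where "J = bump_mass \<rho>"
  have J: "0 \<le> J" by (simp add: J_def)
  define k where "k = \<delta> powr (3 * (2 * a - b))"
  have k: "0 \<le> k" by (simp add: k_def)
  define A where "A x = (\<integral>\<^sup>+y. ennreal (bump \<rho> \<delta> (x - y)) * phi (2 * a) (H y) \<partial>lborel)" for x
  define I where "I x = (\<integral>\<^sup>+y. ennreal (bump \<rho> \<delta> (x - y)) * H y \<partial>lborel)" for x
  have A_le: "A x \<le> ennreal (\<delta> powr - 3)" for x
  proof -
    have "A x \<le> (\<integral>\<^sup>+y. ennreal (\<delta> powr - 3) * phi (2 * a) (H y) \<partial>lborel)"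
      unfolding A_def using \<delta> \<rho> by (intro nn_integral_mono mult_right_mono ennreal_leI bump_le) auto
    also have "\<dots> = ennreal (\<delta> powr - 3) * (\<integral>\<^sup>+x. phi (2 * a) (H x) \<partial>lborel)" by (rule nn_integral_cmult) measurable
    also have "\<dots> \<le> ennreal (\<delta> powr - 3) * 1" using H1 by (intro mult_left_mono) auto
    finally show ?thesis by simp
  qed
  have fin: "AE y in lborel. phi (2 * a) (H y) \<noteq> \<infinity>"
    using H1 by (intro nn_integral_noteq_infinite) (auto simp: top_unique)
  have pw: "phi (g x) (ennreal (k / (1 + J)) * I x) \<le> A x" for x
  proof (cases "a = 0")
    \<comment> \<open>Here q is infinite everywhere, b = 0 as well, and the claim is a supremum
      bound.\<close>
    case True
    have g0: "g x = 0" using g_nonneg[of x] g_le_a[of x] True by simp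
    have "b = 0" using b_nonneg b_le_g[of x] g0 by simp
    then have k1: "k = 1" using True \<delta> by (simp add: k_def)
    have "I x \<le> (\<integral>\<^sup>+y. ennreal (bump \<rho> \<delta> (x - y)) \<partial>lborel)"
      unfolding I_def
    proof (intro nn_integral_mono_AE, use fin in eventually_elim)
      case (elim y)
      then have "H y \<le> 1" using True by (auto simp: phi_zero_exponent split: if_splits)
      then show ?case by (simp add: mult_left_le)
    qed
    also have "\<dots> = ennreal J" using \<delta> \<rho> by (simp add: bump_integral J_def)
    finally have "ennreal (1 / (1 + J)) * I x \<le> ennreal (1 / (1 + J)) * ennreal J" by (intro mult_left_mono) auto
    also have "\<dots> \<le> 1" using J by (simp add: ennreal_mult[symmetric])
    finally show ?thesis using g0 k1 by (simp add: phi_zero_exponent)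
  next
    case False
    then have a0: "0 < a" using a_nonneg by simp
    obtain A' where A': "0 \<le> A'" "A x = ennreal A'" using A_le[of x] by (cases "A x") (auto simp: top_unique)
    show ?thesis
    proof (cases "A' = 0")
      \<comment> \<open>\<open>bilinear_pointwise\<close> divides by the average; if it vanishes,
        positivity of the bump forces H = 0 almost everywhere.\<close>
      case True
      then have "(\<integral>\<^sup>+y. ennreal (bump \<rho> \<delta> (x - y)) * phi (2 * a) (H y) \<partial>lborel) = 0"
        using A' by (simp add: A_def)
      then have "AE y in lborel. ennreal (bump \<rho> \<delta> (x - y)) * phi (2 * a) (H y) = 0"
        by (subst (asm) nn_integral_0_iff_AE) auto
      then have "AE y in lborel. ennreal (bump \<rho> \<delta> (x - y)) * H y = 0"
      proof eventually_elim
        case (elim y)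
        have "ennreal (bump \<rho> \<delta> (x - y)) \<noteq> 0" using bump_pos[OF \<delta>(1), of \<rho> "x - y"] by simp
        then have "phi (2 * a) (H y) = 0" using elim by simp
        then show ?case using a0 by (simp add: phi_eq_0_iff)
      qed
      then have "I x = 0" unfolding I_def by (subst nn_integral_0_iff_AE) auto
      then show ?thesis by simp
    next
      case False
      then have A0: "0 < A'" using A' by simp
      have coef: "0 \<le> g x" "0 \<le> 1 - 2 * a" "0 \<le> 2 * a - g x"
        using g_nonneg[of x] g_le_a[of x] a_less a0 by auto
      have "ennreal k * I x = (\<integral>\<^sup>+y. ennreal k * (ennreal (bump \<rho> \<delta> (x - y)) * H y) \<partial>lborel)"
        unfolding I_def by (rule nn_integral_cmult[symmetric]) measurable
      also have "\<dots> \<le> (\<integral>\<^sup>+y. ennreal (A' powr g x) *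
          (ennreal (g x / A') * (ennreal (bump \<rho> \<delta> (x - y)) * phi (2 * a) (H y))
           + (ennreal (1 - 2 * a) * ennreal (bump \<rho> \<delta> (x - y)) + ennreal (2 * a - g x) * phi (2 * a) (H y))) \<partial>lborel)"
      proof (intro nn_integral_mono_AE, use fin in eventually_elim)
        case (elim y)
        obtain h where h: "0 \<le> h" "H y = ennreal h" using elim by (cases "H y") auto
        have "ennreal k * (ennreal (bump \<rho> \<delta> (x - y)) * H y) = ennreal (k * bump \<rho> \<delta> (x - y) * h)"
          using h k by (simp add: ennreal_mult[symmetric] mult.assoc)
        also have "\<dots> \<le> ennreal (A' powr g x * (g x * (bump \<rho> \<delta> (x - y) * h powr (1 / (2 * a)) / A')
           + (1 - 2 * a) * bump \<rho> \<delta> (x - y) + (2 * a - g x) * h powr (1 / (2 * a))))"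
          unfolding k_def using \<delta> \<rho> a0 A0 h by (intro ennreal_leI bilinear_pointwise) auto
        also have "\<dots> = ennreal (A' powr g x) *
          (ennreal (g x / A') * (ennreal (bump \<rho> \<delta> (x - y)) * phi (2 * a) (H y))
           + (ennreal (1 - 2 * a) * ennreal (bump \<rho> \<delta> (x - y)) + ennreal (2 * a - g x) * phi (2 * a) (H y)))"
          using h a0 A0 coef
          by (simp add: phi_pos_exponent ennreal_mult[symmetric] ennreal_plus[symmetric] add.assoc del: ennreal_plus)
        finally show ?case .
      qed
      also have "\<dots> = ennreal (A' powr g x) * (ennreal (g x / A') * A x
           + (ennreal (1 - 2 * a) * ennreal J + ennreal (2 * a - g x) * (\<integral>\<^sup>+x. phi (2 * a) (H x) \<partial>lborel)))"
        unfolding A_def J_def bump_integral(1)[OF \<delta>(1) \<rho>, of x, symmetric]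
        by (simp add: nn_integral_cmult nn_integral_add)
      also have "\<dots> \<le> ennreal (A' powr g x) * (ennreal (g x / A') * ennreal A'
           + (ennreal (1 - 2 * a) * ennreal J + ennreal (2 * a - g x) * 1))"
        using H1 A' by (intro mult_left_mono add_mono) auto
      also have "\<dots> = ennreal (A' powr g x * (g x + ((1 - 2 * a) * J + (2 * a - g x))))"
        using A0 coef J by (simp add: ennreal_mult[symmetric] ennreal_plus[symmetric] del: ennreal_plus)
      also have "\<dots> \<le> ennreal (A' powr g x * (1 + J))"
      proof (intro ennreal_leI mult_left_mono)
        have "(1 - 2 * a) * J \<le> 1 * J" using a0 J by (intro mult_right_mono) auto
        then show "g x + ((1 - 2 * a) * J + (2 * a - g x)) \<le> 1 + J" using a_less by simp
      qed simp
      finally have "ennreal (1 / (1 + J)) * (ennreal k * I x) \<le> ennreal (1 / (1 + J)) * ennreal (A' powr g x * (1 + J))"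
        by (intro mult_left_mono) auto
      also have "ennreal (1 / (1 + J)) * (ennreal k * I x) = ennreal (k / (1 + J)) * I x"
        using k J by (simp add: mult.assoc[symmetric] ennreal_mult[symmetric])
      also have "ennreal (1 / (1 + J)) * ennreal (A' powr g x * (1 + J)) = ennreal (A' powr g x)"
        using J by (simp add: ennreal_mult[symmetric])
      finally have "phi (g x) (ennreal (k / (1 + J)) * I x) \<le> phi (g x) (ennreal (A' powr g x))"
        by (intro phi_mono g_nonneg)
      also have "\<dots> \<le> A x"
        using A0 A' g_nonneg[of x]
        by (cases "g x = 0") (auto simp: phi_zero_exponent phi_pos_exponent powr_powr)
      finally show ?thesis .
    qed
  qed
  have "modg (\<lambda>x. ennreal (k / (1 + J)) * I x) \<le> (\<integral>\<^sup>+x. A x \<partial>lborel)"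
    unfolding modg_def by (intro nn_integral_mono pw)
  also have "\<dots> = ennreal J * (\<integral>\<^sup>+x. phi (2 * a) (H x) \<partial>lborel)"
    unfolding A_def J_def using \<delta> \<rho> by (intro bump_tonelli) auto
  also have "\<dots> \<le> ennreal J * 1" using H1 by (intro mult_left_mono) auto
  also have "\<dots> \<le> ennreal (1 + J)" by (simp add: ennreal_leI)
  finally show "modg (\<lambda>x. ennreal (\<delta> powr (3 * (2 * a - b)) / (1 + bump_mass \<rho>)) *
     (\<integral>\<^sup>+y. ennreal (bump \<rho> \<delta> (x - y)) * H y \<partial>lborel)) \<le> ennreal (1 + bump_mass \<rho>)"
    by (simp add: k_def J_def I_def)
qed auto

text \<open>Both factors embed into the classical space with exponent 1/a;
  \<open>phi_two_exponents\<close> then puts the product into the one with exponent 1/(2a), the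
  input of \<open>bilinear_core\<close>.\<close>

lemma bilinear_modular:
  assumes \<rho>: "3 < \<rho>"
  shows "\<exists>\<beta>>0. \<forall>\<delta> F1 F2. 0 < \<delta> \<longrightarrow> \<delta> \<le> 1 \<longrightarrow> F1 \<in> borel_measurable borel \<longrightarrow> F2 \<in> borel_measurable borel \<longrightarrow>
    modg F1 \<le> 1 \<longrightarrow> modg F2 \<le> 1 \<longrightarrow>
    modg (\<lambda>x. ennreal (\<beta> * \<delta> powr (3 * (2 * a - b))) * (\<integral>\<^sup>+y. ennreal (bump \<rho> \<delta> (x - y)) * (F1 y * F2 y) \<partial>lborel)) \<le> 1"
proof -
  define J where "J = bump_mass \<rho>"
  have J: "0 \<le> J" by (simp add: J_def)
  \<comment> \<open>Each embedded factor contributes 1 + far_mass.\<close>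
  define N where "N = 2 * (1 + far_mass)"
  have N: "1 \<le> N" by (simp add: N_def)
  define m where "m = emb_const * emb_const / N"
  have m: "0 < m" using emb_const N by (simp add: m_def)
  define \<beta> where "\<beta> = m / (1 + J) / (1 + J)"
  show ?thesis
  proof (intro exI[of _ \<beta>] conjI allI impI)
    show "0 < \<beta>" using m J by (simp add: \<beta>_def)
    fix \<delta> :: real and F1 F2 assume \<delta>: "0 < \<delta>" "\<delta> \<le> 1"
      and [measurable]: "F1 \<in> borel_measurable borel" "F2 \<in> borel_measurable borel"
      and F: "modg F1 \<le> 1" "modg F2 \<le> 1"
    define H where "H y = ennreal m * (F1 y * F2 y)" for y
    have [measurable]: "H \<in> borel_measurable borel" unfolding H_def[abs_def] by measurable
    have "(\<integral>\<^sup>+x. phi (2 * a) (H x) \<partial>lborel)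
      \<le> (\<integral>\<^sup>+x. ennreal (1 / N) * (phi a (ennreal emb_const * F1 x) + phi a (ennreal emb_const * F2 x)) \<partial>lborel)"
    proof (intro nn_integral_mono)
      fix x
      have "H x = ennreal (1 / N) * ((ennreal emb_const * F1 x) * (ennreal emb_const * F2 x))"
      proof -
        have "ennreal m = ennreal (1 / N) * (ennreal emb_const * ennreal emb_const)"
          using N emb_const by (simp add: m_def ennreal_mult[symmetric])
        then show ?thesis by (simp add: H_def mult_ac)
      qed
      then have "phi (2 * a) (H x) \<le> ennreal (1 / N) * phi (2 * a) ((ennreal emb_const * F1 x) * (ennreal emb_const * F2 x))"
        using N a_nonneg a_less by (auto intro!: phi_scale)
      also have "\<dots> \<le> ennreal (1 / N) * (phi a (ennreal emb_const * F1 x) + phi a (ennreal emb_const * F2 x))"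
        by (intro mult_left_mono phi_two_exponents a_nonneg) auto
      finally show "phi (2 * a) (H x) \<le> ennreal (1 / N) * (phi a (ennreal emb_const * F1 x) + phi a (ennreal emb_const * F2 x))" .
    qed
    also have "\<dots> = ennreal (1 / N) * ((\<integral>\<^sup>+x. phi a (ennreal emb_const * F1 x) \<partial>lborel) + (\<integral>\<^sup>+x. phi a (ennreal emb_const * F2 x) \<partial>lborel))"
      by (simp add: nn_integral_cmult nn_integral_add)
    also have "\<dots> \<le> ennreal (1 / N) * (ennreal (1 + far_mass) + ennreal (1 + far_mass))"
      using F by (intro mult_left_mono add_mono embedding) auto
    also have "\<dots> = ennreal (1 / N * N)"
      using N by (simp add: ennreal_mult[symmetric] ennreal_plus[symmetric] N_def del: ennreal_plus)
    also have "\<dots> = 1" using N by simp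
    finally have H1: "(\<integral>\<^sup>+x. phi (2 * a) (H x) \<partial>lborel) \<le> 1" .
    have "(\<integral>\<^sup>+y. ennreal (bump \<rho> \<delta> (x - y)) * H y \<partial>lborel) = ennreal m * (\<integral>\<^sup>+y. ennreal (bump \<rho> \<delta> (x - y)) * (F1 y * F2 y) \<partial>lborel)" for x
    proof -
      have "(\<integral>\<^sup>+y. ennreal (bump \<rho> \<delta> (x - y)) * H y \<partial>lborel) = (\<integral>\<^sup>+y. ennreal m * (ennreal (bump \<rho> \<delta> (x - y)) * (F1 y * F2 y)) \<partial>lborel)"
        by (simp add: H_def mult_ac)
      also have "\<dots> = ennreal m * (\<integral>\<^sup>+y. ennreal (bump \<rho> \<delta> (x - y)) * (F1 y * F2 y) \<partial>lborel)"
        by (rule nn_integral_cmult) measurable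
      finally show ?thesis .
    qed
    moreover have "ennreal (\<beta> * \<delta> powr (3 * (2 * a - b))) =
       ennreal (1 / (1 + J)) * (ennreal (\<delta> powr (3 * (2 * a - b)) / (1 + J)) * ennreal m)"
      using m J by (simp add: \<beta>_def ennreal_mult[symmetric] mult_ac)
    ultimately show "modg (\<lambda>x. ennreal (\<beta> * \<delta> powr (3 * (2 * a - b))) * (\<integral>\<^sup>+y. ennreal (bump \<rho> \<delta> (x - y)) * (F1 y * F2 y) \<partial>lborel)) \<le> 1"
      using bilinear_core[OF \<delta> \<rho> _ H1] by (simp add: J_def mult.assoc)
  qed
qed

text \<open>Minkowski's inequality in modular form: the weight w/C is a sub-probability in time, so
  Jensen and Tonelli reduce the claim to single times. The hypothesis on \<open>W\<close> is
  confined to w \<noteq> 0, so nothing is asked outside the interval of integration.\<close>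

lemma modg_integral:
  fixes W :: "real \<Rightarrow> real^3 \<Rightarrow> ennreal" and w :: "real \<Rightarrow> ennreal"
  assumes [measurable]: "w \<in> borel_measurable borel" "(\<lambda>z. W (fst z) (snd z)) \<in> borel_measurable (borel \<Otimes>\<^sub>M borel)"
    and w: "(\<integral>\<^sup>+s. w s \<partial>lborel) \<le> ennreal C" "0 < C"
    and W: "AE s in lborel. w s \<noteq> 0 \<longrightarrow> modg (W s) \<le> 1"
  shows "modg (\<lambda>x. ennreal (1 / C) * (\<integral>\<^sup>+s. w s * W s x \<partial>lborel)) \<le> 1"
proof -
  have [measurable]: "W s \<in> borel_measurable borel" "(\<lambda>s. W s x) \<in> borel_measurable borel" for s x
    using measurable_compose[OF measurable_Pair1' assms(2), of s] measurable_compose[OF measurable_Pair2' assms(2), of x]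
    by simp_all
  have mass: "(\<integral>\<^sup>+s. ennreal (1 / C) * w s \<partial>lborel) \<le> 1"
  proof -
    have "(\<integral>\<^sup>+s. ennreal (1 / C) * w s \<partial>lborel) = ennreal (1 / C) * (\<integral>\<^sup>+s. w s \<partial>lborel)"
      by (rule nn_integral_cmult) measurable
    also have "\<dots> \<le> ennreal (1 / C) * ennreal C" using w by (intro mult_left_mono) auto
    also have "\<dots> = 1" using w by (simp add: ennreal_mult[symmetric])
    finally show ?thesis .
  qed
  have "modg (\<lambda>x. ennreal (1 / C) * (\<integral>\<^sup>+s. w s * W s x \<partial>lborel))
     \<le> (\<integral>\<^sup>+x. (\<integral>\<^sup>+s. (ennreal (1 / C) * w s) * phi (g x) (W s x) \<partial>lborel) \<partial>lborel)"
    unfolding modg_def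
  proof (intro nn_integral_mono)
    fix x
    have "ennreal (1 / C) * (\<integral>\<^sup>+s. w s * W s x \<partial>lborel) = (\<integral>\<^sup>+s. (ennreal (1 / C) * w s) * W s x \<partial>lborel)"
      by (subst nn_integral_cmult[symmetric]) (auto simp: mult.assoc)
    then show "phi (g x) (ennreal (1 / C) * (\<integral>\<^sup>+s. w s * W s x \<partial>lborel)) \<le> (\<integral>\<^sup>+s. (ennreal (1 / C) * w s) * phi (g x) (W s x) \<partial>lborel)"
      using mass g_nonneg[of x] g_le_1[of x] by (auto intro!: phi_jensen)
  qed
  also have "\<dots> = (\<integral>\<^sup>+s. (\<integral>\<^sup>+x. (ennreal (1 / C) * w s) * phi (g x) (W s x) \<partial>lborel) \<partial>lborel)"
    by (rule lborel_pair.Fubini') measurable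
  also have "\<dots> = (\<integral>\<^sup>+s. (ennreal (1 / C) * w s) * modg (W s) \<partial>lborel)"
    unfolding modg_def by (intro nn_integral_cong nn_integral_cmult) measurable
  also have "\<dots> \<le> (\<integral>\<^sup>+s. ennreal (1 / C) * w s \<partial>lborel)"
    by (intro nn_integral_mono_AE, use W in eventually_elim) (auto simp: mult_left_le)
  also note mass
  finally show ?thesis .
qed

text \<open>The sum is at most twice the maximum, and the modular of the maximum is at most 2; each
  costs a factor 2, whence 1/4.\<close>

lemma modg_add:
  assumes [measurable]: "F1 \<in> borel_measurable borel" "F2 \<in> borel_measurable borel"
    and "modg F1 \<le> 1" "modg F2 \<le> 1"
  shows "modg (\<lambda>x. ennreal (1/4) * (F1 x + F2 x)) \<le> 1"
proof -
  define m where "m x = max (F1 x) (F2 x)" for x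
  have [measurable]: "m \<in> borel_measurable borel" unfolding m_def[abs_def] by measurable
  have "modg m \<le> (\<integral>\<^sup>+x. phi (g x) (F1 x) + phi (g x) (F2 x) \<partial>lborel)"
    unfolding modg_def by (intro nn_integral_mono) (auto simp: m_def max_def add_increasing add_increasing2)
  also have "\<dots> = modg F1 + modg F2" unfolding modg_def by (intro nn_integral_add) measurable
  also have "\<dots> \<le> 1 + 1" using assms by (intro add_mono)
  finally have "modg m \<le> ennreal 2" by simp
  then have "modg (\<lambda>x. ennreal (1 / 2) * m x) \<le> 1" by (intro modg_scale_le_1) auto
  then have 1: "modg (\<lambda>x. ennreal (1 / 2) * m x) \<le> 1" .
  have 2: "ennreal (1/4) * (F1 x + F2 x) \<le> ennreal (1/2) * m x" for x
  proof -
    have "F1 x + F2 x \<le> ennreal 2 * m x"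
      by (auto simp: m_def mult_2 intro!: add_mono)
    then have "ennreal (1/4) * (F1 x + F2 x) \<le> ennreal (1/4) * (ennreal 2 * m x)" by (intro mult_left_mono) auto
    also have "\<dots> = ennreal (1/2) * m x" by (simp add: mult.assoc[symmetric] ennreal_mult[symmetric] del: ennreal_numeral)
    finally show ?thesis .
  qed
  show ?thesis by (rule order_trans[OF modg_mono 1]) (rule 2)
qed

lemma modg_finite_AE:
  assumes [measurable]: "F \<in> borel_measurable borel" and "modg F \<le> 1"
  shows "AE x in lborel. F x < \<infinity>"
proof -
  have "AE x in lborel. phi (g x) (F x) \<noteq> \<infinity>"
    using assms(2) unfolding modg_def by (intro nn_integral_noteq_infinite) (auto simp: top_unique)
  then show ?thesis by eventually_elim (metis less_top phi_infty(1) infinity_ennreal_def)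
qed

lemma modg_SUP:
  assumes [measurable]: "\<And>n. F n \<in> borel_measurable borel" and inc: "incseq F" and "\<And>n. modg (F n) \<le> 1"
  shows "modg (\<lambda>x. SUP n. F n x) \<le> 1"
proof -
  have "modg (\<lambda>x. SUP n. F n x) \<le> (\<integral>\<^sup>+x. (SUP n. phi (g x) (F n x)) \<partial>lborel)"
    unfolding modg_def by (intro nn_integral_mono phi_SUP_le g_nonneg)
  also have "\<dots> = (SUP n. modg (F n))"
    unfolding modg_def using inc
    by (intro nn_integral_monotone_convergence_SUP) (auto simp: incseq_def le_fun_def intro!: phi_mono g_nonneg)
  also have "\<dots> \<le> 1" using assms by (intro SUP_least) auto
  finally show ?thesis .
qed

text \<open>Scaling down from 2^(k+n) to 2^k puts the modular of 2^k F below every 2^(-n). A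
  vanishing modular density means F = 0 where q is finite, but only 2^k F \<le> 1 where q is
  infinite; there all k are used.\<close>

lemma modg_zero_AE:
  assumes [measurable]: "F \<in> borel_measurable borel" and le: "\<And>n::nat. modg (\<lambda>x. ennreal (2 ^ n) * F x) \<le> 1"
  shows "AE x in lborel. F x = 0"
proof -
  have "modg (\<lambda>x. ennreal (2 ^ k) * F x) = 0" for k
  proof (rule ccontr)
    assume "\<not> ?thesis"
    then have pos: "0 < modg (\<lambda>x. ennreal (2 ^ k) * F x)" by (simp add: zero_less_iff_neq_zero)
    have ub: "modg (\<lambda>x. ennreal (2 ^ k) * F x) \<le> ennreal ((1/2) ^ n)" for n
    proof -
      have "modg (\<lambda>x. ennreal (1 / 2 ^ n) * (ennreal (2 ^ (k + n)) * F x)) \<le> ennreal (1 / 2 ^ n) * modg (\<lambda>x. ennreal (2 ^ (k + n)) * F x)"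
        by (intro modg_scale) auto
      also have "\<dots> \<le> ennreal (1 / 2 ^ n) * 1" using le by (intro mult_left_mono) auto
      also have "(\<lambda>x. ennreal (1 / 2 ^ n) * (ennreal (2 ^ (k + n)) * F x)) = (\<lambda>x. ennreal (2 ^ k) * F x)"
      proof -
        have "ennreal (1 / 2 ^ n) * ennreal (2 ^ (k + n)) = ennreal (1 / 2 ^ n * 2 ^ (k + n))"
          by (rule ennreal_mult[symmetric]) auto
        also have "1 / 2 ^ n * 2 ^ (k + n) = (2 ^ k :: real)" by (simp add: power_add)
        finally show ?thesis by (simp only: mult.assoc[symmetric])
      qed
      finally show ?thesis by (simp only: mult_1_right power_one_over)
    qed
    obtain r where r: "0 < r" "modg (\<lambda>x. ennreal (2 ^ k) * F x) = ennreal r"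
      using pos le[of k] by (cases "modg (\<lambda>x. ennreal (2 ^ k) * F x)") (auto simp: top_unique)
    obtain n where "(1/2) ^ n < r" using real_arch_pow_inv[of r "1/2"] r by auto
    then show False using ub[of n] r by simp
  qed
  then have "AE x in lborel. phi (g x) (ennreal (2 ^ k) * F x) = 0" for k
    unfolding modg_def by (subst (asm) nn_integral_0_iff_AE) auto
  then have "AE x in lborel. \<forall>k. phi (g x) (ennreal (2 ^ k) * F x) = 0"
    by (simp add: AE_all_countable)
  then show ?thesis
  proof eventually_elim
    case (elim x)
    show ?case
    proof (cases "g x = 0")
      case False
      then have "0 < g x" using g_nonneg[of x] by simp
      then show ?thesis using elim[rule_format, of 0] by (simp add: phi_eq_0_iff)
    next
      case True
      then have le1: "ennreal (2 ^ k) * F x \<le> 1" for k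
        using elim[rule_format, of k] by (auto simp: phi_zero_exponent split: if_splits)
      then obtain r where r: "0 \<le> r" "F x = ennreal r" using le1[of 0] by (cases "F x") (auto simp: top_unique)
      have "r \<le> (1/2) ^ k" for k
        using le1[of k] r by (simp add: ennreal_mult[symmetric] field_simps power_one_over del: ennreal_power)
      have "\<not> 0 < r"
      proof
        assume "0 < r"
        then obtain n where "(1/2) ^ n < r" using real_arch_pow_inv[of r "1/2"] by auto
        then show False using \<open>r \<le> (1/2) ^ n\<close> by simp
      qed
      then show ?thesis using r by simp
    qed
  qed
qed

end

section \<open>Bounds for the mild formulation\<close>

lemma nn_integral_singular_time:
  assumes "0 \<le> \<theta>" "\<theta> < 1" "0 \<le> t"
  shows "(\<integral>\<^sup>+s. indicator {0<..<t} s * ennreal ((t - s) powr - \<theta>) \<partial>lborel) \<le> ennreal (t powr (1 - \<theta>) / (1 - \<theta>))"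
proof -
  have "((\<lambda>x. x powr - \<theta>) has_integral (t powr (- \<theta> + 1) / (- \<theta> + 1))) {0..t}"
    using assms by (intro has_integral_powr_from_0) auto
  from nn_integral_has_integral_lebesgue'[OF _ this]
  have 1: "(\<integral>\<^sup>+s. ennreal (s powr - \<theta>) * indicator {0..t} s \<partial>lborel) = ennreal (t powr (1 - \<theta>) / (1 - \<theta>))"
    by simp
  have "(\<integral>\<^sup>+s. indicator {0<..<t} s * ennreal ((t - s) powr - \<theta>) \<partial>lborel)
      \<le> (\<integral>\<^sup>+s. ennreal ((t - s) powr - \<theta>) * indicator {0..t} (t - s) \<partial>lborel)"
    by (intro nn_integral_mono) (auto split: split_indicator)
  also have "\<dots> = (\<integral>\<^sup>+s. ennreal (s powr - \<theta>) * indicator {0..t} s \<partial>lborel)"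
    by (rule nn_integral_lborel_reflect) measurable
  finally show ?thesis using 1 by simp
qed

lemma measurable_section_snd:
  assumes "(\<lambda>z. U (fst z) (snd z)) \<in> borel_measurable (M \<Otimes>\<^sub>M N)" "s \<in> space M"
  shows "U s \<in> borel_measurable N"
  using measurable_compose[OF measurable_Pair1'[OF assms(2)] assms(1)] by simp

text \<open>The kernel bounds enter as assumptions, with one constant fixed for the whole
  construction; \<open>theta_less\<close> expresses that the singularity of the bilinear kernel is
  integrable in time.\<close>

locale fns_kernel = reciprocal_exponent +
  fixes \<alpha> \<rho> CK :: real
  assumes alpha: "1/2 < \<alpha>" and rho: "3 + 3 * a < \<rho>" "\<rho> < 4"
    and theta_less: "1 + 3 * (2 * a - b) < 2 * \<alpha>"
    and CK_pos: "0 < CK"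
    and heat_le: "\<And>t x. 0 < t \<Longrightarrow> \<bar>heat_kernel \<alpha> t x\<bar> \<le> CK * bump \<rho> (t powr (1 / (2 * \<alpha>))) x"
    and oseen_le: "\<And>t x j h k. 0 < t \<Longrightarrow>
      \<bar>oseen_kernel \<alpha> t j h k x\<bar> \<le> CK * (bump \<rho> (t powr (1 / (2 * \<alpha>))) x / t powr (1 / (2 * \<alpha>)))"
begin

definition \<theta> :: real where "\<theta> = (1 + 3 * (2 * a - b)) / (2 * \<alpha>)"

lemma theta: "0 < \<theta>" "\<theta> < 1"
proof -
  have "b \<le> a" using b_le_g[of 0] g_le_a[of 0] by simp
  then show "0 < \<theta>" "\<theta> < 1" using alpha theta_less a_nonneg by (auto simp: \<theta>_def)
qed

lemma rho_gt_3: "3 < \<rho>" using rho a_nonneg by simp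

section \<open>Majorant operators with positive kernels\<close>

definition heat_scale :: "real \<Rightarrow> real" where "heat_scale t = t powr (1 / (2 * \<alpha>))"

lemma heat_scale_measurable [measurable]: "heat_scale \<in> borel_measurable borel" unfolding heat_scale_def[abs_def] by measurable

lemma heat_scale: "0 < t \<Longrightarrow> 0 < heat_scale t" "0 < t \<Longrightarrow> t \<le> 1 \<Longrightarrow> heat_scale t \<le> 1"
  using alpha by (auto simp: heat_scale_def powr_le1)

definition heat_maj :: "real \<Rightarrow> real^3 \<Rightarrow> ennreal" where
  "heat_maj t z = ennreal (CK * bump \<rho> (heat_scale t) z)"

text \<open>27 = 3 * 9: the norm is estimated by the sum over the components j, each of which is a
  sum over nine pairs h, k.\<close>

definition oseen_maj :: "real \<Rightarrow> real^3 \<Rightarrow> ennreal" where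
  "oseen_maj t z = ennreal (27 * CK * (bump \<rho> (heat_scale t) z / heat_scale t))"

lemma maj_measurable [measurable (raw)]:
  assumes [measurable]: "t \<in> borel_measurable M" "z \<in> borel_measurable M"
  shows "(\<lambda>x. heat_maj (t x) (z x)) \<in> borel_measurable M" "(\<lambda>x. oseen_maj (t x) (z x)) \<in> borel_measurable M"
  unfolding heat_maj_def oseen_maj_def by measurable

definition Heat0 :: "(real^3 \<Rightarrow> ennreal) \<Rightarrow> real \<Rightarrow> real^3 \<Rightarrow> ennreal" where
  "Heat0 F t x = (\<integral>\<^sup>+y. heat_maj t (x - y) * F y \<partial>lborel)"

definition Duhamel :: "(real \<Rightarrow> real^3 \<Rightarrow> ennreal) \<Rightarrow> real \<Rightarrow> real^3 \<Rightarrow> ennreal" where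
  "Duhamel F t x = (\<integral>\<^sup>+s. indicator {0<..<t} s * Heat0 (F s) (t - s) x \<partial>lborel)"

definition Bil :: "(real \<Rightarrow> real^3 \<Rightarrow> ennreal) \<Rightarrow> (real \<Rightarrow> real^3 \<Rightarrow> ennreal) \<Rightarrow> real \<Rightarrow> real^3 \<Rightarrow> ennreal" where
  "Bil U V t x = (\<integral>\<^sup>+s. indicator {0<..<t} s * (\<integral>\<^sup>+y. oseen_maj (t - s) (x - y) * (U s y * V s y) \<partial>lborel) \<partial>lborel)"

lemma Heat0_measurable [measurable (raw)]:
  assumes [measurable]: "(\<lambda>z. F (fst z) (snd z)) \<in> borel_measurable (M \<Otimes>\<^sub>M borel)"
    "t \<in> borel_measurable M" "x \<in> borel_measurable M"
  shows "(\<lambda>z. Heat0 (F z) (t z) (x z)) \<in> borel_measurable M"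
proof -
  have [measurable]: "(\<lambda>z. F (fst z) (snd z)) \<in> borel_measurable (M \<Otimes>\<^sub>M lborel)"
    using assms(1) by (simp cong: measurable_cong_sets sets_pair_measure_cong)
  show ?thesis unfolding Heat0_def by measurable
qed

lemma indicator_open_interval_measurable [measurable (raw)]:
  fixes s t :: "'a \<Rightarrow> real"
  assumes [measurable]: "s \<in> borel_measurable M" "t \<in> borel_measurable M"
  shows "(\<lambda>z. indicator {0<..<t z} (s z) :: ennreal) \<in> borel_measurable M"
    "(\<lambda>z. indicator {0<..<t z} (s z) :: real) \<in> borel_measurable M"
  unfolding indicator_def greaterThanLessThan_iff by measurable

lemma Duhamel_measurable [measurable (raw)]:
  assumes F [measurable]: "(\<lambda>z. F (fst z) (snd z)) \<in> borel_measurable (borel \<Otimes>\<^sub>M borel)"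
    and [measurable]: "t \<in> borel_measurable M" "x \<in> borel_measurable M"
  shows "(\<lambda>z. Duhamel F (t z) (x z)) \<in> borel_measurable M"
proof -
  have [measurable]: "(\<lambda>p. F (snd (fst p)) (snd p)) \<in> borel_measurable ((M \<Otimes>\<^sub>M lborel) \<Otimes>\<^sub>M borel)"
    using measurable_compose[OF _ F, of "\<lambda>p. (snd (fst p), snd p)" "(M \<Otimes>\<^sub>M lborel) \<Otimes>\<^sub>M borel"] by simp
  show ?thesis unfolding Duhamel_def by measurable
qed

lemma Bil_measurable [measurable (raw)]:
  assumes U: "(\<lambda>z. U (fst z) (snd z)) \<in> borel_measurable (borel \<Otimes>\<^sub>M borel)"
    and V: "(\<lambda>z. V (fst z) (snd z)) \<in> borel_measurable (borel \<Otimes>\<^sub>M borel)"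
    and [measurable]: "t \<in> borel_measurable M" "x \<in> borel_measurable M"
  shows "(\<lambda>z. Bil U V (t z) (x z)) \<in> borel_measurable M"
proof -
  have [measurable]: "(\<lambda>p. U (snd (fst p)) (snd p)) \<in> borel_measurable ((M \<Otimes>\<^sub>M lborel) \<Otimes>\<^sub>M lborel)"
    "(\<lambda>p. V (snd (fst p)) (snd p)) \<in> borel_measurable ((M \<Otimes>\<^sub>M lborel) \<Otimes>\<^sub>M lborel)"
    using measurable_compose[OF _ U, of "\<lambda>p. (snd (fst p), snd p)" "(M \<Otimes>\<^sub>M lborel) \<Otimes>\<^sub>M lborel"]
      measurable_compose[OF _ V, of "\<lambda>p. (snd (fst p), snd p)" "(M \<Otimes>\<^sub>M lborel) \<Otimes>\<^sub>M lborel"] by simp_all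
  show ?thesis unfolding Bil_def by measurable
qed

lemma Bil_mono:
  assumes "\<And>s y. 0 < s \<Longrightarrow> s < t \<Longrightarrow> U s y \<le> U' s y" "\<And>s y. 0 < s \<Longrightarrow> s < t \<Longrightarrow> V s y \<le> V' s y"
  shows "Bil U V t x \<le> Bil U' V' t x"
  unfolding Bil_def using assms
  by (intro nn_integral_mono) (auto split: split_indicator intro!: nn_integral_mono mult_mono)

lemma heat_bound:
  "\<exists>CL>0. \<forall>t F. 0 < t \<longrightarrow> t \<le> 1 \<longrightarrow> F \<in> borel_measurable borel \<longrightarrow> modg F \<le> 1 \<longrightarrow>
    modg (\<lambda>x. ennreal (1 / CL) * Heat0 F t x) \<le> 1"
proof -
  obtain \<beta> where \<beta>: "0 < \<beta>" "\<And>\<delta> F. 0 < \<delta> \<Longrightarrow> \<delta> \<le> 1 \<Longrightarrow> F \<in> borel_measurable borel \<Longrightarrow> modg F \<le> 1 \<Longrightarrow>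
    modg (\<lambda>x. ennreal \<beta> * (\<integral>\<^sup>+y. ennreal (bump \<rho> \<delta> (x - y)) * F y \<partial>lborel)) \<le> 1"
    using heat_modular[OF rho(1)] by auto
  show ?thesis
  proof (intro exI[of _ "CK / \<beta>"] conjI allI impI)
    show "0 < CK / \<beta>" using CK_pos \<beta> by simp
    fix t F assume t: "0 < t" "t \<le> (1::real)" and F [measurable]: "F \<in> borel_measurable borel" and F1: "modg F \<le> 1"
    have "ennreal (1 / (CK / \<beta>)) * Heat0 F t x = ennreal \<beta> * (\<integral>\<^sup>+y. ennreal (bump \<rho> (heat_scale t) (x - y)) * F y \<partial>lborel)" for x
    proof -
      have "Heat0 F t x = (\<integral>\<^sup>+y. ennreal CK * (ennreal (bump \<rho> (heat_scale t) (x - y)) * F y) \<partial>lborel)"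
        unfolding Heat0_def heat_maj_def using CK_pos by (simp add: ennreal_mult mult.assoc)
      also have "\<dots> = ennreal CK * (\<integral>\<^sup>+y. ennreal (bump \<rho> (heat_scale t) (x - y)) * F y \<partial>lborel)"
        by (rule nn_integral_cmult) measurable
      finally show ?thesis using CK_pos \<beta>(1) by (simp add: mult.assoc[symmetric] ennreal_mult[symmetric])
    qed
    then show "modg (\<lambda>x. ennreal (1 / (CK / \<beta>)) * Heat0 F t x) \<le> 1"
      using \<beta>(2)[OF heat_scale(1)[OF t(1)] heat_scale(2)[OF t] F F1] by simp
  qed
qed

lemma Heat0_cmult:
  assumes [measurable]: "F \<in> borel_measurable borel"
  shows "Heat0 (\<lambda>y. k * F y) t x = k * Heat0 F t x"
proof -
  have "Heat0 (\<lambda>y. k * F y) t x = (\<integral>\<^sup>+y. k * (heat_maj t (x - y) * F y) \<partial>lborel)"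
    unfolding Heat0_def by (simp add: mult_ac)
  also have "\<dots> = k * Heat0 F t x" unfolding Heat0_def by (rule nn_integral_cmult) measurable
  finally show ?thesis .
qed

lemma modg_reciprocal_mono:
  assumes "0 < R" "R \<le> R'" "modg (\<lambda>x. ennreal (1 / R) * F x) \<le> 1"
  shows "modg (\<lambda>x. ennreal (1 / R') * F x) \<le> 1"
  using assms(3) by (rule order_trans[rotated])
     (use assms(1,2) in \<open>intro modg_mono mult_right_mono ennreal_leI, auto simp: frac_le\<close>)

text \<open>\<open>\<phi>\<close> is a positive integrable bound for the norm of f in time: division
  by it puts f(s) into the unit ball, and \<open>modg_integral\<close> is applied with a weight
  proportional to it.\<close>

lemma linear_bound:
  assumes u0 [measurable]: "u0 \<in> borel_measurable borel" and m0: "0 < m0" "modg (\<lambda>y. ennreal (1 / m0) * u0 y) \<le> 1"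
    and f [measurable]: "(\<lambda>z. f (fst z) (snd z)) \<in> borel_measurable (borel \<Otimes>\<^sub>M borel)"
    and \<phi> [measurable]: "\<phi> \<in> borel_measurable borel" and \<phi>0: "\<And>s. 0 < \<phi> s"
    and f1: "AE s in lborel. 0 < s \<and> s < 1 \<longrightarrow> modg (\<lambda>y. ennreal (1 / \<phi> s) * f s y) \<le> 1"
    and M: "(\<integral>\<^sup>+s. indicator {0<..<1} s * ennreal (\<phi> s) \<partial>lborel) < \<infinity>"
  shows "\<exists>R>0. \<forall>t. 0 < t \<longrightarrow> t < 1 \<longrightarrow> modg (\<lambda>x. ennreal (1 / R) * (Heat0 u0 t x + Duhamel f t x)) \<le> 1"
proof -
  obtain CL where CL: "0 < CL" "\<And>t F. 0 < t \<Longrightarrow> t \<le> 1 \<Longrightarrow> F \<in> borel_measurable borel \<Longrightarrow> modg F \<le> 1 \<Longrightarrow>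
    modg (\<lambda>x. ennreal (1 / CL) * Heat0 F t x) \<le> 1"
    using heat_bound by auto
  obtain M' where M': "0 \<le> M'" "(\<integral>\<^sup>+s. indicator {0<..<1} s * ennreal (\<phi> s) \<partial>lborel) = ennreal M'"
    using M by (cases "\<integral>\<^sup>+s. indicator {0<..<1} s * ennreal (\<phi> s) \<partial>lborel") auto
  have [measurable]: "f s \<in> borel_measurable borel" for s
    using measurable_section_snd[OF f] by simp
  \<comment> \<open>The summand 1 keeps the weight bound CL * M' + 1 positive even when M' = 0; the
    final 4 * R1 absorbs the factor of \<open>modg_add\<close>.\<close>
  define R1 where "R1 = CL * m0 + CL * M' + 1"
  have R1: "0 < R1" "CL * m0 \<le> R1" "CL * M' + 1 \<le> R1" using CL m0 M' by (auto simp: R1_def intro!: add_nonneg_pos)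
  have "modg (\<lambda>x. ennreal (1 / (4 * R1)) * (Heat0 u0 t x + Duhamel f t x)) \<le> 1" if t: "0 < t" "t < 1" for t
  proof -
    have A: "modg (\<lambda>x. ennreal (1 / R1) * Heat0 u0 t x) \<le> 1"
    proof (rule modg_reciprocal_mono[OF _ R1(2)])
      have "modg (\<lambda>x. ennreal (1 / CL) * Heat0 (\<lambda>y. ennreal (1 / m0) * u0 y) t x) \<le> 1"
        using t m0 by (intro CL) auto
      then show "modg (\<lambda>x. ennreal (1 / (CL * m0)) * Heat0 u0 t x) \<le> 1"
        using CL m0 by (simp add: Heat0_cmult mult.assoc[symmetric] ennreal_mult[symmetric])
    qed (use CL m0 in auto)
    have B: "modg (\<lambda>x. ennreal (1 / R1) * Duhamel f t x) \<le> 1"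
    proof (rule modg_reciprocal_mono[OF _ R1(3)])
      define W where "W s x = ennreal (1 / CL) * Heat0 (\<lambda>y. ennreal (1 / \<phi> s) * f s y) (t - s) x" for s x
      define w where "w s = indicator {0<..<t} s * ennreal (CL * \<phi> s)" for s
      have "modg (\<lambda>x. ennreal (1 / (CL * M' + 1)) * (\<integral>\<^sup>+s. w s * W s x \<partial>lborel)) \<le> 1"
      proof (rule modg_integral)
        show "w \<in> borel_measurable borel" unfolding w_def[abs_def] by measurable
        have [measurable]: "(\<lambda>p. f (fst (fst p)) (snd p)) \<in> borel_measurable ((borel \<Otimes>\<^sub>M borel) \<Otimes>\<^sub>M borel)"
          using measurable_compose[OF _ f, of "\<lambda>p. (fst (fst p), snd p)" "(borel \<Otimes>\<^sub>M borel) \<Otimes>\<^sub>M borel"] by simp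
        show "(\<lambda>z. W (fst z) (snd z)) \<in> borel_measurable (borel \<Otimes>\<^sub>M borel)" unfolding W_def by measurable
        show "AE s in lborel. w s \<noteq> 0 \<longrightarrow> modg (W s) \<le> 1"
          using f1
        proof eventually_elim
          case (elim s)
          show ?case
          proof
            assume "w s \<noteq> 0"
            then have s: "0 < s" "s < t" by (auto simp: w_def split: split_indicator_asm)
            show "modg (W s) \<le> 1" unfolding W_def using s t elim by (intro CL) auto
          qed
        qed
        have "(\<integral>\<^sup>+s. w s \<partial>lborel) \<le> (\<integral>\<^sup>+s. ennreal CL * (indicator {0<..<1} s * ennreal (\<phi> s)) \<partial>lborel)"
          using t CL \<phi>0 by (intro nn_integral_mono) (auto simp: w_def ennreal_mult less_imp_le split: split_indicator)
        also have "\<dots> = ennreal CL * ennreal M'" unfolding M'(2)[symmetric] by (rule nn_integral_cmult) measurable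
        also have "\<dots> \<le> ennreal (CL * M' + 1)" using CL M' by (simp add: ennreal_mult[symmetric] ennreal_leI del: ennreal_plus)
        finally show "(\<integral>\<^sup>+s. w s \<partial>lborel) \<le> ennreal (CL * M' + 1)" .
        show "0 < CL * M' + 1" using CL M' by (intro add_nonneg_pos) auto
      qed
      moreover have "(\<integral>\<^sup>+s. w s * W s x \<partial>lborel) = Duhamel f t x" for x
        unfolding Duhamel_def
      proof (intro nn_integral_cong)
        fix s
        have "ennreal (CL * \<phi> s) * (ennreal (1 / CL) * ennreal (1 / \<phi> s)) = 1"
          using CL \<phi>0[of s] by (simp add: ennreal_mult[symmetric])
        then show "w s * W s x = indicator {0<..<t} s * Heat0 (f s) (t - s) x"
          by (simp add: w_def W_def Heat0_cmult mult.assoc[symmetric]) (simp add: mult.assoc)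
      qed
      ultimately show "modg (\<lambda>x. ennreal (1 / (CL * M' + 1)) * Duhamel f t x) \<le> 1" by simp
    qed (use CL M' in \<open>auto intro!: add_nonneg_pos\<close>)
    have "modg (\<lambda>x. ennreal (1/4) * (ennreal (1 / R1) * Heat0 u0 t x + ennreal (1 / R1) * Duhamel f t x)) \<le> 1"
      using A B by (intro modg_add) auto
    moreover have "ennreal (1/4) * (ennreal (1 / R1) * Heat0 u0 t x + ennreal (1 / R1) * Duhamel f t x)
        = ennreal (1 / (4 * R1)) * (Heat0 u0 t x + Duhamel f t x)" for x
      using R1 by (simp add: distrib_left mult.assoc[symmetric] ennreal_mult[symmetric])
    ultimately show ?thesis by simp
  qed
  then show ?thesis using R1 by (intro exI[of _ "4 * R1"]) auto
qed

text \<open>Fixed by choice once and for all, so that the resulting constant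
  \<open>bil_const\<close> can appear in the assumptions of later lemmas on time integrals.\<close>

definition bil_beta :: real where
  "bil_beta = (SOME \<beta>. 0 < \<beta> \<and> (\<forall>\<delta> F1 F2. 0 < \<delta> \<longrightarrow> \<delta> \<le> 1 \<longrightarrow> F1 \<in> borel_measurable borel \<longrightarrow> F2 \<in> borel_measurable borel \<longrightarrow>
    modg F1 \<le> 1 \<longrightarrow> modg F2 \<le> 1 \<longrightarrow>
    modg (\<lambda>x. ennreal (\<beta> * \<delta> powr (3 * (2 * a - b))) * (\<integral>\<^sup>+y. ennreal (bump \<rho> \<delta> (x - y)) * (F1 y * F2 y) \<partial>lborel)) \<le> 1))"

lemma bil_beta:
  "0 < bil_beta"
  "\<And>\<delta> F1 F2. 0 < \<delta> \<Longrightarrow> \<delta> \<le> 1 \<Longrightarrow> F1 \<in> borel_measurable borel \<Longrightarrow> F2 \<in> borel_measurable borel \<Longrightarrow>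
    modg F1 \<le> 1 \<Longrightarrow> modg F2 \<le> 1 \<Longrightarrow>
    modg (\<lambda>x. ennreal (bil_beta * \<delta> powr (3 * (2 * a - b))) * (\<integral>\<^sup>+y. ennreal (bump \<rho> \<delta> (x - y)) * (F1 y * F2 y) \<partial>lborel)) \<le> 1"
  using someI_ex[OF bilinear_modular[OF rho_gt_3], folded bil_beta_def] by auto

definition bil_const :: real where "bil_const = 27 * CK / bil_beta"

lemma bil_const: "0 < bil_const"
  using bil_beta(1) CK_pos by (simp add: bil_const_def)

text \<open>\<open>u\<close> and \<open>v\<close> bound the norms of the factors at each time. As
  arbitrary functions they serve three purposes: constants for existence, a norm integrable to a
  power for boundedness, exponential weights for uniqueness. The singularity goes into the weight of
  \<open>modg_integral\<close>, since (t - s)^(-\<theta>) \<delta>^(3 (2a - b)) = 1/\<delta> at the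
  scale \<delta> of t - s.\<close>

lemma bil_bound:
  assumes t: "0 < t" "t \<le> 1" and M: "0 < M"
    and U [measurable]: "(\<lambda>z. U (fst z) (snd z)) \<in> borel_measurable (borel \<Otimes>\<^sub>M borel)"
    and V [measurable]: "(\<lambda>z. V (fst z) (snd z)) \<in> borel_measurable (borel \<Otimes>\<^sub>M borel)"
    and u_meas [measurable]: "u \<in> borel_measurable borel" and v_meas [measurable]: "v \<in> borel_measurable borel"
    and u0: "\<And>s. 0 < u s" and v0: "\<And>s. 0 < v s"
    and U1: "AE s in lborel. 0 < s \<and> s < t \<longrightarrow> modg (\<lambda>y. ennreal (1 / u s) * U s y) \<le> 1"
    and V1: "AE s in lborel. 0 < s \<and> s < t \<longrightarrow> modg (\<lambda>y. ennreal (1 / v s) * V s y) \<le> 1"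
    and mass: "(\<integral>\<^sup>+s. indicator {0<..<t} s * ennreal (bil_const * (t - s) powr - \<theta> * (u s * v s)) \<partial>lborel) \<le> ennreal M"
  shows "modg (\<lambda>x. ennreal (1 / M) * Bil U V t x) \<le> 1"
proof -
  have [measurable]: "U s \<in> borel_measurable borel" "V s \<in> borel_measurable borel" for s
    using measurable_section_snd[OF U] measurable_section_snd[OF V] by simp_all
  define w where "w s = indicator {0<..<t} s * ennreal (bil_const * (t - s) powr - \<theta> * (u s * v s))" for s
  define W where "W s x = ennreal (bil_beta * heat_scale (t - s) powr (3 * (2 * a - b))) *
    (\<integral>\<^sup>+y. ennreal (bump \<rho> (heat_scale (t - s)) (x - y)) * ((ennreal (1 / u s) * U s y) * (ennreal (1 / v s) * V s y)) \<partial>lborel)" for s x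
  have "modg (\<lambda>x. ennreal (1 / M) * (\<integral>\<^sup>+s. w s * W s x \<partial>lborel)) \<le> 1"
  proof (rule modg_integral)
    show "w \<in> borel_measurable borel" unfolding w_def[abs_def] by measurable
    have [measurable]: "(\<lambda>p. U (fst (fst p)) (snd p)) \<in> borel_measurable ((borel \<Otimes>\<^sub>M borel) \<Otimes>\<^sub>M lborel)"
      "(\<lambda>p. V (fst (fst p)) (snd p)) \<in> borel_measurable ((borel \<Otimes>\<^sub>M borel) \<Otimes>\<^sub>M lborel)"
      using measurable_compose[OF _ U, of "\<lambda>p. (fst (fst p), snd p)" "(borel \<Otimes>\<^sub>M borel) \<Otimes>\<^sub>M lborel"]
        measurable_compose[OF _ V, of "\<lambda>p. (fst (fst p), snd p)" "(borel \<Otimes>\<^sub>M borel) \<Otimes>\<^sub>M lborel"] by simp_all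
    show "(\<lambda>z. W (fst z) (snd z)) \<in> borel_measurable (borel \<Otimes>\<^sub>M borel)" unfolding W_def by measurable
    show "AE s in lborel. w s \<noteq> 0 \<longrightarrow> modg (W s) \<le> 1"
      using U1 V1
    proof eventually_elim
      case (elim s)
      show ?case
      proof
        assume "w s \<noteq> 0"
        then have s: "0 < s" "s < t" by (auto simp: w_def split: split_indicator_asm)
        show "modg (W s) \<le> 1" unfolding W_def using s t elim heat_scale[of "t - s"] by (intro bil_beta(2)) auto
      qed
    qed
    show "(\<integral>\<^sup>+s. w s \<partial>lborel) \<le> ennreal M" using mass by (simp add: w_def)
  qed (rule M)
  moreover have "(\<integral>\<^sup>+s. w s * W s x \<partial>lborel) = Bil U V t x" for x
    unfolding Bil_def
  proof (intro nn_integral_cong)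
    fix s
    show "w s * W s x = indicator {0<..<t} s * (\<integral>\<^sup>+y. oseen_maj (t - s) (x - y) * (U s y * V s y) \<partial>lborel)"
    proof (cases "0 < s \<and> s < t")
      case True
      define \<delta> where "\<delta> = heat_scale (t - s)"
      have \<delta>: "0 < \<delta>" using True by (simp add: \<delta>_def heat_scale)
      have us: "0 < u s" "0 < v s" using u0 v0 by auto
      have "(t - s) powr - \<theta> = \<delta> powr - (1 + 3 * (2 * a - b))"
        unfolding \<delta>_def heat_scale_def powr_powr \<theta>_def by (simp only: mult_minus_right times_divide_eq_left mult_1)
      then have pw: "(t - s) powr - \<theta> * \<delta> powr (3 * (2 * a - b)) = 1 / \<delta>"
        using \<delta> by (simp add: powr_add[symmetric] powr_minus_divide)
      have W: "W s x = ennreal (bil_beta * \<delta> powr (3 * (2 * a - b)) * (1 / u s * (1 / v s))) *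
          (\<integral>\<^sup>+y. ennreal (bump \<rho> \<delta> (x - y)) * (U s y * V s y) \<partial>lborel)"
      proof -
        have "(\<integral>\<^sup>+y. ennreal (bump \<rho> \<delta> (x - y)) * ((ennreal (1 / u s) * U s y) * (ennreal (1 / v s) * V s y)) \<partial>lborel)
          = (\<integral>\<^sup>+y. ennreal (1 / u s * (1 / v s)) * (ennreal (bump \<rho> \<delta> (x - y)) * (U s y * V s y)) \<partial>lborel)"
          using us by (subst ennreal_mult) (auto simp: mult_ac)
        also have "\<dots> = ennreal (1 / u s * (1 / v s)) * (\<integral>\<^sup>+y. ennreal (bump \<rho> \<delta> (x - y)) * (U s y * V s y) \<partial>lborel)"
          by (rule nn_integral_cmult) measurable
        finally show ?thesis unfolding W_def \<delta>_def[symmetric] using us bil_beta(1) \<delta>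
          by (simp add: mult.assoc[symmetric] ennreal_mult[symmetric])
      qed
      have O: "(\<integral>\<^sup>+y. oseen_maj (t - s) (x - y) * (U s y * V s y) \<partial>lborel)
         = ennreal (27 * CK * (1 / \<delta>)) * (\<integral>\<^sup>+y. ennreal (bump \<rho> \<delta> (x - y)) * (U s y * V s y) \<partial>lborel)"
      proof -
        have "oseen_maj (t - s) (x - y) = ennreal (27 * CK * (1 / \<delta>)) * ennreal (bump \<rho> \<delta> (x - y))" for y
          using CK_pos \<delta> by (simp add: oseen_maj_def \<delta>_def[symmetric] ennreal_mult[symmetric])
        then have "(\<integral>\<^sup>+y. oseen_maj (t - s) (x - y) * (U s y * V s y) \<partial>lborel)
           = (\<integral>\<^sup>+y. ennreal (27 * CK * (1 / \<delta>)) * (ennreal (bump \<rho> \<delta> (x - y)) * (U s y * V s y)) \<partial>lborel)"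
          by (simp add: mult.assoc)
        also have "\<dots> = ennreal (27 * CK * (1 / \<delta>)) * (\<integral>\<^sup>+y. ennreal (bump \<rho> \<delta> (x - y)) * (U s y * V s y) \<partial>lborel)"
          by (rule nn_integral_cmult) measurable
        finally show ?thesis .
      qed
      have "bil_const * (t - s) powr - \<theta> * (u s * v s) * (bil_beta * \<delta> powr (3 * (2 * a - b)) * (1 / u s * (1 / v s)))
        = bil_const * bil_beta * ((t - s) powr - \<theta> * \<delta> powr (3 * (2 * a - b)))"
        using us by (simp add: field_simps)
      also have "\<dots> = 27 * CK * (1 / \<delta>)" unfolding pw using bil_beta(1) by (simp add: bil_const_def)
      finally have k: "ennreal (bil_const * (t - s) powr - \<theta> * (u s * v s)) * ennreal (bil_beta * \<delta> powr (3 * (2 * a - b)) * (1 / u s * (1 / v s)))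
        = ennreal (27 * CK * (1 / \<delta>))"
        using us bil_const bil_beta(1) by (subst ennreal_mult[symmetric]) auto
      show ?thesis unfolding O W k[symmetric] using True by (simp add: w_def mult.assoc)
    qed (auto simp: w_def)
  qed
  ultimately show "modg (\<lambda>x. ennreal (1 / M) * Bil U V t x) \<le> 1" by simp
qed

end

section \<open>Vector-valued operators and their domination\<close>

lemma ennreal_norm_integral_le:
  fixes f :: "'a \<Rightarrow> 'b::{banach, second_countable_topology}"
  shows "ennreal (norm (\<integral>x. f x \<partial>M)) \<le> (\<integral>\<^sup>+x. ennreal (norm (f x)) \<partial>M)"
proof (cases "integrable M f")
  case True
  then show ?thesis by (rule integral_norm_bound_ennreal)
qed (simp add: not_integrable_integral_eq)

lemma heat_kernel_lborel:
  "heat_kernel \<alpha> t x = Re (\<integral>\<xi>. exp (\<i> * of_real (x \<bullet> \<xi>)) * of_real (exp (- t * norm \<xi> powr (2 * \<alpha>))) \<partial>lborel) / (2 * pi) ^ 3"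
  unfolding heat_kernel_def by (rule kernel_of_symbol_lborel) measurable

lemma oseen_kernel_lborel:
  "oseen_kernel \<alpha> t j h k x = Re (\<integral>\<xi>. exp (\<i> * of_real (x \<bullet> \<xi>)) *
     (\<i> * of_real (\<xi> $ k * ((if j = h then 1 else 0) - \<xi> $ j * \<xi> $ h / (norm \<xi>)\<^sup>2)
                   * exp (- t * norm \<xi> powr (2 * \<alpha>)))) \<partial>lborel) / (2 * pi) ^ 3"
  unfolding oseen_kernel_def by (rule kernel_of_symbol_lborel) measurable

lemma borel_measurable_vec_component [measurable (raw)]:
  fixes w :: "'a \<Rightarrow> real^'n"
  assumes [measurable]: "w \<in> borel_measurable M"
  shows "(\<lambda>z. w z $ i) \<in> borel_measurable M"
proof -
  have "(\<lambda>z. w z $ i) = (\<lambda>z. w z \<bullet> axis i 1)" by (simp add: inner_axis)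
  then show ?thesis by simp
qed

lemma kernel_measurable [measurable (raw)]:
  assumes [measurable]: "t \<in> borel_measurable M" "x \<in> borel_measurable M"
  shows "(\<lambda>z. heat_kernel \<alpha> (t z) (x z)) \<in> borel_measurable M"
    "(\<lambda>z. oseen_kernel \<alpha> (t z) j h k (x z)) \<in> borel_measurable M"
  unfolding heat_kernel_lborel oseen_kernel_lborel by measurable

text \<open>All component kernels are gathered in one vector-valued integrand, so that estimates and
  limits are taken once, for the norm.\<close>

definition oseen_vec :: "real \<Rightarrow> real \<Rightarrow> real^3 \<Rightarrow> real^3 \<Rightarrow> real^3" where
  "oseen_vec \<alpha> t z w = (\<chi> j. \<Sum>h\<in>UNIV. \<Sum>k\<in>UNIV. oseen_kernel \<alpha> t j h k z * (w $ h * w $ k))"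

lemma borel_measurable_vec_lambda3:
  fixes f :: "3 \<Rightarrow> 'a \<Rightarrow> real"
  assumes "\<And>i. f i \<in> borel_measurable M"
  shows "(\<lambda>x. (\<chi> i. f i x) :: real^3) \<in> borel_measurable M"
proof -
  have "(\<lambda>x. (\<chi> i. f i x) :: real^3) = (\<lambda>x. \<Sum>i\<in>UNIV. f i x *\<^sub>R axis i 1)"
    by (auto simp: vec_eq_iff axis_def if_distrib[of "\<lambda>y. _ * y"] cong: if_cong)
  then show ?thesis using assms by simp
qed

lemma oseen_vec_measurable [measurable (raw)]:
  assumes [measurable]: "t \<in> borel_measurable M" "x \<in> borel_measurable M" "w \<in> borel_measurable M"
  shows "(\<lambda>z. oseen_vec \<alpha> (t z) (x z) (w z)) \<in> borel_measurable M"
  unfolding oseen_vec_def by (intro borel_measurable_vec_lambda3) measurable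

lemma oseen_vec_0 [simp]: "oseen_vec \<alpha> t z 0 = 0"
  by (simp add: oseen_vec_def vec_eq_iff)

lemma tendsto_oseen_vec:
  assumes "(f \<longlongrightarrow> w) F"
  shows "((\<lambda>x. oseen_vec \<alpha> t z (f x)) \<longlongrightarrow> oseen_vec \<alpha> t z w) F"
proof (rule vec_tendstoI)
  fix j
  have "((\<lambda>x. \<Sum>h\<in>UNIV. \<Sum>k\<in>UNIV. oseen_kernel \<alpha> t j h k z * (f x $ h * f x $ k)) \<longlongrightarrow>
      (\<Sum>h\<in>UNIV. \<Sum>k\<in>UNIV. oseen_kernel \<alpha> t j h k z * (w $ h * w $ k))) F"
    by (intro tendsto_sum tendsto_mult tendsto_const tendsto_vec_nth assms)
  then show "((\<lambda>x. oseen_vec \<alpha> t z (f x) $ j) \<longlongrightarrow> oseen_vec \<alpha> t z w $ j) F"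
    by (simp add: oseen_vec_def)
qed

lemma oseen_vec_diff_le:
  assumes "\<And>j h k. \<bar>oseen_kernel \<alpha> t j h k z\<bar> \<le> K"
  shows "norm (oseen_vec \<alpha> t z w - oseen_vec \<alpha> t z w') \<le> 27 * K * ((norm w + norm w') * norm (w - w'))"
proof -
  define B where "B = (norm w + norm w') * norm (w - w')"
  have prod: "\<bar>w $ h * w $ k - w' $ h * w' $ k\<bar> \<le> B" for h k
  proof -
    have "w $ h * w $ k - w' $ h * w' $ k = w $ h * (w - w') $ k + (w - w') $ h * w' $ k"
      by (simp add: algebra_simps)
    also have "\<bar>\<dots>\<bar> \<le> \<bar>w $ h\<bar> * \<bar>(w - w') $ k\<bar> + \<bar>(w - w') $ h\<bar> * \<bar>w' $ k\<bar>"
      by (metis abs_mult abs_triangle_ineq)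
    also have "\<dots> \<le> norm w * norm (w - w') + norm (w - w') * norm w'"
      by (intro add_mono mult_mono component_le_norm_cart) auto
    finally show ?thesis by (simp add: B_def algebra_simps)
  qed
  have "norm (oseen_vec \<alpha> t z w - oseen_vec \<alpha> t z w') \<le> (\<Sum>j\<in>UNIV. \<bar>(oseen_vec \<alpha> t z w - oseen_vec \<alpha> t z w') $ j\<bar>)"
    by (rule norm_le_l1_cart)
  also have "\<dots> \<le> (\<Sum>j\<in>(UNIV::3 set). 9 * (K * B))"
  proof (intro sum_mono)
    fix j :: 3
    have "(oseen_vec \<alpha> t z w - oseen_vec \<alpha> t z w') $ j
        = (\<Sum>h\<in>UNIV. \<Sum>k\<in>UNIV. oseen_kernel \<alpha> t j h k z * (w $ h * w $ k - w' $ h * w' $ k))"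
      by (simp add: oseen_vec_def sum_subtractf[symmetric] right_diff_distrib)
    also have "\<bar>\<dots>\<bar> \<le> (\<Sum>h\<in>UNIV. \<Sum>k\<in>UNIV. \<bar>oseen_kernel \<alpha> t j h k z * (w $ h * w $ k - w' $ h * w' $ k)\<bar>)"
      by (intro order_trans[OF sum_abs] sum_mono sum_abs)
    also have "\<dots> \<le> (\<Sum>h\<in>(UNIV::3 set). \<Sum>k\<in>(UNIV::3 set). K * B)"
      unfolding abs_mult using assms prod order_trans[OF abs_ge_zero assms]
      by (intro sum_mono mult_mono) auto
    also have "\<dots> = 9 * (K * B)" by simp
    finally show "\<bar>(oseen_vec \<alpha> t z w - oseen_vec \<alpha> t z w') $ j\<bar> \<le> 9 * (K * B)" .
  qed
  also have "\<dots> = 27 * K * B" by simp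
  finally show ?thesis by (simp add: B_def)
qed

text \<open>The induction step for the domination of Picard increments \<open>d\<close> by the increments \<open>U' - U\<close> of the
  majorants, stated without subtraction.\<close>

lemma ennreal_quadratic_step:
  fixes U U' u u' d :: ennreal
  assumes "u \<le> U" "u' \<le> U'" "U + d \<le> U'"
  shows "U * U + (u' + u) * d \<le> U' * U'"
proof -
  have "U * U + (u' + u) * d \<le> U * U + (U' + U) * d"
    using assms by (intro add_left_mono mult_right_mono add_mono) auto
  also have "\<dots> = U * (U + d) + U' * d" by (simp add: algebra_simps)
  also have "\<dots> \<le> U * U' + U' * d" using assms by (intro add_right_mono mult_left_mono) auto
  also have "\<dots> = U' * (U + d)" by (simp add: algebra_simps)
  also have "\<dots> \<le> U' * U'" using assms by (intro mult_left_mono) auto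
  finally show ?thesis .
qed

context fns_kernel
begin

lemma ennreal_heat_kernel_le: "0 < t \<Longrightarrow> ennreal (\<bar>heat_kernel \<alpha> t z\<bar>) \<le> heat_maj t z"
  using heat_le by (auto simp: heat_maj_def heat_scale_def intro!: ennreal_leI)

lemma ennreal_oseen_vec_diff_le:
  assumes "0 < t"
  shows "ennreal (norm (oseen_vec \<alpha> t z w - oseen_vec \<alpha> t z w'))
    \<le> oseen_maj t z * ((ennreal (norm w) + ennreal (norm w')) * ennreal (norm (w - w')))"
proof -
  have "ennreal (norm (oseen_vec \<alpha> t z w - oseen_vec \<alpha> t z w'))
     \<le> ennreal (27 * (CK * (bump \<rho> (heat_scale t) z / heat_scale t)) * ((norm w + norm w') * norm (w - w')))"
    using oseen_le[OF assms] unfolding heat_scale_def[symmetric] by (intro ennreal_leI oseen_vec_diff_le)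
  also have "\<dots> = oseen_maj t z * ((ennreal (norm w) + ennreal (norm w')) * ennreal (norm (w - w')))"
    unfolding oseen_maj_def using CK_pos heat_scale(1)[OF assms]
    by (simp add: ennreal_mult[symmetric] ennreal_plus[symmetric] mult.assoc del: ennreal_plus)
  finally show ?thesis .
qed

lemma ennreal_oseen_vec_le:
  "0 < t \<Longrightarrow> ennreal (norm (oseen_vec \<alpha> t z w)) \<le> oseen_maj t z * (ennreal (norm w) * ennreal (norm w))"
  using ennreal_oseen_vec_diff_le[of t z w 0] by simp

definition heat0 :: "(real^3 \<Rightarrow> real^3) \<Rightarrow> real \<Rightarrow> real^3 \<Rightarrow> real^3" where
  "heat0 F t x = (\<integral>y. heat_kernel \<alpha> t (x - y) *\<^sub>R F y \<partial>lborel)"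

definition duhamel :: "(real \<Rightarrow> real^3 \<Rightarrow> real^3) \<Rightarrow> real \<Rightarrow> real^3 \<Rightarrow> real^3" where
  "duhamel F t x = (\<integral>s. indicator {0<..<t} s *\<^sub>R heat0 (F s) (t - s) x \<partial>lborel)"

text \<open>One integral over the product space rather than an iterated one: the Picard limit is
  then a single application of dominated convergence.\<close>

definition nonlin :: "(real \<Rightarrow> real^3 \<Rightarrow> real^3) \<Rightarrow> real \<Rightarrow> real^3 \<Rightarrow> real^3" where
  "nonlin v t x = (\<integral>z. indicator {0<..<t} (fst z) *\<^sub>R oseen_vec \<alpha> (t - fst z) (x - snd z) (v (fst z) (snd z)) \<partial>(lborel \<Otimes>\<^sub>M lborel))"

lemma nonlin_measurable [measurable (raw)]:
  assumes v: "(\<lambda>z. v (fst z) (snd z)) \<in> borel_measurable (borel \<Otimes>\<^sub>M borel)"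
    and [measurable]: "t \<in> borel_measurable M" "x \<in> borel_measurable M"
  shows "(\<lambda>z. nonlin v (t z) (x z)) \<in> borel_measurable M"
proof -
  interpret sigma_finite_measure "lborel \<Otimes>\<^sub>M lborel :: (real \<times> (real^3)) measure"
    by (simp add: lborel_prod lborel.sigma_finite_measure_axioms)
  have [measurable]: "(\<lambda>p. v (fst (snd p)) (snd (snd p))) \<in> borel_measurable (M \<Otimes>\<^sub>M (lborel \<Otimes>\<^sub>M lborel))"
    using measurable_compose[OF _ v, of "\<lambda>p. (fst (snd p), snd (snd p))" "M \<Otimes>\<^sub>M (lborel \<Otimes>\<^sub>M lborel)"] by simp
  show ?thesis unfolding nonlin_def by measurable
qed

lemma heat0_measurable [measurable (raw)]:
  assumes [measurable]: "(\<lambda>z. F (fst z) (snd z)) \<in> borel_measurable (M \<Otimes>\<^sub>M borel)"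
    "t \<in> borel_measurable M" "x \<in> borel_measurable M"
  shows "(\<lambda>z. heat0 (F z) (t z) (x z)) \<in> borel_measurable M"
proof -
  have [measurable]: "(\<lambda>z. F (fst z) (snd z)) \<in> borel_measurable (M \<Otimes>\<^sub>M lborel)"
    using assms(1) by (simp cong: measurable_cong_sets sets_pair_measure_cong)
  show ?thesis unfolding heat0_def by measurable
qed

lemma duhamel_measurable [measurable (raw)]:
  assumes F [measurable]: "(\<lambda>z. F (fst z) (snd z)) \<in> borel_measurable (borel \<Otimes>\<^sub>M borel)"
    and [measurable]: "t \<in> borel_measurable M" "x \<in> borel_measurable M"
  shows "(\<lambda>z. duhamel F (t z) (x z)) \<in> borel_measurable M"
proof -
  have [measurable]: "(\<lambda>p. F (snd (fst p)) (snd p)) \<in> borel_measurable ((M \<Otimes>\<^sub>M lborel) \<Otimes>\<^sub>M borel)"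
    using measurable_compose[OF _ F, of "\<lambda>p. (snd (fst p), snd p)" "(M \<Otimes>\<^sub>M lborel) \<Otimes>\<^sub>M borel"] by simp
  show ?thesis unfolding duhamel_def by measurable
qed

lemma heat0_le: "0 < t \<Longrightarrow> ennreal (norm (heat0 F t x)) \<le> Heat0 (\<lambda>y. ennreal (norm (F y))) t x"
  unfolding heat0_def Heat0_def
  by (rule order_trans[OF ennreal_norm_integral_le], intro nn_integral_mono)
     (simp add: ennreal_mult ennreal_heat_kernel_le mult_right_mono)

lemma duhamel_le: "ennreal (norm (duhamel F t x)) \<le> Duhamel (\<lambda>s y. ennreal (norm (F s y))) t x"
  unfolding duhamel_def Duhamel_def
  by (rule order_trans[OF ennreal_norm_integral_le], intro nn_integral_mono)
     (auto split: split_indicator intro!: heat0_le)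

lemma Bil_eq_product:
  assumes U: "(\<lambda>z. U (fst z) (snd z)) \<in> borel_measurable (borel \<Otimes>\<^sub>M borel)"
    and V: "(\<lambda>z. V (fst z) (snd z)) \<in> borel_measurable (borel \<Otimes>\<^sub>M borel)"
  shows "Bil U V t x = (\<integral>\<^sup>+z. indicator {0<..<t} (fst z) * (oseen_maj (t - fst z) (x - snd z) * (U (fst z) (snd z) * V (fst z) (snd z)))
     \<partial>(lborel \<Otimes>\<^sub>M lborel))"
proof -
  have [measurable]: "(\<lambda>z. U (fst z) (snd z)) \<in> borel_measurable (lborel \<Otimes>\<^sub>M lborel)"
    "(\<lambda>z. V (fst z) (snd z)) \<in> borel_measurable (lborel \<Otimes>\<^sub>M lborel)"
    using U V by (simp_all cong: measurable_cong_sets sets_pair_measure_cong)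
  have [measurable]: "U s \<in> borel_measurable borel" "V s \<in> borel_measurable borel" for s
    using measurable_section_snd[OF U] measurable_section_snd[OF V] by simp_all
  have "Bil U V t x = (\<integral>\<^sup>+s. \<integral>\<^sup>+y. indicator {0<..<t} s * (oseen_maj (t - s) (x - y) * (U s y * V s y)) \<partial>lborel \<partial>lborel)"
    unfolding Bil_def by (intro nn_integral_cong nn_integral_cmult[symmetric]) measurable
  also have "\<dots> = (\<integral>\<^sup>+z. indicator {0<..<t} (fst z) * (oseen_maj (t - fst z) (x - snd z) * (U (fst z) (snd z) * V (fst z) (snd z)))
     \<partial>(lborel \<Otimes>\<^sub>M lborel))"
    by (subst lborel.nn_integral_fst[symmetric]) auto
  finally show ?thesis .
qed

lemma integrable_nonlin:
  assumes v [measurable]: "(\<lambda>z. v (fst z) (snd z)) \<in> borel_measurable (borel \<Otimes>\<^sub>M borel)"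
    and fin: "Bil (\<lambda>s y. ennreal (norm (v s y))) (\<lambda>s y. ennreal (norm (v s y))) t x < \<infinity>"
  shows "integrable (lborel \<Otimes>\<^sub>M lborel) (\<lambda>z. indicator {0<..<t} (fst z) *\<^sub>R oseen_vec \<alpha> (t - fst z) (x - snd z) (v (fst z) (snd z)))"
proof (rule integrableI_bounded)
  have [measurable]: "(\<lambda>z. v (fst z) (snd z)) \<in> borel_measurable (lborel \<Otimes>\<^sub>M lborel)"
    using v by (simp cong: measurable_cong_sets sets_pair_measure_cong)
  show "(\<lambda>z. indicator {0<..<t} (fst z) *\<^sub>R oseen_vec \<alpha> (t - fst z) (x - snd z) (v (fst z) (snd z))) \<in> borel_measurable (lborel \<Otimes>\<^sub>M lborel)"
    by measurable
  have "(\<integral>\<^sup>+z. ennreal (norm (indicator {0<..<t} (fst z) *\<^sub>R oseen_vec \<alpha> (t - fst z) (x - snd z) (v (fst z) (snd z)))) \<partial>(lborel \<Otimes>\<^sub>M lborel))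
     \<le> Bil (\<lambda>s y. ennreal (norm (v s y))) (\<lambda>s y. ennreal (norm (v s y))) t x"
    by (subst Bil_eq_product, measurable, intro nn_integral_mono)
       (auto split: split_indicator intro!: ennreal_oseen_vec_le)
  also note fin
  finally show "(\<integral>\<^sup>+z. ennreal (norm (indicator {0<..<t} (fst z) *\<^sub>R oseen_vec \<alpha> (t - fst z) (x - snd z) (v (fst z) (snd z)))) \<partial>(lborel \<Otimes>\<^sub>M lborel)) < \<infinity>" .
qed

text \<open>Finiteness for each field separately makes both integrands integrable, so that the
  difference can be written as one integral.\<close>

lemma nonlin_le:
  assumes v [measurable]: "(\<lambda>z. v (fst z) (snd z)) \<in> borel_measurable (borel \<Otimes>\<^sub>M borel)"
    and v' [measurable]: "(\<lambda>z. v' (fst z) (snd z)) \<in> borel_measurable (borel \<Otimes>\<^sub>M borel)"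
    and fin: "Bil (\<lambda>s y. ennreal (norm (v s y))) (\<lambda>s y. ennreal (norm (v s y))) t x < \<infinity>"
      "Bil (\<lambda>s y. ennreal (norm (v' s y))) (\<lambda>s y. ennreal (norm (v' s y))) t x < \<infinity>"
  shows "ennreal (norm (nonlin v t x - nonlin v' t x)) \<le>
    Bil (\<lambda>s y. ennreal (norm (v s y)) + ennreal (norm (v' s y))) (\<lambda>s y. ennreal (norm (v s y - v' s y))) t x"
proof -
  have eq: "nonlin v t x - nonlin v' t x = (\<integral>z. indicator {0<..<t} (fst z) *\<^sub>R
     (oseen_vec \<alpha> (t - fst z) (x - snd z) (v (fst z) (snd z)) - oseen_vec \<alpha> (t - fst z) (x - snd z) (v' (fst z) (snd z))) \<partial>(lborel \<Otimes>\<^sub>M lborel))"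
    unfolding nonlin_def using integrable_nonlin[OF v fin(1)] integrable_nonlin[OF v' fin(2)]
    by (simp add: scaleR_diff_right)
  have "ennreal (norm (nonlin v t x - nonlin v' t x)) \<le> (\<integral>\<^sup>+z. ennreal (norm (indicator {0<..<t} (fst z) *\<^sub>R
     (oseen_vec \<alpha> (t - fst z) (x - snd z) (v (fst z) (snd z)) - oseen_vec \<alpha> (t - fst z) (x - snd z) (v' (fst z) (snd z))))) \<partial>(lborel \<Otimes>\<^sub>M lborel))"
    unfolding eq by (rule ennreal_norm_integral_le)
  also have "\<dots> \<le> Bil (\<lambda>s y. ennreal (norm (v s y)) + ennreal (norm (v' s y))) (\<lambda>s y. ennreal (norm (v s y - v' s y))) t x"
    by (subst Bil_eq_product, measurable, intro nn_integral_mono)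
       (auto split: split_indicator intro!: ennreal_oseen_vec_diff_le)
  finally show ?thesis .
qed

text \<open>\<open>U\<close> is the increasing iteration of the majorants and \<open>Ui\<close> its
  limit. The sums of the norms of the Picard increments stay below \<open>U\<close>, so the iterates
  converge on the good set, and the integrand of \<open>Bil Ui Ui\<close> dominates in the limit of
  the nonlinearity. Smallness comes from the length of the time interval only.\<close>

lemma existence:
  fixes u0 :: "real^3 \<Rightarrow> real^3" and f :: "real \<Rightarrow> real^3 \<Rightarrow> real^3"
  assumes u0 [measurable]: "u0 \<in> borel_measurable borel"
    and f [measurable]: "(\<lambda>z. f (fst z) (snd z)) \<in> borel_measurable (borel \<Otimes>\<^sub>M borel)"
    and R0: "0 < R0"
    and lin: "\<And>t. 0 < t \<Longrightarrow> t < 1 \<Longrightarrow>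
      modg (\<lambda>x. ennreal (1 / R0) * (Heat0 (\<lambda>y. ennreal (norm (u0 y))) t x + Duhamel (\<lambda>s y. ennreal (norm (f s y))) t x)) \<le> 1"
  shows "\<exists>T u R. 0 < T \<and> T < 1 \<and> 0 < R \<and> (\<lambda>z. u (fst z) (snd z)) \<in> borel_measurable (borel \<Otimes>\<^sub>M borel) \<and>
    (\<forall>t. 0 < t \<and> t < T \<longrightarrow> modg (\<lambda>x. ennreal (1 / R) * ennreal (norm (u t x))) \<le> 1 \<and>
      (AE x in lborel. Bil (\<lambda>s y. ennreal (norm (u s y))) (\<lambda>s y. ennreal (norm (u s y))) t x < \<infinity> \<and>
        u t x = heat0 u0 t x + duhamel f t x - nonlin u t x))"
proof -
  \<comment> \<open>The linear and the bilinear part are each kept below R0; 4 is the factor of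
    \<open>modg_add\<close>.\<close>
  define R where "R = 4 * R0"
  have R: "0 < R" using R0 by (simp add: R_def)
  \<comment> \<open>Solves bil_const R^2 T^(1-\<theta>)/(1 - \<theta>) = R0 for T^(1-\<theta>); the
    left side is the total weight in \<open>bil_bound\<close>.\<close>
  define Q where "Q = R0 * (1 - \<theta>) / (bil_const * (R * R))"
  have Q: "0 < Q" using R0 theta bil_const R by (simp add: Q_def)
  define T where "T = min (1/2) (Q powr (1 / (1 - \<theta>)))"
  have T: "0 < T" "T < 1" using Q by (auto simp: T_def)
  have TQ: "T powr (1 - \<theta>) \<le> Q"
  proof -
    have "T powr (1 - \<theta>) \<le> (Q powr (1 / (1 - \<theta>))) powr (1 - \<theta>)"
      using theta T by (intro powr_mono2) (auto simp: T_def)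
    also have "\<dots> = Q" using theta Q by (simp add: powr_powr)
    finally show ?thesis .
  qed
  have mass: "(\<integral>\<^sup>+s. indicator {0<..<t} s * ennreal (bil_const * (t - s) powr - \<theta> * (R * R)) \<partial>lborel) \<le> ennreal R0"
    if t: "0 < t" "t < T" for t
  proof -
    have "(\<integral>\<^sup>+s. indicator {0<..<t} s * ennreal (bil_const * (t - s) powr - \<theta> * (R * R)) \<partial>lborel)
       = (\<integral>\<^sup>+s. ennreal (bil_const * (R * R)) * (indicator {0<..<t} s * ennreal ((t - s) powr - \<theta>)) \<partial>lborel)"
      using bil_const R by (intro nn_integral_cong) (auto simp: ennreal_mult[symmetric] mult_ac split: split_indicator)
    also have "\<dots> = ennreal (bil_const * (R * R)) * (\<integral>\<^sup>+s. indicator {0<..<t} s * ennreal ((t - s) powr - \<theta>) \<partial>lborel)"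
      by (rule nn_integral_cmult) measurable
    also have "\<dots> \<le> ennreal (bil_const * (R * R)) * ennreal (t powr (1 - \<theta>) / (1 - \<theta>))"
      using theta t by (intro mult_left_mono nn_integral_singular_time) auto
    also have "\<dots> = ennreal (bil_const * (R * R) * (t powr (1 - \<theta>) / (1 - \<theta>)))"
      using bil_const R theta by (simp add: ennreal_mult[symmetric])
    also have "\<dots> \<le> ennreal R0"
    proof (rule ennreal_leI)
      have "t powr (1 - \<theta>) \<le> T powr (1 - \<theta>)" using t theta by (intro powr_mono2) auto
      with TQ have "t powr (1 - \<theta>) / (1 - \<theta>) \<le> Q / (1 - \<theta>)" using theta by (intro divide_right_mono) auto
      then have "bil_const * (R * R) * (t powr (1 - \<theta>) / (1 - \<theta>)) \<le> bil_const * (R * R) * (Q / (1 - \<theta>))"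
        using bil_const R by (intro mult_left_mono) auto
      also have "\<dots> = R0" using bil_const R theta by (simp add: Q_def)
      finally show "bil_const * (R * R) * (t powr (1 - \<theta>) / (1 - \<theta>)) \<le> R0" .
    qed
    finally show ?thesis .
  qed
  define L where "L t x = Heat0 (\<lambda>y. ennreal (norm (u0 y))) t x + Duhamel (\<lambda>s y. ennreal (norm (f s y))) t x" for t x
  have L_meas [measurable]: "(\<lambda>z. L (fst z) (snd z)) \<in> borel_measurable (borel \<Otimes>\<^sub>M borel)"
    unfolding L_def by measurable
  define U where "U = rec_nat (\<lambda>t x. 0::ennreal) (\<lambda>n V t x. L t x + Bil V V t x)"
  have U0: "U 0 t x = 0" and US: "U (Suc n) t x = L t x + Bil (U n) (U n) t x" for n t x
    by (simp_all add: U_def)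
  have U_meas [measurable]: "(\<lambda>z. U n (fst z) (snd z)) \<in> borel_measurable (borel \<Otimes>\<^sub>M borel)" for n
    by (induction n) (auto simp: U0 US)
  have U_mono: "U n t x \<le> U (Suc n) t x" for n t x
  proof (induction n arbitrary: t x)
    case (Suc n)
    then show ?case unfolding US by (intro add_left_mono Bil_mono) (simp add: US)
  qed (simp add: U0)
  have sect: "V t \<in> borel_measurable borel" if "(\<lambda>z. V (fst z) (snd z)) \<in> borel_measurable (borel \<Otimes>\<^sub>M borel)"
    for V :: "real \<Rightarrow> real^3 \<Rightarrow> ennreal" and t
    using measurable_section_snd[OF that] by simp
  have bilR: "modg (\<lambda>x. ennreal (1 / R0) * Bil V V t x) \<le> 1"
    if "(\<lambda>z. V (fst z) (snd z)) \<in> borel_measurable (borel \<Otimes>\<^sub>M borel)"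
      "\<And>s. 0 < s \<Longrightarrow> s < T \<Longrightarrow> modg (\<lambda>y. ennreal (1 / R) * V s y) \<le> 1" "0 < t" "t < T" for V t
    using that R R0 T mass[of t] by (intro bil_bound[where u="\<lambda>_. R" and v="\<lambda>_. R"]) auto
  have U_mod: "modg (\<lambda>x. ennreal (1 / R) * U n t x) \<le> 1" if t: "0 < t" "t < T" for n t
    using t
  proof (induction n arbitrary: t)
    case 0
    then show ?case by (simp add: U0 modg_def)
  next
    case (Suc n)
    have [measurable]: "L t \<in> borel_measurable borel" "U n t \<in> borel_measurable borel"
      using sect[OF L_meas] sect[OF U_meas] by auto
    have "modg (\<lambda>x. ennreal (1/4) * (ennreal (1 / R0) * L t x + ennreal (1 / R0) * Bil (U n) (U n) t x)) \<le> 1"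
      using Suc lin[of t] T bilR[OF U_meas] by (intro modg_add) (auto simp: L_def)
    moreover have "ennreal (1/4) * (ennreal (1 / R0) * L t x + ennreal (1 / R0) * Bil (U n) (U n) t x) = ennreal (1 / R) * U (Suc n) t x" for x
      using R0 by (simp add: US R_def distrib_left mult.assoc[symmetric] ennreal_mult[symmetric])
    ultimately show ?case by simp
  qed
  define Ui where "Ui t x = (SUP n. U n t x)" for t x
  have Ui_meas [measurable]: "(\<lambda>z. Ui (fst z) (snd z)) \<in> borel_measurable (borel \<Otimes>\<^sub>M borel)"
    unfolding Ui_def by measurable
  have U_le: "U n t x \<le> Ui t x" for n t x unfolding Ui_def by (rule SUP_upper) simp
  have Ui_mod: "modg (\<lambda>x. ennreal (1 / R) * Ui t x) \<le> 1" if t: "0 < t" "t < T" for t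
  proof -
    have [measurable]: "U n t \<in> borel_measurable borel" for n using sect[OF U_meas] by auto
    have "modg (\<lambda>x. SUP n. ennreal (1 / R) * U n t x) \<le> 1"
      using U_mono t by (intro modg_SUP U_mod) (auto simp: incseq_Suc_iff le_fun_def intro!: mult_left_mono)
    then show ?thesis by (simp add: Ui_def SUP_mult_left_ennreal)
  qed
  \<comment> \<open>Off this set the iterates are put to 0, so that they converge at every point and
    stay jointly measurable; for each t in the interval almost every x is good.\<close>
  define good where "good t x \<longleftrightarrow> 0 < t \<and> t < T \<and> Ui t x < \<infinity> \<and> Bil Ui Ui t x < \<infinity>" for t x
  have good_meas [measurable]: "Measurable.pred (borel \<Otimes>\<^sub>M borel) (\<lambda>z. good (fst z) (snd z))"
    unfolding good_def by measurable
  have finite_of_modg: "AE x in lborel. F x < \<infinity>"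
    if [measurable]: "F \<in> borel_measurable borel" and "modg (\<lambda>x. ennreal (1 / r) * F x) \<le> 1" "0 < r" for F :: "real^3 \<Rightarrow> ennreal" and r
  proof -
    have "AE x in lborel. ennreal (1 / r) * F x < \<infinity>" using that by (intro modg_finite_AE) auto
    then show ?thesis
      by eventually_elim (use that in \<open>auto simp: ennreal_mult_less_top\<close>)
  qed
  have good_AE: "AE x in lborel. good t x" if t: "0 < t" "t < T" for t
  proof -
    have [measurable]: "Ui t \<in> borel_measurable borel" using sect[OF Ui_meas] by auto
    have "AE x in lborel. Ui t x < \<infinity>" using R Ui_mod[OF t] by (intro finite_of_modg) auto
    moreover have "AE x in lborel. Bil Ui Ui t x < \<infinity>"
      using R0 bilR[OF Ui_meas Ui_mod t] by (intro finite_of_modg) auto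
    ultimately show ?thesis by eventually_elim (use t in \<open>simp add: good_def\<close>)
  qed
  define u where "u = rec_nat (\<lambda>t x. 0::real^3) (\<lambda>n v t x. if good t x then heat0 u0 t x + duhamel f t x - nonlin v t x else 0)"
  have v0: "u 0 t x = 0" and uS: "u (Suc n) t x = (if good t x then heat0 u0 t x + duhamel f t x - nonlin (u n) t x else 0)" for n t x
    by (simp_all add: u_def)
  have u_meas [measurable]: "(\<lambda>z. u n (fst z) (snd z)) \<in> borel_measurable (borel \<Otimes>\<^sub>M borel)" for n
    by (induction n) (auto simp: v0 uS)
  have nl0: "nonlin (u 0) t x = 0" for t x by (simp add: nonlin_def v0)
  \<comment> \<open>The domination is stated additively because subtraction in
    \<open>ennreal\<close> is truncated. Both parts are proved together, since the increment
    estimate uses the sizes of the iterates.\<close>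
  have u_le: "ennreal (norm (u n t x)) \<le> U n t x \<and> U n t x + ennreal (norm (u (Suc n) t x - u n t x)) \<le> U (Suc n) t x"
    if t: "0 < t" "t < T" for n t x
    using t
  proof (induction n arbitrary: t x)
    case 0
    show ?case
    proof (cases "good t x")
      case True
      have "ennreal (norm (heat0 u0 t x + duhamel f t x)) \<le> ennreal (norm (heat0 u0 t x)) + ennreal (norm (duhamel f t x))"
        by (simp add: ennreal_plus[symmetric] norm_triangle_ineq ennreal_leI del: ennreal_plus)
      also have "\<dots> \<le> L t x" unfolding L_def using 0 by (intro add_mono heat0_le duhamel_le)
      finally show ?thesis using True by (simp add: v0 U0 US uS nl0 add_increasing2)
    qed (simp add: v0 U0 US uS)
  next
    case (Suc n)
    have "ennreal (norm (u (Suc n) t x)) \<le> ennreal (norm (u n t x)) + ennreal (norm (u (Suc n) t x - u n t x))"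
      using norm_triangle_ineq[of "u n t x" "u (Suc n) t x - u n t x"]
      by (simp add: ennreal_plus[symmetric] ennreal_leI del: ennreal_plus)
    also have "\<dots> \<le> U (Suc n) t x"
      using Suc.IH[OF Suc.prems, of x] by (meson add_right_mono order_trans)
    finally have 1: "ennreal (norm (u (Suc n) t x)) \<le> U (Suc n) t x" .
    have le: "ennreal (norm (u n s y)) \<le> U n s y" "ennreal (norm (u (Suc n) s y)) \<le> U (Suc n) s y"
      "U n s y + ennreal (norm (u (Suc n) s y - u n s y)) \<le> U (Suc n) s y" if "0 < s" "s < t" for s y
    proof -
      have s: "0 < s" "s < T" using that Suc.prems by auto
      show a: "ennreal (norm (u n s y)) \<le> U n s y" and b: "U n s y + ennreal (norm (u (Suc n) s y - u n s y)) \<le> U (Suc n) s y"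
        using Suc.IH[OF s, of y] by auto
      have "ennreal (norm (u (Suc n) s y)) \<le> ennreal (norm (u n s y)) + ennreal (norm (u (Suc n) s y - u n s y))"
        using norm_triangle_ineq[of "u n s y" "u (Suc n) s y - u n s y"]
        by (simp add: ennreal_plus[symmetric] ennreal_leI del: ennreal_plus)
      also have "\<dots> \<le> U n s y + ennreal (norm (u (Suc n) s y - u n s y))" using a by (rule add_right_mono)
      also note b
      finally show "ennreal (norm (u (Suc n) s y)) \<le> U (Suc n) s y" .
    qed
    have 2: "U (Suc n) t x + ennreal (norm (u (Suc (Suc n)) t x - u (Suc n) t x)) \<le> U (Suc (Suc n)) t x"
    proof (cases "good t x")
      case False
      then show ?thesis using U_mono by (simp add: uS)
    next
      case True
      have fin: "Bil (\<lambda>s y. ennreal (norm (u m s y))) (\<lambda>s y. ennreal (norm (u m s y))) t x < \<infinity>" if "m = n \<or> m = Suc n" for m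
      proof -
        have "Bil (\<lambda>s y. ennreal (norm (u m s y))) (\<lambda>s y. ennreal (norm (u m s y))) t x \<le> Bil Ui Ui t x"
          using that order_trans[OF le(1) U_le] order_trans[OF le(2) U_le] by (intro Bil_mono) blast+
        then show ?thesis using True unfolding good_def by auto
      qed
      have "u (Suc (Suc n)) t x - u (Suc n) t x = nonlin (u n) t x - nonlin (u (Suc n)) t x"
        using True by (simp add: uS)
      then have "ennreal (norm (u (Suc (Suc n)) t x - u (Suc n) t x)) = ennreal (norm (nonlin (u (Suc n)) t x - nonlin (u n) t x))"
        by (simp add: norm_minus_commute)
      also have "\<dots> \<le> Bil (\<lambda>s y. ennreal (norm (u (Suc n) s y)) + ennreal (norm (u n s y)))
         (\<lambda>s y. ennreal (norm (u (Suc n) s y - u n s y))) t x"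
        by (intro nonlin_le fin) auto
      finally have "U (Suc n) t x + ennreal (norm (u (Suc (Suc n)) t x - u (Suc n) t x)) \<le> L t x + (Bil (U n) (U n) t x
         + Bil (\<lambda>s y. ennreal (norm (u (Suc n) s y)) + ennreal (norm (u n s y))) (\<lambda>s y. ennreal (norm (u (Suc n) s y - u n s y))) t x)"
        unfolding US[of n] by (simp add: add.assoc add_left_mono)
      also have "\<dots> \<le> L t x + Bil (U (Suc n)) (U (Suc n)) t x"
      proof (rule add_left_mono)
        let ?d = "\<lambda>s y. ennreal (norm (u (Suc n) s y - u n s y))"
        let ?a = "\<lambda>s y. ennreal (norm (u (Suc n) s y)) + ennreal (norm (u n s y))"
        have [measurable]: "(\<lambda>z. U m (fst z) (snd z)) \<in> borel_measurable (lborel \<Otimes>\<^sub>M lborel)"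
            "(\<lambda>z. u m (fst z) (snd z)) \<in> borel_measurable (lborel \<Otimes>\<^sub>M lborel)" for m
          using U_meas[of m] u_meas[of m] by (simp_all cong: measurable_cong_sets sets_pair_measure_cong)
        \<comment> \<open>Both terms are merged into one integrand so that
          \<open>ennreal_quadratic_step\<close> applies pointwise.\<close>
        have "Bil (U n) (U n) t x + Bil ?a ?d t x =
          (\<integral>\<^sup>+z. indicator {0<..<t} (fst z) * (oseen_maj (t - fst z) (x - snd z) * (U n (fst z) (snd z) * U n (fst z) (snd z)))
            + indicator {0<..<t} (fst z) * (oseen_maj (t - fst z) (x - snd z) * (?a (fst z) (snd z) * ?d (fst z) (snd z))) \<partial>(lborel \<Otimes>\<^sub>M lborel))"
          by (subst (1 2) Bil_eq_product) (auto intro!: nn_integral_add[symmetric])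
        also have "\<dots> \<le> Bil (U (Suc n)) (U (Suc n)) t x"
        proof (subst Bil_eq_product, measurable, intro nn_integral_mono)
          fix z :: "real \<times> (real^3)"
          show "indicator {0<..<t} (fst z) * (oseen_maj (t - fst z) (x - snd z) * (U n (fst z) (snd z) * U n (fst z) (snd z)))
            + indicator {0<..<t} (fst z) * (oseen_maj (t - fst z) (x - snd z) * (?a (fst z) (snd z) * ?d (fst z) (snd z)))
            \<le> indicator {0<..<t} (fst z) * (oseen_maj (t - fst z) (x - snd z) * (U (Suc n) (fst z) (snd z) * U (Suc n) (fst z) (snd z)))"
          proof (cases "0 < fst z \<and> fst z < t")
            case True
            then have s: "0 < fst z" "fst z < t" by auto
            have "U n (fst z) (snd z) * U n (fst z) (snd z) + ?a (fst z) (snd z) * ?d (fst z) (snd z)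
               \<le> U (Suc n) (fst z) (snd z) * U (Suc n) (fst z) (snd z)"
              by (rule ennreal_quadratic_step[OF le[OF s]])
            from mult_left_mono[OF this, of "oseen_maj (t - fst z) (x - snd z)"] True
            show ?thesis by (simp add: distrib_left)
          qed simp
        qed
        finally show "Bil (U n) (U n) t x + Bil ?a ?d t x \<le> Bil (U (Suc n)) (U (Suc n)) t x" .
      qed
      finally show ?thesis by (simp add: US)
    qed
    show ?case using 1 2 by blast
  qed
  define w where "w t x = lim (\<lambda>n. u n t x)" for t x
  have w_meas [measurable]: "(\<lambda>z. w (fst z) (snd z)) \<in> borel_measurable (borel \<Otimes>\<^sub>M borel)"
    unfolding w_def by (rule borel_measurable_lim_metric) measurable
  have u_bad: "u n t x = 0" if "\<not> good t x" for n t x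
    using that by (cases n) (auto simp: v0 uS)
  have conv: "(\<lambda>n. u n t x) \<longlonglongrightarrow> w t x" for t x
  proof (cases "good t x")
    case False
    then show ?thesis by (simp add: u_bad w_def lim_def[symmetric])
  next
    case True
    then have t: "0 < t" "t < T" by (auto simp: good_def)
    have sum_le: "(\<Sum>i<n. ennreal (norm (u (Suc i) t x - u i t x))) \<le> U n t x" for n
    proof (induction n)
      case (Suc n)
      have "(\<Sum>i<Suc n. ennreal (norm (u (Suc i) t x - u i t x))) \<le> U n t x + ennreal (norm (u (Suc n) t x - u n t x))"
        using Suc by (simp add: add_right_mono)
      also have "\<dots> \<le> U (Suc n) t x" using u_le[OF t] by blast
      finally show ?case .
    qed simp
    obtain r where r: "0 \<le> r" "Ui t x = ennreal r" using True by (cases "Ui t x") (auto simp: good_def)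
    have "summable (\<lambda>i. norm (u (Suc i) t x - u i t x))"
    proof (rule summableI_nonneg_bounded)
      fix n
      have "ennreal (\<Sum>i<n. norm (u (Suc i) t x - u i t x)) = (\<Sum>i<n. ennreal (norm (u (Suc i) t x - u i t x)))"
        by (rule sum_ennreal[symmetric]) simp
      also have "\<dots> \<le> ennreal r" using sum_le[of n] U_le[of n t x] unfolding r(2)[symmetric] by (rule order_trans)
      finally show "(\<Sum>i<n. norm (u (Suc i) t x - u i t x)) \<le> r" using r by simp
    qed simp
    then have "summable (\<lambda>i. u (Suc i) t x - u i t x)" by (rule summable_norm_cancel)
    then have "convergent (\<lambda>n. \<Sum>i<n. u (Suc i) t x - u i t x)" by (simp add: summable_iff_convergent)
    moreover have "(\<Sum>i<n. u (Suc i) t x - u i t x) = u n t x" for n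
      using sum_lessThan_telescope[of "\<lambda>i. u i t x" n] by (simp add: v0)
    ultimately have "convergent (\<lambda>n. u n t x)" by (simp only:)
    then show ?thesis unfolding w_def by (simp add: convergent_LIMSEQ_iff)
  qed
  have w_le: "ennreal (norm (w t x)) \<le> Ui t x" if t: "0 < t" "t < T" for t x
  proof (rule LIMSEQ_le_const2)
    show "(\<lambda>n. ennreal (norm (u n t x))) \<longlonglongrightarrow> ennreal (norm (w t x))"
      by (intro tendsto_intros conv)
    show "\<exists>N. \<forall>n\<ge>N. ennreal (norm (u n t x)) \<le> Ui t x"
      using u_le[OF t] order_trans[OF _ U_le] by blast
  qed
  have Bil_le: "Bil (\<lambda>s y. ennreal (norm (w s y))) (\<lambda>s y. ennreal (norm (w s y))) t x \<le> Bil Ui Ui t x" if "t < T" for t x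
    using that by (intro Bil_mono w_le) auto
  have eq: "w t x = heat0 u0 t x + duhamel f t x - nonlin w t x" if gd: "good t x" for t x
  proof -
    have t: "0 < t" "t < T" using gd by (auto simp: good_def)
    have [measurable]: "(\<lambda>z. Ui (fst z) (snd z)) \<in> borel_measurable (lborel \<Otimes>\<^sub>M lborel)"
       "(\<lambda>z. w (fst z) (snd z)) \<in> borel_measurable (lborel \<Otimes>\<^sub>M lborel)"
       "(\<lambda>z. u n (fst z) (snd z)) \<in> borel_measurable (lborel \<Otimes>\<^sub>M lborel)" for n
      using Ui_meas w_meas u_meas[of n] by (simp_all cong: measurable_cong_sets sets_pair_measure_cong)
    define D where "D z = indicator {0<..<t} (fst z) * (oseen_maj (t - fst z) (x - snd z) * (Ui (fst z) (snd z) * Ui (fst z) (snd z)))" for z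
    have [measurable]: "D \<in> borel_measurable (lborel \<Otimes>\<^sub>M lborel)" unfolding D_def by measurable
    have D_fin: "(\<integral>\<^sup>+z. D z \<partial>(lborel \<Otimes>\<^sub>M lborel)) < \<infinity>"
      using gd Bil_eq_product[OF Ui_meas Ui_meas, of t x] by (simp add: D_def good_def)
    then have D_AE: "AE z in lborel \<Otimes>\<^sub>M lborel. D z \<noteq> \<infinity>"
      by (intro nn_integral_noteq_infinite) auto
    have D_int: "integrable (lborel \<Otimes>\<^sub>M lborel) (\<lambda>z. enn2real (D z))"
    proof (rule integrableI_bounded)
      have "(\<integral>\<^sup>+z. ennreal (norm (enn2real (D z))) \<partial>(lborel \<Otimes>\<^sub>M lborel)) = (\<integral>\<^sup>+z. D z \<partial>(lborel \<Otimes>\<^sub>M lborel))"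
        using D_AE by (intro nn_integral_cong_AE) (auto elim!: eventually_mono simp: less_top)
      then show "(\<integral>\<^sup>+z. ennreal (norm (enn2real (D z))) \<partial>(lborel \<Otimes>\<^sub>M lborel)) < \<infinity>" using D_fin by simp
    qed measurable
    have "(\<lambda>n. nonlin (u n) t x) \<longlonglongrightarrow> nonlin w t x"
      unfolding nonlin_def
    proof (rule integral_dominated_convergence[OF _ _ D_int])
      show "AE z in lborel \<Otimes>\<^sub>M lborel. (\<lambda>n. indicator {0<..<t} (fst z) *\<^sub>R oseen_vec \<alpha> (t - fst z) (x - snd z) (u n (fst z) (snd z)))
          \<longlonglongrightarrow> indicator {0<..<t} (fst z) *\<^sub>R oseen_vec \<alpha> (t - fst z) (x - snd z) (w (fst z) (snd z))"
        by (intro always_eventually allI tendsto_scaleR tendsto_const tendsto_oseen_vec conv)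
      fix n
      show "AE z in lborel \<Otimes>\<^sub>M lborel. norm (indicator {0<..<t} (fst z) *\<^sub>R oseen_vec \<alpha> (t - fst z) (x - snd z) (u n (fst z) (snd z))) \<le> enn2real (D z)"
        using D_AE
      proof eventually_elim
        case (elim z)
        show ?case
        proof (cases "0 < fst z \<and> fst z < t")
          case True
          then have "ennreal (norm (oseen_vec \<alpha> (t - fst z) (x - snd z) (u n (fst z) (snd z)))) \<le>
             oseen_maj (t - fst z) (x - snd z) * (ennreal (norm (u n (fst z) (snd z))) * ennreal (norm (u n (fst z) (snd z))))"
            by (intro ennreal_oseen_vec_le) auto
          also have "\<dots> \<le> D z"
            using True t u_le[of "fst z" n "snd z"] U_le[of n "fst z" "snd z"]
            by (auto simp: D_def intro!: mult_left_mono mult_mono order_trans[OF _ U_le])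
          finally show ?thesis using True elim by (cases "D z") auto
        qed simp
      qed
    qed measurable
    then have "(\<lambda>n. heat0 u0 t x + duhamel f t x - nonlin (u n) t x) \<longlonglongrightarrow> heat0 u0 t x + duhamel f t x - nonlin w t x"
      by (intro tendsto_intros)
    moreover have "(\<lambda>n. heat0 u0 t x + duhamel f t x - nonlin (u n) t x) \<longlonglongrightarrow> w t x"
      using LIMSEQ_Suc[OF conv[of t x]] gd by (simp add: uS)
    ultimately show ?thesis by (rule LIMSEQ_unique[rotated])
  qed
  show ?thesis
  proof (rule exI[of _ T], rule exI[of _ w], rule exI[of _ R], intro conjI allI impI T R w_meas)
    fix t assume "0 < t \<and> t < T"
    then have t: "0 < t" "t < T" by auto
    show "modg (\<lambda>x. ennreal (1 / R) * ennreal (norm (w t x))) \<le> 1"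
      by (rule order_trans[OF modg_mono Ui_mod[OF t]]) (intro mult_left_mono w_le t, simp)
    show "AE x in lborel. Bil (\<lambda>s y. ennreal (norm (w s y))) (\<lambda>s y. ennreal (norm (w s y))) t x < \<infinity> \<and>
        w t x = heat0 u0 t x + duhamel f t x - nonlin w t x"
      using good_AE[OF t]
    proof eventually_elim
      case (elim x)
      then show ?case using eq[OF elim] order_le_less_trans[OF Bil_le[OF t(2)]] by (auto simp: good_def)
    qed
  qed
qed

end

section \<open>Boundedness and uniqueness for the majorant inequality\<close>

text \<open>Trades an exponential weight for a slightly stronger singularity: applied to x = l (t -
  s), it leaves the small factor l^(-\<gamma>).\<close>

lemma exp_minus_le_powr:
  fixes x :: real
  assumes "0 < x" "0 \<le> \<gamma>" "\<gamma> \<le> 1"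
  shows "exp (- x) \<le> x powr - \<gamma>"
proof -
  have "x powr \<gamma> \<le> 1 + x"
  proof (cases "x \<le> 1")
    case True
    then have "x powr \<gamma> \<le> 1" using assms by (simp add: powr_le1)
    then show ?thesis using assms by simp
  next
    case False
    then have "x powr \<gamma> \<le> x powr 1" using assms by (intro powr_mono) auto
    then show ?thesis using assms by simp
  qed
  also have "\<dots> \<le> exp x" by (rule exp_ge_add_one_self)
  finally show ?thesis using assms by (simp add: exp_minus powr_minus le_imp_inverse_le)
qed

text \<open>P/(P - 2) and P/2 are conjugate exponents, the latter applied to Y^2; the weights of
  Young's inequality are at most 1 and are dropped.\<close>

lemma young_split:
  fixes X Y :: real
  assumes "0 \<le> X" "0 \<le> Y" "2 < P"
  shows "X * Y\<^sup>2 \<le> X powr (P / (P - 2)) + Y powr P"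
proof (cases "X = 0 \<or> Y = 0")
  case True
  then show ?thesis by auto
next
  case False
  then have p: "0 < X" "0 < Y" using assms by auto
  have "(X powr (P / (P - 2))) powr ((P - 2) / P) * (Y powr P) powr (2 / P) * 1 powr 0
    \<le> (P - 2) / P * X powr (P / (P - 2)) + 2 / P * Y powr P + 0 * 1"
    using p assms by (intro weighted_am_gm) (auto simp: field_simps)
  moreover have "(X powr (P / (P - 2))) powr ((P - 2) / P) = X" using p assms by (simp add: powr_powr)
  moreover have "(Y powr P) powr (2 / P) = Y\<^sup>2" using p assms by (simp add: powr_powr powr_numeral)
  ultimately have "X * Y\<^sup>2 \<le> (P - 2) / P * X powr (P / (P - 2)) + 2 / P * Y powr P" by simp
  also have "\<dots> \<le> 1 * X powr (P / (P - 2)) + 1 * Y powr P"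
    using assms by (intro add_mono mult_right_mono) auto
  finally show ?thesis by simp
qed

context fns_kernel
begin

text \<open>The condition \<theta> P/(P - 2) < 1 says \<theta> < 1 - 2/P: after
  \<open>young_split\<close> the singular factor is integrable, with a bound uniform in t. The
  quotient \<open>h s / \<kappa>\<close> will bound the norm of a solution at time s.\<close>

lemma time_mass:
  assumes h [measurable]: "h \<in> borel_measurable borel" and h0: "\<And>s. 0 \<le> h s"
    and P: "2 < P" "\<theta> * (P / (P - 2)) < 1" and \<kappa>: "0 < \<kappa>"
    and fin: "(\<integral>\<^sup>+s. indicator {0<..<T} s * ennreal (h s powr P) \<partial>lborel) < \<infinity>"
    and T: "T \<le> 1"
  shows "\<exists>M>0. \<forall>t. 0 < t \<longrightarrow> t < T \<longrightarrow>
    (\<integral>\<^sup>+s. indicator {0<..<t} s * ennreal (bil_const * (t - s) powr - \<theta> * (h s / \<kappa> * (h s / \<kappa>))) \<partial>lborel) \<le> ennreal M"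
proof -
  obtain K where K: "0 \<le> K" "(\<integral>\<^sup>+s. indicator {0<..<T} s * ennreal (h s powr P) \<partial>lborel) = ennreal K"
    using fin by (cases "\<integral>\<^sup>+s. indicator {0<..<T} s * ennreal (h s powr P) \<partial>lborel") auto
  define \<sigma> where "\<sigma> = \<theta> * (P / (P - 2))"
  have \<sigma>: "0 \<le> \<sigma>" "\<sigma> < 1" using theta P by (auto simp: \<sigma>_def)
  define m where "m = bil_const / (\<kappa> * \<kappa>)"
  have m: "0 < m" using bil_const \<kappa> by (simp add: m_def)
  define M where "M = m * (1 / (1 - \<sigma>) + K)"
  have M: "0 < M" using m \<sigma> K by (auto simp: M_def intro!: mult_pos_pos add_pos_nonneg)
  have "(\<integral>\<^sup>+s. indicator {0<..<t} s * ennreal (bil_const * (t - s) powr - \<theta> * (h s / \<kappa> * (h s / \<kappa>))) \<partial>lborel) \<le> ennreal M"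
    if t: "0 < t" "t < T" for t
  proof -
    have "(\<integral>\<^sup>+s. indicator {0<..<t} s * ennreal (bil_const * (t - s) powr - \<theta> * (h s / \<kappa> * (h s / \<kappa>))) \<partial>lborel)
      \<le> (\<integral>\<^sup>+s. ennreal m * (indicator {0<..<t} s * ennreal ((t - s) powr - \<sigma>) + indicator {0<..<T} s * ennreal (h s powr P)) \<partial>lborel)"
    proof (intro nn_integral_mono)
      fix s
      show "indicator {0<..<t} s * ennreal (bil_const * (t - s) powr - \<theta> * (h s / \<kappa> * (h s / \<kappa>)))
        \<le> ennreal m * (indicator {0<..<t} s * ennreal ((t - s) powr - \<sigma>) + indicator {0<..<T} s * ennreal (h s powr P))"
      proof (cases "0 < s \<and> s < t")
        case True
        have "(t - s) powr - \<theta> * (h s)\<^sup>2 \<le> ((t - s) powr - \<theta>) powr (P / (P - 2)) + h s powr P"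
          using h0 P by (intro young_split) auto
        also have "((t - s) powr - \<theta>) powr (P / (P - 2)) = (t - s) powr - \<sigma>"
          by (simp add: powr_powr \<sigma>_def)
        finally have "m * ((t - s) powr - \<theta> * (h s)\<^sup>2) \<le> m * ((t - s) powr - \<sigma> + h s powr P)"
          using m by (intro mult_left_mono) auto
        moreover have "bil_const * (t - s) powr - \<theta> * (h s / \<kappa> * (h s / \<kappa>)) = m * ((t - s) powr - \<theta> * (h s)\<^sup>2)"
          by (simp add: m_def power2_eq_square)
        ultimately have "ennreal (bil_const * (t - s) powr - \<theta> * (h s / \<kappa> * (h s / \<kappa>))) \<le> ennreal m * (ennreal ((t - s) powr - \<sigma>) + ennreal (h s powr P))"
          using m by (simp add: ennreal_mult[symmetric] ennreal_plus[symmetric] ennreal_leI del: ennreal_plus)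
        then show ?thesis using True t by simp
      qed auto
    qed
    also have "\<dots> = ennreal m * ((\<integral>\<^sup>+s. indicator {0<..<t} s * ennreal ((t - s) powr - \<sigma>) \<partial>lborel) + ennreal K)"
      unfolding K(2)[symmetric] by (simp add: nn_integral_cmult nn_integral_add)
    also have "\<dots> \<le> ennreal m * (ennreal (1 / (1 - \<sigma>)) + ennreal K)"
    proof (intro mult_left_mono add_right_mono)
      have "(\<integral>\<^sup>+s. indicator {0<..<t} s * ennreal ((t - s) powr - \<sigma>) \<partial>lborel) \<le> ennreal (t powr (1 - \<sigma>) / (1 - \<sigma>))"
        using \<sigma> t by (intro nn_integral_singular_time) auto
      also have "\<dots> \<le> ennreal (1 / (1 - \<sigma>))"
        using \<sigma> t T by (intro ennreal_leI divide_right_mono powr_le1) auto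
      finally show "(\<integral>\<^sup>+s. indicator {0<..<t} s * ennreal ((t - s) powr - \<sigma>) \<partial>lborel) \<le> ennreal (1 / (1 - \<sigma>))" .
    qed simp
    also have "\<dots> = ennreal M" using m \<sigma> K by (simp add: M_def ennreal_mult[symmetric] ennreal_plus[symmetric] del: ennreal_plus)
    finally show ?thesis .
  qed
  then show ?thesis using M by blast
qed

text \<open>One use of the integral inequality is enough: the norm of V, a priori only integrable to
  a power in time, enters the right side through \<open>mass\<close>, which is uniform in t.\<close>

lemma solution_bounded:
  fixes V L :: "real \<Rightarrow> real^3 \<Rightarrow> ennreal"
  assumes T: "T < 1" and V [measurable]: "(\<lambda>z. V (fst z) (snd z)) \<in> borel_measurable (borel \<Otimes>\<^sub>M borel)"
    and L [measurable]: "(\<lambda>z. L (fst z) (snd z)) \<in> borel_measurable (borel \<Otimes>\<^sub>M borel)"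
    and R0: "0 < R0" and L1: "\<And>t. 0 < t \<Longrightarrow> t < T \<Longrightarrow> modg (\<lambda>x. ennreal (1 / R0) * L t x) \<le> 1"
    and M: "0 < M" and n [measurable]: "n \<in> borel_measurable borel" and n0: "\<And>s. 0 < n s"
    and mass: "\<And>t. 0 < t \<Longrightarrow> t < T \<Longrightarrow> (\<integral>\<^sup>+s. indicator {0<..<t} s * ennreal (bil_const * (t - s) powr - \<theta> * (n s * n s)) \<partial>lborel) \<le> ennreal M"
    and V1: "AE s in lborel. 0 < s \<and> s < T \<longrightarrow> modg (\<lambda>y. ennreal (1 / n s) * V s y) \<le> 1"
    and le: "AE t in lborel. 0 < t \<and> t < T \<longrightarrow> (AE x in lborel. V t x \<le> L t x + Bil V V t x)"
  shows "\<exists>R>0. AE t in lborel. 0 < t \<and> t < T \<longrightarrow> modg (\<lambda>x. ennreal (1 / R) * V t x) \<le> 1"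
proof -
  define r where "r = max R0 M"
  have r: "0 < r" "R0 \<le> r" "M \<le> r" using R0 by (auto simp: r_def)
  have "AE t in lborel. 0 < t \<and> t < T \<longrightarrow> modg (\<lambda>x. ennreal (1 / (4 * r)) * V t x) \<le> 1"
    using le
  proof eventually_elim
    case (elim t)
    show ?case
    proof
      assume t: "0 < t \<and> t < T"
      have [measurable]: "L t \<in> borel_measurable borel" using measurable_section_snd[OF L] by simp
      have "modg (\<lambda>x. ennreal (1 / M) * Bil V V t x) \<le> 1"
        using t T M n0 mass V1 by (intro bil_bound[where u=n and v=n]) (auto elim!: eventually_mono)
      then have "modg (\<lambda>x. ennreal (1 / r) * Bil V V t x) \<le> 1" using modg_reciprocal_mono[OF M r(3)] by blast
      moreover have "modg (\<lambda>x. ennreal (1 / r) * L t x) \<le> 1" using modg_reciprocal_mono[OF R0 r(2)] L1 t by blast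
      ultimately have *: "modg (\<lambda>x. ennreal (1/4) * (ennreal (1 / r) * L t x + ennreal (1 / r) * Bil V V t x)) \<le> 1"
        by (intro modg_add) auto
      have e: "ennreal (1/4) * (ennreal (1 / r) * L t x + ennreal (1 / r) * Bil V V t x) = ennreal (1 / (4 * r)) * (L t x + Bil V V t x)" for x
        using r by (simp add: distrib_left mult.assoc[symmetric] ennreal_mult[symmetric])
      have "AE x in lborel. V t x \<le> L t x + Bil V V t x" using elim t by blast
      then have "AE x in lborel. ennreal (1 / (4 * r)) * V t x \<le> ennreal (1 / (4 * r)) * (L t x + Bil V V t x)"
        by (auto elim!: eventually_mono intro!: mult_left_mono)
      from modg_mono_AE[OF this] show "modg (\<lambda>x. ennreal (1 / (4 * r)) * V t x) \<le> 1"
        using * unfolding e by (rule order_trans)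
    qed
  qed
  then show ?thesis using r by (intro exI[of _ "4 * r"]) auto
qed

text \<open>The bound w_n(t) = R 2^(-n) exp(l t) for \<open>D\<close> becomes w_(n+1) for
  \<open>Bil S D\<close>: the exponential weight contributes l^(-\<gamma>), and l makes the total
  factor 1/2. Thus \<open>D\<close> lies below every w_n and \<open>modg_zero_AE\<close> applies, on
  the whole interval at once.\<close>

lemma difference_zero:
  fixes S D :: "real \<Rightarrow> real^3 \<Rightarrow> ennreal"
  assumes T: "T < 1" and S [measurable]: "(\<lambda>z. S (fst z) (snd z)) \<in> borel_measurable (borel \<Otimes>\<^sub>M borel)"
    and D [measurable]: "(\<lambda>z. D (fst z) (snd z)) \<in> borel_measurable (borel \<Otimes>\<^sub>M borel)"
    and R: "0 < R" and S1: "AE t in lborel. 0 < t \<and> t < T \<longrightarrow> modg (\<lambda>x. ennreal (1 / R) * S t x) \<le> 1"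
    and D1: "AE t in lborel. 0 < t \<and> t < T \<longrightarrow> modg (\<lambda>x. ennreal (1 / R) * D t x) \<le> 1"
    and le: "AE t in lborel. 0 < t \<and> t < T \<longrightarrow> (AE x in lborel. D t x \<le> Bil S D t x)"
  shows "AE t in lborel. 0 < t \<and> t < T \<longrightarrow> (AE x in lborel. D t x = 0)"
proof -
  \<comment> \<open>Half of the distance from \<theta> to 1, so that the strengthened singularity
    \<theta> + \<gamma> remains integrable.\<close>
  define \<gamma> where "\<gamma> = (1 - \<theta>) / 2"
  have \<gamma>: "0 < \<gamma>" "\<gamma> \<le> 1" "\<theta> + \<gamma> < 1" "1 - (\<theta> + \<gamma>) = \<gamma>" using theta by (auto simp: \<gamma>_def field_simps)
  \<comment> \<open>With l^\<gamma> = Q, the constant R bil_const/\<gamma> is cancelled up to the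
    factor 1/2.\<close>
  define Q where "Q = 2 * R * bil_const / \<gamma>"
  have Q: "0 < Q" using R bil_const \<gamma> by (simp add: Q_def)
  define l where "l = Q powr (1 / \<gamma>)"
  have l: "0 < l" "l powr \<gamma> = Q" using Q \<gamma> by (auto simp: l_def powr_powr)
  define w where "w n t = R * (1/2) ^ n * exp (l * t)" for n t
  have w0: "0 < w n t" for n t using R by (simp add: w_def)
  have w_meas [measurable]: "w n \<in> borel_measurable borel" for n unfolding w_def[abs_def] by measurable
  have mass: "(\<integral>\<^sup>+s. indicator {0<..<t} s * ennreal (bil_const * (t - s) powr - \<theta> * (R * w n s)) \<partial>lborel) \<le> ennreal (w (Suc n) t)"
    if t: "0 < t" "t < T" for t n
  proof -
    define k where "k = bil_const * R * w n t * l powr - \<gamma>"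
    have k: "0 < k" using bil_const R w0 l by (simp add: k_def)
    have "(\<integral>\<^sup>+s. indicator {0<..<t} s * ennreal (bil_const * (t - s) powr - \<theta> * (R * w n s)) \<partial>lborel)
       \<le> (\<integral>\<^sup>+s. ennreal k * (indicator {0<..<t} s * ennreal ((t - s) powr - (\<theta> + \<gamma>))) \<partial>lborel)"
    proof (intro nn_integral_mono)
      fix s
      show "indicator {0<..<t} s * ennreal (bil_const * (t - s) powr - \<theta> * (R * w n s))
         \<le> ennreal k * (indicator {0<..<t} s * ennreal ((t - s) powr - (\<theta> + \<gamma>)))"
      proof (cases "0 < s \<and> s < t")
        case True
        have "w n s = w n t * exp (- (l * (t - s)))" by (simp add: w_def algebra_simps exp_add[symmetric] exp_diff)
        also have "exp (- (l * (t - s))) \<le> (l * (t - s)) powr - \<gamma>"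
          using True l \<gamma> by (intro exp_minus_le_powr) auto
        also have "\<dots> = l powr - \<gamma> * (t - s) powr - \<gamma>" using True l by (simp add: powr_mult)
        finally have "w n s \<le> w n t * (l powr - \<gamma> * (t - s) powr - \<gamma>)" using w0[of n t] by (simp add: mult_left_mono)
        then have "bil_const * (t - s) powr - \<theta> * (R * w n s) \<le> bil_const * (t - s) powr - \<theta> * (R * (w n t * (l powr - \<gamma> * (t - s) powr - \<gamma>)))"
          using bil_const R by (intro mult_left_mono) auto
        also have "\<dots> = k * ((t - s) powr - \<theta> * (t - s) powr - \<gamma>)" by (simp add: k_def mult_ac)
        also have "(t - s) powr - \<theta> * (t - s) powr - \<gamma> = (t - s) powr - (\<theta> + \<gamma>)" by (simp add: powr_add[symmetric])
        finally show ?thesis using True k by (simp add: ennreal_mult[symmetric] ennreal_leI)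
      qed simp
    qed
    also have "\<dots> = ennreal k * (\<integral>\<^sup>+s. indicator {0<..<t} s * ennreal ((t - s) powr - (\<theta> + \<gamma>)) \<partial>lborel)"
      by (rule nn_integral_cmult) measurable
    also have "\<dots> \<le> ennreal k * ennreal (t powr (1 - (\<theta> + \<gamma>)) / (1 - (\<theta> + \<gamma>)))"
      using theta \<gamma> t by (intro mult_left_mono nn_integral_singular_time) auto
    also have "\<dots> \<le> ennreal k * ennreal (1 / \<gamma>)"
    proof (intro mult_left_mono ennreal_leI)
      have "t powr \<gamma> \<le> 1" using t T \<gamma> by (intro powr_le1) auto
      then show "t powr (1 - (\<theta> + \<gamma>)) / (1 - (\<theta> + \<gamma>)) \<le> 1 / \<gamma>"
        unfolding \<gamma>(4) using \<gamma>(1) by (intro divide_right_mono) auto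
    qed simp
    also have "\<dots> = ennreal (w (Suc n) t)"
    proof -
      have "k * (1 / \<gamma>) = w n t * (bil_const * R / \<gamma> / Q)" using l by (simp add: k_def powr_minus_divide mult_ac)
      also have "bil_const * R / \<gamma> / Q = 1/2" using R bil_const \<gamma> by (simp add: Q_def)
      finally have "k * (1 / \<gamma>) = w (Suc n) t" by (simp add: w_def)
      moreover have "ennreal k * ennreal (1 / \<gamma>) = ennreal (k * (1 / \<gamma>))"
        by (rule ennreal_mult[symmetric]) (use k \<gamma> in auto)
      ultimately show ?thesis by simp
    qed
    finally show ?thesis .
  qed
  have claim: "AE t in lborel. 0 < t \<and> t < T \<longrightarrow> modg (\<lambda>x. ennreal (1 / w n t) * D t x) \<le> 1" for n
  proof (induction n)
    case 0
    show ?case using D1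
    proof eventually_elim
      case (elim t)
      then show ?case using modg_reciprocal_mono[OF R, of "w 0 t" "D t"] R l by (auto simp: w_def)
    qed
  next
    case (Suc n)
    show ?case using le
    proof eventually_elim
      case (elim t)
      show ?case
      proof
        assume t: "0 < t \<and> t < T"
        have b: "modg (\<lambda>x. ennreal (1 / w (Suc n) t) * Bil S D t x) \<le> 1"
        proof (rule bil_bound[where u="\<lambda>_. R" and v="w n"])
          show "AE s in lborel. 0 < s \<and> s < t \<longrightarrow> modg (\<lambda>y. ennreal (1 / R) * S s y) \<le> 1"
            by (rule eventually_mono[OF S1]) (use t in auto)
          show "AE s in lborel. 0 < s \<and> s < t \<longrightarrow> modg (\<lambda>y. ennreal (1 / w n s) * D s y) \<le> 1"
            by (rule eventually_mono[OF Suc]) (use t in auto)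
        qed (use t T R w0 mass in auto)
        have "AE x in lborel. ennreal (1 / w (Suc n) t) * D t x \<le> ennreal (1 / w (Suc n) t) * Bil S D t x"
          using elim t by (auto elim!: eventually_mono intro!: mult_left_mono)
        from order_trans[OF modg_mono_AE[OF this] b] show "modg (\<lambda>x. ennreal (1 / w (Suc n) t) * D t x) \<le> 1" .
      qed
    qed
  qed
  have "AE t in lborel. \<forall>n. 0 < t \<and> t < T \<longrightarrow> modg (\<lambda>x. ennreal (1 / w n t) * D t x) \<le> 1"
    using claim unfolding AE_all_countable by blast
  then show ?thesis
  proof eventually_elim
    case (elim t)
    show ?case
    proof
      assume t: "0 < t \<and> t < T"
      have [measurable]: "D t \<in> borel_measurable borel" using measurable_section_snd[OF D] by simp
      have "AE x in lborel. ennreal (1 / w 0 t) * D t x = 0"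
      proof (rule modg_zero_AE)
        fix n :: nat
        have "ennreal (2 ^ n) * ennreal (1 / w 0 t) = ennreal (1 / w n t)"
        proof -
          have "ennreal (2 ^ n) * ennreal (1 / w 0 t) = ennreal (2 ^ n * (1 / w 0 t))"
            by (rule ennreal_mult[symmetric]) (auto simp: w_def R less_imp_le)
          also have "2 ^ n * (1 / w 0 t) = 1 / w n t" using R by (simp add: w_def power_one_over)
          finally show ?thesis .
        qed
        then show "modg (\<lambda>x. ennreal (2 ^ n) * (ennreal (1 / w 0 t) * D t x)) \<le> 1"
          using elim t by (simp only: mult.assoc[symmetric])
      qed measurable
      then show "AE x in lborel. D t x = 0"
        using w0[of 0 t] by (auto elim!: eventually_mono)
    qed
  qed
qed

end

section \<open>Borel representatives\<close>

lemma completion_AE_measurable: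
  assumes g: "g \<in> M \<rightarrow>\<^sub>M N" and ae: "AE x in M. f x = g x" and sp: "f \<in> space M \<rightarrow> space N"
  shows "f \<in> completion M \<rightarrow>\<^sub>M N"
proof (rule measurableI)
  show "x \<in> space (completion M) \<Longrightarrow> f x \<in> space N" for x using sp by auto
  fix A assume A: "A \<in> sets N"
  have "g -` A \<inter> space M \<in> sets (completion M)" using measurable_sets[OF g A] by auto
  moreover have "AE x in completion M. x \<in> g -` A \<inter> space M \<longleftrightarrow> x \<in> f -` A \<inter> space M"
    using AE_completion[OF ae] by eventually_elim auto
  ultimately show "f -` A \<inter> space (completion M) \<in> sets (completion M)"
    using completion.in_sets_AE[of "g -` A \<inter> space M" "f -` A \<inter> space M" M] by auto
qed

lemma ex_borel_version_vec:
  fixes f :: "'a \<Rightarrow> real^3"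
  assumes f: "f \<in> borel_measurable (completion M)"
  shows "\<exists>f'\<in>borel_measurable M. AE x in M. f x = f' x"
proof -
  have "\<exists>h\<in>borel_measurable M. AE x in M. f x $ i = h x" for i
    using f by (intro completion_ex_borel_measurable_real) measurable
  then obtain h where h: "\<And>i. h i \<in> borel_measurable M" "\<And>i. AE x in M. f x $ i = h i x" by metis
  have "AE x in M. \<forall>i. f x $ i = h i x" using h(2) by (simp add: AE_all_countable)
  then have "AE x in M. f x = (\<chi> i. h i x)" by eventually_elim (simp add: vec_eq_iff)
  then show ?thesis by (intro bexI[of _ "\<lambda>x. \<chi> i. h i x"] borel_measurable_vec_lambda3 h(1))
qed

lemma borel_version_on_vec:
  fixes f :: "'a::euclidean_space \<Rightarrow> real^3"
  assumes "f \<in> borel_measurable (lebesgue_on S)" "S \<in> sets borel"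
  shows "\<exists>f'\<in>borel_measurable borel. AE x in lborel. x \<in> S \<longrightarrow> f x = f' x"
proof -
  have "(\<lambda>x. indicator S x *\<^sub>R f x) \<in> borel_measurable lebesgue"
    using assms by (subst (asm) borel_measurable_restrict_space_iff) auto
  from ex_borel_version_vec[OF this] obtain f' where f': "f' \<in> borel_measurable lborel" "AE x in lborel. indicator S x *\<^sub>R f x = f' x"
    by blast
  from f'(2) have "AE x in lborel. x \<in> S \<longrightarrow> f x = f' x" by eventually_elim auto
  then show ?thesis using f'(1) by auto
qed

lemma borel_version_on_real:
  fixes f :: "'a::euclidean_space \<Rightarrow> real"
  assumes "f \<in> borel_measurable (lebesgue_on S)" "S \<in> sets borel"
  shows "\<exists>f'\<in>borel_measurable borel. AE x in lborel. x \<in> S \<longrightarrow> f x = f' x"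
proof -
  have "(\<lambda>x. indicator S x *\<^sub>R f x) \<in> borel_measurable lebesgue"
    using assms by (subst (asm) borel_measurable_restrict_space_iff) auto
  from completion_ex_borel_measurable_real[OF this] obtain f' where f': "f' \<in> borel_measurable lborel" "AE x in lborel. indicator S x *\<^sub>R f x = f' x"
    by blast
  from f'(2) have "AE x in lborel. x \<in> S \<longrightarrow> f x = f' x" by eventually_elim auto
  then show ?thesis using f'(1) by auto
qed

lemma AE_lebesgue_on_iff:
  "S \<in> sets borel \<Longrightarrow> (AE x in lebesgue_on S. P x) \<longleftrightarrow> (AE x in lborel. x \<in> S \<longrightarrow> P x)"
  by (subst AE_restrict_space_iff) (auto simp: AE_completion_iff)

lemma AE_lebesgue_on_prod_iff:
  fixes P :: "real \<Rightarrow> real^3 \<Rightarrow> bool"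
  assumes "I \<in> sets borel"
  shows "(AE (t, x) in lebesgue_on (I \<times> UNIV). P t x) \<longleftrightarrow> (AE z in lborel \<Otimes>\<^sub>M lborel. fst z \<in> I \<longrightarrow> P (fst z) (snd z))"
proof -
  have "I \<times> (UNIV :: (real^3) set) \<in> sets borel"
    using assms by (subst borel_prod[symmetric]) auto
  then show ?thesis
    unfolding lborel_prod by (subst AE_lebesgue_on_iff) (simp_all add: case_prod_beta mem_Times_iff)
qed

text \<open>Elements of the mixed space are Lebesgue measurable, whereas Tonelli and measurable
  sections are used for Borel functions on the product. The slicewise statement is recorded as well,
  because the convolutions at a fixed time see only one slice.\<close>

lemma joint_borel_version:
  fixes f :: "real \<Rightarrow> real^3 \<Rightarrow> real^3"
  assumes "(\<lambda>(t, x). f t x) \<in> borel_measurable (lebesgue_on (I \<times> UNIV))" "I \<in> sets borel"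
  shows "\<exists>f'. (\<lambda>z. f' (fst z) (snd z)) \<in> borel_measurable (borel \<Otimes>\<^sub>M borel) \<and>
    (AE z in lborel \<Otimes>\<^sub>M lborel. fst z \<in> I \<longrightarrow> f (fst z) (snd z) = f' (fst z) (snd z)) \<and>
    (AE t in lborel. t \<in> I \<longrightarrow> (AE x in lborel. f t x = f' t x))"
proof -
  have "I \<times> (UNIV :: (real^3) set) \<in> sets borel"
    using assms(2) by (subst borel_prod[symmetric]) auto
  from borel_version_on_vec[OF assms(1) this] obtain F where F: "F \<in> borel_measurable borel"
    "AE z in lborel. z \<in> I \<times> UNIV \<longrightarrow> (case z of (t, x) \<Rightarrow> f t x) = F z" by blast
  define f' where "f' t x = F (t, x)" for t x
  have 1: "(\<lambda>z. f' (fst z) (snd z)) \<in> borel_measurable (borel \<Otimes>\<^sub>M borel)"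
    using F(1) by (simp add: f'_def borel_prod)
  have 2: "AE z in lborel \<Otimes>\<^sub>M lborel. fst z \<in> I \<longrightarrow> f (fst z) (snd z) = f' (fst z) (snd z)"
    using F(2) unfolding lborel_prod by eventually_elim (auto simp: f'_def)
  have "AE t in lborel. AE x in lborel. t \<in> I \<longrightarrow> f t x = f' t x"
    using lborel_pair.AE_pair[OF 2] by simp
  then have 3: "AE t in lborel. t \<in> I \<longrightarrow> (AE x in lborel. f t x = f' t x)"
    by eventually_elim auto
  show ?thesis using 1 2 3 by blast
qed

text \<open>Turns the integrals over an interval in \<open>mild_solution\<close> into Borel
  integrals over the line. The second claim holds without integrability, as both sides are then
  0.\<close>

lemma lebesgue_on_integral_version:
  fixes g g' :: "real \<Rightarrow> 'b::{banach, second_countable_topology}"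
  assumes [measurable]: "g' \<in> borel_measurable borel" and S [measurable]: "S \<in> sets borel"
    and ae: "AE s in lborel. s \<in> S \<longrightarrow> g s = g' s"
  shows "integrable (lebesgue_on S) g \<longleftrightarrow> integrable lborel (\<lambda>s. indicator S s *\<^sub>R g' s)"
    "(\<integral>s. g s \<partial>lebesgue_on S) = (\<integral>s. indicator S s *\<^sub>R g' s \<partial>lborel)"
proof -
  have Sl: "S \<inter> space lebesgue \<in> sets lebesgue" using S by auto
  have ae': "AE s in lborel. indicator S s *\<^sub>R g s = indicator S s *\<^sub>R g' s"
    using ae by eventually_elim (auto split: split_indicator)
  have m': "(\<lambda>s. indicator S s *\<^sub>R g' s) \<in> borel_measurable lborel" by measurable
  have m: "(\<lambda>s. indicator S s *\<^sub>R g s) \<in> borel_measurable lebesgue"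
    by (rule completion_AE_measurable[OF m' ae']) auto
  have m'': "(\<lambda>s. indicator S s *\<^sub>R g' s) \<in> borel_measurable lebesgue"
    using m' by (rule measurable_completion)
  show "integrable (lebesgue_on S) g \<longleftrightarrow> integrable lborel (\<lambda>s. indicator S s *\<^sub>R g' s)"
    unfolding integrable_restrict_space[OF Sl] integrable_completion[OF m', symmetric] set_integrable_def
    using AE_completion[OF ae'] m m'' by (intro integrable_cong_AE)
  show "(\<integral>s. g s \<partial>lebesgue_on S) = (\<integral>s. indicator S s *\<^sub>R g' s \<partial>lborel)"
    unfolding integral_restrict_space[OF Sl] integral_completion[OF m', symmetric] set_lebesgue_integral_def
    using AE_completion[OF ae'] m m'' by (intro integral_cong_AE)
qed

lemma has_conv_version:
  fixes v v' :: "real^3 \<Rightarrow> 'b::{banach, second_countable_topology}"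
  assumes G [measurable]: "G \<in> borel_measurable borel" and v' [measurable]: "v' \<in> borel_measurable borel"
    and ae: "AE y in lborel. v y = v' y"
  shows "has_conv G v x \<longleftrightarrow> integrable lborel (\<lambda>y. G (x - y) *\<^sub>R v' y)"
    "conv G v x = (\<integral>y. G (x - y) *\<^sub>R v' y \<partial>lborel)"
proof -
  have ae': "AE y in lborel. G (x - y) *\<^sub>R v y = G (x - y) *\<^sub>R v' y"
    using ae by eventually_elim simp
  have m': "(\<lambda>y. G (x - y) *\<^sub>R v' y) \<in> borel_measurable lborel" by measurable
  have m: "(\<lambda>y. G (x - y) *\<^sub>R v y) \<in> borel_measurable lebesgue"
    by (rule completion_AE_measurable[OF m' ae']) auto
  have m'': "(\<lambda>y. G (x - y) *\<^sub>R v' y) \<in> borel_measurable lebesgue"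
    using m' by (rule measurable_completion)
  show "has_conv G v x \<longleftrightarrow> integrable lborel (\<lambda>y. G (x - y) *\<^sub>R v' y)"
    unfolding has_conv_def integrable_completion[OF m', symmetric]
    using AE_completion[OF ae'] m m'' by (intro integrable_cong_AE)
  show "conv G v x = (\<integral>y. G (x - y) *\<^sub>R v' y \<partial>lborel)"
    unfolding conv_def integral_completion[OF m', symmetric]
    using AE_completion[OF ae'] m m'' by (intro integral_cong_AE)
qed

lemma vec3_expansion: "(\<chi> j. F j) = (\<Sum>j\<in>UNIV. F j *\<^sub>R axis j (1::real))"
  by (auto simp: vec_eq_iff axis_def if_distrib[of "\<lambda>y. _ * y"] cong: if_cong)

text \<open>Integrability of every component allows the sums to pass through the Bochner integral,
  whose default value 0 is not additive.\<close>

lemma oseen_conv_eq: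
  assumes v' [measurable]: "v' \<in> borel_measurable borel" and ae: "AE y in lborel. v y = v' y"
    and hc: "\<And>j h k. has_conv (oseen_kernel \<alpha> t j h k) (\<lambda>y. v y $ h * v y $ k) x"
  shows "integrable lborel (\<lambda>y. oseen_vec \<alpha> t (x - y) (v' y))"
    "oseen_conv \<alpha> t v x = (\<integral>y. oseen_vec \<alpha> t (x - y) (v' y) \<partial>lborel)"
proof -
  have ae2: "AE y in lborel. v y $ h * v y $ k = v' y $ h * v' y $ k" for h k
    using ae by eventually_elim simp
  have int: "integrable lborel (\<lambda>y. oseen_kernel \<alpha> t j h k (x - y) * (v' y $ h * v' y $ k))" for j h k
    using hc[of j h k] has_conv_version(1)[OF _ _ ae2[of h k], of "oseen_kernel \<alpha> t j h k" x] by simp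
  have cv: "conv (oseen_kernel \<alpha> t j h k) (\<lambda>y. v y $ h * v y $ k) x = (\<integral>y. oseen_kernel \<alpha> t j h k (x - y) * (v' y $ h * v' y $ k) \<partial>lborel)" for j h k
    using has_conv_version(2)[OF _ _ ae2[of h k], of "oseen_kernel \<alpha> t j h k" x] by simp
  have int1: "integrable lborel (\<lambda>y. \<Sum>h\<in>UNIV. \<Sum>k\<in>UNIV. oseen_kernel \<alpha> t j h k (x - y) * (v' y $ h * v' y $ k))" for j
    by (intro Bochner_Integration.integrable_sum int)
  have cvj: "(\<integral>y. (\<Sum>h\<in>UNIV. \<Sum>k\<in>UNIV. oseen_kernel \<alpha> t j h k (x - y) * (v' y $ h * v' y $ k)) \<partial>lborel)
     = (\<Sum>h\<in>UNIV. \<Sum>k\<in>UNIV. conv (oseen_kernel \<alpha> t j h k) (\<lambda>y. v y $ h * v y $ k) x)" for j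
    unfolding cv
    by (subst Bochner_Integration.integral_sum, intro Bochner_Integration.integrable_sum int)
       (intro sum.cong refl Bochner_Integration.integral_sum int)
  show "integrable lborel (\<lambda>y. oseen_vec \<alpha> t (x - y) (v' y))"
    unfolding oseen_vec_def vec3_expansion
    by (intro Bochner_Integration.integrable_sum integrable_scaleR_left int)
  have "(\<integral>y. oseen_vec \<alpha> t (x - y) (v' y) \<partial>lborel)
     = (\<Sum>j\<in>UNIV. (\<integral>y. (\<Sum>h\<in>UNIV. \<Sum>k\<in>UNIV. oseen_kernel \<alpha> t j h k (x - y) * (v' y $ h * v' y $ k)) \<partial>lborel) *\<^sub>R axis j 1)"
    unfolding oseen_vec_def vec3_expansion
    by (subst Bochner_Integration.integral_sum) (auto intro!: integrable_scaleR_left int1 simp: integral_scaleR_left[OF int1])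
  also have "\<dots> = (\<Sum>j\<in>UNIV. (\<Sum>h\<in>UNIV. \<Sum>k\<in>UNIV. conv (oseen_kernel \<alpha> t j h k) (\<lambda>y. v y $ h * v y $ k) x) *\<^sub>R axis j 1)"
    by (simp only: cvj)
  finally show "oseen_conv \<alpha> t v x = (\<integral>y. oseen_vec \<alpha> t (x - y) (v' y) \<partial>lborel)"
    unfolding oseen_conv_def vec3_expansion by simp
qed

section \<open>Norms and mild solutions in terms of the modular\<close>

locale fns_setting = fns_kernel +
  fixes q :: "real^3 \<Rightarrow> ennreal"
  assumes q_ge_1: "\<And>x. 1 \<le> q x" and g_recip: "\<And>x. g x = recip (q x)"
begin

lemma omega_eq_phi:
  assumes "0 \<le> s"
  shows "omega (q x) s = phi (g x) (ennreal s)"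
proof (cases "q x" rule: ennreal_finite_cases)
  case 1
  then show ?thesis using assms by (simp add: omega_def g_recip recip_def phi_zero_exponent)
next
  case (2 r)
  then have r: "1 \<le> r" using q_ge_1[of x] by simp
  have "g x = 1 / r" using 2 r by (simp add: g_recip recip_def inverse_ennreal divide_inverse)
  then show ?thesis using 2 r assms by (simp add: omega_def phi_pos_exponent)
qed

lemma modular_eq: "modular lebesgue q F = modg (\<lambda>x. ennreal (norm (F x)))"
  unfolding modular_def modg_def by (simp add: nn_integral_completion omega_eq_phi)

lemma modular_scaled: "0 < k \<Longrightarrow> modular lebesgue q (\<lambda>x. F x /\<^sub>R k) = modg (\<lambda>x. ennreal (1 / k) * ennreal (norm (F x)))"
  unfolding modular_eq by (simp add: ennreal_mult[symmetric] divide_inverse)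

lemma modg_cong_AE: "AE x in lborel. F x = F' x \<Longrightarrow> modg F = modg F'"
  by (intro antisym modg_mono_AE) (auto elim!: eventually_mono)

lemma var_norm_le:
  assumes "0 < k" "modg (\<lambda>x. ennreal (1 / k) * ennreal (norm (F x))) \<le> 1"
  shows "0 \<le> var_norm lebesgue q F" "var_norm lebesgue q F \<le> k"
proof -
  have k: "k \<in> {c. 0 < c \<and> modular lebesgue q (\<lambda>x. F x /\<^sub>R c) \<le> 1}"
    using assms by (simp add: modular_scaled)
  show "0 \<le> var_norm lebesgue q F" unfolding var_norm_def using k by (intro cInf_greatest) auto
  show "var_norm lebesgue q F \<le> k" unfolding var_norm_def
    using k by (intro cInf_lower bdd_belowI[of _ 0]) auto
qed

lemma var_Lp_modg:
  fixes F :: "real^3 \<Rightarrow> real^3"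
  assumes "F \<in> var_Lp lebesgue q"
  shows "\<exists>k>0. modg (\<lambda>x. ennreal (1 / k) * ennreal (norm (F x))) \<le> 1"
proof -
  from assms obtain c where F: "F \<in> borel_measurable lebesgue" and c: "0 < c" "modular lebesgue q (\<lambda>x. c *\<^sub>R F x) < \<infinity>"
    by (auto simp: var_Lp_def)
  from ex_borel_version_vec[OF F] obtain F' where F' [measurable]: "F' \<in> borel_measurable borel" "AE x in lborel. F x = F' x"
    by auto
  have eq: "modg (\<lambda>x. ennreal k * ennreal (norm (F x))) = modg (\<lambda>x. ennreal k * ennreal (norm (F' x)))" for k
    using F'(2) by (intro modg_cong_AE) (auto elim!: eventually_mono)
  have "modg (\<lambda>x. ennreal c * ennreal (norm (F' x))) < \<infinity>"
    using c eq[of c] by (simp add: modular_eq ennreal_mult)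
  then obtain N where N: "0 \<le> N" "modg (\<lambda>x. ennreal c * ennreal (norm (F' x))) = ennreal N"
    by (cases "modg (\<lambda>x. ennreal c * ennreal (norm (F' x)))") auto
  define M where "M = max 1 N"
  have M: "1 \<le> M" by (simp add: M_def)
  have "modg (\<lambda>x. ennreal (1 / M) * (ennreal c * ennreal (norm (F' x)))) \<le> 1"
    using N by (intro modg_scale_le_1) (auto simp: M_def ennreal_leI)
  moreover have "ennreal (1 / M) * (ennreal c * ennreal (norm (F' x))) = ennreal (1 / (M / c)) * ennreal (norm (F' x))" for x
    using M c by (simp add: mult.assoc[symmetric] ennreal_mult[symmetric])
  ultimately have "modg (\<lambda>x. ennreal (1 / (M / c)) * ennreal (norm (F' x))) \<le> 1" by simp
  then have "modg (\<lambda>x. ennreal (1 / (M / c)) * ennreal (norm (F x))) \<le> 1" by (simp only: eq)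
  then show ?thesis using M c by (intro exI[of _ "M / c"]) auto
qed

text \<open>Strict inequality avoids the question whether the infimum is attained; the first
  assumption excludes an infimum over the empty set.\<close>

lemma var_norm_less:
  fixes F :: "real^3 \<Rightarrow> real^3"
  assumes "\<exists>k>0. modg (\<lambda>x. ennreal (1 / k) * ennreal (norm (F x))) \<le> 1" "var_norm lebesgue q F < k"
  shows "modg (\<lambda>x. ennreal (1 / k) * ennreal (norm (F x))) \<le> 1"
proof -
  let ?S = "{c. 0 < c \<and> modular lebesgue q (\<lambda>x. F x /\<^sub>R c) \<le> 1}"
  have "?S \<noteq> {}" using assms(1) by (auto simp: modular_scaled)
  moreover have "bdd_below ?S" by (intro bdd_belowI[of _ 0]) auto
  ultimately obtain c where c: "c \<in> ?S" "c < k"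
    using assms(2) unfolding var_norm_def by (auto simp: cInf_less_iff)
  then show ?thesis by (intro modg_reciprocal_mono[of c k]) (auto simp: modular_scaled)
qed

text \<open>\<open>n\<close> is a Borel version of the norm in time, with arbitrary values off I.
  The unit-ball bound is given for every r above |n t| because the norm is an infimum; |n| + 1 is
  such an r for the force, and |n| + 1/k for solutions.\<close>

lemma mixed_LpE:
  assumes "v \<in> mixed_Lp I p q" and I [measurable]: "I \<in> sets borel"
  obtains v' n k where "(\<lambda>z. v' (fst z) (snd z)) \<in> borel_measurable (borel \<Otimes>\<^sub>M borel)"
    "AE z in lborel \<Otimes>\<^sub>M lborel. fst z \<in> I \<longrightarrow> v (fst z) (snd z) = v' (fst z) (snd z)"
    "AE t in lborel. t \<in> I \<longrightarrow> (AE x in lborel. v t x = v' t x)"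
    "n \<in> borel_measurable borel" "0 < k"
    "AE t in lborel. t \<in> I \<longrightarrow> (\<forall>r. \<bar>n t\<bar> < r \<longrightarrow> modg (\<lambda>x. ennreal (1 / r) * ennreal (norm (v' t x))) \<le> 1)"
    "(\<integral>\<^sup>+t. indicator I t * omega (p t) (norm (k * n t)) \<partial>lborel) < \<infinity>"
proof -
  from assms have m: "(\<lambda>(t, x). v t x) \<in> borel_measurable (lebesgue_on (I \<times> UNIV))"
    and vL: "AE t in lebesgue_on I. v t \<in> var_Lp lebesgue q"
    and N: "(\<lambda>t. var_norm lebesgue q (v t)) \<in> var_Lp (lebesgue_on I) p"
    by (auto simp: mixed_Lp_def)
  from joint_borel_version[OF m I] obtain v' where v': "(\<lambda>z. v' (fst z) (snd z)) \<in> borel_measurable (borel \<Otimes>\<^sub>M borel)"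
    "AE z in lborel \<Otimes>\<^sub>M lborel. fst z \<in> I \<longrightarrow> v (fst z) (snd z) = v' (fst z) (snd z)"
    "AE t in lborel. t \<in> I \<longrightarrow> (AE x in lborel. v t x = v' t x)" by blast
  from N obtain k where Nm: "(\<lambda>t. var_norm lebesgue q (v t)) \<in> borel_measurable (lebesgue_on I)"
    and k: "0 < k" "modular (lebesgue_on I) p (\<lambda>t. k *\<^sub>R var_norm lebesgue q (v t)) < \<infinity>"
    by (auto simp: var_Lp_def)
  from borel_version_on_real[OF Nm I] obtain n where n: "n \<in> borel_measurable borel"
    "AE t in lborel. t \<in> I \<longrightarrow> var_norm lebesgue q (v t) = n t" by blast
  have vL': "AE t in lborel. t \<in> I \<longrightarrow> v t \<in> var_Lp lebesgue q"
    using vL AE_lebesgue_on_iff[OF I] by simp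
  have 1: "AE t in lborel. t \<in> I \<longrightarrow> (\<forall>r. \<bar>n t\<bar> < r \<longrightarrow> modg (\<lambda>x. ennreal (1 / r) * ennreal (norm (v' t x))) \<le> 1)"
    using vL' n(2) v'(3)
  proof eventually_elim
    case (elim t)
    show ?case
    proof (intro impI allI)
      fix r assume t: "t \<in> I" and r: "\<bar>n t\<bar> < r"
      have "modg (\<lambda>x. ennreal (1 / r) * ennreal (norm (v t x))) \<le> 1"
        using elim t r by (intro var_norm_less var_Lp_modg) auto
      moreover have "modg (\<lambda>x. ennreal (1 / r) * ennreal (norm (v t x))) = modg (\<lambda>x. ennreal (1 / r) * ennreal (norm (v' t x)))"
        using elim t by (intro modg_cong_AE) (auto elim!: eventually_mono)
      ultimately show "modg (\<lambda>x. ennreal (1 / r) * ennreal (norm (v' t x))) \<le> 1" by simp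
    qed
  qed
  have "modular (lebesgue_on I) p (\<lambda>t. k *\<^sub>R var_norm lebesgue q (v t)) =
      (\<integral>\<^sup>+t. omega (p t) (norm (k * var_norm lebesgue q (v t))) * indicator I t \<partial>lborel)"
    unfolding modular_def using I by (subst nn_integral_restrict_space) (auto simp: nn_integral_completion)
  also have "\<dots> = (\<integral>\<^sup>+t. indicator I t * omega (p t) (norm (k * n t)) \<partial>lborel)"
    using n(2) by (intro nn_integral_cong_AE) (auto elim!: eventually_mono split: split_indicator)
  finally have 2: "(\<integral>\<^sup>+t. indicator I t * omega (p t) (norm (k * n t)) \<partial>lborel) < \<infinity>" using k by simp
  show ?thesis by (rule that[OF v' n(1) k(1) 1 2])
qed

lemma conv_heat_eq:
  assumes [measurable]: "F' \<in> borel_measurable borel" and "AE y in lborel. F y = F' y"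
  shows "conv (heat_kernel \<alpha> t) F x = heat0 F' t x"
  using assms by (simp add: has_conv_version heat0_def)

lemma oseen_conv_le:
  assumes v' [measurable]: "v' \<in> borel_measurable borel" and ae: "AE y in lborel. v y = v' y" and t: "0 < t"
    and hc: "\<And>j h k. has_conv (oseen_kernel \<alpha> t j h k) (\<lambda>y. v y $ h * v y $ k) x"
  shows "ennreal (norm (oseen_conv \<alpha> t v x)) \<le> (\<integral>\<^sup>+y. oseen_maj t (x - y) * (ennreal (norm (v' y)) * ennreal (norm (v' y))) \<partial>lborel)"
  unfolding oseen_conv_eq(2)[OF v' ae hc]
  by (rule order_trans[OF ennreal_norm_integral_le]) (intro nn_integral_mono ennreal_oseen_vec_le t)

lemma oseen_conv_diff_le:
  assumes v' [measurable]: "v' \<in> borel_measurable borel" "w' \<in> borel_measurable borel"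
    and ae: "AE y in lborel. v y = v' y" "AE y in lborel. w y = w' y" and t: "0 < t"
    and hc: "\<And>j h k. has_conv (oseen_kernel \<alpha> t j h k) (\<lambda>y. v y $ h * v y $ k) x"
      "\<And>j h k. has_conv (oseen_kernel \<alpha> t j h k) (\<lambda>y. w y $ h * w y $ k) x"
  shows "ennreal (norm (oseen_conv \<alpha> t v x - oseen_conv \<alpha> t w x)) \<le>
    (\<integral>\<^sup>+y. oseen_maj t (x - y) * ((ennreal (norm (v' y)) + ennreal (norm (w' y))) * ennreal (norm (v' y - w' y))) \<partial>lborel)"
proof -
  note 1 = oseen_conv_eq[OF v'(1) ae(1) hc(1)] and 2 = oseen_conv_eq[OF v'(2) ae(2) hc(2)]
  have eq: "oseen_conv \<alpha> t v x - oseen_conv \<alpha> t w x = (\<integral>y. oseen_vec \<alpha> t (x - y) (v' y) - oseen_vec \<alpha> t (x - y) (w' y) \<partial>lborel)"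
    unfolding 1(2) 2(2) using 1(1) 2(1) by simp
  show ?thesis unfolding eq
    by (rule order_trans[OF ennreal_norm_integral_le]) (intro nn_integral_mono ennreal_oseen_vec_diff_le t)
qed

lemma norm_lebesgue_on_integral_le:
  fixes G :: "real \<Rightarrow> real^3"
  assumes S: "S \<in> sets borel" and le: "AE s in lborel. s \<in> S \<longrightarrow> ennreal (norm (G s)) \<le> H s"
  shows "ennreal (norm (\<integral>s. G s \<partial>lebesgue_on S)) \<le> (\<integral>\<^sup>+s. indicator S s * H s \<partial>lborel)"
proof -
  have "ennreal (norm (\<integral>s. G s \<partial>lebesgue_on S)) \<le> (\<integral>\<^sup>+s. ennreal (norm (G s)) \<partial>lebesgue_on S)"
    by (rule ennreal_norm_integral_le)
  also have "\<dots> = (\<integral>\<^sup>+s. ennreal (norm (G s)) * indicator S s \<partial>lborel)"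
    using S by (subst nn_integral_restrict_space) (auto simp: nn_integral_completion)
  also have "\<dots> \<le> (\<integral>\<^sup>+s. indicator S s * H s \<partial>lborel)"
    using le by (intro nn_integral_mono_AE) (auto elim!: eventually_mono split: split_indicator)
  finally show ?thesis .
qed

text \<open>Turns the equation into the scalar inequality V \<le> L + Bil V V. Convergence is asked
  only for the components of the nonlinearity, where sums are moved through integrals; the other
  norms lie below the nonnegative integrals in any case, a divergent Bochner integral being
  0.\<close>

lemma mild_le:
  assumes t: "0 < t"
    and u0' [measurable]: "u0' \<in> borel_measurable borel" and u0: "AE y in lborel. u0 y = u0' y"
    and f': "(\<lambda>z. f' (fst z) (snd z)) \<in> borel_measurable (borel \<Otimes>\<^sub>M borel)"
    and f: "AE s in lborel. 0 < s \<and> s < t \<longrightarrow> (AE y in lborel. f s y = f' s y)"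
    and v': "(\<lambda>z. v' (fst z) (snd z)) \<in> borel_measurable (borel \<Otimes>\<^sub>M borel)"
    and v: "AE s in lborel. 0 < s \<and> s < t \<longrightarrow> (AE y in lborel. v s y = v' s y)"
    and hc: "AE s in lborel. 0 < s \<and> s < t \<longrightarrow> (\<forall>j h k. has_conv (oseen_kernel \<alpha> (t - s) j h k) (\<lambda>y. v s y $ h * v s y $ k) x)"
    and eq: "w = conv (heat_kernel \<alpha> t) u0 x
          + (\<integral>s. conv (heat_kernel \<alpha> (t - s)) (f s) x \<partial>lebesgue_on {0<..<t})
          - (\<integral>s. oseen_conv \<alpha> (t - s) (v s) x \<partial>lebesgue_on {0<..<t})"
  shows "ennreal (norm w) \<le> (Heat0 (\<lambda>y. ennreal (norm (u0' y))) t x + Duhamel (\<lambda>s y. ennreal (norm (f' s y))) t x)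
    + Bil (\<lambda>s y. ennreal (norm (v' s y))) (\<lambda>s y. ennreal (norm (v' s y))) t x"
proof -
  have [measurable]: "f' s \<in> borel_measurable borel" "v' s \<in> borel_measurable borel" for s
    using measurable_section_snd[OF f'] measurable_section_snd[OF v'] by simp_all
  have a: "ennreal (norm (conv (heat_kernel \<alpha> t) u0 x)) \<le> Heat0 (\<lambda>y. ennreal (norm (u0' y))) t x"
    using heat0_le[OF t] conv_heat_eq[OF u0' u0] by simp
  have b: "ennreal (norm (\<integral>s. conv (heat_kernel \<alpha> (t - s)) (f s) x \<partial>lebesgue_on {0<..<t})) \<le> Duhamel (\<lambda>s y. ennreal (norm (f' s y))) t x"
    unfolding Duhamel_def
  proof (rule norm_lebesgue_on_integral_le)
    show "AE s in lborel. s \<in> {0<..<t} \<longrightarrow> ennreal (norm (conv (heat_kernel \<alpha> (t - s)) (f s) x)) \<le> Heat0 (\<lambda>y. ennreal (norm (f' s y))) (t - s) x"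
      using f
    proof eventually_elim
      case (elim s)
      show ?case
      proof
        assume s: "s \<in> {0<..<t}"
        then have "conv (heat_kernel \<alpha> (t - s)) (f s) x = heat0 (f' s) (t - s) x"
          using elim by (intro conv_heat_eq) auto
        then show "ennreal (norm (conv (heat_kernel \<alpha> (t - s)) (f s) x)) \<le> Heat0 (\<lambda>y. ennreal (norm (f' s y))) (t - s) x"
          using s heat0_le[of "t - s" "f' s" x] by simp
      qed
    qed
  qed simp
  have c: "ennreal (norm (\<integral>s. oseen_conv \<alpha> (t - s) (v s) x \<partial>lebesgue_on {0<..<t})) \<le> Bil (\<lambda>s y. ennreal (norm (v' s y))) (\<lambda>s y. ennreal (norm (v' s y))) t x"
    unfolding Bil_def
  proof (rule norm_lebesgue_on_integral_le)
    show "AE s in lborel. s \<in> {0<..<t} \<longrightarrow> ennreal (norm (oseen_conv \<alpha> (t - s) (v s) x)) \<le>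
      (\<integral>\<^sup>+y. oseen_maj (t - s) (x - y) * (ennreal (norm (v' s y)) * ennreal (norm (v' s y))) \<partial>lborel)"
      using v hc by eventually_elim (auto intro!: oseen_conv_le)
  qed simp
  have "norm w \<le> norm (conv (heat_kernel \<alpha> t) u0 x) + norm (\<integral>s. conv (heat_kernel \<alpha> (t - s)) (f s) x \<partial>lebesgue_on {0<..<t})
    + norm (\<integral>s. oseen_conv \<alpha> (t - s) (v s) x \<partial>lebesgue_on {0<..<t})"
    unfolding eq by (meson add_right_mono norm_triangle_ineq norm_triangle_ineq4 order_trans)
  then have "ennreal (norm w) \<le> ennreal (norm (conv (heat_kernel \<alpha> t) u0 x)) + ennreal (norm (\<integral>s. conv (heat_kernel \<alpha> (t - s)) (f s) x \<partial>lebesgue_on {0<..<t}))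
    + ennreal (norm (\<integral>s. oseen_conv \<alpha> (t - s) (v s) x \<partial>lebesgue_on {0<..<t}))"
    by (simp add: ennreal_plus[symmetric] ennreal_leI del: ennreal_plus)
  also have "\<dots> \<le> (Heat0 (\<lambda>y. ennreal (norm (u0' y))) t x + Duhamel (\<lambda>s y. ennreal (norm (f' s y))) t x)
    + Bil (\<lambda>s y. ennreal (norm (v' s y))) (\<lambda>s y. ennreal (norm (v' s y))) t x"
    by (intro add_mono a b c)
  finally show ?thesis .
qed

lemma mild_diff:
  assumes v': "(\<lambda>z. v' (fst z) (snd z)) \<in> borel_measurable (borel \<Otimes>\<^sub>M borel)"
    and v: "AE s in lborel. 0 < s \<and> s < t \<longrightarrow> (AE y in lborel. v s y = v' s y)"
    and hcv: "AE s in lborel. 0 < s \<and> s < t \<longrightarrow> (\<forall>j h k. has_conv (oseen_kernel \<alpha> (t - s) j h k) (\<lambda>y. v s y $ h * v s y $ k) x)"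
    and intv: "integrable (lebesgue_on {0<..<t}) (\<lambda>s. oseen_conv \<alpha> (t - s) (v s) x)"
    and w': "(\<lambda>z. w' (fst z) (snd z)) \<in> borel_measurable (borel \<Otimes>\<^sub>M borel)"
    and w: "AE s in lborel. 0 < s \<and> s < t \<longrightarrow> (AE y in lborel. w s y = w' s y)"
    and hcw: "AE s in lborel. 0 < s \<and> s < t \<longrightarrow> (\<forall>j h k. has_conv (oseen_kernel \<alpha> (t - s) j h k) (\<lambda>y. w s y $ h * w s y $ k) x)"
    and intw: "integrable (lebesgue_on {0<..<t}) (\<lambda>s. oseen_conv \<alpha> (t - s) (w s) x)"
  shows "ennreal (norm ((\<integral>s. oseen_conv \<alpha> (t - s) (v s) x \<partial>lebesgue_on {0<..<t}) - (\<integral>s. oseen_conv \<alpha> (t - s) (w s) x \<partial>lebesgue_on {0<..<t})))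
    \<le> Bil (\<lambda>s y. ennreal (norm (v' s y)) + ennreal (norm (w' s y))) (\<lambda>s y. ennreal (norm (v' s y - w' s y))) t x"
proof -
  have [measurable]: "w' s \<in> borel_measurable borel" "v' s \<in> borel_measurable borel" for s
    using measurable_section_snd[OF w'] measurable_section_snd[OF v'] by simp_all
  have eq: "(\<integral>s. oseen_conv \<alpha> (t - s) (v s) x \<partial>lebesgue_on {0<..<t}) - (\<integral>s. oseen_conv \<alpha> (t - s) (w s) x \<partial>lebesgue_on {0<..<t})
    = (\<integral>s. oseen_conv \<alpha> (t - s) (v s) x - oseen_conv \<alpha> (t - s) (w s) x \<partial>lebesgue_on {0<..<t})"
    using intv intw by simp
  show ?thesis unfolding eq Bil_def
  proof (rule norm_lebesgue_on_integral_le)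
    show "AE s in lborel. s \<in> {0<..<t} \<longrightarrow> ennreal (norm (oseen_conv \<alpha> (t - s) (v s) x - oseen_conv \<alpha> (t - s) (w s) x)) \<le>
      (\<integral>\<^sup>+y. oseen_maj (t - s) (x - y) * ((ennreal (norm (v' s y)) + ennreal (norm (w' s y))) * ennreal (norm (v' s y - w' s y))) \<partial>lborel)"
      using v hcv w hcw by eventually_elim (auto intro!: oseen_conv_diff_le)
  qed simp
qed

text \<open>Where the majorants are finite, Tonelli yields every convergence demanded by
  \<open>mild_solution\<close>, and Fubini identifies the iterated integral of the nonlinearity with
  the product integral \<open>nonlin\<close>.\<close>

lemma mild_point:
  assumes t: "0 < t"
    and u0' [measurable]: "u0' \<in> borel_measurable borel" and u0: "AE y in lborel. u0 y = u0' y"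
    and f' [measurable]: "(\<lambda>z. f' (fst z) (snd z)) \<in> borel_measurable (borel \<Otimes>\<^sub>M borel)"
    and f: "AE s in lborel. 0 < s \<and> s < t \<longrightarrow> (AE y in lborel. f s y = f' s y)"
    and u [measurable]: "(\<lambda>z. u (fst z) (snd z)) \<in> borel_measurable (borel \<Otimes>\<^sub>M borel)"
    and finL: "Heat0 (\<lambda>y. ennreal (norm (u0' y))) t x + Duhamel (\<lambda>s y. ennreal (norm (f' s y))) t x < \<infinity>"
    and finB: "Bil (\<lambda>s y. ennreal (norm (u s y))) (\<lambda>s y. ennreal (norm (u s y))) t x < \<infinity>"
    and eq: "u t x = heat0 u0' t x + duhamel f' t x - nonlin u t x"
  shows "has_conv (heat_kernel \<alpha> t) u0 x \<and>
        (AE s in lebesgue_on {0<..<t}. has_conv (heat_kernel \<alpha> (t - s)) (f s) x) \<and>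
        integrable (lebesgue_on {0<..<t}) (\<lambda>s. conv (heat_kernel \<alpha> (t - s)) (f s) x) \<and>
        (AE s in lebesgue_on {0<..<t}. \<forall>j h k.
           has_conv (oseen_kernel \<alpha> (t - s) j h k) (\<lambda>y. u s y $ h * u s y $ k) x) \<and>
        integrable (lebesgue_on {0<..<t}) (\<lambda>s. oseen_conv \<alpha> (t - s) (u s) x) \<and>
        u t x = conv (heat_kernel \<alpha> t) u0 x
          + (\<integral>s. conv (heat_kernel \<alpha> (t - s)) (f s) x \<partial>lebesgue_on {0<..<t})
          - (\<integral>s. oseen_conv \<alpha> (t - s) (u s) x \<partial>lebesgue_on {0<..<t})"
proof -
  have [measurable]: "f' s \<in> borel_measurable borel" "u s \<in> borel_measurable borel" for s
    using measurable_section_snd[OF f'] measurable_section_snd[OF u] by simp_all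
  have S: "{0<..<t} \<in> sets borel" by simp
  have heat_int: "integrable lborel (\<lambda>y. heat_kernel \<alpha> \<tau> (x - y) *\<^sub>R F y)"
    if "0 < \<tau>" "Heat0 (\<lambda>y. ennreal (norm (F y))) \<tau> x < \<infinity>" and [measurable]: "F \<in> borel_measurable borel" for F :: "real^3 \<Rightarrow> real^3" and \<tau>
  proof (rule integrableI_bounded)
    have "(\<integral>\<^sup>+y. ennreal (norm (heat_kernel \<alpha> \<tau> (x - y) *\<^sub>R F y)) \<partial>lborel) \<le> Heat0 (\<lambda>y. ennreal (norm (F y))) \<tau> x"
      unfolding Heat0_def using that(1)
      by (intro nn_integral_mono) (simp add: ennreal_mult ennreal_heat_kernel_le mult_right_mono)
    with that(2) show "(\<integral>\<^sup>+y. ennreal (norm (heat_kernel \<alpha> \<tau> (x - y) *\<^sub>R F y)) \<partial>lborel) < \<infinity>" by (rule order_le_less_trans[rotated])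
  qed measurable
  have fin1: "Heat0 (\<lambda>y. ennreal (norm (u0' y))) t x < \<infinity>" "Duhamel (\<lambda>s y. ennreal (norm (f' s y))) t x < \<infinity>"
    using finL by auto
  have A: "has_conv (heat_kernel \<alpha> t) u0 x"
    using heat_int[OF t fin1(1) u0'] has_conv_version(1)[OF _ u0' u0, of "heat_kernel \<alpha> t" x] by simp
  have "AE s in lborel. indicator {0<..<t} s * Heat0 (\<lambda>y. ennreal (norm (f' s y))) (t - s) x \<noteq> \<infinity>"
  proof (rule nn_integral_noteq_infinite)
    have [measurable]: "(\<lambda>p. f' (fst p) (snd p)) \<in> borel_measurable (lborel \<Otimes>\<^sub>M borel)"
      using f' by (simp cong: measurable_cong_sets sets_pair_measure_cong)
    show "(\<lambda>s. indicator {0<..<t} s * Heat0 (\<lambda>y. ennreal (norm (f' s y))) (t - s) x) \<in> borel_measurable lborel" by measurable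
    show "(\<integral>\<^sup>+s. indicator {0<..<t} s * Heat0 (\<lambda>y. ennreal (norm (f' s y))) (t - s) x \<partial>lborel) \<noteq> \<infinity>"
      using fin1(2) by (simp add: Duhamel_def)
  qed
  then have "AE s in lborel. s \<in> {0<..<t} \<longrightarrow> has_conv (heat_kernel \<alpha> (t - s)) (f s) x"
    using f
  proof eventually_elim
    case (elim s)
    show ?case
    proof
      assume s: "s \<in> {0<..<t}"
      then have "Heat0 (\<lambda>y. ennreal (norm (f' s y))) (t - s) x < \<infinity>" using elim(1) by (simp add: less_top)
      then have "integrable lborel (\<lambda>y. heat_kernel \<alpha> (t - s) (x - y) *\<^sub>R f' s y)"
        using s by (intro heat_int) auto
      then show "has_conv (heat_kernel \<alpha> (t - s)) (f s) x"
        using elim(2) s has_conv_version(1)[of "heat_kernel \<alpha> (t - s)" "f' s" "f s" x] by simp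
    qed
  qed
  then have B: "AE s in lebesgue_on {0<..<t}. has_conv (heat_kernel \<alpha> (t - s)) (f s) x"
    by (simp only: AE_lebesgue_on_iff[OF S])
  have cf: "AE s in lborel. s \<in> {0<..<t} \<longrightarrow> conv (heat_kernel \<alpha> (t - s)) (f s) x = heat0 (f' s) (t - s) x"
    using f by eventually_elim (auto intro!: conv_heat_eq)
  have h_meas: "(\<lambda>s. heat0 (f' s) (t - s) x) \<in> borel_measurable borel" by measurable
  have C: "integrable (lebesgue_on {0<..<t}) (\<lambda>s. conv (heat_kernel \<alpha> (t - s)) (f s) x)"
    unfolding lebesgue_on_integral_version(1)[OF h_meas S cf]
  proof (rule integrableI_bounded)
    have "(\<integral>\<^sup>+s. ennreal (norm (indicator {0<..<t} s *\<^sub>R heat0 (f' s) (t - s) x)) \<partial>lborel) \<le> Duhamel (\<lambda>s y. ennreal (norm (f' s y))) t x"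
      unfolding Duhamel_def by (intro nn_integral_mono) (auto split: split_indicator intro!: heat0_le)
    with fin1(2) show "(\<integral>\<^sup>+s. ennreal (norm (indicator {0<..<t} s *\<^sub>R heat0 (f' s) (t - s) x)) \<partial>lborel) < \<infinity>" by (rule order_le_less_trans[rotated])
  qed (use h_meas in measurable)
  have duh: "(\<integral>s. conv (heat_kernel \<alpha> (t - s)) (f s) x \<partial>lebesgue_on {0<..<t}) = duhamel f' t x"
    unfolding lebesgue_on_integral_version(2)[OF h_meas S cf] duhamel_def ..
  have u_meas [measurable]: "(\<lambda>z. u (fst z) (snd z)) \<in> borel_measurable (borel \<Otimes>\<^sub>M lborel)"
    "(\<lambda>z. u (fst z) (snd z)) \<in> borel_measurable (lborel \<Otimes>\<^sub>M lborel)"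
    using u by (simp_all cong: measurable_cong_sets sets_pair_measure_cong)
  have "AE s in lborel. indicator {0<..<t} s * (\<integral>\<^sup>+y. oseen_maj (t - s) (x - y) * (ennreal (norm (u s y)) * ennreal (norm (u s y))) \<partial>lborel) \<noteq> \<infinity>"
  proof (rule nn_integral_noteq_infinite)
    show "(\<integral>\<^sup>+s. indicator {0<..<t} s * (\<integral>\<^sup>+y. oseen_maj (t - s) (x - y) * (ennreal (norm (u s y)) * ennreal (norm (u s y))) \<partial>lborel) \<partial>lborel) \<noteq> \<infinity>"
      using finB by (simp add: Bil_def)
  qed measurable
  then have D': "AE s in lborel. s \<in> {0<..<t} \<longrightarrow> (\<forall>j h k. has_conv (oseen_kernel \<alpha> (t - s) j h k) (\<lambda>y. u s y $ h * u s y $ k) x)"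
  proof eventually_elim
    case (elim s)
    show ?case
    proof (intro impI allI)
      fix j h k assume s: "s \<in> {0<..<t}"
      then have fin: "(\<integral>\<^sup>+y. oseen_maj (t - s) (x - y) * (ennreal (norm (u s y)) * ennreal (norm (u s y))) \<partial>lborel) < \<infinity>"
        using elim by (simp add: less_top)
      have "integrable lborel (\<lambda>y. oseen_kernel \<alpha> (t - s) j h k (x - y) *\<^sub>R (u s y $ h * u s y $ k))"
      proof (rule integrableI_bounded)
        have "(\<integral>\<^sup>+y. ennreal (norm (oseen_kernel \<alpha> (t - s) j h k (x - y) *\<^sub>R (u s y $ h * u s y $ k))) \<partial>lborel)
          \<le> (\<integral>\<^sup>+y. oseen_maj (t - s) (x - y) * (ennreal (norm (u s y)) * ennreal (norm (u s y))) \<partial>lborel)"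
        proof (intro nn_integral_mono)
          fix y
          have "\<bar>oseen_kernel \<alpha> (t - s) j h k (x - y)\<bar> \<le> CK * (bump \<rho> (heat_scale (t - s)) (x - y) / heat_scale (t - s))"
            using oseen_le[of "t - s"] s by (simp add: heat_scale_def)
          also have "\<dots> \<le> 27 * CK * (bump \<rho> (heat_scale (t - s)) (x - y) / heat_scale (t - s))"
            using CK_pos heat_scale(1)[of "t - s"] s by (intro mult_right_mono) auto
          finally have 1: "\<bar>oseen_kernel \<alpha> (t - s) j h k (x - y)\<bar> \<le> 27 * CK * (bump \<rho> (heat_scale (t - s)) (x - y) / heat_scale (t - s))" .
          have "norm (oseen_kernel \<alpha> (t - s) j h k (x - y) *\<^sub>R (u s y $ h * u s y $ k))
             \<le> 27 * CK * (bump \<rho> (heat_scale (t - s)) (x - y) / heat_scale (t - s)) * (norm (u s y) * norm (u s y))"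
          proof -
            have "norm (oseen_kernel \<alpha> (t - s) j h k (x - y) *\<^sub>R (u s y $ h * u s y $ k))
              = \<bar>oseen_kernel \<alpha> (t - s) j h k (x - y)\<bar> * (\<bar>u s y $ h\<bar> * \<bar>u s y $ k\<bar>)"
              by (simp add: abs_mult)
            also have "\<dots> \<le> 27 * CK * (bump \<rho> (heat_scale (t - s)) (x - y) / heat_scale (t - s)) * (norm (u s y) * norm (u s y))"
              using CK_pos heat_scale(1)[of "t - s"] s by (intro mult_mono 1 component_le_norm_cart) auto
            finally show ?thesis .
          qed
          then have "ennreal (norm (oseen_kernel \<alpha> (t - s) j h k (x - y) *\<^sub>R (u s y $ h * u s y $ k)))
            \<le> ennreal (27 * CK * (bump \<rho> (heat_scale (t - s)) (x - y) / heat_scale (t - s)) * (norm (u s y) * norm (u s y)))"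
            by (rule ennreal_leI)
          also have "\<dots> = oseen_maj (t - s) (x - y) * (ennreal (norm (u s y)) * ennreal (norm (u s y)))"
            unfolding oseen_maj_def ennreal_mult[OF norm_ge_zero norm_ge_zero, symmetric]
            using CK_pos heat_scale(1)[of "t - s"] s by (intro ennreal_mult) auto
          finally show "ennreal (norm (oseen_kernel \<alpha> (t - s) j h k (x - y) *\<^sub>R (u s y $ h * u s y $ k)))
            \<le> oseen_maj (t - s) (x - y) * (ennreal (norm (u s y)) * ennreal (norm (u s y)))" .
        qed
        with fin show "(\<integral>\<^sup>+y. ennreal (norm (oseen_kernel \<alpha> (t - s) j h k (x - y) *\<^sub>R (u s y $ h * u s y $ k))) \<partial>lborel) < \<infinity>"
          by (rule order_le_less_trans[rotated])
      qed measurable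
      then show "has_conv (oseen_kernel \<alpha> (t - s) j h k) (\<lambda>y. u s y $ h * u s y $ k) x"
        using has_conv_version(1)[of "oseen_kernel \<alpha> (t - s) j h k" "\<lambda>y. u s y $ h * u s y $ k" "\<lambda>y. u s y $ h * u s y $ k" x] by simp
    qed
  qed
  then have D: "AE s in lebesgue_on {0<..<t}. \<forall>j h k. has_conv (oseen_kernel \<alpha> (t - s) j h k) (\<lambda>y. u s y $ h * u s y $ k) x"
    by (simp only: AE_lebesgue_on_iff[OF S])
  have co: "AE s in lborel. s \<in> {0<..<t} \<longrightarrow> oseen_conv \<alpha> (t - s) (u s) x = (\<integral>y. oseen_vec \<alpha> (t - s) (x - y) (u s y) \<partial>lborel)"
    using D' by eventually_elim (auto intro!: oseen_conv_eq(2))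
  have o_meas: "(\<lambda>s. \<integral>y. oseen_vec \<alpha> (t - s) (x - y) (u s y) \<partial>lborel) \<in> borel_measurable borel" by measurable
  note nl_int = integrable_nonlin[OF u finB]
  have inner: "(\<integral>y. indicator {0<..<t} s *\<^sub>R oseen_vec \<alpha> (t - s) (x - y) (u s y) \<partial>lborel)
     = indicator {0<..<t} s *\<^sub>R (\<integral>y. oseen_vec \<alpha> (t - s) (x - y) (u s y) \<partial>lborel)" for s
    by (cases "s \<in> {0<..<t}") simp_all
  have E: "integrable (lebesgue_on {0<..<t}) (\<lambda>s. oseen_conv \<alpha> (t - s) (u s) x)"
    unfolding lebesgue_on_integral_version(1)[OF o_meas S co]
    using lborel_pair.integrable_fst'[OF nl_int] by (simp add: inner)
  have nl: "(\<integral>s. oseen_conv \<alpha> (t - s) (u s) x \<partial>lebesgue_on {0<..<t}) = nonlin u t x"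
    unfolding lebesgue_on_integral_version(2)[OF o_meas S co] nonlin_def
    using lborel_pair.integral_fst'[OF nl_int] by (simp add: inner)
  show ?thesis
    using A B C D E unfolding duh nl conv_heat_eq[OF u0' u0] by (simp add: eq)
qed

end

section \<open>Log-Hoelder exponents and local well-posedness\<close>

text \<open>An uncountable family of almost sure bounds is reduced to a sequence with the same
  supremum.\<close>

lemma essinf_AE: "AE x in M. essinf M p \<le> p x"
proof -
  let ?S = "{z. AE x in M. z \<le> p x}"
  have "?S \<noteq> {}" by (auto intro!: exI[of _ 0])
  then obtain z :: "nat \<Rightarrow> ennreal" where z: "range z \<subseteq> ?S" "Sup ?S = (SUP i. z i)"
    using ennreal_Sup_countable_SUP[of ?S] by blast
  have "AE x in M. \<forall>i. z i \<le> p x" using z(1) by (subst AE_all_countable) auto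
  then show ?thesis unfolding essinf_def z(2) by eventually_elim (auto intro: SUP_least)
qed

lemma log_holder_continuous:
  fixes g :: "'a::real_normed_vector \<Rightarrow> real"
  assumes c: "0 < c" and h: "\<And>x y. \<bar>g x - g y\<bar> \<le> c / ln (exp 1 + 1 / norm (x - y))"
  shows "continuous_on UNIV g"
  unfolding continuous_on_iff
proof (intro ballI allI impI)
  fix x :: 'a and e :: real assume e: "0 < e"
  \<comment> \<open>Below this distance ln (1/|x - y|) exceeds 2c/e, so the oscillation is at most
    e/2.\<close>
  show "\<exists>d>0. \<forall>x'\<in>UNIV. dist x' x < d \<longrightarrow> dist (g x') (g x) < e"
  proof (intro exI[of _ "exp (- (2 * c / e))"] conjI ballI impI)
    fix y assume y: "dist y x < exp (- (2 * c / e))"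
    show "dist (g y) (g x) < e"
    proof (cases "y = x")
      case False
      then have d: "0 < norm (y - x)" by simp
      have "exp (2 * c / e) \<le> 1 / norm (y - x)"
        using y d by (simp add: dist_norm exp_minus field_simps)
      then have "exp (2 * c / e) \<le> exp 1 + 1 / norm (y - x)" by (simp add: add_increasing)
      then have L: "2 * c / e \<le> ln (exp 1 + 1 / norm (y - x))"
        using ln_mono[of "exp (2 * c / e)" "exp 1 + 1 / norm (y - x)"] d by (simp add: add_pos_pos)
      have "\<bar>g y - g x\<bar> \<le> c / ln (exp 1 + 1 / norm (y - x))" by (rule h)
      also have "\<dots> \<le> c / (2 * c / e)"
        using L c e order_less_le_trans[OF _ L, of 0] by (intro divide_left_mono) (auto simp: zero_less_mult_iff)
      also have "\<dots> < e" using c e by simp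
      finally show ?thesis by (simp add: dist_real_def)
    qed (use e in simp)
  qed simp
qed

text \<open>The locale asks for bounds on 1/q at every point, while the essential bounds hold almost
  everywhere; continuity closes the gap.\<close>

lemma continuous_le_everywhere:
  fixes g :: "'a::euclidean_space \<Rightarrow> real"
  assumes "continuous_on UNIV g" "AE x in lebesgue. g x \<le> a"
  shows "g x \<le> a"
proof -
  have "closed {x. g x \<le> a}" using assms(1) by (intro closed_Collect_le) (auto intro: continuous_intros)
  from mem_closed_if_AE_lebesgue[OF this] show ?thesis using assms(2) by auto
qed

lemma recip_cases:
  assumes "1 \<le> r"
  obtains "r = \<infinity>" "recip r = 0" "inverse r = 0" | s where "1 \<le> s" "r = ennreal s" "recip r = 1 / s" "inverse r = ennreal (1 / s)"
proof (cases r rule: ennreal_finite_cases)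
  case (2 s)
  then have s: "1 \<le> s" using assms by simp
  then have "inverse r = ennreal (1 / s)" using 2 by (simp add: inverse_ennreal inverse_eq_divide)
  moreover from this have "recip r = 1 / s" using s by (simp add: recip_def)
  ultimately show ?thesis using s 2 that(2) by blast
qed (use that in \<open>simp add: recip_def\<close>)

lemma recip_antimono:
  assumes "1 \<le> r" "r \<le> s"
  shows "recip s \<le> recip r"
proof -
  have s: "1 \<le> s" using assms by (rule order_trans)
  show ?thesis
    by (rule recip_cases[OF assms(1)]; rule recip_cases[OF s])
       (use assms(2) in \<open>auto simp: top_unique frac_le\<close>)
qed

lemma recip_bounds:
  assumes "1 \<le> r"
  shows "0 \<le> recip r" "recip r \<le> 1" "inverse r = ennreal (recip r)"
  by (rule recip_cases[OF assms]; simp)+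

lemma recip_less:
  assumes "1 \<le> r" "ennreal k < r" "0 < k"
  shows "recip r < 1 / k"
  by (rule recip_cases[OF assms(1)]) (use assms in \<open>simp_all add: ennreal_less_iff frac_less2\<close>)

text \<open>The assumption q^- = q_\<infinity> identifies the limit of 1/q at infinity with its
  upper bound \<open>a\<close>, so the decay condition becomes the bound on a - g on which the
  embedding rests. From q^- > 3 comes a < 1/3.\<close>

lemma log_exponent_reciprocal:
  assumes q: "q \<in> log_exponents" and inf: "essinf lebesgue q = exponent_at_infinity q" and gt: "essinf lebesgue q > 3"
  shows "\<exists>c. reciprocal_exponent (\<lambda>x. recip (q x)) (recip (essinf lebesgue q)) (recip (esssup lebesgue q)) c"
proof -
  define g where "g x = recip (q x)" for x
  define a where "a = recip (essinf lebesgue q)"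
  define b where "b = recip (esssup lebesgue q)"
  from q obtain c ginf where q1: "\<And>x. 1 \<le> q x" and c: "0 < c"
    and lh: "\<And>x y. \<bar>g x - g y\<bar> \<le> c / ln (exp 1 + 1 / norm (x - y))"
    and ld: "\<And>x. \<bar>g x - ginf\<bar> \<le> c / ln (exp 1 + norm x)"
    by (auto simp: log_exponents_def exponents_def g_def)
  have g01: "0 \<le> g x" "g x \<le> 1" "inverse (q x) = ennreal (g x)" for x
    using recip_bounds[OF q1[of x]] by (auto simp: g_def)
  have cont: "continuous_on UNIV g" using log_holder_continuous[OF c lh] .
  have lim: "(g \<longlongrightarrow> ginf) at_infinity"
  proof (rule tendstoI)
    fix e :: real assume e: "0 < e"
    have "\<forall>\<^sub>F x::real^3 in at_infinity. exp (2 * c / e) \<le> norm x"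
      by (rule eventually_at_infinityI) simp
    then show "\<forall>\<^sub>F x in at_infinity. dist (g x) ginf < e"
    proof eventually_elim
      case (elim x)
      have "exp (2 * c / e) \<le> exp 1 + norm x" using elim by (simp add: add_increasing)
      then have L: "2 * c / e \<le> ln (exp 1 + norm x)"
        using ln_mono[of "exp (2 * c / e)" "exp 1 + norm x"] by (simp add: add_pos_nonneg)
      have "\<bar>g x - ginf\<bar> \<le> c / ln (exp 1 + norm x)" by (rule ld)
      also have "\<dots> \<le> c / (2 * c / e)"
        using L c e ln_e_plus_ge_1[of "norm x"] by (intro divide_left_mono) auto
      also have "\<dots> < e" using c e by simp
      finally show ?case by (simp add: dist_real_def)
    qed
  qed
  have ginf0: "0 \<le> ginf"
    by (rule tendsto_lowerbound[OF lim]) (auto simp: g01 trivial_limit_at_infinity)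
  have "((\<lambda>x. inverse (q x)) \<longlongrightarrow> ennreal ginf) at_infinity"
    unfolding g01(3) using lim by (intro tendsto_ennrealI)
  then have "Lim at_infinity (\<lambda>x. inverse (q x)) = ennreal ginf"
    by (intro tendsto_Lim) (auto simp: trivial_limit_at_infinity)
  then have "essinf lebesgue q = inverse (ennreal ginf)" using inf by (simp add: exponent_at_infinity_def)
  then have a_eq: "a = ginf" using ginf0
    by (cases "ginf = 0") (auto simp: a_def recip_def inverse_ennreal)
  have inf1: "1 \<le> essinf lebesgue q"
    using gt by (rule order_trans[rotated, OF less_imp_le]) simp
  have a13: "a < 1/3" unfolding a_def using gt by (intro recip_less inf1) auto
  have ga: "g x \<le> a" for x
  proof (rule continuous_le_everywhere[OF cont])
    show "AE x in lebesgue. g x \<le> a"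
      using essinf_AE[of lebesgue q] by eventually_elim (use inf1 in \<open>auto simp: g_def a_def intro: recip_antimono\<close>)
  qed
  have bg: "b \<le> g x" for x
  proof -
    have "AE x in lebesgue. - g x \<le> - b"
      using esssup_AE[of q lebesgue] by eventually_elim (use q1 in \<open>auto simp: g_def b_def intro: recip_antimono\<close>)
    then have "- g x \<le> - b" by (intro continuous_le_everywhere continuous_on_minus cont)
    then show ?thesis by simp
  qed
  have "reciprocal_exponent g a b c"
  proof
    show "g \<in> borel_measurable borel" using cont by (rule borel_measurable_continuous_onI)
    show "0 \<le> b" by (simp add: b_def recip_def)
    show "a - g x \<le> c / ln (exp 1 + norm x)" for x using ld[of x] unfolding a_eq by simp
  qed (use bg ga a13 c lh in auto)
  then show ?thesis unfolding g_def[abs_def] a_def b_def by blast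
qed

text \<open>Values of X up to 1 are absorbed by the summand 1; on a finite time interval this passes
  from p(t) to the constant P.\<close>

lemma omega_ge_powr:
  assumes "ennreal P \<le> r" "0 \<le> X" "0 < P"
  shows "ennreal (X powr P) \<le> 1 + omega r X"
proof (cases "X \<le> 1")
  case True
  then have "X powr P \<le> 1" using assms by (simp add: powr_le1)
  then have "ennreal (X powr P) \<le> 1" by simp
  then show ?thesis by (rule order_trans) simp
next
  case False
  show ?thesis
  proof (cases r rule: ennreal_finite_cases)
    case (2 s)
    then have "X powr P \<le> X powr s" using assms False by (intro powr_mono) auto
    then have "ennreal (X powr P) \<le> omega r X" using 2 by (simp add: omega_def ennreal_leI)
    then show ?thesis by (simp add: add_increasing)
  qed (use False in \<open>simp add: omega_def\<close>)
qed

lemma omega_le_1: "0 \<le> X \<Longrightarrow> X \<le> 1 \<Longrightarrow> omega r X \<le> 1"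
  by (auto simp: omega_def powr_le1 enn2real_nonneg)

context fns_setting
begin

text \<open>Membership with the variable exponent p gives integrability of the power P in time, the
  hypothesis of \<open>time_mass\<close>. \<open>p'\<close> is a Borel version of p, which makes the
  integrand measurable when the integral is split.\<close>

lemma weak_solution_bounds:
  assumes T: "0 < T" "T < 1" and v: "v \<in> mixed_Lp {0<..<T} p q"
    and p' [measurable]: "p' \<in> borel_measurable borel"
    and p: "AE t in lborel. 0 < t \<and> t < T \<longrightarrow> ennreal P \<le> p t \<and> p t = p' t"
    and P: "2 < P" "\<theta> * (P / (P - 2)) < 1"
  obtains v' n M where "(\<lambda>z. v' (fst z) (snd z)) \<in> borel_measurable (borel \<Otimes>\<^sub>M borel)"
    "AE z in lborel \<Otimes>\<^sub>M lborel. fst z \<in> {0<..<T} \<longrightarrow> v (fst z) (snd z) = v' (fst z) (snd z)"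
    "AE t in lborel. t \<in> {0<..<T} \<longrightarrow> (AE x in lborel. v t x = v' t x)"
    "n \<in> borel_measurable borel" "\<And>s. 0 < n s" "0 < M"
    "AE s in lborel. 0 < s \<and> s < T \<longrightarrow> modg (\<lambda>y. ennreal (1 / n s) * ennreal (norm (v' s y))) \<le> 1"
    "\<And>t. 0 < t \<Longrightarrow> t < T \<Longrightarrow> (\<integral>\<^sup>+s. indicator {0<..<t} s * ennreal (bil_const * (t - s) powr - \<theta> * (n s * n s)) \<partial>lborel) \<le> ennreal M"
proof -
  obtain v' n k where v': "(\<lambda>z. v' (fst z) (snd z)) \<in> borel_measurable (borel \<Otimes>\<^sub>M borel)"
    "AE z in lborel \<Otimes>\<^sub>M lborel. fst z \<in> {0<..<T} \<longrightarrow> v (fst z) (snd z) = v' (fst z) (snd z)"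
    "AE t in lborel. t \<in> {0<..<T} \<longrightarrow> (AE x in lborel. v t x = v' t x)"
    and n [measurable]: "n \<in> borel_measurable borel" and k: "0 < k"
    and n1: "AE t in lborel. t \<in> {0<..<T} \<longrightarrow> (\<forall>r. \<bar>n t\<bar> < r \<longrightarrow> modg (\<lambda>x. ennreal (1 / r) * ennreal (norm (v' t x))) \<le> 1)"
    and fin0: "(\<integral>\<^sup>+t. indicator {0<..<T} t * omega (p t) (norm (k * n t)) \<partial>lborel) < \<infinity>"
    by (rule mixed_LpE[OF v]) simp
  have "(\<integral>\<^sup>+t. indicator {0<..<T} t * omega (p t) (norm (k * n t)) \<partial>lborel)
     = (\<integral>\<^sup>+t. indicator {0<..<T} t * omega (p' t) (norm (k * n t)) \<partial>lborel)"
    using p by (intro nn_integral_cong_AE) (auto elim!: eventually_mono split: split_indicator)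
  with fin0 have fin: "(\<integral>\<^sup>+t. indicator {0<..<T} t * omega (p' t) (norm (k * n t)) \<partial>lborel) < \<infinity>" by simp
  \<comment> \<open>The summand 1 makes h / k strictly larger than |n|, as the infimum in the norm
    requires, and keeps it positive where n vanishes.\<close>
  define h where "h t = 1 + k * \<bar>n t\<bar>" for t
  have h [measurable]: "h \<in> borel_measurable borel" unfolding h_def[abs_def] by measurable
  have h1: "1 \<le> h t" for t using k by (simp add: h_def)
  have "(\<integral>\<^sup>+s. indicator {0<..<T} s * ennreal (h s powr P) \<partial>lborel) < \<infinity>"
  proof -
    have "(\<integral>\<^sup>+s. indicator {0<..<T} s * ennreal (h s powr P) \<partial>lborel)
      \<le> (\<integral>\<^sup>+s. ennreal (2 powr P) * (2 * indicator {0<..<T} s + indicator {0<..<T} s * omega (p' s) (norm (k * n s))) \<partial>lborel)"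
    proof (intro nn_integral_mono_AE, use p in eventually_elim)
      case (elim s)
      show ?case
      proof (cases "0 < s \<and> s < T")
        case True
        define X where "X = k * \<bar>n s\<bar>"
        have X: "0 \<le> X" "norm (k * n s) = X" using k by (auto simp: X_def abs_mult)
        have "h s powr P \<le> (2 * max 1 X) powr P" using X h1[of s] P by (intro powr_mono2) (auto simp: h_def X_def)
        also have "\<dots> = 2 powr P * max 1 X powr P" by (simp add: powr_mult)
        also have "\<dots> \<le> 2 powr P * (1 + X powr P)" by (intro mult_left_mono) (auto simp: max_def)
        finally have "ennreal (h s powr P) \<le> ennreal (2 powr P) * (1 + ennreal (X powr P))"
          using ennreal_leI by (fastforce simp: ennreal_mult ennreal_plus)
        also have "\<dots> \<le> ennreal (2 powr P) * (1 + (1 + omega (p' s) X))"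
          using elim True X P by (intro mult_left_mono add_left_mono omega_ge_powr) auto
        also have "1 + (1 + omega (p' s) X) = 2 + omega (p' s) X" by (simp add: add.assoc[symmetric])
        finally show ?thesis using True X(2) by simp
      qed simp
    qed
    also have "\<dots> = ennreal (2 powr P) * (2 * emeasure lborel {0<..<T} + (\<integral>\<^sup>+s. indicator {0<..<T} s * omega (p' s) (norm (k * n s)) \<partial>lborel))"
      unfolding omega_def by (simp add: nn_integral_cmult nn_integral_add)
    also have "\<dots> < \<infinity>" using fin T by (simp add: ennreal_mult_less_top ennreal_mult_eq_top_iff less_top[symmetric])
    finally show ?thesis .
  qed
  from time_mass[OF h _ P k this] obtain M where M: "0 < M" "\<And>t. 0 < t \<Longrightarrow> t < T \<Longrightarrow>
    (\<integral>\<^sup>+s. indicator {0<..<t} s * ennreal (bil_const * (t - s) powr - \<theta> * (h s / k * (h s / k))) \<partial>lborel) \<le> ennreal M"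
    using h1 T by (meson less_imp_le order_trans zero_le_one)
  have lt: "\<bar>n s\<bar> < h s / k" for s using k by (simp add: h_def field_simps)
  show ?thesis
  proof (rule that[OF v' _ _ M(1) _ M(2)])
    show "(\<lambda>s. h s / k) \<in> borel_measurable borel" by measurable
    show "0 < h s / k" for s using k h1[of s] by simp
    show "AE s in lborel. 0 < s \<and> s < T \<longrightarrow> modg (\<lambda>y. ennreal (1 / (h s / k)) * ennreal (norm (v' s y))) \<le> 1"
      using n1
    proof eventually_elim
      case (elim s)
      then show ?case using lt[of s] by (simp only: greaterThanLessThan_iff) blast
    qed
  qed
qed

end

text \<open>Null slices give a null set in the product for measurable sets, hence the assumption on
  the predicate.\<close>

lemma AE_pairI:
  assumes "Measurable.pred (borel \<Otimes>\<^sub>M borel) (\<lambda>z. P (fst z) (snd z))"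
    and "AE t in lborel. AE x in lborel. P t x"
  shows "AE z in lborel \<Otimes>\<^sub>M lborel. P (fst z :: real) (snd z :: real^3)"
proof (rule lborel_pair.AE_pair_measure)
  have "{z \<in> space (borel \<Otimes>\<^sub>M borel). P (fst z) (snd z)} \<in> sets (borel \<Otimes>\<^sub>M borel)"
    using assms(1) by (rule predE)
  then show "{z \<in> space (lborel \<Otimes>\<^sub>M lborel). P (fst z) (snd z)} \<in> sets (lborel \<Otimes>\<^sub>M lborel)"
    by (simp cong: sets_pair_measure_cong add: space_pair_measure)
qed (use assms(2) in simp)

context fns_setting
begin

lemma modg_time_measurable:
  assumes "(\<lambda>z. u (fst z) (snd z)) \<in> borel_measurable (borel \<Otimes>\<^sub>M borel)"
  shows "(\<lambda>t. modg (\<lambda>x. ennreal k * ennreal (norm (u t x)))) \<in> borel_measurable borel"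
proof -
  have [measurable]: "(\<lambda>z. u (fst z) (snd z)) \<in> borel_measurable (borel \<Otimes>\<^sub>M lborel)"
    using assms by (simp cong: measurable_cong_sets sets_pair_measure_cong)
  show ?thesis unfolding modg_def by measurable
qed

text \<open>The norm is below y exactly when some rational c with 0 < c < y is admissible in the
  infimum, and for fixed c the modular is measurable in t. The bound by R keeps the set of
  admissible constants nonempty.\<close>

lemma var_norm_time_measurable:
  assumes u: "(\<lambda>z. u (fst z) (snd z)) \<in> borel_measurable (borel \<Otimes>\<^sub>M borel)" and I [measurable]: "I \<in> sets borel"
    and R: "0 < R" "\<And>t. t \<in> I \<Longrightarrow> modg (\<lambda>x. ennreal (1 / R) * ennreal (norm (u t x))) \<le> 1"
  shows "(\<lambda>t. var_norm lebesgue q (u t :: real^3 \<Rightarrow> real^3)) \<in> borel_measurable (lebesgue_on I)"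
proof (rule borel_measurableI_less)
  fix y :: real
  have eq: "{t \<in> space (lebesgue_on I). var_norm lebesgue q (u t) < y} =
    (\<Union>c\<in>{c \<in> \<rat>. 0 < c \<and> c < y}. {t. t \<in> I \<and> modg (\<lambda>x. ennreal (1 / c) * ennreal (norm (u t x))) \<le> 1})"
  proof (intro set_eqI iffI)
    fix t assume "t \<in> {t \<in> space (lebesgue_on I). var_norm lebesgue q (u t) < y}"
    then have t: "t \<in> I" "var_norm lebesgue q (u t) < y" by auto
    then obtain c where c: "c \<in> \<rat>" "var_norm lebesgue q (u t) < c" "c < y" using Rats_dense_in_real by blast
    have "0 \<le> var_norm lebesgue q (u t)" using var_norm_le(1)[OF R(1) R(2)[OF t(1)]] .
    then have "0 < c" using c by simp
    moreover have "modg (\<lambda>x. ennreal (1 / c) * ennreal (norm (u t x))) \<le> 1"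
      using R t c by (intro var_norm_less) auto
    ultimately show "t \<in> (\<Union>c\<in>{c \<in> \<rat>. 0 < c \<and> c < y}. {t. t \<in> I \<and> modg (\<lambda>x. ennreal (1 / c) * ennreal (norm (u t x))) \<le> 1})"
      using c t by auto
  next
    fix t assume "t \<in> (\<Union>c\<in>{c \<in> \<rat>. 0 < c \<and> c < y}. {t. t \<in> I \<and> modg (\<lambda>x. ennreal (1 / c) * ennreal (norm (u t x))) \<le> 1})"
    then obtain c where c: "0 < c" "c < y" "t \<in> I" "modg (\<lambda>x. ennreal (1 / c) * ennreal (norm (u t x))) \<le> 1" by auto
    then show "t \<in> {t \<in> space (lebesgue_on I). var_norm lebesgue q (u t) < y}"
      using var_norm_le(2)[OF c(1,4)] by auto
  qed
  have "(\<Union>c\<in>{c \<in> \<rat>. 0 < c \<and> c < y}. {t. t \<in> I \<and> modg (\<lambda>x. ennreal (1 / c) * ennreal (norm (u t x))) \<le> 1}) \<in> sets borel"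
  proof (rule sets.countable_UN'')
    show "countable {c \<in> \<rat>. 0 < c \<and> c < y}" by (rule countable_subset[OF _ countable_rat]) auto
    fix c
    note [measurable] = modg_time_measurable[OF u, of "1 / c"]
    show "{t. t \<in> I \<and> modg (\<lambda>x. ennreal (1 / c) * ennreal (norm (u t x))) \<le> 1} \<in> sets borel" by measurable
  qed
  moreover have "(\<Union>c\<in>{c \<in> \<rat>. 0 < c \<and> c < y}. {t. t \<in> I \<and> modg (\<lambda>x. ennreal (1 / c) * ennreal (norm (u t x))) \<le> 1}) \<subseteq> I" by auto
  ultimately show "{t \<in> space (lebesgue_on I). var_norm lebesgue q (u t) < y} \<in> sets (lebesgue_on I)"
    unfolding eq by (subst sets_restrict_space_iff) auto
qed

text \<open>Valid for every p: after division by R the norm is at most 1, where the modular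
  integrand is at most 1, and the interval has finite length.\<close>

lemma bounded_in_mixed_Lp:
  assumes u: "(\<lambda>z. u (fst z) (snd z)) \<in> borel_measurable (borel \<Otimes>\<^sub>M borel)" and T: "0 < T" "T < 1"
    and R: "0 < R" "\<And>t. t \<in> {0<..<T} \<Longrightarrow> modg (\<lambda>x. ennreal (1 / R) * ennreal (norm (u t x))) \<le> 1"
  shows "u \<in> mixed_Lp {0<..<T} p q"
proof -
  have "(\<lambda>(t, x). u t x) \<in> borel_measurable borel"
    using u by (simp add: borel_prod case_prod_beta')
  then have 1: "(\<lambda>(t, x). u t x) \<in> borel_measurable (lebesgue_on ({0<..<T} \<times> UNIV))"
    by (intro measurable_restrict_space1 measurable_completion) simp
  have uB: "u t \<in> borel_measurable borel" for t using measurable_section_snd[OF u] by simp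
  have "u t \<in> var_Lp lebesgue q" if t: "t \<in> {0<..<T}" for t
  proof -
    have "u t \<in> borel_measurable lebesgue" using uB[of t] by (intro measurable_completion) simp
    moreover have "modular lebesgue q (\<lambda>x. (1 / R) *\<^sub>R u t x) < \<infinity>"
    proof -
      have "modular lebesgue q (\<lambda>x. (1 / R) *\<^sub>R u t x) = modg (\<lambda>x. ennreal (1 / R) * ennreal (norm (u t x)))"
        using R(1) by (simp add: modular_eq ennreal_mult[symmetric])
      also have "\<dots> \<le> 1" using R(2)[OF t] .
      finally show ?thesis by (rule order_le_less_trans) simp
    qed
    ultimately show ?thesis using R(1) unfolding var_Lp_def by (intro CollectI conjI exI[of _ "1 / R"]) auto
  qed
  then have 2: "AE t in lebesgue_on {0<..<T}. u t \<in> var_Lp lebesgue q"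
    by (subst AE_lebesgue_on_iff) auto
  have "modular (lebesgue_on {0<..<T}) p (\<lambda>t. (1 / R) *\<^sub>R var_norm lebesgue q (u t)) \<le> (\<integral>\<^sup>+t. 1 \<partial>lebesgue_on {0<..<T})"
    unfolding modular_def
  proof (intro nn_integral_mono omega_le_1)
    fix t assume "t \<in> space (lebesgue_on {0<..<T})"
    then have t: "t \<in> {0<..<T}" by simp
    show "norm ((1 / R) *\<^sub>R var_norm lebesgue q (u t)) \<le> 1"
      using var_norm_le[OF R(1) R(2)[OF t]] R(1) by simp
  qed simp
  also have "\<dots> < \<infinity>" using T by (simp add: emeasure_restrict_space)
  finally have 3: "(\<lambda>t. var_norm lebesgue q (u t)) \<in> var_Lp (lebesgue_on {0<..<T}) p"
    using R(1) var_norm_time_measurable[OF u _ R(1) R(2)] unfolding var_Lp_def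
    by (intro CollectI conjI exI[of _ "1 / R"]) auto
  show ?thesis using 1 2 3 by (simp add: mixed_Lp_def)
qed

text \<open>Both solutions are bounded in time by \<open>solution_bounded\<close>. The linear parts
  cancel in the difference, so D = |v - w| satisfies D \<le> Bil S D with S = |v| + |w|, and
  \<open>difference_zero\<close> applies.\<close>

lemma mild_unique:
  assumes T: "0 < T" "T < 1"
    and p' [measurable]: "p' \<in> borel_measurable borel"
    and p: "AE t in lborel. 0 < t \<and> t < T \<longrightarrow> ennreal P \<le> p t \<and> p t = p' t"
    and P: "2 < P" "\<theta> * (P / (P - 2)) < 1"
    and u0' [measurable]: "u0' \<in> borel_measurable borel" and u0: "AE y in lborel. u0 y = u0' y"
    and f' [measurable]: "(\<lambda>z. f' (fst z) (snd z)) \<in> borel_measurable (borel \<Otimes>\<^sub>M borel)"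
    and f: "AE s in lborel. 0 < s \<and> s < T \<longrightarrow> (AE y in lborel. f s y = f' s y)"
    and R0: "0 < R0" and lin: "\<And>t. 0 < t \<Longrightarrow> t < T \<Longrightarrow>
      modg (\<lambda>x. ennreal (1 / R0) * (Heat0 (\<lambda>y. ennreal (norm (u0' y))) t x + Duhamel (\<lambda>s y. ennreal (norm (f' s y))) t x)) \<le> 1"
    and v: "v \<in> mixed_Lp {0<..<T} p q" "mild_solution \<alpha> T u0 f v"
    and w: "w \<in> mixed_Lp {0<..<T} p q" "mild_solution \<alpha> T u0 f w"
  shows "AE (t, x) in lebesgue_on ({0<..<T} \<times> UNIV). v t x = w t x"
proof -
  define L where "L t x = Heat0 (\<lambda>y. ennreal (norm (u0' y))) t x + Duhamel (\<lambda>s y. ennreal (norm (f' s y))) t x" for t x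
  have L_meas [measurable]: "(\<lambda>z. L (fst z) (snd z)) \<in> borel_measurable (borel \<Otimes>\<^sub>M borel)"
    unfolding L_def by measurable
  \<comment> \<open>Extracted from \<open>mild_solution\<close>: convergence of the nonlinearity and
    the equation itself, with the null sets in s taken with respect to
    \<open>lborel\<close>.\<close>
  define Q where "Q z t x \<longleftrightarrow>
        (AE s in lborel. 0 < s \<and> s < t \<longrightarrow> (\<forall>j h k. has_conv (oseen_kernel \<alpha> (t - s) j h k) (\<lambda>y. z s y $ h * z s y $ k) x)) \<and>
        integrable (lebesgue_on {0<..<t}) (\<lambda>s. oseen_conv \<alpha> (t - s) (z s) x) \<and>
        z t x = conv (heat_kernel \<alpha> t) u0 x
          + (\<integral>s. conv (heat_kernel \<alpha> (t - s)) (f s) x \<partial>lebesgue_on {0<..<t})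
          - (\<integral>s. oseen_conv \<alpha> (t - s) (z s) x \<partial>lebesgue_on {0<..<t})" for z t x
  have QAE: "AE t in lborel. t \<in> {0<..<T} \<longrightarrow> (AE x in lborel. Q z t x)" if z: "mild_solution \<alpha> T u0 f z" for z
  proof -
    have "AE (t, x) in lebesgue_on ({0<..<T} \<times> UNIV). Q z t x"
      using z unfolding mild_solution_def Q_def
      by (rule eventually_mono) (auto simp: AE_lebesgue_on_iff)
    then have "AE z' in lborel \<Otimes>\<^sub>M lborel. fst z' \<in> {0<..<T} \<longrightarrow> Q z (fst z') (snd z')"
      by (subst (asm) AE_lebesgue_on_prod_iff) auto
    from lborel_pair.AE_pair[OF this] show ?thesis by eventually_elim auto
  qed
  have bounded: "\<exists>z' R. (\<lambda>p. z' (fst p) (snd p)) \<in> borel_measurable (borel \<Otimes>\<^sub>M borel) \<and>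
      (AE p in lborel \<Otimes>\<^sub>M lborel. fst p \<in> {0<..<T} \<longrightarrow> z (fst p) (snd p) = z' (fst p) (snd p)) \<and>
      (AE t in lborel. t \<in> {0<..<T} \<longrightarrow> (AE x in lborel. z t x = z' t x)) \<and> 0 < R \<and>
      (AE t in lborel. 0 < t \<and> t < T \<longrightarrow> modg (\<lambda>x. ennreal (1 / R) * ennreal (norm (z' t x))) \<le> 1)"
    if z: "z \<in> mixed_Lp {0<..<T} p q" "mild_solution \<alpha> T u0 f z" for z
  proof -
    obtain z' n M where z': "(\<lambda>p. z' (fst p) (snd p)) \<in> borel_measurable (borel \<Otimes>\<^sub>M borel)"
      "AE p in lborel \<Otimes>\<^sub>M lborel. fst p \<in> {0<..<T} \<longrightarrow> z (fst p) (snd p) = z' (fst p) (snd p)"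
      "AE t in lborel. t \<in> {0<..<T} \<longrightarrow> (AE x in lborel. z t x = z' t x)"
      and n: "n \<in> borel_measurable borel" "\<And>s. 0 < n s" and M: "0 < M"
      and n1: "AE s in lborel. 0 < s \<and> s < T \<longrightarrow> modg (\<lambda>y. ennreal (1 / n s) * ennreal (norm (z' s y))) \<le> 1"
      and mass: "\<And>t. 0 < t \<Longrightarrow> t < T \<Longrightarrow> (\<integral>\<^sup>+s. indicator {0<..<t} s * ennreal (bil_const * (t - s) powr - \<theta> * (n s * n s)) \<partial>lborel) \<le> ennreal M"
      using weak_solution_bounds[OF T z(1) p' p P] by blast
    note [measurable] = z'(1)
    have le: "AE t in lborel. 0 < t \<and> t < T \<longrightarrow> (AE x in lborel. ennreal (norm (z' t x)) \<le>
      L t x + Bil (\<lambda>s y. ennreal (norm (z' s y))) (\<lambda>s y. ennreal (norm (z' s y))) t x)"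
      using QAE[OF z(2)] z'(3)
    proof eventually_elim
      case (elim t)
      show ?case
      proof
        assume t: "0 < t \<and> t < T"
        then have "AE x in lborel. Q z t x" "AE x in lborel. z t x = z' t x" using elim by auto
        then show "AE x in lborel. ennreal (norm (z' t x)) \<le> L t x + Bil (\<lambda>s y. ennreal (norm (z' s y))) (\<lambda>s y. ennreal (norm (z' s y))) t x"
        proof eventually_elim
          case (elim x)
          have f1: "AE s in lborel. 0 < s \<and> s < t \<longrightarrow> (AE y in lborel. f s y = f' s y)"
            using f by eventually_elim (use t in auto)
          have z1: "AE s in lborel. 0 < s \<and> s < t \<longrightarrow> (AE y in lborel. z s y = z' s y)"
            using z'(3) by eventually_elim (use t in auto)
          show ?case unfolding L_def
            using mild_le[OF _ u0' u0 f' f1 z'(1) z1, of x "z t x"] t elim unfolding Q_def by simp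
        qed
      qed
    qed
    have "\<exists>R>0. AE t in lborel. 0 < t \<and> t < T \<longrightarrow> modg (\<lambda>x. ennreal (1 / R) * ennreal (norm (z' t x))) \<le> 1"
      by (rule solution_bounded[OF T(2) _ L_meas R0 _ M n mass n1 le]) (use lin in \<open>auto simp: L_def\<close>)
    then show ?thesis using z' by blast
  qed
  obtain v' Rv where v' [measurable]: "(\<lambda>p. v' (fst p) (snd p)) \<in> borel_measurable (borel \<Otimes>\<^sub>M borel)"
    and v'1: "AE p in lborel \<Otimes>\<^sub>M lborel. fst p \<in> {0<..<T} \<longrightarrow> v (fst p) (snd p) = v' (fst p) (snd p)"
    and v'2: "AE t in lborel. t \<in> {0<..<T} \<longrightarrow> (AE x in lborel. v t x = v' t x)"
    and Rv: "0 < Rv" "AE t in lborel. 0 < t \<and> t < T \<longrightarrow> modg (\<lambda>x. ennreal (1 / Rv) * ennreal (norm (v' t x))) \<le> 1"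
    using bounded[OF v] by blast
  obtain w' Rw where w' [measurable]: "(\<lambda>p. w' (fst p) (snd p)) \<in> borel_measurable (borel \<Otimes>\<^sub>M borel)"
    and w'1: "AE p in lborel \<Otimes>\<^sub>M lborel. fst p \<in> {0<..<T} \<longrightarrow> w (fst p) (snd p) = w' (fst p) (snd p)"
    and w'2: "AE t in lborel. t \<in> {0<..<T} \<longrightarrow> (AE x in lborel. w t x = w' t x)"
    and Rw: "0 < Rw" "AE t in lborel. 0 < t \<and> t < T \<longrightarrow> modg (\<lambda>x. ennreal (1 / Rw) * ennreal (norm (w' t x))) \<le> 1"
    using bounded[OF w] by blast
  define r where "r = max Rv Rw"
  have r: "0 < r" "Rv \<le> r" "Rw \<le> r" using Rv by (auto simp: r_def)
  define S where "S t x = ennreal (norm (v' t x)) + ennreal (norm (w' t x))" for t x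
  define D where "D t x = ennreal (norm (v' t x - w' t x))" for t x
  have D_le_S: "D t x \<le> S t x" for t x
    by (simp add: D_def S_def ennreal_plus[symmetric] norm_triangle_ineq4 ennreal_leI del: ennreal_plus)
  have S1: "AE t in lborel. 0 < t \<and> t < T \<longrightarrow> modg (\<lambda>x. ennreal (1 / (4 * r)) * S t x) \<le> 1"
    using Rv(2) Rw(2)
  proof eventually_elim
    case (elim t)
    show ?case
    proof
      assume t: "0 < t \<and> t < T"
      have [measurable]: "v' t \<in> borel_measurable borel" "w' t \<in> borel_measurable borel"
        using measurable_section_snd[OF v'] measurable_section_snd[OF w'] by simp_all
      have "modg (\<lambda>x. ennreal (1/4) * (ennreal (1 / r) * ennreal (norm (v' t x)) + ennreal (1 / r) * ennreal (norm (w' t x)))) \<le> 1"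
        using elim t modg_reciprocal_mono[OF Rv(1) r(2)] modg_reciprocal_mono[OF Rw(1) r(3)] by (intro modg_add) auto
      moreover have "ennreal (1/4) * (ennreal (1 / r) * ennreal (norm (v' t x)) + ennreal (1 / r) * ennreal (norm (w' t x)))
          = ennreal (1 / (4 * r)) * S t x" for x
        using r by (simp add: S_def distrib_left mult.assoc[symmetric] ennreal_mult[symmetric])
      ultimately show "modg (\<lambda>x. ennreal (1 / (4 * r)) * S t x) \<le> 1" by simp
    qed
  qed
  then have D1: "AE t in lborel. 0 < t \<and> t < T \<longrightarrow> modg (\<lambda>x. ennreal (1 / (4 * r)) * D t x) \<le> 1"
  proof eventually_elim
    case (elim t)
    have "modg (\<lambda>x. ennreal (1 / (4 * r)) * D t x) \<le> modg (\<lambda>x. ennreal (1 / (4 * r)) * S t x)"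
      by (intro modg_mono mult_left_mono D_le_S) simp
    then show ?case using elim by (auto intro: order_trans)
  qed
  have le: "AE t in lborel. 0 < t \<and> t < T \<longrightarrow> (AE x in lborel. D t x \<le> Bil S D t x)"
    using QAE[OF v(2)] QAE[OF w(2)] v'2 w'2
  proof eventually_elim
    case (elim t)
    show ?case
    proof
      assume t: "0 < t \<and> t < T"
      then have "AE x in lborel. Q v t x" "AE x in lborel. Q w t x" "AE x in lborel. v t x = v' t x" "AE x in lborel. w t x = w' t x"
        using elim by auto
      then show "AE x in lborel. D t x \<le> Bil S D t x"
      proof eventually_elim
        case (elim x)
        have v1: "AE s in lborel. 0 < s \<and> s < t \<longrightarrow> (AE y in lborel. v s y = v' s y)"
          using v'2 by eventually_elim (use t in auto)
        have w1: "AE s in lborel. 0 < s \<and> s < t \<longrightarrow> (AE y in lborel. w s y = w' s y)"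
          using w'2 by eventually_elim (use t in auto)
        have "v' t x - w' t x = (\<integral>s. oseen_conv \<alpha> (t - s) (w s) x \<partial>lebesgue_on {0<..<t}) - (\<integral>s. oseen_conv \<alpha> (t - s) (v s) x \<partial>lebesgue_on {0<..<t})"
        proof -
          define X where "X = conv (heat_kernel \<alpha> t) u0 x + (\<integral>s. conv (heat_kernel \<alpha> (t - s)) (f s) x \<partial>lebesgue_on {0<..<t})"
          have "v t x = X - (\<integral>s. oseen_conv \<alpha> (t - s) (v s) x \<partial>lebesgue_on {0<..<t})"
            "w t x = X - (\<integral>s. oseen_conv \<alpha> (t - s) (w s) x \<partial>lebesgue_on {0<..<t})"
            using elim(1,2) by (simp_all only: Q_def X_def)
          then show ?thesis using elim(3,4) by simp
        qed
        then have "D t x = ennreal (norm ((\<integral>s. oseen_conv \<alpha> (t - s) (v s) x \<partial>lebesgue_on {0<..<t}) - (\<integral>s. oseen_conv \<alpha> (t - s) (w s) x \<partial>lebesgue_on {0<..<t})))"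
          unfolding D_def by (simp add: norm_minus_commute)
        also have "\<dots> \<le> Bil S D t x"
          unfolding S_def D_def using elim unfolding Q_def by (intro mild_diff v' w' v1 w1) auto
        finally show ?case .
      qed
    qed
  qed
  have S_meas: "(\<lambda>z. S (fst z) (snd z)) \<in> borel_measurable (borel \<Otimes>\<^sub>M borel)"
    and D_meas: "(\<lambda>z. D (fst z) (snd z)) \<in> borel_measurable (borel \<Otimes>\<^sub>M borel)"
    unfolding S_def D_def by measurable
  have r4: "0 < 4 * r" using r by simp
  have "AE t in lborel. 0 < t \<and> t < T \<longrightarrow> (AE x in lborel. D t x = 0)"
    by (rule difference_zero[OF T(2) S_meas D_meas r4 S1 D1 le])
  then have ae: "AE t in lborel. AE x in lborel. 0 < t \<and> t < T \<longrightarrow> D t x = 0"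
    by eventually_elim auto
  have "AE z in lborel \<Otimes>\<^sub>M lborel. 0 < fst z \<and> fst z < T \<longrightarrow> D (fst z) (snd z) = 0"
    by (rule AE_pairI[OF _ ae]) (use D_meas in measurable)
  then have "AE z in lborel \<Otimes>\<^sub>M lborel. fst z \<in> {0<..<T} \<longrightarrow> v (fst z) (snd z) = w (fst z) (snd z)"
    using v'1 w'1 by eventually_elim (auto simp: D_def)
  then show ?thesis by (subst AE_lebesgue_on_prod_iff) auto
qed

lemma local_well_posedness:
  assumes p: "p \<in> exponents (lebesgue_on {0<..<1})"
    and pP: "AE t in lebesgue_on {0<..<1}. ennreal P \<le> p t" and P: "2 < P" "\<theta> * (P / (P - 2)) < 1"
    and f: "f \<in> mixed_Lp {0<..<1} (\<lambda>_. 1) q" and u0: "u0 \<in> var_Lp lebesgue q"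
  shows "\<exists>T. 0 < T \<and> T \<le> 1 \<and>
    (\<exists>u. u \<in> mixed_Lp {0<..<T} p q \<and> mild_solution \<alpha> T u0 f u \<and>
      (\<forall>v. v \<in> mixed_Lp {0<..<T} p q \<and> mild_solution \<alpha> T u0 f v \<longrightarrow>
        (AE (t, x) in lebesgue_on ({0<..<T} \<times> UNIV). v t x = u t x)))"
proof -
  have pm: "p \<in> borel_measurable (lebesgue_on {0<..<1})" using p by (simp add: exponents_def)
  have "(\<lambda>t. p t * indicator {0<..<1} t) \<in> borel_measurable lebesgue"
    using pm by (subst (asm) borel_measurable_restrict_space_iff_ennreal) auto
  from completion_ex_borel_measurable[OF this] obtain p' where p': "p' \<in> borel_measurable borel"
    "AE t in lborel. p t * indicator {0<..<1} t = p' t" by auto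
  have pp: "AE t in lborel. t \<in> {0<..<1} \<longrightarrow> ennreal P \<le> p t"
    using pP by (subst (asm) AE_lebesgue_on_iff) auto
  have pT: "AE t in lborel. 0 < t \<and> t < T \<longrightarrow> ennreal P \<le> p t \<and> p t = p' t" if "T < 1" for T
    using pp p'(2) by eventually_elim (use that in auto)
  obtain f' nf k where f' [measurable]: "(\<lambda>z. f' (fst z) (snd z)) \<in> borel_measurable (borel \<Otimes>\<^sub>M borel)"
    and f'1: "AE t in lborel. t \<in> {0<..<1} \<longrightarrow> (AE x in lborel. f t x = f' t x)"
    and nf [measurable]: "nf \<in> borel_measurable borel" and k: "0 < k"
    and nf1: "AE t in lborel. t \<in> {0<..<1} \<longrightarrow> (\<forall>r. \<bar>nf t\<bar> < r \<longrightarrow> modg (\<lambda>x. ennreal (1 / r) * ennreal (norm (f' t x))) \<le> 1)"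
    and nf_fin: "(\<integral>\<^sup>+t. indicator {0<..<1} t * omega 1 (norm (k * nf t)) \<partial>lborel) < \<infinity>"
    by (rule mixed_LpE[OF f]) simp
  \<comment> \<open>Strictly above the norm of f and positive, as \<open>linear_bound\<close>
    demands; the added 1 is integrable over the unit interval.\<close>
  define \<phi> where "\<phi> t = \<bar>nf t\<bar> + 1" for t
  have "\<phi> \<in> borel_measurable borel" unfolding \<phi>_def[abs_def] by measurable
  moreover have "0 < \<phi> s" for s by (simp add: \<phi>_def)
  ultimately have \<phi>: "\<phi> \<in> borel_measurable borel" "\<And>s. 0 < \<phi> s" by auto
  have \<phi>1: "AE s in lborel. 0 < s \<and> s < 1 \<longrightarrow> modg (\<lambda>y. ennreal (1 / \<phi> s) * ennreal (norm (f' s y))) \<le> 1"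
    using nf1
  proof eventually_elim
    case (elim s)
    have "\<bar>nf s\<bar> < \<phi> s" by (simp add: \<phi>_def)
    then show ?case using elim by (simp only: greaterThanLessThan_iff) blast
  qed
  have \<phi>_fin: "(\<integral>\<^sup>+s. indicator {0<..<1} s * ennreal (\<phi> s) \<partial>lborel) < \<infinity>"
  proof -
    have om: "omega 1 (norm (k * nf t)) = ennreal (k * \<bar>nf t\<bar>)" for t
      using k by (simp add: omega_def abs_mult)
    have "(\<integral>\<^sup>+s. indicator {0<..<1} s * ennreal (\<phi> s) \<partial>lborel)
      = (\<integral>\<^sup>+s. ennreal (1 / k) * (indicator {0<..<1} s * omega 1 (norm (k * nf s))) + indicator {0<..<1} s \<partial>lborel)"
      unfolding om \<phi>_def using k by (intro nn_integral_cong) (auto simp: ennreal_mult[symmetric] split: split_indicator)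
    also have "\<dots> = ennreal (1 / k) * (\<integral>\<^sup>+s. indicator {0<..<1} s * omega 1 (norm (k * nf s)) \<partial>lborel) + emeasure lborel {0<..<1::real}"
      unfolding om by (simp add: nn_integral_add nn_integral_cmult)
    also have "\<dots> < \<infinity>" using nf_fin by (simp add: ennreal_mult_less_top)
    finally show ?thesis .
  qed
  from u0 have "u0 \<in> borel_measurable lebesgue" by (simp add: var_Lp_def)
  from ex_borel_version_vec[OF this] obtain u0' where u0' [measurable]: "u0' \<in> borel_measurable borel"
    and u0'1: "AE x in lborel. u0 x = u0' x" by auto
  obtain m0 where m0: "0 < m0" "modg (\<lambda>x. ennreal (1 / m0) * ennreal (norm (u0 x))) \<le> 1"
    using var_Lp_modg[OF u0] by blast
  have "modg (\<lambda>x. ennreal (1 / m0) * ennreal (norm (u0 x))) = modg (\<lambda>x. ennreal (1 / m0) * ennreal (norm (u0' x)))"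
    using u0'1 by (intro modg_cong_AE) (auto elim!: eventually_mono)
  with m0 have m0': "modg (\<lambda>x. ennreal (1 / m0) * ennreal (norm (u0' x))) \<le> 1" by simp
  obtain R0 where R0: "0 < R0" and lin: "\<And>t. 0 < t \<Longrightarrow> t < 1 \<Longrightarrow>
      modg (\<lambda>x. ennreal (1 / R0) * (Heat0 (\<lambda>y. ennreal (norm (u0' y))) t x + Duhamel (\<lambda>s y. ennreal (norm (f' s y))) t x)) \<le> 1"
    using linear_bound[OF _ m0(1) m0' _ \<phi> \<phi>1 \<phi>_fin] by auto
  obtain T u R where T: "0 < T" "T < 1" and R: "0 < R" and u [measurable]: "(\<lambda>z. u (fst z) (snd z)) \<in> borel_measurable (borel \<Otimes>\<^sub>M borel)"
    and uR: "\<And>t. 0 < t \<and> t < T \<Longrightarrow> modg (\<lambda>x. ennreal (1 / R) * ennreal (norm (u t x))) \<le> 1"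
    and ueq: "\<And>t. 0 < t \<and> t < T \<Longrightarrow> AE x in lborel. Bil (\<lambda>s y. ennreal (norm (u s y))) (\<lambda>s y. ennreal (norm (u s y))) t x < \<infinity> \<and>
        u t x = heat0 u0' t x + duhamel f' t x - nonlin u t x"
    using existence[OF u0' f' R0 lin] by blast
  have fT: "AE s in lborel. 0 < s \<and> s < T \<longrightarrow> (AE y in lborel. f s y = f' s y)"
    using f'1 by eventually_elim (use T in auto)
  have uL: "u \<in> mixed_Lp {0<..<T} p q"
    by (rule bounded_in_mixed_Lp[OF u T R uR]) simp
  \<comment> \<open>The equation is expressed through a vanishing norm, which makes the predicate
    visibly measurable for \<open>AE_pairI\<close>.\<close>
  define G where "G t x \<longleftrightarrow> Heat0 (\<lambda>y. ennreal (norm (u0' y))) t x + Duhamel (\<lambda>s y. ennreal (norm (f' s y))) t x < \<infinity> \<and>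
    Bil (\<lambda>s y. ennreal (norm (u s y))) (\<lambda>s y. ennreal (norm (u s y))) t x < \<infinity> \<and>
    norm (u t x - (heat0 u0' t x + duhamel f' t x - nonlin u t x)) = 0" for t x
  have Gt: "AE x in lborel. G t x" if t: "0 < t \<and> t < T" for t
  proof -
    have "AE x in lborel. ennreal (1 / R0) * (Heat0 (\<lambda>y. ennreal (norm (u0' y))) t x + Duhamel (\<lambda>s y. ennreal (norm (f' s y))) t x) < \<infinity>"
      using t T lin by (intro modg_finite_AE) auto
    then show ?thesis using ueq[OF t]
    proof eventually_elim
      case (elim x)
      then show ?case using R0 by (auto simp: G_def ennreal_mult_less_top)
    qed
  qed
  have Gae: "AE t in lborel. AE x in lborel. 0 < t \<and> t < T \<longrightarrow> G t x"
  proof (rule AE_I2)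
    fix t :: real
    show "AE x in lborel. 0 < t \<and> t < T \<longrightarrow> G t x"
    proof (cases "0 < t \<and> t < T")
      case True
      from Gt[OF this] show ?thesis by eventually_elim simp
    qed auto
  qed
  have Gz: "AE z in lborel \<Otimes>\<^sub>M lborel. 0 < fst z \<and> fst z < T \<longrightarrow> G (fst z) (snd z)"
    by (rule AE_pairI[OF _ Gae]) (unfold G_def, measurable)
  have mild: "mild_solution \<alpha> T u0 f u"
    unfolding mild_solution_def
  proof (subst AE_lebesgue_on_prod_iff, simp, rule eventually_mono[OF Gz], intro impI, goal_cases)
    case (1 z)
    then have t: "0 < fst z" "fst z < T" and G: "G (fst z) (snd z)" by auto
    have f1: "AE s in lborel. 0 < s \<and> s < fst z \<longrightarrow> (AE y in lborel. f s y = f' s y)"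
      using fT by eventually_elim (use t in auto)
    show ?case using G unfolding G_def by (intro mild_point[OF t(1) u0' u0'1 f' f1 u]) auto
  qed
  have "AE (t, x) in lebesgue_on ({0<..<T} \<times> UNIV). v t x = u t x"
    if v: "v \<in> mixed_Lp {0<..<T} p q" "mild_solution \<alpha> T u0 f v" for v
    using lin T by (intro mild_unique[OF T p'(1) pT[OF T(2)] P u0' u0'1 f' fT R0 _ v uL mild]) auto
  then show ?thesis using T uL mild by (intro exI[of _ T] conjI exI[of _ u]) auto
qed

end

theorem theorem4p14:
  fixes \<alpha> :: real and q :: "real^3 \<Rightarrow> ennreal" and p :: "real \<Rightarrow> ennreal"
    and f :: "real \<Rightarrow> real^3 \<Rightarrow> real^3" and u0 :: "real^3 \<Rightarrow> real^3"
  assumes "1/2 < \<alpha>" and "\<alpha> \<le> 1"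
    and "q \<in> log_exponents"
    and "essinf lebesgue q = exponent_at_infinity q" and "essinf lebesgue q > 3"
    and "p \<in> exponents (lebesgue_on {0<..<1})"
    and "essinf (lebesgue_on {0<..<1}) p > 4"
    and "2 * \<alpha> * recip (essinf (lebesgue_on {0<..<1}) p)
         + 3/2 * (2 * recip (essinf lebesgue q) - recip (esssup lebesgue q)) < \<alpha> - 1/2"
    and "f \<in> mixed_Lp {0<..<1} (\<lambda>_. 1) q"
    and "AE s in lebesgue_on {0<..<1}. divergence_free (f s)"
    and "u0 \<in> var_Lp lebesgue q" and "divergence_free u0"
  shows "\<exists>T. 0 < T \<and> T \<le> 1 \<and>
    (\<exists>u. u \<in> mixed_Lp {0<..<T} p q \<and> mild_solution \<alpha> T u0 f u \<and>
      (\<forall>v. v \<in> mixed_Lp {0<..<T} p q \<and> mild_solution \<alpha> T u0 f v \<longrightarrow>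
        (AE (t, x) in lebesgue_on ({0<..<T} \<times> UNIV). v t x = u t x)))"
proof -
  define a where "a = recip (essinf lebesgue q)"
  define b where "b = recip (esssup lebesgue q)"
  define pm where "pm = essinf (lebesgue_on {0<..<1}) p"
  define e where "e = recip pm"
  obtain c where rc: "reciprocal_exponent (\<lambda>x. recip (q x)) a b c"
    using log_exponent_reciprocal[OF assms(3-5)] by (auto simp: a_def b_def)
  then interpret reciprocal_exponent "\<lambda>x. recip (q x)" a b c .
  have pm1: "1 \<le> pm" using assms(7) unfolding pm_def[symmetric] by (rule order_trans[rotated, OF less_imp_le]) simp
  have e: "0 \<le> e" "e < 1/4" "inverse pm = ennreal e"
    using recip_bounds[OF pm1] recip_less[OF pm1, of 4] assms(7) by (auto simp: e_def pm_def)
  have cond: "2 * \<alpha> * e + 3/2 * (2 * a - b) < \<alpha> - 1/2"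
    using assms(8) by (simp add: a_def b_def e_def pm_def)
  \<comment> \<open>Chosen so that 2\<alpha> * gap is half of the slack in the hypothesis on the
    exponents.\<close>
  define gap where "gap = (\<alpha> - 1/2 - (2 * \<alpha> * e + 3/2 * (2 * a - b))) / (4 * \<alpha>)"
  have gap: "0 < gap" using cond assms(1) by (simp add: gap_def)
  define \<epsilon> where "\<epsilon> = e + min gap (1/8)"
  have \<epsilon>: "e < \<epsilon>" "0 < \<epsilon>" "\<epsilon> < 1/2" using gap e by (auto simp: \<epsilon>_def)
  have "2 * \<alpha> * \<epsilon> \<le> 2 * \<alpha> * (e + gap)" using assms(1) by (intro mult_left_mono) (auto simp: \<epsilon>_def)
  also have "\<dots> = 2 * \<alpha> * e + (\<alpha> - 1/2 - (2 * \<alpha> * e + 3/2 * (2 * a - b))) / 2"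
    using assms(1) by (simp add: gap_def field_simps)
  also have "\<dots> < \<alpha> - 1/2 - 3/2 * (2 * a - b)" using cond by (simp add: field_simps)
  finally have cond': "2 * \<alpha> * \<epsilon> + 3/2 * (2 * a - b) < \<alpha> - 1/2" by simp
  define P where "P = 1 / \<epsilon>"
  have P: "2 < P" using \<epsilon> by (simp add: P_def field_simps)
  have "ennreal P \<le> pm"
  proof (rule recip_cases[OF pm1])
    fix s assume s: "1 \<le> s" "pm = ennreal s" "recip pm = 1 / s"
    then have "1 / s \<le> \<epsilon>" using \<epsilon> by (simp add: e_def)
    then have "P \<le> s" using s \<epsilon> by (simp add: P_def field_simps)
    then show ?thesis using s by (simp add: ennreal_leI)
  qed simp
  then have pP: "AE t in lebesgue_on {0<..<1}. ennreal P \<le> p t"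
    using essinf_AE[of "lebesgue_on {0<..<1}" p] unfolding pm_def by (auto elim!: eventually_mono)
  \<comment> \<open>The midpoint of the window from 3 + 3a to 4.\<close>
  define \<rho> where "\<rho> = 3 + (3 * a + 1) / 2"
  have \<rho>: "3 + 3 * a < \<rho>" "\<rho> < 4" "3 < \<rho>" using a_less a_nonneg by (auto simp: \<rho>_def)
  obtain CK where CK: "0 < CK" "\<And>t x. 0 < t \<Longrightarrow> \<bar>heat_kernel \<alpha> t x\<bar> \<le> CK * bump \<rho> (t powr (1 / (2 * \<alpha>))) x"
    "\<And>t x j h k. 0 < t \<Longrightarrow> \<bar>oseen_kernel \<alpha> t j h k x\<bar> \<le> CK * (bump \<rho> (t powr (1 / (2 * \<alpha>))) x / t powr (1 / (2 * \<alpha>)))"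
    using kernel_bounds[OF assms(1) \<rho>(3,2)] by blast
  have "0 \<le> 2 * \<alpha> * \<epsilon>" using assms(1) \<epsilon> by simp
  then have th: "1 + 3 * (2 * a - b) < 2 * \<alpha>" using cond' by linarith
  interpret fns_setting "\<lambda>x. recip (q x)" a b c \<alpha> \<rho> CK q
    using assms(1,3) \<rho> CK th by unfold_locales (auto simp: log_exponents_def exponents_def)
  \<comment> \<open>Multiplied by 2 and divided by 2\<alpha>, \<open>cond'\<close> reads \<theta> <
    1 - 2\<epsilon> = 1 - 2/P, the condition of \<open>time_mass\<close>.\<close>
  have "(1 - 2 * \<epsilon>) * (2 * \<alpha>) = 2 * \<alpha> - 2 * (2 * \<alpha> * \<epsilon>)" by (simp add: algebra_simps)
  with cond' have "1 + 3 * (2 * a - b) < (1 - 2 * \<epsilon>) * (2 * \<alpha>)" by linarith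
  then have "\<theta> < 1 - 2 * \<epsilon>"
    using assms(1) unfolding \<theta>_def by (subst pos_divide_less_eq) auto
  then have "\<theta> * (1 / (1 - 2 * \<epsilon>)) < 1" using \<epsilon> by (simp add: pos_divide_less_eq)
  moreover have "P / (P - 2) = 1 / (1 - 2 * \<epsilon>)" using \<epsilon> by (simp add: P_def field_simps)
  ultimately have "\<theta> * (P / (P - 2)) < 1" by simp
  from local_well_posedness[OF assms(6) pP P this assms(9) assms(11)] show ?thesis .
qed

end
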